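(* Let $M$ be a $d\times d$ dilation matrix and let $\phi\in L_2(\mathbb R^d)$ be a compactly supported refinable function satisfying $\widehat\phi(M^T\xi)=\widehat a(\xi)\widehat\phi(\xi)$ with $\widehat\phi(0)\ne0$, where $a\in l_0(\mathbb Z^d)$ has order $m$ sum rules with respect to $M$ with a matching filter $\upsilon\in l_0(\mathbb Z^d)$ such that $\widehat\upsilon(\xi)=1/\widehat\phi(\xi)+O(\|\xi\|^m)$ as $\xi\to0$. Then there exist $s\in\mathbb N$, $b\in(l_0(\mathbb Z^d))^{s\times1}$, $\epsilon_1,\dots,\epsilon_s\in\{\pm1\}$ and $\theta\in l_0(\mathbb Z^d)$ such that: (1) $\{a;b\}_{\Theta,(\epsilon_1,\dots,\epsilon_s)}$, with $\widehat\Theta(\xi):=\overline{\widehat\theta(\xi)}\,\widehat\theta(\xi)$, forms an OEP-based quasi-tight $M$-framelet filter bank, that is, for all $\xi\in\mathbb R^d$ and $\omega\in\Omega_M$, $$\overline{\widehat a(\xi)}\,\widehat\Theta(M^T\xi)\,\widehat a(\xi+2\pi\omega)+\overline{\widehat b(\xi)}^T\mathrm{Diag}(\epsilon_1,\dots,\epsilon_s)\widehat b(\xi+2\pi\omega)=\boldsymbol\delta(\omega)\widehat\Theta(\xi).$$ (2) $\{\mathring\phi;\psi\}_{(\epsilon_1,\dots,\epsilon_s)}$ is a compactly supported quasi-tight $M$-framelet in $L_2(\mathbb R^d)$ and $\psi$ has order $m$ vanishing moments, where $\widehat{\mathring\phi}(\xi):=\widehat\theta(\xi)\widehat\phi(\xi)$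 and $\widehat\psi(\xi):=\widehat b(M^{-T}\xi)\widehat\phi(M^{-T}\xi)$.
   Context: $m$ is a positive integer. A dilation matrix is a $d\times d$ integer matrix all of whose eigenvalues exceed one in modulus. $(l_0(\mathbb Z^d))^{r\times s}$ is the space of finitely supported $u:\mathbb Z^d\to\mathbb C^{r\times s}$ ($l_0(\mathbb Z^d)$ when $r=s=1$), with $\widehat u(\xi):=\sum_{k}u(k)e^{-ik\cdot\xi}$; $\widehat f(\xi)=\int_{\mathbb R^d}f(x)e^{-ix\cdot\xi}dx$. $f(\xi)=g(\xi)+O(\|\xi\|^m)$ as $\xi\to0$ means $\partial^\mu f(0)=\partial^\mu g(0)$ for all $|\mu|<m$. $\boldsymbol\delta(0):=1$, $\boldsymbol\delta(x):=0$ for $x\ne0$. $\Omega_M:=(M^{-T}\mathbb Z^d)\cap[0,1)^d$. Sum rules: $a\in l_0(\mathbb Z^d)$ has order $m$ sum rules with respect to $M$ with matching filter $\upsilon\in l_0(\mathbb Z^d)$ if $\widehat\upsilon(0)\ne0$ and $\widehat\upsilon(M^T\xi)\widehat a(\xi+2\pi\omega)=\boldsymbol\delta(\omega)\widehat\upsilon(\xi)+O(\|\xi\|^m)$ as $\xi\to0$ for all $\omega\in\Omega_M$. Framelets: for $\mathring\phi\in L_2(\mathbb R^d)$ and $\psi=(\psi_1,\dots,\psi_s)^T\in(L_2(\mathbb R^d))^s$ put $\psi_{\ell,M^j;k}:=|\det M|^{j/2}\psi_\ell(M^j\cdot-k)$. $\{\mathring\phi;\psi\}$ is an $M$-framelet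 if there are $C_1,C_2>0$ with $C_1\|f\|^2\le\sum_{k\in\mathbb Z^d}|\langle f,\mathring\phi(\cdot-k)\rangle|^2+\sum_{j=0}^\infty\sum_{\ell=1}^s\sum_{k\in\mathbb Z^d}|\langle f,\psi_{\ell,M^j;k}\rangle|^2\le C_2\|f\|^2$ for all $f\in L_2(\mathbb R^d)$. $\{\mathring\phi;\psi\}_{(\epsilon_1,\dots,\epsilon_s)}$ is a quasi-tight $M$-framelet if in addition $f=\sum_k\langle f,\mathring\phi(\cdot-k)\rangle\mathring\phi(\cdot-k)+\sum_{j=0}^\infty\sum_{\ell=1}^s\sum_k\epsilon_\ell\langle f,\psi_{\ell,M^j;k}\rangle\psi_{\ell,M^j;k}$ for all $f\in L_2(\mathbb R^d)$, converging unconditionally in $L_2(\mathbb R^d)$. $\psi$ has order $m$ vanishing moments if $\widehat\psi(\xi)=O(\|\xi\|^m)$ as $\xi\to0$. *)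

theory Defs
  imports "HOL-Analysis.Analysis"
begin

text \<open>The dimension is \<open>CARD('n)\<close>: \<open>\<real>\<^sup>d\<close> is \<open>real ^ 'n\<close> and \<open>\<int>\<^sup>d\<close> is \<open>int ^ 'n\<close>, embedded into
  \<open>real ^ 'n\<close> by \<open>of_lattice\<close>.\<close>

definition of_lattice :: "int ^ 'n \<Rightarrow> real ^ 'n" where
  "of_lattice k = (\<chi> i. real_of_int (k $ i))"

subsection \<open>Dilation matrices\<close>

definition is_eigenvalue :: "complex ^ 'n ^ 'n \<Rightarrow> complex \<Rightarrow> bool" where
  "is_eigenvalue A c \<longleftrightarrow> (\<exists>v. v \<noteq> 0 \<and> A *v v = c *s v)"

definition dilation_matrix :: "real ^ 'n ^ 'n \<Rightarrow> bool" where
  "dilation_matrix M \<longleftrightarrow>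
     (\<forall>i j. M $ i $ j \<in> \<int>) \<and>
     (\<forall>c. is_eigenvalue (map_matrix complex_of_real M) c \<longrightarrow> cmod c > 1)"

text \<open>\<open>\<Omega>\<^sub>M = (M\<^sup>-\<^sup>T \<int>\<^sup>d) \<inter> [0,1)\<^sup>d\<close>\<close>
definition Omega :: "real ^ 'n ^ 'n \<Rightarrow> (real ^ 'n) set" where
  "Omega M = range (\<lambda>k. matrix_inv (transpose M) *v of_lattice k)
             \<inter> {x. \<forall>i. 0 \<le> x $ i \<and> x $ i < 1}"

definition delta :: "real ^ 'n \<Rightarrow> complex" where
  "delta x = (if x = 0 then 1 else 0)"

subsection \<open>Finitely supported filters\<close>

definition l0 :: "(int ^ 'n \<Rightarrow> complex) set" where
  "l0 = {u. finite {k. u k \<noteq> 0}}"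

definition filter_hat :: "(int ^ 'n \<Rightarrow> complex) \<Rightarrow> real ^ 'n \<Rightarrow> complex" where
  "filter_hat u \<xi> = (\<Sum>k | u k \<noteq> 0. u k * exp (- (\<i> * complex_of_real (of_lattice k \<bullet> \<xi>))))"

subsection \<open>Agreement to order \<open>m\<close> at the origin\<close>

definition partial_deriv :: "'n \<Rightarrow> (real ^ 'n \<Rightarrow> complex) \<Rightarrow> real ^ 'n \<Rightarrow> complex" where
  "partial_deriv i f x = vector_derivative (\<lambda>t. f (x + t *\<^sub>R axis i 1)) (at 0)"

text \<open>\<open>\<partial>\<^sup>\<mu> f\<close> for a multi-index \<open>\<mu>\<close>.  An index type of class \<open>finite\<close> carries no order, so the
  coordinates are listed in an arbitrary fixed order; the choice is immaterial for functions that
  are smooth near the point of interest.\<close>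
definition multi_deriv :: "('n::finite \<Rightarrow> nat) \<Rightarrow> (real ^ 'n \<Rightarrow> complex) \<Rightarrow> real ^ 'n \<Rightarrow> complex" where
  "multi_deriv \<mu> f = foldr (\<lambda>i. partial_deriv i ^^ \<mu> i) (SOME is. distinct is \<and> set is = UNIV) f"

text \<open>\<open>f(\<xi>) = g(\<xi>) + O(\<parallel>\<xi>\<parallel>\<^sup>m)\<close> as \<open>\<xi> \<rightarrow> 0\<close>, in the sense of Taylor coefficients.  It is only used for
  functions that are smooth near the origin: trigonometric polynomials, Fourier transforms of
  compactly supported functions, and the reciprocal of such a transform not vanishing at \<open>0\<close>.\<close>
definition agree_to_order :: "nat \<Rightarrow> (real ^ 'n::finite \<Rightarrow> complex) \<Rightarrow> (real ^ 'n \<Rightarrow> complex) \<Rightarrow> bool" where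
  "agree_to_order m f g \<longleftrightarrow>
     (\<forall>\<mu>. (\<Sum>i\<in>UNIV. \<mu> i) < m \<longrightarrow> multi_deriv \<mu> f 0 = multi_deriv \<mu> g 0)"

definition sum_rules ::
    "nat \<Rightarrow> real ^ 'n ^ 'n \<Rightarrow> (int ^ 'n::finite \<Rightarrow> complex) \<Rightarrow> (int ^ 'n \<Rightarrow> complex) \<Rightarrow> bool" where
  "sum_rules m M a \<upsilon> \<longleftrightarrow>
     filter_hat \<upsilon> 0 \<noteq> 0 \<and>
     (\<forall>\<omega>\<in>Omega M. agree_to_order m
        (\<lambda>\<xi>. filter_hat \<upsilon> (transpose M *v \<xi>) * filter_hat a (\<xi> + (2 * pi) *\<^sub>R \<omega>))
        (\<lambda>\<xi>. delta \<omega> * filter_hat \<upsilon> \<xi>))"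

subsection \<open>Square-integrable functions\<close>

text \<open>Elements of \<open>L\<^sub>2(\<real>\<^sup>d)\<close> are represented by functions; everything below depends only on their
  classes modulo equality almost everywhere.\<close>
definition L2 :: "(real ^ 'n::finite \<Rightarrow> complex) set" where
  "L2 = {f. f \<in> borel_measurable lebesgue \<and> integrable lebesgue (\<lambda>x. (cmod (f x))\<^sup>2)}"

definition L2_norm :: "(real ^ 'n::finite \<Rightarrow> complex) \<Rightarrow> real" where
  "L2_norm f = sqrt (integral\<^sup>L lebesgue (\<lambda>x. (cmod (f x))\<^sup>2))"

definition L2_inner :: "(real ^ 'n::finite \<Rightarrow> complex) \<Rightarrow> (real ^ 'n \<Rightarrow> complex) \<Rightarrow> complex" where
  "L2_inner f g = integral\<^sup>L lebesgue (\<lambda>x. f x * cnj (g x))"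

definition compactly_supported :: "(real ^ 'n::finite \<Rightarrow> complex) \<Rightarrow> bool" where
  "compactly_supported f \<longleftrightarrow> (\<exists>K. compact K \<and> (AE x in lebesgue. x \<notin> K \<longrightarrow> f x = 0))"

text \<open>The integral formula is adequate for compactly supported functions in \<open>L2\<close>, which are
  integrable; no other functions are transformed below.\<close>
definition fourier :: "(real ^ 'n::finite \<Rightarrow> complex) \<Rightarrow> real ^ 'n \<Rightarrow> complex" where
  "fourier f \<xi> = integral\<^sup>L lebesgue (\<lambda>x. f x * exp (- (\<i> * complex_of_real (x \<bullet> \<xi>))))"

definition vanishing_moments :: "nat \<Rightarrow> (real ^ 'n::finite \<Rightarrow> complex) \<Rightarrow> bool" where
  "vanishing_moments m f \<longleftrightarrow> agree_to_order m (fourier f) (\<lambda>_. 0)"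

subsection \<open>Framelets\<close>

definition shift :: "(real ^ 'n \<Rightarrow> complex) \<Rightarrow> int ^ 'n \<Rightarrow> real ^ 'n \<Rightarrow> complex" where
  "shift f k = (\<lambda>x. f (x - of_lattice k))"

text \<open>\<open>f\<^bsub>M^j;k\<^esub> = |det M|\<^bsup>j/2\<^esup> f(M\<^sup>j \<cdot> - k)\<close>\<close>
definition dilate_shift ::
    "real ^ 'n ^ 'n \<Rightarrow> (real ^ 'n::finite \<Rightarrow> complex) \<Rightarrow> nat \<Rightarrow> int ^ 'n \<Rightarrow> real ^ 'n \<Rightarrow> complex" where
  "dilate_shift M f j k =
     (\<lambda>x. complex_of_real (\<bar>det M\<bar> powr (real j / 2)) * f ((((*v) M) ^^ j) x - of_lattice k))"

text \<open>The generators \<open>\<psi>\<^sub>1, \<dots>, \<psi>\<^sub>s\<close> are given by a function on indices of which only the values on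
  \<open>{1..s}\<close> matter.  The sums are taken in \<open>ennreal\<close>, so that the upper bound includes convergence.\<close>
definition is_framelet ::
    "real ^ 'n ^ 'n \<Rightarrow> (real ^ 'n::finite \<Rightarrow> complex) \<Rightarrow> nat \<Rightarrow> (nat \<Rightarrow> real ^ 'n \<Rightarrow> complex) \<Rightarrow> bool" where
  "is_framelet M \<phi> s \<psi> \<longleftrightarrow>
     \<phi> \<in> L2 \<and> (\<forall>l\<in>{1..s}. \<psi> l \<in> L2) \<and>
     (\<exists>C1 C2 :: real. C1 > 0 \<and> C2 > 0 \<and> (\<forall>f\<in>L2.
        let S = (\<Sum>\<^sub>\<infinity>k\<in>UNIV. ennreal ((cmod (L2_inner f (shift \<phi> k)))\<^sup>2))
              + (\<Sum>\<^sub>\<infinity>j\<in>UNIV. \<Sum>l=1..s. \<Sum>\<^sub>\<infinity>k\<in>UNIV.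
                   ennreal ((cmod (L2_inner f (dilate_shift M (\<psi> l) j k)))\<^sup>2))
        in ennreal (C1 * (L2_norm f)\<^sup>2) \<le> S \<and> S \<le> ennreal (C2 * (L2_norm f)\<^sup>2)))"

text \<open>The family occurring in the reconstruction formula: \<open>Inl k\<close> stands for \<open>\<phi>(\<cdot> - k)\<close> and
  \<open>Inr (j, l, k)\<close> for \<open>\<psi>\<^bsub>l,M^j;k\<^esub>\<close>.\<close>
type_synonym 'n framelet_index = "(int ^ 'n) + (nat \<times> nat \<times> (int ^ 'n))"

definition framelet_indices :: "nat \<Rightarrow> 'n framelet_index set" where
  "framelet_indices s = UNIV <+> (UNIV \<times> {1..s} \<times> UNIV)"

fun framelet_elem ::
    "real ^ 'n ^ 'n \<Rightarrow> (real ^ 'n::finite \<Rightarrow> complex) \<Rightarrow> (nat \<Rightarrow> real ^ 'n \<Rightarrow> complex)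
     \<Rightarrow> 'n framelet_index \<Rightarrow> real ^ 'n \<Rightarrow> complex" where
  "framelet_elem M \<phi> \<psi> (Inl k) = shift \<phi> k"
| "framelet_elem M \<phi> \<psi> (Inr (j, l, k)) = dilate_shift M (\<psi> l) j k"

fun framelet_sign :: "(nat \<Rightarrow> real) \<Rightarrow> 'n framelet_index \<Rightarrow> complex" where
  "framelet_sign \<epsilon> (Inl k) = 1"
| "framelet_sign \<epsilon> (Inr (j, l, k)) = complex_of_real (\<epsilon> l)"

text \<open>Unconditional convergence is convergence, in \<open>L\<^sub>2\<close>-norm, of the net of all finite partial sums
  (as in \<open>has_sum\<close>, which is unavailable here because \<open>L2\<close> is not a type).\<close>
definition quasi_tight_framelet ::
    "real ^ 'n ^ 'n \<Rightarrow> (real ^ 'n::finite \<Rightarrow> complex) \<Rightarrow> nat \<Rightarrow> (nat \<Rightarrow> real ^ 'n \<Rightarrow> complex)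
     \<Rightarrow> (nat \<Rightarrow> real) \<Rightarrow> bool" where
  "quasi_tight_framelet M \<phi> s \<psi> \<epsilon> \<longleftrightarrow>
     is_framelet M \<phi> s \<psi> \<and>
     (\<forall>f\<in>L2. ((\<lambda>F. L2_norm (\<lambda>x. f x -
          (\<Sum>i\<in>F. framelet_sign \<epsilon> i * L2_inner f (framelet_elem M \<phi> \<psi> i) * framelet_elem M \<phi> \<psi> i x)))
        \<longlongrightarrow> 0) (finite_subsets_at_top (framelet_indices s)))"

text \<open>\<open>b 1, \<dots>, b s\<close> are the components of the \<open>s \<times> 1\<close> matrix-valued filter \<open>b\<close>.\<close>
definition OEP_quasi_tight_filter_bank ::
    "real ^ 'n ^ 'n \<Rightarrow> (int ^ 'n::finite \<Rightarrow> complex) \<Rightarrow> nat \<Rightarrow> (nat \<Rightarrow> int ^ 'n \<Rightarrow> complex)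
     \<Rightarrow> (int ^ 'n \<Rightarrow> complex) \<Rightarrow> (nat \<Rightarrow> real) \<Rightarrow> bool" where
  "OEP_quasi_tight_filter_bank M a s b \<Theta> \<epsilon> \<longleftrightarrow>
     (\<forall>\<xi>. \<forall>\<omega>\<in>Omega M.
        cnj (filter_hat a \<xi>) * filter_hat \<Theta> (transpose M *v \<xi>) * filter_hat a (\<xi> + (2 * pi) *\<^sub>R \<omega>)
        + (\<Sum>l=1..s. cnj (filter_hat (b l) \<xi>) * complex_of_real (\<epsilon> l)
                       * filter_hat (b l) (\<xi> + (2 * pi) *\<^sub>R \<omega>))
        = delta \<omega> * filter_hat \<Theta> \<xi>)"

end

theory Submission
 imports Defs "HOL-Computational_Algebra.Fundamental_Theorem_Algebra"
begin

text \<open>The sum rules make \<open>a(\<xi> + 2\<pi>\<omega>)\<close> flat of order \<open>m\<close> at \<open>0\<close> for \<open>\<omega> \<noteq> 0\<close>, and a trigonometric polynomial \<open>\<theta>\<close>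
  that inverts the Fourier transform of \<open>\<phi>\<close> up to order \<open>2m\<close> makes the diagonal defect flat of order \<open>2m\<close>. The OEP
  kernel is then a Hermitian combination of products of two factors flat of order \<open>m\<close>, and polarization turns it
  into a signed sum of squares, whose terms are the high-pass filters.

  The filter identity makes the coarse operators \<open>P\<^sub>J f = \<Sum>\<^sub>k \<langle>f, \<phi>'\<^bsub>J;k\<^esub>\<rangle> \<phi>'\<^bsub>J;k\<^esub>\<close> telescope into the framelet expansion, and
  \<open>P\<^sub>J f\<close> tends to \<open>f\<close> because the integer shifts of \<open>\<phi>'\<close> sum to \<open>1\<close>. Unconditional convergence rests on the Bessel
  inequality. No smoothness of \<open>\<phi>\<close> is available for it; instead, a wavelet is a combination of differences
  of integer translates of \<open>\<phi>\<close>, and the refinement equation makes the norms of \<open>\<phi>(\<cdot> - M\<^bsup>-n\<^esup>y) - \<phi>\<close> decay geometrically,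
  so that Schur's test applies.\<close>

text \<open>Two obstacles shape the proof. First, flatness is a statement about Taylor coefficients,
  while the high-pass filters need the kernel factored, with one finite family of pairs serving
  every \<omega> at once. On the diagonal this is ideal theory: a trigonometric polynomial flat of
  order 2m lies in the 2m-th power of the maximal ideal at the origin, whence the order 2m asked of
  \<theta>\<phi> - 1. The different \<omega> are then separated by characters.

  Second, the eigenvalue condition gives M^{-n}x \<rightarrow> 0 but no rate in a prescribed norm,
  and \<phi> is merely in L2. The rate comes from finite dimension: the autocorrelations of the
  differences, sampled on the lattice, live on one fixed finite set and form an orbit of one linear
  map; an orbit that tends to 0 in a finite-dimensional space does so geometrically.

  The expansion is studied first for functions of bounded support. They have finitely many nonzero
  coefficients on each level, so that telescoping is an identity between finite sums; the Bessel
  inequality and density carry the result to L2.\<close>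

abbreviation "leb == lebesgue"
abbreviation leb_int (binder "LI " 10) where "leb_int f == integral\<^sup>L leb f"
abbreviation "Lint == integrable leb"
abbreviation "Lmeas == borel_measurable leb"
abbreviation tp :: "real ^ 'n => real ^ 'n" where "tp x == (2 * pi) *\<^sub>R x"

text \<open>As a simp rule this turns \<open>transpose A *v x\<close> into \<open>x v* A\<close>,
  and facts stated for \<open>transpose M *v \<xi>\<close> would no longer match.\<close>

declare transpose_matrix_vector [simp del]

lemma of_lattice_0 [simp]: "of_lattice 0 = 0"
 by (simp add: of_lattice_def vec_eq_iff)
lemma of_lattice_nth [simp]: "of_lattice k $ i = real_of_int (k $ i)"
 by (simp add: of_lattice_def)
lemma of_lattice_add: "of_lattice (k + l) = of_lattice k + of_lattice l"
 by (simp add: vec_eq_iff)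
lemma of_lattice_diff: "of_lattice (k - l) = of_lattice k - of_lattice l"
 by (simp add: vec_eq_iff)
lemma of_lattice_uminus: "of_lattice (- k) = - of_lattice k"
 by (simp add: vec_eq_iff)
lemma of_lattice_eq_iff [simp]: "of_lattice k = of_lattice l \<longleftrightarrow> k = l"
 by (simp add: vec_eq_iff)

section \<open>Integer matrices acting on the lattice\<close>

definition intmat :: "real ^ 'n ^ 'm => bool" where
 "intmat A \<longleftrightarrow> (\<forall>i j. A $ i $ j \<in> \<int>)"

text \<open>The floors only give the result its integer type; on an integer matrix they are exact,
  and this is multiplication by \<open>A\<close> on the lattice.\<close>

definition zmul :: "real ^ 'n ^ 'm => int ^ 'n => int ^ 'm::finite" where
 "zmul A k = (\<chi> i. \<Sum>j\<in>UNIV. \<lfloor>A $ i $ j\<rfloor> * k $ j)"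

lemma of_lattice_zmul:
 fixes A :: "real ^ 'n ^ 'm::finite"
 assumes "intmat A" shows "of_lattice (zmul A k) = A *v of_lattice k"
proof -
 have "real_of_int \<lfloor>A $ i $ j\<rfloor> = A $ i $ j" for i j
  using assms by (metis intmat_def of_int_floor)
 then show ?thesis
  by (auto simp add: vec_eq_iff zmul_def matrix_vector_mult_def intro!: sum.cong)
qed

lemma intmat_transpose: "intmat A ==> intmat (transpose A)"
 by (simp add: intmat_def transpose_def)

section \<open>The algebraic half: flatness at the origin, the filter bank and the choice of
  \<theta>\<close>

subsection \<open>Trigonometric polynomials\<close>

definition ek :: "int ^ 'n => real ^ 'n => complex" where
 "ek k \<xi> = exp (- (\<i> * complex_of_real (of_lattice k \<bullet> \<xi>)))"

lemma ek_0 [simp]: "ek 0 \<xi> = 1" "ek k 0 = 1"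
 by (simp_all add: ek_def)
lemma ek_add: "ek (k + l) \<xi> = ek k \<xi> * ek l \<xi>"
 by (simp add: ek_def of_lattice_add inner_add_left exp_add [symmetric] algebra_simps)
lemma ek_plus: "ek k (\<xi> + \<eta>) = ek k \<xi> * ek k \<eta>"
 by (simp add: ek_def inner_add_right exp_add [symmetric] algebra_simps)
lemma cnj_ek: "cnj (ek k \<xi>) = ek (- k) \<xi>"
 by (simp add: ek_def of_lattice_uminus exp_cnj)
lemma norm_ek [simp]: "cmod (ek k \<xi>) = 1"
 by (simp add: ek_def)
lemma ek_nonzero [simp]: "ek k \<xi> \<noteq> 0"
 by (simp add: ek_def)
lemma ek_mult_cnj [simp]: "cnj (ek k \<xi>) * ek k \<xi> = 1"
 by (simp add: cnj_ek ek_add [symmetric])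

lemma ek_lattice: "ek k (tp (of_lattice l)) = 1"
proof -
 have "of_lattice k \<bullet> of_lattice l = real_of_int (\<Sum>i\<in>UNIV. k $ i * l $ i)"
  by (simp add: inner_vec_def)
 then have "ek k (tp (of_lattice l)) = cis (2 * pi * of_int (- (\<Sum>i\<in>UNIV. k $ i * l $ i)))"
  unfolding ek_def cis_conv_exp inner_scaleR_right by simp
 then show ?thesis
  by (metis Ints_of_int cis_multiple_2pi)
qed

lemma ek_zmul:
 assumes "intmat M" shows "ek k (transpose M *v \<xi>) = ek (zmul M k) \<xi>"
 unfolding ek_def of_lattice_zmul [OF assms]
 by (metis dot_lmul_matrix transpose_matrix_vector transpose_transpose)

definition TP :: "(real ^ 'n => complex) set" where
 "TP = filter_hat ` l0"

lemma filter_hat_ek: "filter_hat u \<xi> = (\<Sum>k | u k \<noteq> 0. u k * ek k \<xi>)"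
 by (simp add: filter_hat_def ek_def)

lemma filter_hat_superset:
 assumes "finite F" "{k. u k \<noteq> 0} \<subseteq> F"
 shows "filter_hat u \<xi> = (\<Sum>k\<in>F. u k * ek k \<xi>)"
 unfolding filter_hat_ek using assms by (intro sum.mono_neutral_left) auto

text \<open>The frequencies need not be distinct, as is the case in products: coefficients over the
  same frequency are added up on the fibres of \<open>\<kappa>\<close>.\<close>

lemma TP_sumI:
 fixes \<kappa> :: "'a => int ^ 'n"
 assumes "finite I"
 shows "(%\<xi>. \<Sum>i\<in>I. c i * ek (\<kappa> i) \<xi>) \<in> TP"
proof -
 define u where "u k = (\<Sum>i | i \<in> I \<and> \<kappa> i = k. c i)" for k
 have sub: "{k. u k \<noteq> 0} \<subseteq> \<kappa> ` I"
 proof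
  fix k assume "k \<in> {k. u k \<noteq> 0}"
  then have "{i. i \<in> I \<and> \<kappa> i = k} \<noteq> {}"
   unfolding u_def by (metis (mono_tags, lifting) mem_Collect_eq sum.empty)
  then show "k \<in> \<kappa> ` I" by auto
 qed
 have "filter_hat u \<xi> = (\<Sum>i\<in>I. c i * ek (\<kappa> i) \<xi>)" for \<xi>
 proof -
  have "filter_hat u \<xi> = (\<Sum>k\<in>\<kappa> ` I. u k * ek k \<xi>)"
   using sub assms by (intro filter_hat_superset) auto
  also have "... = (\<Sum>k\<in>\<kappa> ` I. \<Sum>i | i \<in> I \<and> \<kappa> i = k. c i * ek (\<kappa> i) \<xi>)"
   unfolding u_def sum_distrib_right by (intro sum.cong) auto
  also have "... = (\<Sum>i\<in>I. c i * ek (\<kappa> i) \<xi>)"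
   using assms by (rule sum.image_gen [symmetric])
  finally show ?thesis .
 qed
 moreover have "u \<in> l0"
  using finite_subset [OF sub] assms by (simp add: l0_def)
 ultimately show ?thesis
  unfolding TP_def by (intro image_eqI [of _ _ u]) auto
qed

lemma TP_E:
 assumes "f \<in> TP"
 obtains c :: "int ^ 'n => complex" and F where "finite F" "f = (%\<xi>. \<Sum>k\<in>F. c k * ek k \<xi>)"
proof -
 obtain u where u: "u \<in> l0" "f = filter_hat u" using assms by (auto simp: TP_def)
 show ?thesis
  by (rule that [of "{k. u k \<noteq> 0}" u]) (use u in \<open>auto simp: l0_def filter_hat_ek fun_eq_iff\<close>)
qed

lemma TP_ek: "ek k \<in> TP"
 using TP_sumI [of "{()}" "%_. 1" "%_. k"] by simp

lemma TP_const: "(%_. c) \<in> TP"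
 using TP_sumI [of "{()}" "%_. c" "%_. 0"] by simp

lemma TP_mult: assumes "f \<in> TP" "g \<in> TP" shows "(%\<xi>. f \<xi> * g \<xi>) \<in> TP"
proof -
 obtain F c where f: "finite F" "f = (%\<xi>. \<Sum>k\<in>F. c k * ek k \<xi>)" using assms(1) by (rule TP_E)
 obtain G d where g: "finite G" "g = (%\<xi>. \<Sum>k\<in>G. d k * ek k \<xi>)" using assms(2) by (rule TP_E)
 have "(%\<xi>. \<Sum>x\<in>F \<times> G. (c (fst x) * d (snd x)) * ek (fst x + snd x) \<xi>) \<in> TP"
  using f g by (intro TP_sumI) auto
 also have "(%\<xi>. \<Sum>x\<in>F \<times> G. (c (fst x) * d (snd x)) * ek (fst x + snd x) \<xi>) = (%\<xi>. f \<xi> * g \<xi>)"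
  by (simp add: f g sum_product sum.cartesian_product ek_add case_prod_beta mult_ac fun_eq_iff)
 finally show ?thesis .
qed

lemma TP_scale: "f \<in> TP ==> (%\<xi>. c * f \<xi>) \<in> TP"
 by (rule TP_mult [OF TP_const])

lemma TP_sum:
 assumes "!!i. i \<in> I ==> f i \<in> TP" shows "(%\<xi>. \<Sum>i\<in>I. f i \<xi>) \<in> TP"
proof (cases "finite I")
 case True
 have "\<exists>u. u \<in> l0 \<and> f i = filter_hat u" if "i \<in> I" for i using assms [OF that] by (auto simp: TP_def)
 then obtain u where u: "!!i. i \<in> I ==> u i \<in> l0 \<and> f i = filter_hat (u i)" by metis
 have "(%\<xi>. \<Sum>x\<in>(SIGMA i:I. {k. u i k \<noteq> 0}). u (fst x) (snd x) * ek (snd x) \<xi>) \<in> TP"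
  using True u by (intro TP_sumI finite_SigmaI) (auto simp: l0_def)
 also have "(%\<xi>. \<Sum>x\<in>(SIGMA i:I. {k. u i k \<noteq> 0}). u (fst x) (snd x) * ek (snd x) \<xi>)
   = (%\<xi>. \<Sum>i\<in>I. f i \<xi>)"
 proof
  fix \<xi>
  have "(\<Sum>i\<in>I. f i \<xi>) = (\<Sum>i\<in>I. \<Sum>k | u i k \<noteq> 0. u i k * ek k \<xi>)"
   using u by (intro sum.cong) (auto simp: filter_hat_ek)
  then show "(\<Sum>x\<in>(SIGMA i:I. {k. u i k \<noteq> 0}). u (fst x) (snd x) * ek (snd x) \<xi>) = (\<Sum>i\<in>I. f i \<xi>)"
   using True u by (subst (asm) sum.Sigma) (auto simp: l0_def case_prod_beta)
 qed
 finally show ?thesis .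
qed (simp add: TP_const)

lemma TP_add: assumes "f \<in> TP" "g \<in> TP" shows "(%\<xi>. f \<xi> + g \<xi>) \<in> TP"
 using TP_sum [of UNIV "%b. if b then f else g"] assms by (simp add: UNIV_bool add.commute)

lemma TP_diff: assumes "f \<in> TP" "g \<in> TP" shows "(%\<xi>. f \<xi> - g \<xi>) \<in> TP"
 using TP_add [OF assms(1) TP_scale [OF assms(2), of "-1"]] by simp

lemma TP_prod: "(!!i. i \<in> I ==> f i \<in> TP) ==> (%\<xi>. \<Prod>i\<in>I. f i \<xi>) \<in> TP"
 by (induction I rule: infinite_finite_induct) (auto intro: TP_mult TP_const)

lemma TP_power: "f \<in> TP ==> (%\<xi>. f \<xi> ^ n) \<in> TP"
 by (induction n) (auto intro: TP_mult TP_const)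

lemma TP_cnj: assumes "f \<in> TP" shows "(%\<xi>. cnj (f \<xi>)) \<in> TP"
proof -
 obtain F c where f: "finite F" "f = (%\<xi>. \<Sum>k\<in>F. c k * ek k \<xi>)" using assms by (rule TP_E)
 show ?thesis using TP_sumI [OF f(1), of "%k. cnj (c k)" "%k. - k"] by (simp add: f(2) cnj_ek)
qed

lemma TP_shift: assumes "f \<in> TP" shows "(%\<xi>. f (\<xi> + p)) \<in> TP"
proof -
 obtain F c where f: "finite F" "f = (%\<xi>. \<Sum>k\<in>F. c k * ek k \<xi>)" using assms by (rule TP_E)
 show ?thesis using TP_sumI [OF f(1), of "%k. c k * ek k p" "%k. k"] by (simp add: f(2) ek_plus mult_ac)
qed

lemma TP_transpose: assumes "f \<in> TP" "intmat M" shows "(%\<xi>. f (transpose M *v \<xi>)) \<in> TP"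
proof -
 obtain F c where f: "finite F" "f = (%\<xi>. \<Sum>k\<in>F. c k * ek k \<xi>)" using assms(1) by (rule TP_E)
 show ?thesis using TP_sumI [OF f(1), of c "zmul M"] unfolding f(2) ek_zmul [OF assms(2)] .
qed

lemma TP_periodic: assumes "f \<in> TP" shows "f (\<xi> + tp (of_lattice l)) = f \<xi>"
proof -
 obtain F c where f: "finite F" "f = (%\<xi>. \<Sum>k\<in>F. c k * ek k \<xi>)" using assms by (rule TP_E)
 show ?thesis by (simp add: f(2) ek_plus ek_lattice)
qed

lemma TP_bounded: assumes "f \<in> TP" obtains B where "!!\<xi>. cmod (f \<xi>) \<le> B" 
proof -
 obtain F c where f: "finite F" "f = (%\<xi>. \<Sum>k\<in>F. c k * ek k \<xi>)" using assms by (rule TP_E)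
 have "cmod (f \<xi>) \<le> (\<Sum>k\<in>F. cmod (c k))" for \<xi>
  unfolding f(2) by (rule sum_norm_le) (simp add: norm_mult)
 then show ?thesis by (rule that)
qed

text \<open>Artin's argument for the independence of characters.\<close>
lemma ek_independent:
 assumes "finite F" "!!\<xi>. (\<Sum>k\<in>F. c k * ek k \<xi>) = 0"
 shows "\<forall>k\<in>F. c k = 0"
 using assms
proof (induction F arbitrary: c rule: finite_induct)
 case (insert k F)
 have eq: "c k * ek k \<xi> + (\<Sum>k\<in>F. c k * ek k \<xi>) = 0" for \<xi>
  using insert.prems [of \<xi>] insert.hyps by simp
 have "(\<Sum>l\<in>F. (c l * (ek l h - ek k h)) * ek l \<xi>) = 0" for h \<xi>
 proof -
  have "(\<Sum>l\<in>F. (c l * (ek l h - ek k h)) * ek l \<xi>)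
    = (\<Sum>l\<in>F. c l * ek l (\<xi> + h)) - ek k h * (\<Sum>l\<in>F. c l * ek l \<xi>)"
   unfolding ek_plus sum_distrib_left sum_subtractf [symmetric]
   by (intro sum.cong) (auto simp: algebra_simps)
  also have "(\<Sum>l\<in>F. c l * ek l (\<xi> + h)) = - (c k * ek k (\<xi> + h))"
   using eq [of "\<xi> + h"] by (simp add: eq_neg_iff_add_eq_0 add.commute)
  also have "(\<Sum>l\<in>F. c l * ek l \<xi>) = - (c k * ek k \<xi>)"
   using eq [of \<xi>] by (simp add: eq_neg_iff_add_eq_0 add.commute)
  also have "- (c k * ek k (\<xi> + h)) - ek k h * - (c k * ek k \<xi>) = 0" by (simp add: ek_plus)
  finally show ?thesis .
 qed
 from insert.IH [OF this] have *: "c l * (ek l h - ek k h) = 0" if "l \<in> F" for l h using that by blast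
 have F0: "c l = 0" if "l \<in> F" for l
 proof -
  have "l \<noteq> k" using that insert.hyps by auto
  then obtain i where i: "l $ i \<noteq> k $ i" by (auto simp: vec_eq_iff)
  \<comment> \<open>Half a period of the character with frequency \<open>l - k\<close>, in a
    coordinate where \<open>l\<close> and \<open>k\<close> differ, so that this character takes the
    value -1.\<close>
  define h :: "real ^ 'a" where "h = (pi / real_of_int (l $ i - k $ i)) *\<^sub>R axis i 1"
  have "ek (l - k) h = -1"
   using i by (simp add: ek_def h_def inner_axis of_lattice_diff exp_minus)
  moreover have "ek l h = ek (l - k) h * ek k h" by (simp add: ek_add [symmetric])
  ultimately have e: "ek l h - ek k h = - 2 * ek k h" by simp
  have "ek l h - ek k h \<noteq> 0" unfolding e by simp
  then show ?thesis using * [OF that, of h] by simp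
 qed
 then show ?case using eq [of 0] by simp
qed simp

subsection \<open>Order of vanishing\<close>

text \<open>The bound is global: all functions considered are bounded, so only the behaviour near \<open>p\<close> matters.\<close>
definition flat :: "nat => real ^ 'n => (real ^ 'n => complex) => bool" where
 "flat n p f \<longleftrightarrow> (\<exists>C. \<forall>\<xi>. cmod (f \<xi>) \<le> C * norm (\<xi> - p) ^ n)"

lemma flatI: "(!!\<xi>. cmod (f \<xi>) \<le> C * norm (\<xi> - p) ^ n) ==> flat n p f"
 by (auto simp: flat_def)

lemma flatE:
 assumes "flat n p f"
 obtains C where "C \<ge> 0" "!!\<xi>. cmod (f \<xi>) \<le> C * norm (\<xi> - p) ^ n"
proof -
 obtain C where C: "!!\<xi>. cmod (f \<xi>) \<le> C * norm (\<xi> - p) ^ n" using assms by (auto simp: flat_def)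
 have "cmod (f \<xi>) \<le> max C 0 * norm (\<xi> - p) ^ n" for \<xi>
  by (rule order_trans [OF C]) (simp add: mult_right_mono)
 then show ?thesis by (intro that [of "max C 0"]) auto
qed

lemma flat_add: assumes "flat n p f" "flat n p g" shows "flat n p (%\<xi>. f \<xi> + g \<xi>)"
proof -
 obtain C D where "!!\<xi>. cmod (f \<xi>) \<le> C * norm (\<xi> - p) ^ n" "!!\<xi>. cmod (g \<xi>) \<le> D * norm (\<xi> - p) ^ n"
  using assms by (auto simp: flat_def)
 then have "cmod (f \<xi> + g \<xi>) \<le> (C + D) * norm (\<xi> - p) ^ n" for \<xi>
  by (metis add_mono distrib_right norm_triangle_le)
 then show ?thesis by (rule flatI)
qed

lemma flat_mult: assumes "flat a p f" "flat b p g" shows "flat (a + b) p (%\<xi>. f \<xi> * g \<xi>)"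
proof -
 obtain C where C: "C \<ge> 0" "!!\<xi>. cmod (f \<xi>) \<le> C * norm (\<xi> - p) ^ a" using assms(1) by (rule flatE) auto
 obtain D where D: "D \<ge> 0" "!!\<xi>. cmod (g \<xi>) \<le> D * norm (\<xi> - p) ^ b" using assms(2) by (rule flatE) auto
 have "cmod (f \<xi> * g \<xi>) \<le> (C * norm (\<xi> - p) ^ a) * (D * norm (\<xi> - p) ^ b)" for \<xi>
  unfolding norm_mult by (intro mult_mono C D mult_nonneg_nonneg) auto
 then show ?thesis by (intro flatI [of _ "C * D"]) (simp add: power_add mult_ac)
qed

lemma flat_mult_bounded: "flat n p f ==> flat 0 p g ==> flat n p (%\<xi>. f \<xi> * g \<xi>)"
 using flat_mult [of n p f 0 g] by simp

lemma flat_const: "flat 0 p (%_. c)"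
 by (rule flatI [of _ "cmod c"]) simp

lemma flat_scale: "flat n p f ==> flat n p (%\<xi>. c * f \<xi>)"
 using flat_mult_bounded [OF _ flat_const, of n p f c] by (simp add: mult.commute)

lemma flat_diff: "flat n p f ==> flat n p g ==> flat n p (%\<xi>. f \<xi> - g \<xi>)"
 using flat_add [of n p f "%\<xi>. -1 * g \<xi>"] flat_scale [of n p g "-1"] by simp

lemma flat_zero: "flat n p (%_. 0)"
 by (rule flatI [of _ 0]) simp

lemma flat_sum: "(!!i. i \<in> I ==> flat n p (f i)) ==> flat n p (%\<xi>. \<Sum>i\<in>I. f i \<xi>)"
 by (induction I rule: infinite_finite_induct) (auto intro: flat_add flat_zero)

lemma flat_cnj: "flat n p (%\<xi>. cnj (f \<xi>)) \<longleftrightarrow> flat n p f"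
 by (simp add: flat_def)

lemma flat_power: "flat n p f ==> flat (n * k) p (%\<xi>. f \<xi> ^ k)"
 by (induction k) (auto intro: flat_const dest: flat_mult simp: flat_const)

text \<open>Since the bound is global, lowering the order uses boundedness: beyond distance 1 from
  \<open>p\<close> the higher power of the distance is the weaker bound.\<close>

lemma flat_mono:
 assumes "flat n p f" "flat 0 p f" "m \<le> n" shows "flat m p f"
proof -
 obtain C where C: "C \<ge> 0" "!!\<xi>. cmod (f \<xi>) \<le> C * norm (\<xi> - p) ^ n" using assms(1) by (rule flatE) auto
 obtain B where B: "B \<ge> 0" "!!\<xi>. cmod (f \<xi>) \<le> B" using assms(2) by (rule flatE) auto
 have "cmod (f \<xi>) \<le> (C + B) * norm (\<xi> - p) ^ m" for \<xi>
 proof (cases "norm (\<xi> - p) \<le> 1")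
  case True
  have "cmod (f \<xi>) \<le> C * norm (\<xi> - p) ^ n" by (rule C)
  also have "... \<le> (C + B) * norm (\<xi> - p) ^ m"
   using True C B assms by (intro mult_mono power_decreasing) auto
  finally show ?thesis .
 next
  case False
  have "cmod (f \<xi>) \<le> B * 1" using B by simp
  also have "... \<le> (C + B) * norm (\<xi> - p) ^ m"
   using False C B by (intro mult_mono one_le_power) auto
  finally show ?thesis .
 qed
 then show ?thesis by (rule flatI)
qed

lemma flat_at: "flat (Suc n) p f ==> f p = 0"
 by (auto simp: flat_def elim: allE [of _ p])

lemma flat_linear:
 fixes L :: "real ^ 'n => real ^ 'n"
 assumes "flat n 0 f" "linear L" shows "flat n 0 (%\<xi>. f (L \<xi>))"
proof -
 obtain C where C: "C \<ge> 0" "!!\<xi>. cmod (f \<xi>) \<le> C * norm (\<xi> - 0) ^ n" using assms(1) by (rule flatE) auto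
 obtain B where B: "B > 0" "!!\<xi>. norm (L \<xi>) \<le> B * norm \<xi>"
  using linear_bounded_pos [OF assms(2)] by auto
 have "cmod (f (L \<xi>)) \<le> (C * B ^ n) * norm (\<xi> - 0) ^ n" for \<xi>
 proof -
  have "cmod (f (L \<xi>)) \<le> C * norm (L \<xi>) ^ n" using C(2) [of "L \<xi>"] by simp
  also have "... \<le> C * (B * norm \<xi>) ^ n" using B C by (intro mult_left_mono power_mono) auto
  finally show ?thesis by (simp add: power_mult_distrib mult_ac)
 qed
 then show ?thesis by (rule flatI)
qed

text \<open>Near \<open>p\<close> the modulus of \<open>g\<close> exceeds half of its value at
  \<open>p\<close>; farther away the distance to \<open>p\<close> is bounded below and boundedness
  of \<open>f\<close> is enough.\<close>

lemma flat_divide: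
 assumes fg: "flat n p (%\<xi>. f \<xi> * g \<xi>)" and f: "flat 0 p f" and g: "isCont g p" "g p \<noteq> 0"
 shows "flat n p f"
proof -
 obtain C where C: "C \<ge> 0" "!!\<xi>. cmod (f \<xi> * g \<xi>) \<le> C * norm (\<xi> - p) ^ n" using fg by (rule flatE) auto
 obtain B where B: "B \<ge> 0" "!!\<xi>. cmod (f \<xi>) \<le> B" using f by (rule flatE) auto
 define c where "c = cmod (g p) / 2"
 have c: "c > 0" using g by (simp add: c_def)
 have "\<forall>\<^sub>F \<xi> in nhds p. cmod (g \<xi>) > c"
  using g by (intro order_tendstoD(1) [of _ "cmod (g p)"] tendsto_norm) (auto simp: c_def isCont_def tendsto_at_iff_tendsto_nhds)
 then obtain r where r: "r > 0" "!!\<xi>. dist \<xi> p < r ==> cmod (g \<xi>) > c"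
  unfolding eventually_nhds_metric by blast
 have "cmod (f \<xi>) \<le> (C / c + B / r ^ n) * norm (\<xi> - p) ^ n" for \<xi>
 proof (cases "dist \<xi> p < r")
  case True
  have "cmod (f \<xi>) * c \<le> cmod (f \<xi>) * cmod (g \<xi>)" using r(2) [OF True] by (intro mult_left_mono) auto
  also have "... \<le> C * norm (\<xi> - p) ^ n" using C(2) [of \<xi>] by (simp add: norm_mult)
  finally have "cmod (f \<xi>) \<le> C / c * norm (\<xi> - p) ^ n" using c by (simp add: field_simps)
  also have "... \<le> (C / c + B / r ^ n) * norm (\<xi> - p) ^ n"
   using B r by (intro mult_right_mono) auto
  finally show ?thesis .
 next
  case False
  then have *: "r ^ n \<le> norm (\<xi> - p) ^ n" using r by (intro power_mono) (auto simp: dist_norm)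
  have "cmod (f \<xi>) \<le> B / r ^ n * r ^ n" using B r by simp
  also have "... \<le> (C / c + B / r ^ n) * norm (\<xi> - p) ^ n"
   using * B C c r by (intro mult_mono) auto
  finally show ?thesis .
 qed
 then show ?thesis by (rule flatI)
qed

lemma TP_flat_0: "f \<in> TP ==> flat 0 p f"
 by (rule TP_bounded, assumption) (rule flatI [of _ _ _ 0, simplified])

text \<open>Let t \<rightarrow> 0 to remove the constant term, divide by t and repeat. Restriction
  to rays reduces Taylor expansions in several variables to this.\<close>

lemma poly_small_coeffs:
 fixes a :: "nat => complex"
 assumes "r > 0" "!!t. 0 < t ==> t < r ==> cmod (\<Sum>k<n. a k * of_real t ^ k) \<le> C * t ^ n" "k < n"
 shows "a k = 0"
 using assms(2,3)
proof (induction n arbitrary: a k)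
 case (Suc n)
 have split: "(\<Sum>k<Suc n. a k * of_real t ^ k) = a 0 + of_real t * (\<Sum>k<n. a (Suc k) * of_real t ^ k)" for t
  by (subst sum.lessThan_Suc_shift) (simp add: sum_distrib_left mult_ac)
 have "((%t. cmod (\<Sum>k<Suc n. a k * of_real t ^ k)) \<longlongrightarrow> cmod (\<Sum>k<Suc n. a k * of_real 0 ^ k)) (at_right 0)"
  by (intro tendsto_intros)
 moreover have "((%t. C * t ^ Suc n) \<longlongrightarrow> C * 0 ^ Suc n) (at_right (0::real))"
  by (intro tendsto_intros)
 moreover have "\<forall>\<^sub>F t in at_right 0. cmod (\<Sum>k<Suc n. a k * of_real t ^ k) \<le> C * t ^ Suc n"
  unfolding eventually_at_right_field using Suc.prems(1) \<open>r > 0\<close> by blast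
 ultimately have "cmod (\<Sum>k<Suc n. a k * of_real 0 ^ k) \<le> C * 0 ^ Suc n"
  by (intro tendsto_le [of "at_right (0::real)"]) auto
 then have a0: "a 0 = 0" unfolding split by simp
 have "cmod (\<Sum>k<n. a (Suc k) * of_real t ^ k) \<le> C * t ^ n" if t: "0 < t" "t < r" for t
  using Suc.prems(1) [OF t] t unfolding split a0 by (simp add: norm_mult mult.left_commute)
 from Suc.IH [of "%k. a (Suc k)", OF this] have "a (Suc k) = 0" if "k < n" for k using that by blast
 with a0 show ?case using Suc.prems(2) by (cases k) auto
qed simp

subsection \<open>Fourier transforms of measures of bounded support\<close>

text \<open>Trigonometric polynomials arise from counting measures, Fourier transforms of compactly
 supported functions from Lebesgue measure.\<close>

lemma norm_integral_le:
 fixes f :: "'a => complex"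
 assumes "integrable M f" "integrable M g" "!!x. cmod (f x) \<le> g x"
 shows "cmod (\<integral>x. f x \<partial>M) \<le> (\<integral>x. g x \<partial>M)"
 by (rule order_trans [OF integral_norm_bound]) (intro integral_mono integrable_norm assms)

definition FT :: "'a measure => ('a => real ^ 'n) => ('a => complex) => real ^ 'n => complex" where
 "FT N X c \<xi> = (\<integral>w. c w * exp (- (\<i> * complex_of_real (X w \<bullet> \<xi>))) \<partial>N)"

text \<open>The k-th moment, a homogeneous polynomial of degree k in \<xi>; up to the factor
  (-\<i>)^k / k! it is the Taylor part of degree k of \<open>FT\<close> at 0.\<close>

definition FTm :: "'a measure => ('a => real ^ 'n) => ('a => complex) => nat => real ^ 'n => complex" where
 "FTm N X c k \<xi> = (\<integral>w. c w * complex_of_real ((X w \<bullet> \<xi>) ^ k) \<partial>N)"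

text \<open>Bounded positions make every moment of an integrable density finite and the Taylor
  remainders uniform.\<close>

locale bounded_FT =
 fixes N :: "'a measure" and X :: "'a => real ^ 'n::finite" and R :: real
 assumes X_meas: "X \<in> borel_measurable N" and X_bd: "!!w. norm (X w) \<le> R"
begin

lemma X_coord [measurable]: "(%w. X w $ j) \<in> borel_measurable N"
 using measurable_compose [OF X_meas borel_measurable_nth] .

lemma X_inner [measurable]: "(%w. X w \<bullet> \<xi>) \<in> borel_measurable N"
 using X_meas by measurable

lemma integrable_mult_bdd:
 fixes c g :: "'a => complex"
 assumes c: "integrable N c" and g: "g \<in> borel_measurable N" and B: "!!w. cmod (g w) \<le> B"
 shows "integrable N (%w. c w * g w)"
proof (rule Bochner_Integration.integrable_bound)
 show "integrable N (%w. B * cmod (c w))" using c by auto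
 show "(%w. c w * g w) \<in> borel_measurable N" using c g by auto
 show "AE w in N. norm (c w * g w) \<le> norm (B * cmod (c w))"
 proof (intro AE_I2)
  fix w
  have "norm (c w * g w) \<le> cmod (c w) * B" unfolding norm_mult by (intro mult_left_mono B) auto
  also have "... \<le> norm (B * cmod (c w))" by (simp add: mult.commute abs_mult mult_right_mono abs_ge_self)
  finally show "norm (c w * g w) \<le> norm (B * cmod (c w))" .
 qed
qed

lemma inner_bd: "\<bar>X w \<bullet> \<xi>\<bar> \<le> R * norm \<xi>"
 by (rule order_trans [OF Cauchy_Schwarz_ineq2]) (simp add: X_bd mult_right_mono)

lemma coord_bd: "\<bar>X w $ j\<bar> \<le> R"
 using component_le_norm_cart [of "X w" j] X_bd [of w] by linarith

lemma FT_integrable: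
 assumes "integrable N c" shows "integrable N (%w. c w * exp (- (\<i> * complex_of_real (X w \<bullet> \<xi>))))"
 by (rule integrable_mult_bdd [OF assms, where B = 1]) auto

lemma FTm_integrable:
 assumes "integrable N c" shows "integrable N (%w. c w * complex_of_real ((X w \<bullet> \<xi>) ^ k))"
 by (rule integrable_mult_bdd [OF assms, where B = "(R * norm \<xi>) ^ k"])
  (auto simp: norm_power power_abs intro!: power_mono inner_bd)

lemma coord_integrable:
 assumes "integrable N c" shows "integrable N (%w. c w * complex_of_real (X w $ j))"
 by (rule integrable_mult_bdd [OF assms, where B = R]) (auto simp: coord_bd)

lemma FT_bounded: assumes "integrable N c" shows "flat 0 p (FT N X c)"
proof (rule flatI)
 fix \<xi>
 have "cmod (FT N X c \<xi>) \<le> (\<integral>w. cmod (c w * exp (- (\<i> * complex_of_real (X w \<bullet> \<xi>)))) \<partial>N)"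
  unfolding FT_def by (rule integral_norm_bound)
 then show "cmod (FT N X c \<xi>) \<le> (\<integral>w. cmod (c w) \<partial>N) * norm (\<xi> - p) ^ 0"
  by (simp add: norm_mult)
qed

lemma exp_taylor_bd:
 fixes u :: real assumes "\<bar>u\<bar> \<le> V"
 shows "cmod (exp (- (\<i> * of_real u)) - (\<Sum>k<n. (- \<i>) ^ k / fact k * of_real (u ^ k))) \<le> 3 * \<bar>u\<bar> ^ n"
proof (cases n)
 case (Suc m)
 have "cmod (exp (- (\<i> * of_real u)) - (\<Sum>k\<le>m. (- (\<i> * of_real u)) ^ k / fact k)) \<le> exp \<bar>Re (- (\<i> * of_real u))\<bar> * (cmod (- (\<i> * of_real u))) ^ Suc m / fact m"
  by (rule Taylor_exp)
 also have "... = \<bar>u\<bar> ^ Suc m / fact m" by (simp add: norm_mult)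
 also have "... \<le> \<bar>u\<bar> ^ Suc m / 1" by (intro divide_left_mono) (auto simp: fact_ge_1)
 also have "... \<le> 3 * \<bar>u\<bar> ^ n" by (simp add: Suc)
 also have "(\<Sum>k\<le>m. (- (\<i> * complex_of_real u)) ^ k / fact k) = (\<Sum>k<n. (- \<i>) ^ k / fact k * of_real (u ^ k))"
  unfolding Suc lessThan_Suc_atMost by (intro sum.cong) (auto simp flip: power_mult_distrib)
 finally show ?thesis .
qed simp

lemma FT_taylor:
 assumes c: "integrable N c"
 shows "flat n 0 (%\<xi>. FT N X c \<xi> - (\<Sum>k<n. (- \<i>) ^ k / fact k * FTm N X c k \<xi>))"
proof (rule flatI)
 fix \<xi> :: "real ^ 'n"
 have "FT N X c \<xi> - (\<Sum>k<n. (- \<i>) ^ k / fact k * FTm N X c k \<xi>)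
  = (\<integral>w. c w * (exp (- (\<i> * of_real (X w \<bullet> \<xi>))) - (\<Sum>k<n. (- \<i>) ^ k / fact k * of_real ((X w \<bullet> \<xi>) ^ k))) \<partial>N)"
 proof -
  have "(\<Sum>k<n. (- \<i>) ^ k / fact k * FTm N X c k \<xi>)
   = (\<integral>w. (\<Sum>k<n. (- \<i>) ^ k / fact k * (c w * of_real ((X w \<bullet> \<xi>) ^ k))) \<partial>N)"
   unfolding FTm_def
   by (subst Bochner_Integration.integral_sum)
    (auto intro!: integrable_mult_right FTm_integrable c simp: integral_mult_right_zero simp del: of_real_power)
  then have "FT N X c \<xi> - (\<Sum>k<n. (- \<i>) ^ k / fact k * FTm N X c k \<xi>)
   = (\<integral>w. c w * exp (- (\<i> * complex_of_real (X w \<bullet> \<xi>))) - (\<Sum>k<n. (- \<i>) ^ k / fact k * (c w * of_real ((X w \<bullet> \<xi>) ^ k))) \<partial>N)"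
   unfolding FT_def
   by (subst Bochner_Integration.integral_diff)
    (intro FT_integrable FTm_integrable c Bochner_Integration.integrable_sum integrable_mult_right | simp)+
  also have "... = (\<integral>w. c w * (exp (- (\<i> * of_real (X w \<bullet> \<xi>))) - (\<Sum>k<n. (- \<i>) ^ k / fact k * of_real ((X w \<bullet> \<xi>) ^ k))) \<partial>N)"
   by (intro Bochner_Integration.integral_cong) (simp_all add: right_diff_distrib sum_distrib_left mult_ac)
  finally show ?thesis .
 qed
 also have "cmod ... \<le> (\<integral>w. cmod (c w) * (3 * (R * norm \<xi>) ^ n) \<partial>N)"
 proof (rule norm_integral_le)
  show "integrable N (%w. c w * (exp (- (\<i> * of_real (X w \<bullet> \<xi>))) - (\<Sum>k<n. (- \<i>) ^ k / fact k * of_real ((X w \<bullet> \<xi>) ^ k))))"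
   unfolding right_diff_distrib sum_distrib_left
   unfolding mult.left_commute [of "c _"]
   by (intro Bochner_Integration.integrable_diff FT_integrable Bochner_Integration.integrable_sum c integrable_mult_right FTm_integrable)
  show "integrable N (%w. cmod (c w) * (3 * (R * norm \<xi>) ^ n))" using c by auto
  fix w
  have "cmod (exp (- (\<i> * of_real (X w \<bullet> \<xi>))) - (\<Sum>k<n. (- \<i>) ^ k / fact k * of_real ((X w \<bullet> \<xi>) ^ k)))
    \<le> 3 * \<bar>X w \<bullet> \<xi>\<bar> ^ n" by (rule exp_taylor_bd) (rule inner_bd)
  also have "... \<le> 3 * (R * norm \<xi>) ^ n" by (intro mult_left_mono power_mono inner_bd) auto
  finally show "cmod (c w * (exp (- (\<i> * of_real (X w \<bullet> \<xi>))) - (\<Sum>k<n. (- \<i>) ^ k / fact k * of_real ((X w \<bullet> \<xi>) ^ k)))) \<le> cmod (c w) * (3 * (R * norm \<xi>) ^ n)"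
   unfolding norm_mult by (intro mult_left_mono) auto
 qed
 finally show "cmod (FT N X c \<xi> - (\<Sum>k<n. (- \<i>) ^ k / fact k * FTm N X c k \<xi>)) \<le> ((\<integral>w. cmod (c w) \<partial>N) * (3 * R ^ n)) * norm (\<xi> - 0) ^ n"
  by (simp add: power_mult_distrib mult_ac)
qed

lemma FTm_scale: "FTm N X c k (t *\<^sub>R \<xi>) = of_real t ^ k * FTm N X c k \<xi>"
 unfolding FTm_def integral_mult_right_zero [symmetric]
 by (intro Bochner_Integration.integral_cong) (simp_all add: power_mult_distrib mult_ac)

text \<open>On a ray the Taylor polynomial is a polynomial in t with the moments as coefficients.
  The bound concerns one ray, and its constant may depend on that ray, as happens after division by
  \<open>wgen j\<close>.\<close>

lemma FTm_ray:
 assumes c: "integrable N c" and "r > 0"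
  and bd: "!!t. 0 < t ==> t < r ==> cmod (FT N X c (t *\<^sub>R \<xi>)) \<le> C * t ^ n" and "k < n"
 shows "FTm N X c k \<xi> = 0"
proof -
 obtain D where D: "!!\<xi>. cmod (FT N X c \<xi> - (\<Sum>k<n. (- \<i>) ^ k / fact k * FTm N X c k \<xi>)) \<le> D * norm \<xi> ^ n"
  using FT_taylor [OF c, of n] by (auto simp: flat_def)
 have "cmod (\<Sum>k<n. ((- \<i>) ^ k / fact k * FTm N X c k \<xi>) * of_real t ^ k) \<le> (C + D * norm \<xi> ^ n) * t ^ n"
  if t: "0 < t" "t < r" for t
 proof -
  have tri: "cmod B \<le> cmod A + cmod (A - B)" for A B
   using norm_triangle_sub [of B A] by (simp add: norm_minus_commute)
  have e: "(\<Sum>k<n. ((- \<i>) ^ k / fact k * FTm N X c k \<xi>) * of_real t ^ k) = (\<Sum>k<n. (- \<i>) ^ k / fact k * FTm N X c k (t *\<^sub>R \<xi>))"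
   by (simp add: FTm_scale mult_ac)
  have "cmod (\<Sum>k<n. (- \<i>) ^ k / fact k * FTm N X c k (t *\<^sub>R \<xi>)) \<le>
   cmod (FT N X c (t *\<^sub>R \<xi>)) + cmod (FT N X c (t *\<^sub>R \<xi>) - (\<Sum>k<n. (- \<i>) ^ k / fact k * FTm N X c k (t *\<^sub>R \<xi>)))"
   by (rule tri)
  also have "... \<le> C * t ^ n + D * norm (t *\<^sub>R \<xi>) ^ n" by (intro add_mono bd t D)
  finally show ?thesis unfolding e using t by (simp add: power_mult_distrib algebra_simps)
 qed
 from poly_small_coeffs [where a = "%k. (- \<i>) ^ k / fact k * FTm N X c k \<xi>", OF \<open>r > 0\<close> this \<open>k < n\<close>]
 show ?thesis by simp
qed

text \<open>Flatness becomes the vanishing of moments, a condition that is linear in the density and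
  passes to derivatives.\<close>

lemma flat_FT_iff:
 assumes c: "integrable N c"
 shows "flat n 0 (FT N X c) \<longleftrightarrow> (\<forall>k<n. \<forall>\<xi>. FTm N X c k \<xi> = 0)"
proof
 assume "flat n 0 (FT N X c)"
 then obtain C where C: "!!\<xi>. cmod (FT N X c \<xi>) \<le> C * norm \<xi> ^ n" by (auto simp: flat_def)
 show "\<forall>k<n. \<forall>\<xi>. FTm N X c k \<xi> = 0"
 proof (intro allI impI)
  fix k \<xi> assume "k < n"
  show "FTm N X c k \<xi> = 0"
  proof (rule FTm_ray [OF c])
   fix t :: real assume "0 < t" "t < 1"
   then show "cmod (FT N X c (t *\<^sub>R \<xi>)) \<le> C * norm \<xi> ^ n * t ^ n"
    using C [of "t *\<^sub>R \<xi>"] by (simp add: power_mult_distrib mult_ac)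
  qed (use \<open>k < n\<close> in auto)
 qed
next
 assume "\<forall>k<n. \<forall>\<xi>. FTm N X c k \<xi> = 0"
 then show "flat n 0 (FT N X c)" using FT_taylor [OF c, of n] by simp
qed

text \<open>Expand the vanishing moment of order k + 1 at \<xi> + t e_j in powers of t: the
  coefficient of t is k + 1 times the moment of order k of the density multiplied by the j-th
  coordinate.\<close>

lemma FTm_coord:
 assumes c: "integrable N c" and z: "!!\<xi>. FTm N X c (Suc k) \<xi> = 0"
 shows "FTm N X (%w. c w * of_real (X w $ j)) k \<xi> = 0"
proof -
 let ?n = "Suc k"
 define a where "a i = of_nat (?n choose i) * (\<integral>w. (c w * of_real ((X w \<bullet> axis j 1) ^ i)) * of_real ((X w \<bullet> \<xi>) ^ (?n - i)) \<partial>N)" for i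
 have int: "integrable N (%w. (c w * of_real ((X w \<bullet> axis j 1) ^ i)) * of_real ((X w \<bullet> \<xi>) ^ l))" for i l
  by (intro FTm_integrable c)
 have "(\<Sum>i<Suc ?n. a i * of_real t ^ i) = 0" for t :: real
 proof -
  have "0 = FTm N X c ?n (\<xi> + t *\<^sub>R axis j 1)" by (simp add: z)
  also have "... = (\<integral>w. (\<Sum>i\<le>?n. of_nat (?n choose i) * (of_real t ^ i * ((c w * of_real ((X w \<bullet> axis j 1) ^ i)) * of_real ((X w \<bullet> \<xi>) ^ (?n - i))))) \<partial>N)"
   unfolding FTm_def
  proof (rule Bochner_Integration.integral_cong [OF refl])
   fix w
   have "complex_of_real ((X w \<bullet> (\<xi> + t *\<^sub>R axis j 1)) ^ ?n) = (of_real (t * (X w \<bullet> axis j 1)) + of_real (X w \<bullet> \<xi>)) ^ ?n"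
    by (simp add: inner_add_right add.commute)
   also have "... = (\<Sum>i\<le>?n. of_nat (?n choose i) * of_real (t * (X w \<bullet> axis j 1)) ^ i * of_real (X w \<bullet> \<xi>) ^ (?n - i))"
    by (rule binomial_ring)
   finally show "c w * complex_of_real ((X w \<bullet> (\<xi> + t *\<^sub>R axis j 1)) ^ ?n) = (\<Sum>i\<le>?n. of_nat (?n choose i) * (of_real t ^ i * ((c w * of_real ((X w \<bullet> axis j 1) ^ i)) * of_real ((X w \<bullet> \<xi>) ^ (?n - i)))))"
    by (simp only: sum_distrib_left of_real_power of_real_mult power_mult_distrib mult_ac)
  qed
  also have "... = (\<Sum>i\<le>?n. of_nat (?n choose i) * (of_real t ^ i * (\<integral>w. (c w * of_real ((X w \<bullet> axis j 1) ^ i)) * of_real ((X w \<bullet> \<xi>) ^ (?n - i)) \<partial>N)))"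
   by (subst Bochner_Integration.integral_sum)
    (auto intro!: integrable_mult_right int simp: integral_mult_right_zero simp del: of_real_power)
  also have "... = (\<Sum>i<Suc ?n. a i * of_real t ^ i)"
   unfolding lessThan_Suc_atMost a_def by (intro sum.cong) (auto simp: mult_ac)
  finally show ?thesis by simp
 qed
 then have "a 1 = 0"
  by (intro poly_small_coeffs [where r = 1 and n = "Suc ?n" and C = 0]) auto
 moreover have "1 + complex_of_nat k \<noteq> 0" by (metis of_nat_Suc of_nat_eq_0_iff nat.distinct(1))
 ultimately show ?thesis by (simp add: a_def FTm_def inner_axis del: of_real_power)
qed

text \<open>Differentiation under the integral, with the second-order Taylor bound as an explicit
  remainder K t^2.\<close>

lemma partial_deriv_FT:
 assumes c: "integrable N c"
 shows "partial_deriv j (FT N X c) = FT N X (%w. - \<i> * (c w * of_real (X w $ j)))"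
proof
 fix \<xi>
 let ?c = "%w. - \<i> * (c w * of_real (X w $ j))"
 have ci: "integrable N ?c" using coord_integrable [OF c] by auto
 define K where "K = (\<integral>w. cmod (c w) \<partial>N) * (3 * R ^ 2)"
 have bound: "cmod (FT N X c (\<xi> + t *\<^sub>R axis j 1) - FT N X c \<xi> - of_real t * FT N X ?c \<xi>) \<le> K * t ^ 2" for t
 proof -
  have "FT N X c (\<xi> + t *\<^sub>R axis j 1) - FT N X c \<xi> - of_real t * FT N X ?c \<xi>
   = (\<integral>w. c w * exp (- (\<i> * complex_of_real (X w \<bullet> (\<xi> + t *\<^sub>R axis j 1)))) - c w * exp (- (\<i> * complex_of_real (X w \<bullet> \<xi>)))
      - of_real t * (?c w * exp (- (\<i> * complex_of_real (X w \<bullet> \<xi>)))) \<partial>N)"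
   unfolding FT_def using FT_integrable [OF c] FT_integrable [OF ci]
   by (simp add: integral_mult_right_zero)
  also have "cmod ... \<le> (\<integral>w. cmod (c w) * (3 * R ^ 2 * t ^ 2) \<partial>N)"
  proof (rule norm_integral_le)
   show "integrable N (%w. c w * exp (- (\<i> * complex_of_real (X w \<bullet> (\<xi> + t *\<^sub>R axis j 1)))) - c w * exp (- (\<i> * complex_of_real (X w \<bullet> \<xi>)))
      - of_real t * (?c w * exp (- (\<i> * complex_of_real (X w \<bullet> \<xi>)))))"
    using FT_integrable [OF c] FT_integrable [OF ci] by (intro Bochner_Integration.integrable_diff integrable_mult_right) auto
   show "integrable N (%w. cmod (c w) * (3 * R ^ 2 * t ^ 2))" using c by auto
   fix w
   let ?u = "t * X w $ j"
   have e: "exp (- (\<i> * complex_of_real (X w \<bullet> (\<xi> + t *\<^sub>R axis j 1)))) = exp (- (\<i> * complex_of_real (X w \<bullet> \<xi>))) * exp (- (\<i> * of_real ?u))"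
    by (simp add: inner_add_right inner_axis exp_add [symmetric] algebra_simps)
   have "c w * exp (- (\<i> * complex_of_real (X w \<bullet> (\<xi> + t *\<^sub>R axis j 1)))) - c w * exp (- (\<i> * complex_of_real (X w \<bullet> \<xi>)))
      - of_real t * (?c w * exp (- (\<i> * complex_of_real (X w \<bullet> \<xi>))))
    = c w * exp (- (\<i> * complex_of_real (X w \<bullet> \<xi>))) * (exp (- (\<i> * of_real ?u)) - (\<Sum>k<2. (- \<i>) ^ k / fact k * of_real (?u ^ k)))"
    unfolding e by (simp add: numeral_2_eq_2 algebra_simps)
   then have "cmod (c w * exp (- (\<i> * complex_of_real (X w \<bullet> (\<xi> + t *\<^sub>R axis j 1)))) - c w * exp (- (\<i> * complex_of_real (X w \<bullet> \<xi>)))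
      - of_real t * (?c w * exp (- (\<i> * complex_of_real (X w \<bullet> \<xi>)))))
    = cmod (c w) * cmod (exp (- (\<i> * of_real ?u)) - (\<Sum>k<2. (- \<i>) ^ k / fact k * of_real (?u ^ k)))"
    by (simp add: norm_mult)
   also have "... \<le> cmod (c w) * (3 * \<bar>?u\<bar> ^ 2)"
    by (intro mult_left_mono exp_taylor_bd [OF order_refl]) auto
   also have "... \<le> cmod (c w) * (3 * R ^ 2 * t ^ 2)"
   proof (intro mult_left_mono)
    have "\<bar>X w $ j\<bar> ^ 2 \<le> R ^ 2" by (intro power_mono coord_bd) auto
    then have "t^2 * (X w $ j)^2 \<le> t^2 * R^2" by (intro mult_left_mono) auto
    then show "3 * \<bar>?u\<bar> ^ 2 \<le> 3 * R ^ 2 * t ^ 2"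
     by (simp add: power_mult_distrib mult_ac)
   qed auto
   finally show "cmod (c w * exp (- (\<i> * complex_of_real (X w \<bullet> (\<xi> + t *\<^sub>R axis j 1)))) - c w * exp (- (\<i> * complex_of_real (X w \<bullet> \<xi>)))
      - of_real t * (?c w * exp (- (\<i> * complex_of_real (X w \<bullet> \<xi>))))) \<le> cmod (c w) * (3 * R ^ 2 * t ^ 2)" .
  qed
  finally show ?thesis by (simp add: K_def mult_ac)
 qed
 have "((%t. FT N X c (\<xi> + t *\<^sub>R axis j 1)) has_vector_derivative FT N X ?c \<xi>) (at 0)"
  unfolding has_vector_derivative_def has_derivative_iff_norm
 proof
  show "((%t. norm (FT N X c (\<xi> + t *\<^sub>R axis j 1) - FT N X c (\<xi> + 0 *\<^sub>R axis j 1) - (t - 0) *\<^sub>R FT N X ?c \<xi>) / norm (t - 0)) \<longlongrightarrow> 0) (at 0)"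
  proof (rule tendsto_sandwich [of "%_. 0" _ _ "%t. K * \<bar>t\<bar>"])
   show "\<forall>\<^sub>F t in at 0. norm (FT N X c (\<xi> + t *\<^sub>R axis j 1) - FT N X c (\<xi> + 0 *\<^sub>R axis j 1) - (t - 0) *\<^sub>R FT N X ?c \<xi>) / norm (t - 0) \<le> K * \<bar>t\<bar>"
   proof (rule eventuallyI)
    fix t :: real
    show "norm (FT N X c (\<xi> + t *\<^sub>R axis j 1) - FT N X c (\<xi> + 0 *\<^sub>R axis j 1) - (t - 0) *\<^sub>R FT N X ?c \<xi>) / norm (t - 0) \<le> K * \<bar>t\<bar>"
     using bound [of t] by (cases "t = 0") (auto simp: divide_le_eq scaleR_conv_of_real power2_eq_square abs_mult_self_eq mult.assoc)
   qed
   show "((%t. K * \<bar>t\<bar>) \<longlongrightarrow> 0) (at (0::real))"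
    by (rule tendsto_eq_intros refl)+ simp
  qed auto
 qed (rule bounded_linear_scaleR_left)
 then show "partial_deriv j (FT N X c) \<xi> = FT N X ?c \<xi>"
  unfolding partial_deriv_def by (rule vector_derivative_at)
qed

lemma partial_deriv_flat:
 assumes c: "integrable N c" and "flat (Suc n) 0 (FT N X c)"
 shows "\<exists>d. integrable N d \<and> partial_deriv j (FT N X c) = FT N X d \<and> flat n 0 (FT N X d)"
proof (intro exI conjI)
 let ?c = "%w. - \<i> * (c w * of_real (X w $ j))"
 show ci: "integrable N ?c" using coord_integrable [OF c] by auto
 show "partial_deriv j (FT N X c) = FT N X ?c" by (rule partial_deriv_FT [OF c])
 have "FTm N X c k \<xi> = 0" if "k < Suc n" for k \<xi>
  using assms(2) that flat_FT_iff [OF c] by blast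
 then have z: "FTm N X (%w. c w * of_real (X w $ j)) k \<xi> = 0" if "k < n" for k \<xi>
  using that by (intro FTm_coord c) auto
 have "FTm N X ?c k \<xi> = 0" if "k < n" for k \<xi>
  using z [OF that, of \<xi>] unfolding FTm_def
  by (simp add: mult.assoc integral_mult_right_zero)
 then show "flat n 0 (FT N X ?c)" unfolding flat_FT_iff [OF ci] by blast
qed

lemma multi_deriv_flat_aux:
 assumes "integrable N c" "flat (n + (\<Sum>i\<leftarrow>L. \<mu> i)) 0 (FT N X c)"
 shows "\<exists>d. integrable N d \<and> foldr (%i. partial_deriv i ^^ \<mu> i) L (FT N X c) = FT N X d \<and> flat n 0 (FT N X d)"
 using assms(2)
proof (induction L arbitrary: n)
 case Nil then show ?case using assms(1) by auto
next
 case (Cons i L)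
 have "flat (n + \<mu> i + (\<Sum>i\<leftarrow>L. \<mu> i)) 0 (FT N X c)" using Cons.prems by (simp add: add.assoc)
 from Cons.IH [OF this] obtain d where d: "integrable N d" "foldr (%i. partial_deriv i ^^ \<mu> i) L (FT N X c) = FT N X d" "flat (n + \<mu> i) 0 (FT N X d)"
  by blast
 have "\<exists>e. integrable N e \<and> (partial_deriv i ^^ k) (FT N X d) = FT N X e \<and> flat n 0 (FT N X e)" if "flat (n + k) 0 (FT N X d)" for k
  using that
 proof (induction k arbitrary: n)
  case 0 then show ?case using d(1) by auto
 next
  case (Suc k)
  have "flat (Suc n + k) 0 (FT N X d)" using Suc.prems by simp
  from Suc.IH [OF this] obtain e where e: "integrable N e" "(partial_deriv i ^^ k) (FT N X d) = FT N X e" "flat (Suc n) 0 (FT N X e)" by blast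
  show ?case using partial_deriv_flat [OF e(1,3), of i] e(2) by simp
 qed
 from this [OF d(3)] show ?case using d(2) by simp
qed

lemma multi_deriv_FT:
 assumes "integrable N c"
 shows "integrable N (%w. c w * (\<Prod>i\<leftarrow>L. (- \<i> * of_real (X w $ i)) ^ \<mu> i)) \<and>
  foldr (%i. partial_deriv i ^^ \<mu> i) L (FT N X c) = FT N X (%w. c w * (\<Prod>i\<leftarrow>L. (- \<i> * of_real (X w $ i)) ^ \<mu> i))"
proof (induction L)
 case (Cons i L)
 define d where "d = (%w. c w * (\<Prod>i\<leftarrow>L. (- \<i> * of_real (X w $ i)) ^ \<mu> i))"
 have d: "integrable N d" "foldr (%i. partial_deriv i ^^ \<mu> i) L (FT N X c) = FT N X d" using Cons by (auto simp: d_def)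
 have "integrable N (%w. d w * (- \<i> * of_real (X w $ i)) ^ k) \<and>
  (partial_deriv i ^^ k) (FT N X d) = FT N X (%w. d w * (- \<i> * of_real (X w $ i)) ^ k)" for k
 proof (induction k)
  case (Suc k)
  let ?e = "%w. d w * (- \<i> * of_real (X w $ i)) ^ k"
  have eq: "(%w. d w * (- \<i> * of_real (X w $ i)) ^ Suc k) = (%w. - \<i> * (?e w * of_real (X w $ i)))" by (simp add: fun_eq_iff mult_ac)
  have "integrable N (%w. - \<i> * (?e w * of_real (X w $ i)))"
   using Suc by (intro integrable_mult_right impI coord_integrable) blast
  moreover have "(partial_deriv i ^^ Suc k) (FT N X d) = FT N X (%w. - \<i> * (?e w * of_real (X w $ i)))"
   using Suc partial_deriv_FT [of ?e i] by simp
  ultimately show ?case unfolding eq ..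
 qed (use d in auto)
 from this [of "\<mu> i"] show ?case unfolding foldr.simps o_def d(2) by (simp add: d_def mult_ac)
qed (use assms in simp)

end

lemma multi_deriv_zero [simp]:
 fixes \<mu> :: "'n::finite => nat" shows "multi_deriv \<mu> (%_. 0) = (%_. 0)"
proof -
 have p: "partial_deriv i (%_. 0) = (%_. 0)" for i :: 'n
  by (simp add: partial_deriv_def fun_eq_iff)
 have "(partial_deriv i ^^ k) (%_. 0) = (%_. 0)" for i :: 'n and k
  by (induction k) (auto simp: p)
 then have "foldr (%i. partial_deriv i ^^ \<mu> i) L (%_. 0) = (%_. 0)" for L
  by (induction L) auto
 then show ?thesis by (simp add: multi_deriv_def)
qed

lemma enumeration_exists: "\<exists>L :: 'n::finite list. distinct L \<and> set L = UNIV"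
 using finite_distinct_list [OF finite [of "UNIV :: 'n set"]] by blast

text \<open>A monomial is given by a multi-index or by the list of its factors;
  \<open>count_list js\<close> is the multi-index that belongs to the list
  \<open>js\<close>.\<close>

lemma prod_list_count:
 fixes f :: "'n::finite => complex"
 assumes "distinct L" "set L = UNIV"
 shows "(\<Prod>i\<leftarrow>L. f i ^ count_list js i) = (\<Prod>j\<leftarrow>js. f j)"
proof -
 have "(\<Prod>i\<leftarrow>L. f i ^ count_list js i) = (\<Prod>i\<in>UNIV. f i ^ count_list js i)"
  using assms by (metis prod.distinct_set_conv_list)
 also have "... = (\<Prod>j\<leftarrow>js. f j)"
 proof (induction js)
  case (Cons j js)
  have "(\<Prod>i\<in>UNIV. f i ^ count_list (j # js) i) = (\<Prod>i\<in>UNIV. (if i = j then f i else 1) * f i ^ count_list js i)"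
   by (intro prod.cong) auto
  then show ?case using Cons by (simp add: prod.distrib)
 qed simp
 finally show ?thesis .
qed

context bounded_FT begin

lemma FTm_Suc:
 assumes "integrable N c"
 shows "FTm N X c (Suc k) \<xi> = (\<Sum>j\<in>UNIV. of_real (\<xi> $ j) * FTm N X (%w. c w * of_real (X w $ j)) k \<xi>)"
proof -
 have "FTm N X c (Suc k) \<xi> = (\<integral>w. (\<Sum>j\<in>UNIV. of_real (\<xi> $ j) * ((c w * of_real (X w $ j)) * of_real ((X w \<bullet> \<xi>) ^ k))) \<partial>N)"
  unfolding FTm_def
 proof (rule Bochner_Integration.integral_cong [OF refl])
  fix w
  have "complex_of_real ((X w \<bullet> \<xi>) ^ Suc k) = (\<Sum>j\<in>UNIV. of_real (X w $ j) * of_real (\<xi> $ j)) * of_real ((X w \<bullet> \<xi>) ^ k)"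
   by (simp add: inner_vec_def)
  then show "c w * complex_of_real ((X w \<bullet> \<xi>) ^ Suc k) = (\<Sum>j\<in>UNIV. of_real (\<xi> $ j) * ((c w * of_real (X w $ j)) * of_real ((X w \<bullet> \<xi>) ^ k)))"
   by (simp only: sum_distrib_left sum_distrib_right mult_ac)
 qed
 also have "... = (\<Sum>j\<in>UNIV. of_real (\<xi> $ j) * FTm N X (%w. c w * of_real (X w $ j)) k \<xi>)"
  unfolding FTm_def
  by (subst Bochner_Integration.integral_sum)
   (auto intro!: integrable_mult_right FTm_integrable coord_integrable assms simp: integral_mult_right_zero simp del: of_real_power)
 finally show ?thesis .
qed

lemma FTm_from_monomials:
 assumes c: "integrable N c" and z: "!!js. length js = k ==> (\<integral>w. c w * (\<Prod>j\<leftarrow>js. of_real (X w $ j)) \<partial>N) = 0"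
 shows "FTm N X c k \<xi> = 0"
 using assms
proof (induction k arbitrary: c)
 case 0
 then show ?case using "0.prems"(2) [of "[]"] by (simp add: FTm_def)
next
 case (Suc k)
 have z: "FTm N X (%w. c w * of_real (X w $ j)) k \<xi> = 0" for j
 proof (rule Suc.IH)
  show "integrable N (%w. c w * of_real (X w $ j))" by (rule coord_integrable [OF Suc.prems(1)])
  fix js :: "'n list" assume "length js = k"
  then show "(\<integral>w. c w * of_real (X w $ j) * (\<Prod>j\<leftarrow>js. of_real (X w $ j)) \<partial>N) = 0"
   using Suc.prems(2) [of "j # js"] by (simp add: mult.assoc)
 qed
 show ?case by (simp add: FTm_Suc [OF Suc.prems(1)] z)
qed

text \<open>The bridge between the derivatives of the statement and the estimates of the proof. It
  is crossed in both directions: the sum rules become flatness of trigonometric polynomials, and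
  flatness of the transforms of the wavelets becomes vanishing moments.\<close>

theorem agree_to_order_FT_iff:
 assumes c: "integrable N c"
 shows "agree_to_order m (FT N X c) (%_. 0) \<longleftrightarrow> flat m 0 (FT N X c)"
proof -
 define L :: "'n list" where "L = (SOME is. distinct is \<and> set is = UNIV)"
 have L: "distinct L" "set L = UNIV"
  using someI_ex [OF enumeration_exists] by (auto simp: L_def)
 have md: "multi_deriv \<mu> f = foldr (%i. partial_deriv i ^^ \<mu> i) L f" for \<mu> and f :: "real ^ 'n => complex"
  by (simp add: multi_deriv_def L_def)
 have sumL: "(\<Sum>i\<leftarrow>L. \<mu> i) = (\<Sum>i\<in>UNIV. \<mu> i)" for \<mu> :: "'n => nat"
  unfolding sum_list_distinct_conv_sum_set [OF L(1)] L(2) ..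
 show ?thesis
 proof
  assume flat: "flat m 0 (FT N X c)"
  show "agree_to_order m (FT N X c) (%_. 0)"
   unfolding agree_to_order_def
  proof (intro allI impI)
   fix \<mu> :: "'n => nat" assume lt: "(\<Sum>i\<in>UNIV. \<mu> i) < m"
   have "flat (Suc 0 + (\<Sum>i\<leftarrow>L. \<mu> i)) 0 (FT N X c)"
    by (rule flat_mono [OF flat FT_bounded [OF c]]) (use lt in \<open>simp add: sumL\<close>)
   from multi_deriv_flat_aux [OF c this] obtain d where "multi_deriv \<mu> (FT N X c) = FT N X d" "flat (Suc 0) 0 (FT N X d)"
    unfolding md by blast
   then show "multi_deriv \<mu> (FT N X c) 0 = multi_deriv \<mu> (%_. 0) 0"
    using flat_at by auto
  qed
 next
  assume ag: "agree_to_order m (FT N X c) (%_. 0)"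
  have "FTm N X c k \<xi> = 0" if "k < m" for k \<xi>
  proof (rule FTm_from_monomials [OF c])
   fix js :: "'n list" assume len: "length js = k"
   \<comment> \<open>The derivative with this multi-index at 0 is, up to (-\<i>)^k, the integral of
     the density against the monomial with factors \<open>js\<close>.\<close>
   let ?\<mu> = "count_list js"
   have "(\<Sum>i\<in>UNIV. ?\<mu> i) = k" using sum_count_set [of js UNIV] len by simp
   then have "multi_deriv ?\<mu> (FT N X c) 0 = 0" using ag that by (auto simp: agree_to_order_def)
   then have "0 = (\<integral>w. c w * (\<Prod>i\<leftarrow>L. (- \<i> * of_real (X w $ i)) ^ ?\<mu> i) \<partial>N)"
    unfolding md conjunct2 [OF multi_deriv_FT [OF c]] by (simp add: FT_def)
   also have "... = (\<integral>w. (- \<i>) ^ k * (c w * (\<Prod>j\<leftarrow>js. of_real (X w $ j))) \<partial>N)"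
   proof (rule Bochner_Integration.integral_cong [OF refl])
    fix w
    have "(\<Prod>i\<leftarrow>L. (- \<i> * of_real (X w $ i)) ^ ?\<mu> i) = (\<Prod>j\<leftarrow>js. - \<i> * of_real (X w $ j))"
     by (rule prod_list_count [OF L])
    also have "... = (- \<i>) ^ k * (\<Prod>j\<leftarrow>js. of_real (X w $ j))"
     unfolding len [symmetric] by (induction js) auto
    finally show "c w * (\<Prod>i\<leftarrow>L. (- \<i> * of_real (X w $ i)) ^ ?\<mu> i) = (- \<i>) ^ k * (c w * (\<Prod>j\<leftarrow>js. of_real (X w $ j)))"
     by (simp only: mult_ac)
   qed
   also have "... = (- \<i>) ^ k * (\<integral>w. (c w * (\<Prod>j\<leftarrow>js. of_real (X w $ j))) \<partial>N)"
    by (rule integral_mult_right_zero)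
   finally show "(\<integral>w. c w * (\<Prod>j\<leftarrow>js. of_real (X w $ j)) \<partial>N) = 0" by simp
  qed
  then show "flat m 0 (FT N X c)" unfolding flat_FT_iff [OF c] by blast
 qed
qed

end

lemma TP_as_FT:
 fixes f :: "real ^ 'n::finite => complex"
 assumes "f \<in> TP"
 obtains F and X :: "int ^ 'n => real ^ 'n" and c R where "finite F" "bounded_FT (count_space F) X R"
  "integrable (count_space F) c" "f = FT (count_space F) X c"
proof -
 obtain F c where f: "finite F" "f = (%\<xi>. \<Sum>k\<in>F. c k * ek k \<xi>)" using assms by (rule TP_E)
 \<comment> \<open>\<open>bounded_FT\<close> bounds \<open>X\<close> on the whole type, also off the
   set \<open>F\<close> that carries the counting measure.\<close>
 define X where "X k = (if k \<in> F then of_lattice k else (0 :: real ^ 'n))" for k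
 show ?thesis
 proof (rule that [OF f(1), of X "\<Sum>k\<in>F. norm (X k)" c])
  show "bounded_FT (count_space F) X (\<Sum>k\<in>F. norm (X k))"
  proof
   show "norm (X w) \<le> (\<Sum>k\<in>F. norm (X k))" for w
   proof (cases "w \<in> F")
    case True then show ?thesis using f(1) by (intro member_le_sum) auto
   qed (auto simp: X_def sum_nonneg)
  qed simp
  show "integrable (count_space F) c" using f(1) by (rule integrable_count_space)
  show "f = FT (count_space F) X c"
   unfolding FT_def f(2) lebesgue_integral_count_space_finite [OF f(1)]
   by (intro ext sum.cong) (auto simp: X_def ek_def)
 qed
qed

lemma TP_agree_imp_flat:
 assumes "f \<in> TP" "agree_to_order m f (%_. 0)" shows "flat m 0 f"
 by (rule TP_as_FT [OF assms(1)]) (use assms(2) bounded_FT.agree_to_order_FT_iff in blast)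

subsection \<open>Trigonometric polynomials vanishing to high order\<close>

text \<open>With z_j = exp(-\<i>\<xi>_j) trigonometric polynomials are Laurent polynomials in the
  z_j; the functions z_j - 1 generate the ideal of those that vanish at the origin.\<close>

definition wgen :: "'n => real ^ 'n => complex" where
 "wgen j \<xi> = ek (axis j 1) \<xi> - 1"

lemma of_lattice_axis: "of_lattice (axis j n) = axis j (real_of_int n)"
 by (simp add: vec_eq_iff axis_def)

lemma wgen_exp: "wgen j \<xi> = exp (- (\<i> * of_real (\<xi> $ j))) - 1"
 by (simp add: wgen_def ek_def of_lattice_axis inner_axis' del: of_lattice_nth)

lemma wgen_TP: "wgen j \<in> TP"
 using TP_diff [OF TP_ek TP_const, of "axis j 1" 1] by (simp add: wgen_def [abs_def])

lemma exp_minus_one_bounds: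
 fixes u :: real
 shows "cmod (exp (- (\<i> * of_real u)) - 1) \<le> \<bar>u\<bar>"
  and "\<bar>u\<bar> \<le> 1 / 2 ==> \<bar>u\<bar> / 2 \<le> cmod (exp (- (\<i> * of_real u)) - 1)"
proof -
 show "cmod (exp (- (\<i> * of_real u)) - 1) \<le> \<bar>u\<bar>"
  using Taylor_exp [of "- (\<i> * of_real u)" 0] by (simp add: norm_mult)
 assume u: "\<bar>u\<bar> \<le> 1 / 2"
 have "cmod (exp (- (\<i> * of_real u)) - 1 + \<i> * of_real u) \<le> \<bar>u\<bar> ^ 2"
  using Taylor_exp [of "- (\<i> * of_real u)" 1] by (simp add: norm_mult power2_eq_square algebra_simps)
 moreover have "\<bar>u\<bar> ^ 2 \<le> \<bar>u\<bar> / 2" using u by (simp add: power2_eq_square mult_left_mono [of "\<bar>u\<bar>" "1/2" "\<bar>u\<bar>", simplified])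
 moreover have "cmod (\<i> * of_real u) \<le> cmod (exp (- (\<i> * of_real u)) - 1 + \<i> * of_real u) + cmod (exp (- (\<i> * of_real u)) - 1)"
  by (metis add_diff_cancel_left' norm_triangle_sub norm_minus_commute add.commute norm_triangle_ineq4)
 ultimately show "\<bar>u\<bar> / 2 \<le> cmod (exp (- (\<i> * of_real u)) - 1)" by (simp add: norm_mult)
qed

lemma wgen_flat: "flat 1 0 (wgen j)"
proof (rule flatI)
 fix \<xi> :: "real ^ 'a"
 have "cmod (wgen j \<xi>) \<le> \<bar>\<xi> $ j\<bar>" unfolding wgen_exp by (rule exp_minus_one_bounds)
 also have "... \<le> norm \<xi>" by (rule component_le_norm_cart)
 finally show "cmod (wgen j \<xi>) \<le> 1 * norm (\<xi> - 0) ^ 1" by simp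
qed

text \<open>Divisibility of z^n - 1 by z - 1, by induction in both directions as exponents may be
  negative.\<close>

lemma ek_axis_divides: "\<exists>g\<in>TP. \<forall>\<xi>. ek (axis j n) \<xi> - 1 = wgen j \<xi> * g \<xi>"
proof (induction n rule: int_induct [where k = 0])
 case base
 have "axis j 0 = (0 :: int ^ 'a)" by (simp add: axis_def vec_eq_iff)
 then have "ek (axis j 0) \<xi> = 1" for \<xi> by (metis ek_0(1))
 then show ?case by (intro bexI [of _ "%_. 0"]) (auto intro: TP_const)
next
 case (step1 i)
 then obtain g where g: "g \<in> TP" "!!\<xi>. ek (axis j i) \<xi> - 1 = wgen j \<xi> * g \<xi>" by auto
 have s: "axis j (i + 1) = axis j 1 + axis j i" by (simp add: axis_def vec_eq_iff)
 show ?case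
 proof (intro bexI allI)
  show "(%\<xi>. ek (axis j 1) \<xi> * g \<xi> + 1) \<in> TP" by (intro TP_add TP_mult TP_ek g TP_const)
  fix \<xi>
  have "ek (axis j i) \<xi> = wgen j \<xi> * g \<xi> + 1" using g(2) [of \<xi>] by (simp add: diff_eq_eq)
  then show "ek (axis j (i + 1)) \<xi> - 1 = wgen j \<xi> * (ek (axis j 1) \<xi> * g \<xi> + 1)"
   unfolding s ek_add wgen_def by algebra
 qed
next
 case (step2 i)
 then obtain g where g: "g \<in> TP" "!!\<xi>. ek (axis j i) \<xi> - 1 = wgen j \<xi> * g \<xi>" by auto
 have s: "axis j (i - 1) = - axis j 1 + axis j i" by (simp add: axis_def vec_eq_iff)
 show ?case
 proof (intro bexI allI)
  show "(%\<xi>. ek (- axis j 1) \<xi> * g \<xi> - ek (- axis j 1) \<xi>) \<in> TP" by (intro TP_diff TP_mult TP_ek g)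
  fix \<xi>
  have "ek (axis j i) \<xi> = wgen j \<xi> * g \<xi> + 1" using g(2) [of \<xi>] by (simp add: diff_eq_eq)
  moreover have "ek (- axis j 1) \<xi> * ek (axis j 1) \<xi> = 1" by (simp add: ek_add [symmetric])
  ultimately show "ek (axis j (i - 1)) \<xi> - 1 = wgen j \<xi> * (ek (- axis j 1) \<xi> * g \<xi> - ek (- axis j 1) \<xi>)"
   unfolding s ek_add wgen_def by algebra
 qed
qed

text \<open>On a ray with \<xi>_j \<noteq> 0 the divisor is comparable to t, so division costs
  exactly one order. This kills the moments off the hyperplane \<xi>_j = 0, and continuity, evident
  for a finite sum, extends this to the hyperplane.\<close>

lemma (in bounded_FT) flat_quotient_wgen:
 assumes c: "integrable N c" and "finite F" "N = count_space F"
  and fl: "flat (Suc n) 0 (%\<xi>. wgen j \<xi> * FT N X c \<xi>)"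
 shows "flat n 0 (FT N X c)"
 unfolding flat_FT_iff [OF c]
proof (intro allI impI)
 fix k \<xi> assume k: "k < n"
 obtain C where C: "!!\<xi>. cmod (wgen j \<xi> * FT N X c \<xi>) \<le> C * norm \<xi> ^ Suc n" using fl by (auto simp: flat_def)
 have nz: "FTm N X c k \<xi> = 0" if "\<xi> $ j \<noteq> 0" for \<xi>
 proof (rule FTm_ray [OF c _ _ k])
  \<comment> \<open>Below this t one has |t \<xi>_j| \<le> 1/2, the range of the lower bound for
    \<open>wgen j\<close>.\<close>
  show "0 < 1 / (2 * \<bar>\<xi> $ j\<bar>)" using that by simp
  fix t :: real assume t: "0 < t" "t < 1 / (2 * \<bar>\<xi> $ j\<bar>)"
  have "\<bar>t * \<xi> $ j\<bar> \<le> 1 / 2" using t that by (simp add: abs_mult field_simps)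
  then have "t * \<bar>\<xi> $ j\<bar> / 2 \<le> cmod (wgen j (t *\<^sub>R \<xi>))"
   using exp_minus_one_bounds(2) [of "t * \<xi> $ j"] t by (simp add: wgen_exp abs_mult)
  then have "t * \<bar>\<xi> $ j\<bar> / 2 * cmod (FT N X c (t *\<^sub>R \<xi>)) \<le> cmod (wgen j (t *\<^sub>R \<xi>)) * cmod (FT N X c (t *\<^sub>R \<xi>))"
   by (intro mult_right_mono) auto
  also have "... \<le> C * norm (t *\<^sub>R \<xi>) ^ Suc n" using C [of "t *\<^sub>R \<xi>"] by (simp add: norm_mult)
  also have "... = t * (C * norm \<xi> ^ Suc n * t ^ n)" using t by (simp add: power_mult_distrib)
  finally have "\<bar>\<xi> $ j\<bar> / 2 * cmod (FT N X c (t *\<^sub>R \<xi>)) \<le> C * norm \<xi> ^ Suc n * t ^ n"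
   using t by (simp add: mult.assoc del: power_Suc)
  then show "cmod (FT N X c (t *\<^sub>R \<xi>)) \<le> (2 * C * norm \<xi> ^ Suc n / \<bar>\<xi> $ j\<bar>) * t ^ n"
   using that by (simp add: field_simps del: power_Suc)
 qed
 have fin: "FTm N X c k \<xi> = (\<Sum>w\<in>F. c w * complex_of_real ((X w \<bullet> \<xi>) ^ k))" for \<xi>
  unfolding FTm_def \<open>N = count_space F\<close> by (rule lebesgue_integral_count_space_finite [OF \<open>finite F\<close>])
 show "FTm N X c k \<xi> = 0"
 proof (cases "\<xi> $ j = 0")
  case True
  have "((%t. FTm N X c k (\<xi> + t *\<^sub>R axis j 1)) \<longlongrightarrow> FTm N X c k (\<xi> + 0 *\<^sub>R axis j 1)) (at 0)"
   unfolding fin by (intro tendsto_intros)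
  moreover have "((%t. FTm N X c k (\<xi> + t *\<^sub>R axis j 1)) \<longlongrightarrow> 0) (at 0)"
   by (rule tendsto_eventually) (use True in \<open>auto simp: eventually_at_filter intro!: eventuallyI nz\<close>)
  ultimately show ?thesis using tendsto_unique [OF at_neq_bot] by fastforce
 qed (rule nz)
qed

lemma TP_quotient_wgen:
 assumes "g \<in> TP" "flat (Suc n) 0 (%\<xi>. wgen j \<xi> * g \<xi>)" shows "flat n 0 g"
proof -
 obtain F and X :: "int ^ 'a => real ^ 'a" and c R where *: "finite F" "bounded_FT (count_space F) X R"
  "integrable (count_space F) c" "g = FT (count_space F) X c" by (rule TP_as_FT [OF assms(1)])
 show ?thesis using bounded_FT.flat_quotient_wgen [OF *(2,3,1) refl] assms(2) *(4) by blast
qed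

text \<open>The n-th power of the maximal ideal at the origin, in terms of its generators
  \<open>wgen j\<close>.\<close>

primrec mideal :: "nat => (real ^ 'n::finite => complex) set" where
 "mideal 0 = TP"
| "mideal (Suc n) = {f. \<exists>g. (\<forall>j. g j \<in> mideal n) \<and> f = (%\<xi>. \<Sum>j\<in>UNIV. wgen j \<xi> * g j \<xi>)}"

lemma mideal_zero: "(%_. 0) \<in> mideal n"
proof (induction n)
 case (Suc n)
 then show ?case by (auto intro!: exI [of _ "%_ _. 0"])
qed (auto intro: TP_const)

lemma mideal_add: "f \<in> mideal n ==> g \<in> mideal n ==> (%\<xi>. f \<xi> + g \<xi>) \<in> mideal n"
proof (induction n arbitrary: f g)
 case (Suc n)
 from Suc.prems obtain f' g' where "\<forall>j. f' j \<in> mideal n" "\<forall>j. g' j \<in> mideal n"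
  "f = (%\<xi>. \<Sum>j\<in>UNIV. wgen j \<xi> * f' j \<xi>)" "g = (%\<xi>. \<Sum>j\<in>UNIV. wgen j \<xi> * g' j \<xi>)" by auto
 then show ?case using Suc.IH
  by (auto intro!: exI [of _ "%j \<xi>. f' j \<xi> + g' j \<xi>"] simp: sum.distrib distrib_left)
qed (auto intro: TP_add)

lemma mideal_wgen: assumes "g \<in> mideal n" shows "(%\<xi>. wgen j \<xi> * g \<xi>) \<in> mideal (Suc n)"
proof -
 have "(\<Sum>i\<in>UNIV. wgen i \<xi> * (if i = j then g else (%_. 0)) \<xi>) = wgen j \<xi> * g \<xi>" for \<xi>
  by (subst sum.mono_neutral_right [of UNIV "{j}"]) auto
 then show ?thesis
  using assms mideal_zero [of n] by (auto intro!: exI [of _ "%i. if i = j then g else (%_. 0)"])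
qed

lemma mideal_TP_flat: "f \<in> mideal n ==> f \<in> TP \<and> flat n 0 f"
proof (induction n arbitrary: f)
 case (Suc n)
 then obtain g where g: "\<forall>j. g j \<in> mideal n" "f = (%\<xi>. \<Sum>j\<in>UNIV. wgen j \<xi> * g j \<xi>)" by auto
 have "flat (1 + n) 0 (%\<xi>. wgen j \<xi> * g j \<xi>)" for j
  using Suc.IH g(1) by (intro flat_mult wgen_flat) auto
 moreover have "(%\<xi>. wgen j \<xi> * g j \<xi>) \<in> TP" for j
  using Suc.IH g(1) by (intro TP_mult wgen_TP) auto
 ultimately show ?case unfolding g(2) by (intro conjI TP_sum flat_sum) auto
qed (auto intro: TP_flat_0)

text \<open>Trigonometric polynomials in the coordinates from \<open>A\<close> only;
  \<open>A\<close> is the induction parameter in \<open>flat_imp_mideal\<close>.\<close>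

definition TPon :: "'n set => (real ^ 'n => complex) set" where
 "TPon A = {f. \<exists>F c. finite F \<and> (\<forall>k\<in>F. \<forall>i. i \<notin> A \<longrightarrow> k $ i = 0) \<and> f = (%\<xi>. \<Sum>k\<in>F. c k * ek k \<xi>)}"

lemma TPon_UNIV: "TPon UNIV = TP"
proof (intro set_eqI iffI)
 fix f assume "f \<in> TPon UNIV" then show "f \<in> TP" by (auto simp: TPon_def intro: TP_sumI)
next
 fix f :: "real ^ 'a => complex" assume "f \<in> TP" then show "f \<in> TPon UNIV" by (rule TP_E) (auto simp: TPon_def)
qed

lemma TPon_sumI:
 fixes \<kappa> :: "'a => int ^ 'n"
 assumes "finite I" "!!i j. i \<in> I ==> j \<notin> A ==> \<kappa> i $ j = 0"
 shows "(%\<xi>. \<Sum>i\<in>I. c i * ek (\<kappa> i) \<xi>) \<in> TPon A"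
proof -
 have "(\<Sum>i\<in>I. c i * ek (\<kappa> i) \<xi>) = (\<Sum>k\<in>\<kappa> ` I. (\<Sum>i | i \<in> I \<and> \<kappa> i = k. c i) * ek k \<xi>)" for \<xi>
 proof -
  have "(\<Sum>i\<in>I. c i * ek (\<kappa> i) \<xi>) = (\<Sum>k\<in>\<kappa> ` I. \<Sum>i | i \<in> I \<and> \<kappa> i = k. c i * ek (\<kappa> i) \<xi>)"
   using assms(1) by (rule sum.image_gen)
  also have "... = (\<Sum>k\<in>\<kappa> ` I. (\<Sum>i | i \<in> I \<and> \<kappa> i = k. c i) * ek k \<xi>)"
   unfolding sum_distrib_right by (intro sum.cong) auto
  finally show ?thesis .
 qed
 then show ?thesis unfolding TPon_def
  using assms by (auto intro!: exI [of _ "\<kappa> ` I"] exI [of _ "%k. \<Sum>i | i \<in> I \<and> \<kappa> i = k. c i"])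
qed

lemma TPon_decompose:
 assumes "f \<in> TPon (insert j A)"
 obtains g where "(%\<xi>. f (\<xi> - (\<xi> $ j) *\<^sub>R axis j 1)) \<in> TPon A" "g \<in> TP"
  "!!\<xi>. f \<xi> = f (\<xi> - (\<xi> $ j) *\<^sub>R axis j 1) + wgen j \<xi> * g \<xi>"
proof -
 obtain F c where F: "finite F" "!!k i. k \<in> F ==> i \<notin> insert j A ==> k $ i = 0"
  and f: "f = (%\<xi>. \<Sum>k\<in>F. c k * ek k \<xi>)" using assms by (auto simp: TPon_def)
 obtain g where g: "!!n. g n \<in> TP" "!!n \<xi>. ek (axis j n) \<xi> - 1 = wgen j \<xi> * g n \<xi>"
  using ek_axis_divides [of j] by metis
 define z where "z k = k - axis j (k $ j)" for k :: "int ^ 'a"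
 have zk: "ek k (\<xi> - (\<xi> $ j) *\<^sub>R axis j 1) = ek (z k) \<xi>" for k \<xi>
  by (simp add: ek_def z_def of_lattice_diff of_lattice_axis inner_diff_left inner_diff_right inner_axis inner_axis' mult.commute)
 have f0: "f (\<xi> - (\<xi> $ j) *\<^sub>R axis j 1) = (\<Sum>k\<in>F. c k * ek (z k) \<xi>)" for \<xi>
  by (simp add: f zk)
 show ?thesis
 proof (rule that)
  show "(%\<xi>. f (\<xi> - (\<xi> $ j) *\<^sub>R axis j 1)) \<in> TPon A"
   unfolding f0 by (rule TPon_sumI [OF F(1)]) (use F(2) in \<open>auto simp: z_def axis_def\<close>)
  show "(%\<xi>. \<Sum>k\<in>F. c k * (ek (z k) \<xi> * g (k $ j) \<xi>)) \<in> TP"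
   by (intro TP_sum TP_scale TP_mult TP_ek g)
  fix \<xi>
  have e: "ek k \<xi> = ek (z k) \<xi> + wgen j \<xi> * (ek (z k) \<xi> * g (k $ j) \<xi>)" for k
  proof -
   have "ek k \<xi> = ek (z k) \<xi> * ek (axis j (k $ j)) \<xi>" by (simp add: ek_add [symmetric] z_def)
   also have "ek (axis j (k $ j)) \<xi> = 1 + wgen j \<xi> * g (k $ j) \<xi>" using g(2) [of "k $ j" \<xi>] by (simp add: diff_eq_eq)
   finally show ?thesis by (simp add: algebra_simps)
  qed
  have "f \<xi> = (\<Sum>k\<in>F. c k * (ek (z k) \<xi> + wgen j \<xi> * (ek (z k) \<xi> * g (k $ j) \<xi>)))"
   by (simp only: f e [symmetric])
  also have "... = f (\<xi> - (\<xi> $ j) *\<^sub>R axis j 1) + wgen j \<xi> * (\<Sum>k\<in>F. c k * (ek (z k) \<xi> * g (k $ j) \<xi>))"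
   unfolding f0 by (simp add: distrib_left sum.distrib sum_distrib_left mult.left_commute)
  finally show "f \<xi> = f (\<xi> - (\<xi> $ j) *\<^sub>R axis j 1) + wgen j \<xi> * (\<Sum>k\<in>F. c k * (ek (z k) \<xi> * g (k $ j) \<xi>))" .
 qed
qed

text \<open>The Taylor coefficients at the origin detect the power of the maximal ideal: set one coordinate
 to zero, divide the difference by \<open>wgen j\<close>, and recurse on the coordinates and on the order.\<close>
lemma flat_imp_mideal:
 assumes "f \<in> TP" "flat n 0 f" shows "f \<in> mideal n"
 using assms
proof (induction n arbitrary: f)
 case (Suc n)
 have "f \<in> TPon A ==> flat (Suc n) 0 f ==> f \<in> mideal (Suc n)" if "finite A" for A and f :: "real ^ 'a => complex"
  using that
 proof (induction A arbitrary: f rule: finite_induct)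
  case empty
  then obtain F c where F: "\<forall>k\<in>F. k = 0" "f = (%\<xi>. \<Sum>k\<in>F. c k * ek k \<xi>)"
   by (auto simp: TPon_def vec_eq_iff)
  have "f \<xi> = f 0" for \<xi> unfolding F(2) by (intro sum.cong) (use F(1) in auto)
  moreover have "f 0 = 0" using flat_at [OF empty.prems(2)] .
  ultimately have "f = (%_. 0)" by auto
  then show ?case using mideal_zero by blast
 next
  case (insert j A)
  obtain g where g: "(%\<xi>. f (\<xi> - (\<xi> $ j) *\<^sub>R axis j 1)) \<in> TPon A" "g \<in> TP"
   "!!\<xi>. f \<xi> = f (\<xi> - (\<xi> $ j) *\<^sub>R axis j 1) + wgen j \<xi> * g \<xi>"
   using TPon_decompose [OF insert.prems(1)] by blast
  have "norm (\<xi> - (\<xi> $ j) *\<^sub>R axis j 1) \<le> norm \<xi>" for \<xi> :: "real ^ 'a"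
   by (rule norm_le_componentwise_cart) (simp add: axis_def)
  then have le: "norm (\<xi> - (\<xi> $ j) *\<^sub>R axis j 1) ^ Suc n \<le> norm \<xi> ^ Suc n" for \<xi> :: "real ^ 'a"
   by (intro power_mono) auto
  obtain C where C: "C \<ge> 0" "!!\<xi>. cmod (f \<xi>) \<le> C * norm (\<xi> - 0) ^ Suc n" using insert.prems(2) by (rule flatE) auto
  have fl: "flat (Suc n) 0 (%\<xi>. f (\<xi> - (\<xi> $ j) *\<^sub>R axis j 1))"
  proof (rule flatI)
   fix \<xi>
   show "cmod (f (\<xi> - (\<xi> $ j) *\<^sub>R axis j 1)) \<le> C * norm (\<xi> - 0) ^ Suc n"
    using C(2) [of "\<xi> - (\<xi> $ j) *\<^sub>R axis j 1"] mult_left_mono [OF le [of \<xi>] C(1)] by simp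
  qed
  have "wgen j \<xi> * g \<xi> = f \<xi> - f (\<xi> - (\<xi> $ j) *\<^sub>R axis j 1)" for \<xi>
   using g(3) [of \<xi>] unfolding eq_diff_eq by (metis add.commute)
  then have "flat (Suc n) 0 (%\<xi>. wgen j \<xi> * g \<xi>)"
   using flat_diff [OF insert.prems(2) fl] by simp
  then have "flat n 0 g" by (rule TP_quotient_wgen [OF g(2)])
  then have "g \<in> mideal n" by (rule Suc.IH [OF g(2)])
  then have "(%\<xi>. wgen j \<xi> * g \<xi>) \<in> mideal (Suc n)" by (rule mideal_wgen)
  from mideal_add [OF insert.IH [OF g(1) fl] this]
  have "(%\<xi>. f (\<xi> - (\<xi> $ j) *\<^sub>R axis j 1) + wgen j \<xi> * g \<xi>) \<in> mideal (Suc n)" .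
  also have "(%\<xi>. f (\<xi> - (\<xi> $ j) *\<^sub>R axis j 1) + wgen j \<xi> * g \<xi>) = f"
   by (rule ext) (rule g(3) [symmetric])
  finally show ?case .
 qed
 from this [of UNIV f] show ?case using Suc.prems by (simp add: TPon_UNIV)
qed simp

text \<open>The two arguments are kept apart because the kernels are evaluated at \<eta> = \<xi> +
  2\<pi>\<omega>, not only on the diagonal.\<close>

abbreviation listkernel :: "((real ^ 'n => complex) \<times> (real ^ 'n => complex)) list => real ^ 'n => real ^ 'n => complex" where
 "listkernel ps \<xi> \<eta> \<equiv> (\<Sum>pq\<leftarrow>ps. cnj (fst pq \<xi>) * snd pq \<eta>)"

definition flatpairs :: "nat => nat => ((real ^ 'n => complex) \<times> (real ^ 'n => complex)) list => bool" where
 "flatpairs a b ps \<longleftrightarrow> (\<forall>pq\<in>set ps. fst pq \<in> TP \<and> flat a 0 (fst pq) \<and> snd pq \<in> TP \<and> flat b 0 (snd pq))"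

text \<open>The generators are distributed one by one: the first \<open>a\<close> of them go to the
  left factor, conjugated so as to cancel the conjugation in \<open>listkernel\<close>, and the
  remaining power of the ideal is the right factor.\<close>

lemma mideal_split:
 "f \<in> mideal (a + b) ==> \<exists>ps. flatpairs a b ps \<and> f = (%\<xi>. listkernel ps \<xi> \<xi>)"
proof (induction a arbitrary: f)
 case 0
 then have "f \<in> TP" "flat b 0 f" using mideal_TP_flat by force+
 then show ?case
  by (intro exI [of _ "[(%_. 1, f)]"]) (auto simp: flatpairs_def TP_const flat_const)
next
 case (Suc a)
 then obtain g where g: "\<forall>j. g j \<in> mideal (a + b)" "f = (%\<xi>. \<Sum>j\<in>UNIV. wgen j \<xi> * g j \<xi>)" by auto
 have "\<exists>ps. flatpairs (Suc a) b ps \<and> (%\<xi>. \<Sum>j\<in>J. wgen j \<xi> * g j \<xi>) = (%\<xi>. listkernel ps \<xi> \<xi>)" if "finite J" for J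
  using that
 proof (induction J rule: finite_induct)
  case empty show ?case by (intro exI [of _ "[]"]) (auto simp: flatpairs_def)
 next
  case (insert j J)
  then obtain ps where ps: "flatpairs (Suc a) b ps" "(%\<xi>. \<Sum>j\<in>J. wgen j \<xi> * g j \<xi>) = (%\<xi>. listkernel ps \<xi> \<xi>)" by blast
  obtain qs where qs: "flatpairs a b qs" "g j = (%\<xi>. listkernel qs \<xi> \<xi>)" using Suc.IH g(1) by blast
  define qs' where "qs' = map (%pq. (%\<xi>. cnj (wgen j \<xi>) * fst pq \<xi>, snd pq)) qs"
  have "flat (1 + a) 0 (%\<xi>. cnj (wgen j \<xi>) * p \<xi>)" if "flat a 0 p" for p
   using that wgen_flat by (intro flat_mult) (auto simp: flat_cnj)
  then have "flatpairs (Suc a) b qs'" using qs(1)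
   by (auto simp: flatpairs_def qs'_def intro!: TP_mult TP_cnj [OF wgen_TP])
  moreover have "listkernel qs' \<xi> \<xi> = wgen j \<xi> * g j \<xi>" for \<xi>
   unfolding qs(2) qs'_def by (simp add: o_def sum_list_const_mult [symmetric] mult.assoc)
  ultimately show ?case using ps insert.hyps
   by (intro exI [of _ "qs' @ ps"]) (auto simp: flatpairs_def fun_eq_iff)
 qed
 from this [of UNIV] show ?case using g(2) by auto
qed

lemma TP_split:
 assumes "f \<in> TP" "flat (2 * m) 0 f"
 obtains ps where "flatpairs m m ps" "f = (%\<xi>. listkernel ps \<xi> \<xi>)"
 using mideal_split [of f m m] flat_imp_mideal [OF assms] by (auto simp: mult_2)

subsection \<open>The finite set \<open>\<Omega>\<^sub>M\<close>\<close>

lemma finite_int_vec_box: "finite {k :: int ^ 'n::finite. \<forall>i. \<bar>k $ i\<bar> \<le> B}"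
proof -
 have "{k :: int ^ 'n. \<forall>i. \<bar>k $ i\<bar> \<le> B} \<subseteq> (%f. \<chi> i. f i) ` PiE UNIV (%_. {-B..B})"
 proof
  fix k :: "int ^ 'n" assume "k \<in> {k. \<forall>i. \<bar>k $ i\<bar> \<le> B}"
  then have "\<bar>k $ i\<bar> \<le> B" for i by auto
  then have "- B \<le> k $ i \<and> k $ i \<le> B" for i by (simp add: abs_le_iff) (smt (verit))
  then have "($) k \<in> PiE UNIV (%_. {-B..B})" by (auto simp: PiE_def)
  then show "k \<in> (%f. \<chi> i. f i) ` PiE UNIV (%_. {-B..B})" by (rule rev_image_eqI) (simp add: vec_eq_iff)
 qed
 moreover have "finite (PiE (UNIV :: 'n set) (%_. {-B..B}))" by (intro finite_PiE) auto
 ultimately show ?thesis using finite_surj by blast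
qed

lemma finite_lattice_ball: "finite {k :: int ^ 'n::finite. norm (of_lattice k) \<le> B}"
proof (rule finite_subset [OF _ finite_int_vec_box [of "\<lceil>B\<rceil>"]])
 show "{k :: int ^ 'n. norm (of_lattice k) \<le> B} \<subseteq> {k. \<forall>i. \<bar>k $ i\<bar> \<le> \<lceil>B\<rceil>}"
 proof clarify
  fix k :: "int ^ 'n" and i assume "norm (of_lattice k) \<le> B"
  then have "\<bar>real_of_int (k $ i)\<bar> \<le> B" using component_le_norm_cart [of "of_lattice k" i] by simp
  then show "\<bar>k $ i\<bar> \<le> \<lceil>B\<rceil>" by linarith
 qed
qed

locale integer_matrix =
 fixes M :: "real ^ 'n::finite ^ 'n"
 assumes intM: "intmat M" and invM: "invertible M"
begin

abbreviation "MT \<equiv> transpose M"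
abbreviation "MTi \<equiv> matrix_inv (transpose M)"

lemma invMT: "invertible MT"
 using invM by (rule transpose_invertible)

lemma MT_MTi [simp]: "MT *v (MTi *v x) = x" and MTi_MT [simp]: "MTi *v (MT *v x) = x"
proof -
 have "MT ** MTi = mat 1 \<and> MTi ** MT = mat 1"
  using invMT unfolding invertible_def matrix_inv_def by (rule someI_ex)
 then show "MT *v (MTi *v x) = x" "MTi *v (MT *v x) = x" by (simp_all add: matrix_vector_mul_assoc)
qed

lemma Omega_lattice: assumes "\<omega> \<in> Omega M" obtains k where "MT *v \<omega> = of_lattice k"
 using assms by (auto simp: Omega_def simp del: transpose_matrix_vector)

text \<open>\<Omega> represents the classes of M^{-T}Z^d modulo Z^d: here existence of a
  representative, in \<open>Omega_diff_lattice\<close> its uniqueness.\<close>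

lemma Omega_frac:
 obtains \<omega> l where "\<omega> \<in> Omega M" "MTi *v of_lattice k = \<omega> + of_lattice l"
proof -
 define l :: "int ^ 'n" where "l = (\<chi> i. \<lfloor>(MTi *v of_lattice k) $ i\<rfloor>)"
 define \<omega> where "\<omega> = MTi *v of_lattice k - of_lattice l"
 have "of_lattice l = MTi *v of_lattice (zmul MT l)"
  by (simp add: of_lattice_zmul [OF intmat_transpose [OF intM]] del: transpose_matrix_vector)
 then have "\<omega> = MTi *v of_lattice (k - zmul MT l)"
  unfolding \<omega>_def of_lattice_diff by (simp add: matrix_vector_mult_diff_distrib)
 moreover have "0 \<le> \<omega> $ i \<and> \<omega> $ i < 1" for i
  by (simp add: \<omega>_def l_def) (linarith)
 ultimately have "\<omega> \<in> Omega M" by (auto simp: Omega_def)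
 then show ?thesis by (rule that [of \<omega> l]) (simp add: \<omega>_def)
qed

lemma Omega_diff_lattice:
 assumes "\<omega> \<in> Omega M" "\<omega>' \<in> Omega M" "\<omega> - \<omega>' = of_lattice l" shows "\<omega> = \<omega>'"
proof -
 have "l $ i = 0" for i
 proof -
  have "real_of_int (l $ i) = \<omega> $ i - \<omega>' $ i" using arg_cong [OF assms(3), of "%x. x $ i"] by simp
  moreover have "0 \<le> \<omega> $ i" "\<omega> $ i < 1" "0 \<le> \<omega>' $ i" "\<omega>' $ i < 1" using assms(1,2) by (auto simp: Omega_def)
  ultimately have "\<bar>real_of_int (l $ i)\<bar> < 1" by linarith
  then show ?thesis by linarith
 qed
 then have "l = 0" by (simp add: vec_eq_iff)
 then show ?thesis using assms(3) by simp
qed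

lemma zero_in_Omega: "0 \<in> Omega M"
proof -
 have "MTi *v of_lattice 0 = 0" by simp
 then show ?thesis unfolding Omega_def by (auto intro!: rangeI image_eqI [of _ _ 0])
qed

lemma finite_Omega: "finite (Omega M)"
proof -
 obtain B where B: "B > 0" "!!x. norm (MT *v x) \<le> B * norm x"
  using linear_bounded_pos [OF matrix_vector_mul_linear [of MT]] by blast
 have "Omega M \<subseteq> (%k. MTi *v of_lattice k) ` {k. norm (of_lattice k) \<le> B * real CARD('n)}"
 proof
  fix \<omega> assume \<omega>: "\<omega> \<in> Omega M"
  then obtain k where k: "\<omega> = MTi *v of_lattice k" and c: "\<forall>i. 0 \<le> \<omega> $ i \<and> \<omega> $ i < 1" by (auto simp: Omega_def)
  have "norm \<omega> \<le> (\<Sum>i\<in>UNIV. \<bar>\<omega> $ i\<bar>)" by (rule norm_le_l1_cart)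
  also have "... \<le> (\<Sum>i\<in>(UNIV :: 'n set). 1)"
  proof (rule sum_mono)
   fix i show "\<bar>\<omega> $ i\<bar> \<le> 1" using c [rule_format, of i] by linarith
  qed
  finally have "norm \<omega> \<le> real CARD('n)" by simp
  moreover have "of_lattice k = MT *v \<omega>" unfolding k by simp
  ultimately have "norm (of_lattice k) \<le> B * real CARD('n)"
   using B(2) [of \<omega>] B(1) by (metis less_eq_real_def mult_left_mono order_trans)
  then show "\<omega> \<in> (%k. MTi *v of_lattice k) ` {k. norm (of_lattice k) \<le> B * real CARD('n)}" using k by blast
 qed
 then show ?thesis using finite_lattice_ball finite_surj by blast
qed

text \<open>Hermitian symmetry exchanges \<omega> with -\<omega>, which has to be brought back into
  \<Omega> by an integer vector.\<close>

lemma Omega_neg: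
 assumes "\<omega> \<in> Omega M"
 obtains \<omega>' l where "\<omega>' \<in> Omega M" "- \<omega> = \<omega>' + of_lattice l" "\<omega>' = 0 \<longleftrightarrow> \<omega> = 0"
proof -
 obtain k where k: "\<omega> = MTi *v of_lattice k" using assms by (auto simp: Omega_def)
 have "- \<omega> = MTi *v of_lattice (- k)" unfolding k of_lattice_uminus by (rule linear_neg [OF matrix_vector_mul_linear, symmetric])
 then obtain \<omega>' l where w: "\<omega>' \<in> Omega M" "- \<omega> = \<omega>' + of_lattice l" using Omega_frac [of "- k"] by metis
 have "\<omega>' = 0 \<longleftrightarrow> \<omega> = 0"
 proof
  assume "\<omega>' = 0"
  then have "- \<omega> = of_lattice l" using w(2) by simp
  then have "\<omega> - 0 = of_lattice (- l)" unfolding of_lattice_uminus by (metis diff_zero minus_minus)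
  then show "\<omega> = 0" using Omega_diff_lattice [OF assms zero_in_Omega] by blast
 next
  assume "\<omega> = 0"
  then have "\<omega>' - 0 = of_lattice (- l)" using w(2) by (simp add: of_lattice_uminus eq_neg_iff_add_eq_0)
  then show "\<omega>' = 0" using Omega_diff_lattice [OF w(1) zero_in_Omega] by blast
 qed
 then show ?thesis using that w by blast
qed

lemma Omega_separated:
 assumes "\<omega> \<in> Omega M" "\<omega>' \<in> Omega M" "\<omega> \<noteq> \<omega>'"
 obtains k where "ek k (tp \<omega>) \<noteq> ek k (tp \<omega>')"
proof -
 have "\<exists>i. (\<omega> - \<omega>') $ i \<notin> \<int>"
 proof (rule ccontr)
  assume "\<not> ?thesis"
  then have "\<forall>i. \<exists>n. (\<omega> - \<omega>') $ i = real_of_int n" by (auto elim: Ints_cases)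
  then obtain n where "\<forall>i. (\<omega> - \<omega>') $ i = real_of_int (n i)" by metis
  then have "\<omega> - \<omega>' = of_lattice (\<chi> i. n i)" by (simp add: vec_eq_iff)
  then show False using Omega_diff_lattice assms by blast
 qed
 then obtain i where i: "(\<omega> - \<omega>') $ i \<notin> \<int>" ..
 show ?thesis
 proof (rule that [of "axis i 1"], rule notI)
  assume eq: "ek (axis i 1) (tp \<omega>) = ek (axis i 1) (tp \<omega>')"
  have "tp \<omega> = tp (\<omega> - \<omega>') + tp \<omega>'" by (simp add: scaleR_diff_right)
  with eq have "ek (axis i 1) (tp (\<omega> - \<omega>')) = 1" by (metis ek_nonzero ek_plus mult_cancel_right1)
  moreover define x where "x = (\<omega> - \<omega>') $ i"
  ultimately have "exp (- (\<i> * of_real (2 * pi * x))) = 1"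
   by (simp add: ek_def of_lattice_axis inner_axis' del: vector_minus_component)
  then obtain n :: int where "Im (- (\<i> * of_real (2 * pi * x))) = of_int (2 * n) * pi"
   unfolding exp_eq_1 by blast
  then have "- (2 * pi * x) = of_int (2 * n) * pi" by simp
  then have "(2 * pi) * (x + of_int n) = 0" unfolding distrib_left by simp
  then have "x + of_int n = 0" by simp
  then have "x = of_int (- n)" by simp
  then show False using i Ints_of_int unfolding x_def by metis
 qed
qed

text \<open>Lagrange interpolation, with the characters separating the points of \<Omega>.\<close>

lemma Omega_indicator:
 assumes "\<omega>' \<in> Omega M"
 obtains w where "w \<in> TP" "!!\<omega>. \<omega> \<in> Omega M ==> w (tp \<omega>) = (if \<omega> = \<omega>' then 1 else 0)"
proof -
 have "\<forall>\<omega>. \<exists>k. \<omega> \<in> Omega M - {\<omega>'} \<longrightarrow> ek k (tp \<omega>') \<noteq> ek k (tp \<omega>)"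
  by (metis DiffE Omega_separated assms insertI1)
 then obtain k where k: "!!\<omega>. \<omega> \<in> Omega M - {\<omega>'} ==> ek (k \<omega>) (tp \<omega>') \<noteq> ek (k \<omega>) (tp \<omega>)" by metis
 define w where "w \<xi> = (\<Prod>\<omega>\<in>Omega M - {\<omega>'}. (1 / (ek (k \<omega>) (tp \<omega>') - ek (k \<omega>) (tp \<omega>)))
   * (ek (k \<omega>) \<xi> - ek (k \<omega>) (tp \<omega>)))" for \<xi>
 show ?thesis
 proof (rule that)
  show "w \<in> TP" unfolding w_def by (intro TP_prod TP_scale TP_diff TP_ek TP_const)
  fix \<omega> assume "\<omega> \<in> Omega M"
  then show "w (tp \<omega>) = (if \<omega> = \<omega>' then 1 else 0)"
   using k finite_Omega by (auto simp: w_def intro!: prod.neutral)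
 qed
qed

subsection \<open>Kernels spanned by flat pairs\<close>

text \<open>The order of quantifiers matters: a single list of pairs has to represent the kernel for
  all \<omega>, since a filter may not depend on \<omega>.\<close>

definition rep :: "nat => (real ^ 'n => real ^ 'n => complex) => bool" where
 "rep m K \<longleftrightarrow> (\<exists>ps. flatpairs m m ps \<and> (\<forall>\<xi>. \<forall>\<omega>\<in>Omega M. K \<xi> \<omega> = listkernel ps \<xi> (\<xi> + tp \<omega>)))"

lemma rep_add: assumes "rep m K" "rep m L" shows "rep m (%\<xi> \<omega>. K \<xi> \<omega> + L \<xi> \<omega>)"
proof -
 obtain ps qs where "flatpairs m m ps" "flatpairs m m qs"
  "!!\<xi> \<omega>. \<omega> \<in> Omega M ==> K \<xi> \<omega> = listkernel ps \<xi> (\<xi> + tp \<omega>)"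
  "!!\<xi> \<omega>. \<omega> \<in> Omega M ==> L \<xi> \<omega> = listkernel qs \<xi> (\<xi> + tp \<omega>)"
  using assms by (auto simp: rep_def)
 then show ?thesis unfolding rep_def by (intro exI [of _ "ps @ qs"]) (auto simp: flatpairs_def)
qed

lemma rep_zero: "rep m (%_ _. 0)"
 unfolding rep_def by (intro exI [of _ "[]"]) (auto simp: flatpairs_def)

lemma rep_sum: "(!!i. i \<in> I ==> rep m (K i)) ==> rep m (%\<xi> \<omega>. \<Sum>i\<in>I. K i \<xi> \<omega>)"
 by (induction I rule: infinite_finite_induct) (auto intro: rep_add rep_zero)

lemma rep_cong:
 assumes "rep m K" "!!\<xi> \<omega>. \<omega> \<in> Omega M ==> L \<xi> \<omega> = K \<xi> \<omega>" shows "rep m L"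
proof -
 obtain ps where "flatpairs m m ps" "\<forall>\<xi>. \<forall>\<omega>\<in>Omega M. K \<xi> \<omega> = listkernel ps \<xi> (\<xi> + tp \<omega>)"
  using assms(1) unfolding rep_def by blast
 with assms(2) show ?thesis unfolding rep_def by (intro exI [of _ ps]) auto
qed

lemma rep_single:
 assumes "p \<in> TP" "flat m 0 p" "q \<in> TP" "flat m 0 q"
 shows "rep m (%\<xi> \<omega>. cnj (p \<xi>) * q (\<xi> + tp \<omega>))"
 unfolding rep_def using assms by (intro exI [of _ "[(p, q)]"]) (auto simp: flatpairs_def)

text \<open>The indicator of a single \<open>\<omega>'\<close> is itself a kernel, as
 \<open>ek k (2\<pi>\<omega>) = cnj (ek k \<xi>) * ek k (\<xi> + 2\<pi>\<omega>)\<close>.\<close>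
lemma rep_local:
 assumes "\<omega>' \<in> Omega M" "p \<in> TP" "flat m 0 p" "q \<in> TP" "flat m 0 q"
 shows "rep m (%\<xi> \<omega>. if \<omega> = \<omega>' then cnj (p \<xi>) * q (\<xi> + tp \<omega>) else 0)"
proof -
 obtain w where w: "w \<in> TP" "!!\<omega>. \<omega> \<in> Omega M ==> w (tp \<omega>) = (if \<omega> = \<omega>' then 1 else 0)"
  using Omega_indicator [OF assms(1)] by blast
 obtain F c where f: "finite F" "w = (%\<xi>. \<Sum>k\<in>F. c k * ek k \<xi>)" using w(1) by (rule TP_E)
 have "rep m (%\<xi> \<omega>. \<Sum>k\<in>F. cnj (ek k \<xi> * p \<xi>) * (c k * (ek k (\<xi> + tp \<omega>) * q (\<xi> + tp \<omega>))))"
 proof (rule rep_sum)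
  fix k
  have "flat m 0 (%\<xi>. ek k \<xi> * p \<xi>)" "flat m 0 (%\<xi>. ek k \<xi> * q \<xi>)"
   using flat_mult_bounded [OF assms(3) TP_flat_0 [OF TP_ek]] flat_mult_bounded [OF assms(5) TP_flat_0 [OF TP_ek]] by (auto simp: mult.commute)
  then show "rep m (%\<xi> \<omega>. cnj (ek k \<xi> * p \<xi>) * (c k * (ek k (\<xi> + tp \<omega>) * q (\<xi> + tp \<omega>))))"
   by (intro rep_single TP_scale TP_mult TP_ek assms flat_scale)
 qed
 then show ?thesis
 proof (rule rep_cong)
  fix \<xi> \<omega> assume om: "\<omega> \<in> Omega M"
  have e: "cnj (ek k \<xi>) * ek k (\<xi> + tp \<omega>) = ek k (tp \<omega>)" for k
   by (simp add: ek_plus mult.assoc [symmetric])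
  have "(\<Sum>k\<in>F. cnj (ek k \<xi> * p \<xi>) * (c k * (ek k (\<xi> + tp \<omega>) * q (\<xi> + tp \<omega>))))
    = (\<Sum>k\<in>F. c k * (cnj (ek k \<xi>) * ek k (\<xi> + tp \<omega>))) * (cnj (p \<xi>) * q (\<xi> + tp \<omega>))"
   unfolding sum_distrib_right by (intro sum.cong) (auto simp: mult_ac)
  also have "(\<Sum>k\<in>F. c k * (cnj (ek k \<xi>) * ek k (\<xi> + tp \<omega>))) = w (tp \<omega>)"
   unfolding e f(2) ..
  finally show "(if \<omega> = \<omega>' then cnj (p \<xi>) * q (\<xi> + tp \<omega>) else 0) =
    (\<Sum>k\<in>F. cnj (ek k \<xi> * p \<xi>) * (c k * (ek k (\<xi> + tp \<omega>) * q (\<xi> + tp \<omega>))))"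
   using w(2) [OF om] by simp
 qed
qed

lemma rep_local_list:
 assumes "\<omega>' \<in> Omega M" "flatpairs m m ps"
 shows "rep m (%\<xi> \<omega>. if \<omega> = \<omega>' then listkernel ps \<xi> (\<xi> + tp \<omega>) else 0)"
 using assms(2)
proof (induction ps)
 case Nil show ?case by (rule rep_cong [OF rep_zero]) simp
next
 case (Cons pq ps)
 have "rep m (%\<xi> \<omega>. if \<omega> = \<omega>' then cnj (fst pq \<xi>) * snd pq (\<xi> + tp \<omega>) else 0)"
  using Cons.prems by (intro rep_local assms(1)) (auto simp: flatpairs_def)
 moreover have "rep m (%\<xi> \<omega>. if \<omega> = \<omega>' then listkernel ps \<xi> (\<xi> + tp \<omega>) else 0)"
  using Cons by (auto simp: flatpairs_def)
 ultimately show ?case by (rule rep_cong [OF rep_add]) auto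
qed

lemma TP_MT_periodic:
 assumes "f \<in> TP" "\<omega> \<in> Omega M" shows "f (MT *v (\<xi> + tp \<omega>)) = f (MT *v \<xi>)"
proof -
 obtain k where "MT *v \<omega> = of_lattice k" by (rule Omega_lattice [OF assms(2)])
 then show ?thesis using TP_periodic [OF assms(1)]
  by (simp add: matrix_vector_right_distrib matrix_vector_mult_scaleR del: transpose_matrix_vector)
qed

text \<open>Off the diagonal the two factors of \<open>a\<close> exchange their roles: \<open>a(\<xi> + 2\<pi>\<omega>)\<close> is flat as a
 function of \<open>\<xi>\<close> and \<open>a(\<xi>) = a(\<eta> - 2\<pi>\<omega>)\<close> is flat as a function of \<open>\<eta> = \<xi> + 2\<pi>\<omega>\<close>.\<close>
lemma rep_OEP_kernel:
 assumes A: "A \<in> TP" and t: "t \<in> TP"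
  and fl: "!!\<omega>. \<omega> \<in> Omega M ==> \<omega> \<noteq> 0 ==> flat m 0 (%\<xi>. A (\<xi> + tp \<omega>))"
  and diag: "flat (2 * m) 0 (%\<xi>. t \<xi> - cnj (A \<xi>) * t (MT *v \<xi>) * A \<xi>)"
 shows "rep m (%\<xi> \<omega>. delta \<omega> * t \<xi> - cnj (A \<xi>) * t (MT *v \<xi>) * A (\<xi> + tp \<omega>))"
proof -
 let ?K = "%\<xi> \<omega>. delta \<omega> * t \<xi> - cnj (A \<xi>) * t (MT *v \<xi>) * A (\<xi> + tp \<omega>)"
 have tM: "(%\<xi>. t (MT *v \<xi>)) \<in> TP" using t intM by (rule TP_transpose)
 have "rep m (%\<xi> \<omega>. if \<omega> = \<omega>' then ?K \<xi> \<omega> else 0)" if om: "\<omega>' \<in> Omega M" for \<omega>'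
 proof (cases "\<omega>' = 0")
  case True
  have "(%\<xi>. t \<xi> - cnj (A \<xi>) * t (MT *v \<xi>) * A \<xi>) \<in> TP" by (intro TP_diff TP_mult TP_cnj A t tM)
  then obtain ps where ps: "flatpairs m m ps" "(%\<xi>. t \<xi> - cnj (A \<xi>) * t (MT *v \<xi>) * A \<xi>) = (%\<xi>. listkernel ps \<xi> \<xi>)"
   using diag by (rule TP_split)
  show ?thesis
   by (rule rep_cong [OF rep_local_list [OF om ps(1)]])
    (use fun_cong [OF ps(2)] True in \<open>auto simp: delta_def\<close>)
 next
  case False
  obtain \<omega>'' l where neg: "\<omega>'' \<in> Omega M" "- \<omega>' = \<omega>'' + of_lattice l" "\<omega>'' = 0 \<longleftrightarrow> \<omega>' = 0"
   by (rule Omega_neg [OF om])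
  have per: "A (\<xi> - tp \<omega>') = A (\<xi> + tp \<omega>'')" for \<xi>
  proof -
   have "\<xi> - tp \<omega>' = (\<xi> + tp \<omega>'') + tp (of_lattice l)"
    using arg_cong [OF neg(2), of "%x. \<xi> + tp x"] by (simp add: scaleR_add_right)
   then show ?thesis using TP_periodic [OF A] by metis
  qed
  have p: "flat m 0 (%\<xi>. cnj (A (\<xi> + tp \<omega>')))" using fl [OF om False] by (simp add: flat_cnj)
  have "flat m 0 (%\<xi>. cnj (A (\<xi> - tp \<omega>')))" using fl neg False by (simp add: flat_cnj per)
  \<comment> \<open>The factor \<open>t (MT *v \<xi>)\<close> joins the second entry of the pair; it
    has the same value at \<xi> and at \<xi> + 2\<pi>\<omega>, because M^T\<omega> is
    integral.\<close>
  then have q: "flat m 0 (%\<xi>. cnj (A (\<xi> - tp \<omega>')) * (- 1 * t (MT *v \<xi>)))"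
   by (intro flat_mult_bounded flat_scale TP_flat_0 [OF tM])
  have "rep m (%\<xi> \<omega>. if \<omega> = \<omega>' then cnj (cnj (A (\<xi> + tp \<omega>'))) *
    (cnj (A ((\<xi> + tp \<omega>) - tp \<omega>')) * (- 1 * t (MT *v (\<xi> + tp \<omega>)))) else 0)"
  proof (rule rep_local [OF om _ p _ q])
   show "(%\<xi>. cnj (A (\<xi> + tp \<omega>'))) \<in> TP" by (intro TP_cnj TP_shift A)
   have "(%\<xi>. A (\<xi> - tp \<omega>')) \<in> TP" unfolding per by (intro TP_shift A)
   then show "(%\<xi>. cnj (A (\<xi> - tp \<omega>')) * (- 1 * t (MT *v \<xi>))) \<in> TP"
    by (intro TP_mult [OF TP_cnj TP_scale] tM)
  qed
  then show ?thesis
   by (rule rep_cong) (use False om in \<open>auto simp: delta_def TP_MT_periodic [OF t]\<close>)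
 qed
 then have "rep m (%\<xi> \<omega>. \<Sum>\<omega>'\<in>Omega M. if \<omega> = \<omega>' then ?K \<xi> \<omega> else 0)" by (rule rep_sum)
 then show ?thesis by (rule rep_cong) (simp add: finite_Omega)
qed

theorem OEP_filter_bank_exists:
 assumes A: "A \<in> TP" and t: "t \<in> TP" and treal: "!!\<xi>. cnj (t \<xi>) = t \<xi>"
  and fl: "!!\<omega>. \<omega> \<in> Omega M ==> \<omega> \<noteq> 0 ==> flat m 0 (%\<xi>. A (\<xi> + tp \<omega>))"
  and diag: "flat (2 * m) 0 (%\<xi>. t \<xi> - cnj (A \<xi>) * t (MT *v \<xi>) * A \<xi>)"
 obtains s b \<epsilon> where "s \<ge> (1 :: nat)"
  "!!l. l \<in> {1..s} ==> b l \<in> l0 \<and> flat m 0 (filter_hat (b l)) \<and> \<epsilon> l \<in> {1, -1 :: real}"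
  "!!\<xi> \<omega>. \<omega> \<in> Omega M ==> cnj (A \<xi>) * t (MT *v \<xi>) * A (\<xi> + tp \<omega>)
    + (\<Sum>l=1..s. cnj (filter_hat (b l) \<xi>) * complex_of_real (\<epsilon> l) * filter_hat (b l) (\<xi> + tp \<omega>))
    = delta \<omega> * t \<xi>"
proof -
 let ?K = "%\<xi> \<omega>. delta \<omega> * t \<xi> - cnj (A \<xi>) * t (MT *v \<xi>) * A (\<xi> + tp \<omega>)"
 have "rep m ?K" using assms by (intro rep_OEP_kernel) auto
 then obtain ps0 where ps0: "flatpairs m m ps0"
  "!!\<xi> \<omega>. \<omega> \<in> Omega M ==> ?K \<xi> \<omega> = listkernel ps0 \<xi> (\<xi> + tp \<omega>)" unfolding rep_def by blast
 \<comment> \<open>The zero pair guarantees at least one generator even if \<open>ps0\<close> is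
   empty.\<close>
 define ps where "ps = (%_. 0, %_. 0) # ps0"
 have ps: "flatpairs m m ps" "!!\<xi> \<omega>. \<omega> \<in> Omega M ==> ?K \<xi> \<omega> = listkernel ps \<xi> (\<xi> + tp \<omega>)"
  using ps0 by (auto simp: ps_def flatpairs_def TP_const flat_zero)
 \<comment> \<open>As \<open>t\<close> is real, the kernel is Hermitian: the conjugate of its value
   at \<xi> + 2\<pi>\<omega> and the representative of -\<omega> is its value at \<xi> and \<omega>.
   Hence the pairs with their entries exchanged represent it as well.\<close>
 have swap: "?K \<xi> \<omega> = (\<Sum>pq\<leftarrow>ps. cnj (snd pq \<xi>) * fst pq (\<xi> + tp \<omega>))" if om: "\<omega> \<in> Omega M" for \<xi> \<omega>
 proof -
  obtain \<omega>'' l where neg: "\<omega>'' \<in> Omega M" "- \<omega> = \<omega>'' + of_lattice l" "\<omega>'' = 0 \<longleftrightarrow> \<omega> = 0"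
   by (rule Omega_neg [OF om])
  let ?\<eta> = "\<xi> + tp \<omega>"
  have per: "f (?\<eta> + tp \<omega>'') = f \<xi>" if "f \<in> TP" for f
  proof -
   have "\<xi> = (?\<eta> + tp \<omega>'') + tp (of_lattice l)"
    using arg_cong [OF neg(2), of "%x. ?\<eta> + tp x"] by (simp add: scaleR_add_right)
   then show ?thesis using TP_periodic [OF that] by metis
  qed
  have "cnj (?K ?\<eta> \<omega>'') = ?K \<xi> \<omega>"
   using neg(3) per [OF A] TP_MT_periodic [OF t om, of \<xi>] by (auto simp: delta_def treal)
  also have "cnj (?K ?\<eta> \<omega>'') = (\<Sum>pq\<leftarrow>ps. cnj (cnj (fst pq ?\<eta>) * snd pq (?\<eta> + tp \<omega>'')))"
   unfolding ps(2) [OF neg(1)] by (induction ps) auto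
  also have "... = (\<Sum>pq\<leftarrow>ps. cnj (snd pq \<xi>) * fst pq ?\<eta>)"
   using ps(1) by (intro arg_cong [of _ _ sum_list] map_cong refl) (auto simp: flatpairs_def per)
  finally show ?thesis by simp
 qed
 \<comment> \<open>A pair p, q yields (p + q)/2 with sign 1 and (p - q)/2 with sign -1; the signed
   squares add up to the mean of the pair and the exchanged pair.\<close>
 define half where "half = (%pq :: (real ^ 'n => complex) \<times> (real ^ 'n => complex).
  [(1 :: real, %\<xi>. 1 / 2 * (fst pq \<xi> + snd pq \<xi>)), (- 1, %\<xi>. 1 / 2 * (fst pq \<xi> - snd pq \<xi>))])"
 define fs where "fs = concat (map half ps)"
 have fs: "(\<Sum>ef\<leftarrow>fs. cnj (snd ef \<xi>) * complex_of_real (fst ef) * snd ef \<eta>)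
   = 1 / 2 * (listkernel ps \<xi> \<eta> + (\<Sum>pq\<leftarrow>ps. cnj (snd pq \<xi>) * fst pq \<eta>))" for \<xi> \<eta>
  unfolding fs_def by (induction ps) (auto simp: half_def algebra_simps)
 have fs_mem: "snd ef \<in> TP \<and> flat m 0 (snd ef) \<and> fst ef \<in> {1, -1}" if "ef \<in> set fs" for ef
 proof -
  obtain pq where pq: "pq \<in> set ps" "ef \<in> set (half pq)" using \<open>ef \<in> set fs\<close> by (auto simp: fs_def)
  have "fst pq \<in> TP" "flat m 0 (fst pq)" "snd pq \<in> TP" "flat m 0 (snd pq)" using ps(1) pq(1) by (auto simp: flatpairs_def)
  then show ?thesis using pq(2) unfolding half_def
   by (elim set_ConsD [THEN disjE]) (auto intro!: TP_scale [of _ "1/2", simplified] flat_scale [of _ _ _ "1/2", simplified] TP_add TP_diff flat_add flat_diff)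
 qed
 define s where "s = length fs"
 have "\<exists>u. u \<in> l0 \<and> filter_hat u = snd (fs ! (l - 1))" if "l \<in> {1..s}" for l
 proof -
  have "fs ! (l - 1) \<in> set fs" using that by (intro nth_mem) (auto simp: s_def)
  then have "snd (fs ! (l - 1)) \<in> TP" using fs_mem by blast
  then show ?thesis unfolding TP_def by force
 qed
 then obtain b where b: "!!l. l \<in> {1..s} ==> b l \<in> l0 \<and> filter_hat (b l) = snd (fs ! (l - 1))" by metis
 show ?thesis
 proof (rule that [of s b "%l. fst (fs ! (l - 1))"])
  show "s \<ge> 1" by (simp add: s_def fs_def ps_def half_def)
  fix l assume l: "l \<in> {1..s}"
  then have "fs ! (l - 1) \<in> set fs" by (intro nth_mem) (auto simp: s_def)
  then show "b l \<in> l0 \<and> flat m 0 (filter_hat (b l)) \<and> fst (fs ! (l - 1)) \<in> {1, -1}"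
   using b [OF l] fs_mem by metis
 next
  fix \<xi> \<omega> assume om: "\<omega> \<in> Omega M"
  let ?\<eta> = "\<xi> + tp \<omega>"
  let ?g = "%ef. cnj (snd ef \<xi>) * complex_of_real (fst ef) * snd ef ?\<eta>"
  have "(\<Sum>l=1..s. cnj (filter_hat (b l) \<xi>) * complex_of_real (fst (fs ! (l - 1))) * filter_hat (b l) ?\<eta>)
    = (\<Sum>l=1..s. ?g (fs ! (l - 1)))" using b by (intro sum.cong) auto
  also have "... = (\<Sum>l<s. ?g (fs ! l))"
   by (rule sum.reindex_bij_witness [of _ Suc "%l. l - 1"]) auto
  also have "... = (\<Sum>ef\<leftarrow>fs. ?g ef)"
   by (simp add: sum_list_sum_nth s_def atLeast0LessThan)
  also have "... = ?K \<xi> \<omega>" unfolding fs using ps(2) [OF om, of \<xi>] swap [OF om, of \<xi>] by simp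
  finally show "cnj (A \<xi>) * t (MT *v \<xi>) * A ?\<eta>
    + (\<Sum>l=1..s. cnj (filter_hat (b l) \<xi>) * complex_of_real (fst (fs ! (l - 1))) * filter_hat (b l) ?\<eta>)
    = delta \<omega> * t \<xi>" by simp
 qed
qed

end

subsection \<open>Trigonometric approximation of jets at the origin\<close>

text \<open>The local counterpart of \<open>flat\<close>: it compares polynomials, which are
  unbounded, with trigonometric polynomials near the origin.\<close>

definition locO :: "nat => (real ^ 'n => complex) => bool" where
 "locO n f \<longleftrightarrow> (\<exists>C r. r > 0 \<and> (\<forall>\<xi>. norm \<xi> < r \<longrightarrow> cmod (f \<xi>) \<le> C * norm \<xi> ^ n))"

lemma locOI: "r > 0 ==> (!!\<xi>. norm \<xi> < r ==> cmod (f \<xi>) \<le> C * norm \<xi> ^ n) ==> locO n f"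
 by (auto simp: locO_def)

lemma locOE:
 assumes "locO n f"
 obtains C r where "C \<ge> 0" "r > 0" "!!\<xi>. norm \<xi> < r ==> cmod (f \<xi>) \<le> C * norm \<xi> ^ n"
proof -
 obtain C r where C: "r > 0" "!!\<xi>. norm \<xi> < r ==> cmod (f \<xi>) \<le> C * norm \<xi> ^ n" using assms by (auto simp: locO_def)
 have "cmod (f \<xi>) \<le> max C 0 * norm \<xi> ^ n" if "norm \<xi> < r" for \<xi>
  by (rule order_trans [OF C(2) [OF that]]) (simp add: mult_right_mono)
 then show ?thesis using C(1) by (intro that [of "max C 0" r]) auto
qed

lemma flat_imp_locO: "flat n 0 f ==> locO n f"
 unfolding flat_def locO_def by (metis diff_zero zero_less_one)

lemma locO_add: assumes "locO n f" "locO n g" shows "locO n (%\<xi>. f \<xi> + g \<xi>)"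
proof -
 obtain C r where C: "C \<ge> 0" "r > 0" "!!\<xi>. norm \<xi> < r ==> cmod (f \<xi>) \<le> C * norm \<xi> ^ n" using assms(1) by (rule locOE) blast
 obtain D s where D: "D \<ge> 0" "s > 0" "!!\<xi>. norm \<xi> < s ==> cmod (g \<xi>) \<le> D * norm \<xi> ^ n" using assms(2) by (rule locOE) blast
 show ?thesis
 proof (rule locOI [of "min r s" _ "C + D"])
  fix \<xi> :: "real ^ 'a" assume "norm \<xi> < min r s"
  then show "cmod (f \<xi> + g \<xi>) \<le> (C + D) * norm \<xi> ^ n"
   using C(3) [of \<xi>] D(3) [of \<xi>] norm_triangle_ineq [of "f \<xi>" "g \<xi>"] by (simp add: distrib_right)
 qed (use C D in auto)
qed

lemma locO_mult: assumes "locO a f" "locO b g" shows "locO (a + b) (%\<xi>. f \<xi> * g \<xi>)"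
proof -
 obtain C r where C: "C \<ge> 0" "r > 0" "!!\<xi>. norm \<xi> < r ==> cmod (f \<xi>) \<le> C * norm \<xi> ^ a" using assms(1) by (rule locOE) blast
 obtain D s where D: "D \<ge> 0" "s > 0" "!!\<xi>. norm \<xi> < s ==> cmod (g \<xi>) \<le> D * norm \<xi> ^ b" using assms(2) by (rule locOE) blast
 show ?thesis
 proof (rule locOI [of "min r s" _ "C * D"])
  fix \<xi> :: "real ^ 'a" assume *: "norm \<xi> < min r s"
  have "cmod (f \<xi>) * cmod (g \<xi>) \<le> (C * norm \<xi> ^ a) * (D * norm \<xi> ^ b)"
   using * C D by (intro mult_mono) auto
  then show "cmod (f \<xi> * g \<xi>) \<le> (C * D) * norm \<xi> ^ (a + b)" by (simp add: norm_mult power_add mult_ac)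
 qed (use C D in auto)
qed

lemma locO_mono: assumes "locO n f" "m \<le> n" shows "locO m f"
proof -
 obtain C r where C: "C \<ge> 0" "r > 0" "!!\<xi>. norm \<xi> < r ==> cmod (f \<xi>) \<le> C * norm \<xi> ^ n" using assms(1) by (rule locOE) blast
 show ?thesis
 proof (rule locOI [of "min r 1" _ C])
  fix \<xi> :: "real ^ 'a" assume *: "norm \<xi> < min r 1"
  have "cmod (f \<xi>) \<le> C * norm \<xi> ^ n" using C * by auto
  also have "... \<le> C * norm \<xi> ^ m" using * C(1) assms(2) by (intro mult_left_mono power_decreasing) auto
  finally show "cmod (f \<xi>) \<le> C * norm \<xi> ^ m" .
 qed (use C in auto)
qed

lemma locO_bounded_imp_flat:
 assumes "locO n f" "flat 0 0 f" shows "flat n 0 f"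
proof -
 obtain C r where C: "C \<ge> 0" "r > 0" "!!\<xi>. norm \<xi> < r ==> cmod (f \<xi>) \<le> C * norm \<xi> ^ n" using assms(1) by (rule locOE) blast
 obtain B where B: "B \<ge> 0" "!!\<xi>. cmod (f \<xi>) \<le> B" using assms(2) by (rule flatE) auto
 show ?thesis
 proof (rule flatI [of _ "C + B / r ^ n"])
  fix \<xi> :: "real ^ 'a"
  show "cmod (f \<xi>) \<le> (C + B / r ^ n) * norm (\<xi> - 0) ^ n"
  proof (cases "norm \<xi> < r")
   case True
   have "cmod (f \<xi>) \<le> C * norm \<xi> ^ n" by (rule C) fact
   also have "... \<le> (C + B / r ^ n) * norm \<xi> ^ n" using B C by (intro mult_right_mono) auto
   finally show ?thesis by simp
  next
   case False
   then have *: "r ^ n \<le> norm \<xi> ^ n" using C by (intro power_mono) auto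
   have "cmod (f \<xi>) \<le> B / r ^ n * r ^ n" using B C by simp
   also have "... \<le> (C + B / r ^ n) * norm \<xi> ^ n" using * B C by (intro mult_mono) auto
   finally show ?thesis by simp
  qed
 qed
qed

definition trig_jet :: "nat => (real ^ 'n => complex) => bool" where
 "trig_jet n f \<longleftrightarrow> (\<exists>p\<in>TP. locO n (%\<xi>. f \<xi> - p \<xi>))"

lemma trig_jet_TP: "p \<in> TP ==> trig_jet n p"
 unfolding trig_jet_def by (intro bexI [of _ p]) (auto intro: flat_imp_locO flat_zero)

lemma trig_jet_add: assumes "trig_jet n f" "trig_jet n g" shows "trig_jet n (%\<xi>. f \<xi> + g \<xi>)"
proof -
 obtain p q where pq: "p \<in> TP" "locO n (%\<xi>. f \<xi> - p \<xi>)" "q \<in> TP" "locO n (%\<xi>. g \<xi> - q \<xi>)"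
  using assms by (auto simp: trig_jet_def)
 have "locO n (%\<xi>. (f \<xi> - p \<xi>) + (g \<xi> - q \<xi>))" using pq by (intro locO_add)
 then show ?thesis unfolding trig_jet_def
  by (intro bexI [OF _ TP_add [OF pq(1,3)]]) (simp add: algebra_simps)
qed

lemma trig_jet_locO_0: assumes "trig_jet n f" shows "locO 0 f"
proof -
 obtain p where p: "p \<in> TP" "locO n (%\<xi>. f \<xi> - p \<xi>)" using assms by (auto simp: trig_jet_def)
 have "locO 0 (%\<xi>. (f \<xi> - p \<xi>) + p \<xi>)"
  by (rule locO_add [OF locO_mono [OF p(2)] flat_imp_locO [OF TP_flat_0 [OF p(1)]]]) simp
 then show ?thesis by simp
qed

lemma trig_jet_mult: assumes "trig_jet n f" "trig_jet n g" shows "trig_jet n (%\<xi>. f \<xi> * g \<xi>)"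
proof -
 obtain p q where pq: "p \<in> TP" "locO n (%\<xi>. f \<xi> - p \<xi>)" "q \<in> TP" "locO n (%\<xi>. g \<xi> - q \<xi>)"
  using assms by (auto simp: trig_jet_def)
 have "locO (0 + n) (%\<xi>. f \<xi> * (g \<xi> - q \<xi>))" by (intro locO_mult pq trig_jet_locO_0 [OF assms(1)])
 moreover have "locO (n + 0) (%\<xi>. (f \<xi> - p \<xi>) * q \<xi>)" by (intro locO_mult pq flat_imp_locO TP_flat_0)
 ultimately have "locO n (%\<xi>. f \<xi> * (g \<xi> - q \<xi>) + (f \<xi> - p \<xi>) * q \<xi>)" by (intro locO_add) auto
 then show ?thesis unfolding trig_jet_def
  by (intro bexI [OF _ TP_mult [OF pq(1,3)]]) (simp add: algebra_simps)
qed

lemma trig_jet_sum: "(!!i. i \<in> I ==> trig_jet n (f i)) ==> trig_jet n (%\<xi>. \<Sum>i\<in>I. f i \<xi>)"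
 by (induction I rule: infinite_finite_induct) (auto intro: trig_jet_add trig_jet_TP TP_const)

lemma Ln_partial_sum_bound:
 assumes "cmod w \<le> 1 / 2"
 shows "cmod (Ln (1 + w) - (\<Sum>k<n. (- 1) ^ Suc k / of_nat k * w ^ k)) \<le> 2 * cmod w ^ n"
proof -
 \<comment> \<open>The term k = 0 is 0, as division by zero yields 0; the series effectively starts
   at k = 1.\<close>
 let ?a = "%k. (- 1) ^ Suc k / of_nat k * w ^ k"
 have w: "cmod w < 1" using assms by simp
 have s: "?a sums Ln (1 + w)" by (rule Ln_series [OF w])
 have le: "cmod (?a k) \<le> cmod w ^ k" for k
 proof (cases "k = 0")
  case False
  then have "cmod w ^ k / real k \<le> cmod w ^ k / 1" by (intro divide_left_mono) auto
  then show ?thesis by (simp add: norm_mult norm_divide norm_power)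
 qed simp
 have g: "(%k. cmod w ^ (k + n)) sums (cmod w ^ n * (1 / (1 - cmod w)))"
  using sums_mult [OF geometric_sums [of "cmod w"], of "cmod w ^ n"] w by (simp add: power_add mult.commute)
 have "Ln (1 + w) - (\<Sum>k<n. ?a k) = (\<Sum>k. ?a (k + n))"
  using suminf_minus_initial_segment [OF sums_summable [OF s], of n] sums_unique [OF s] by simp
 also have "cmod ... \<le> (\<Sum>k. cmod w ^ (k + n))"
  by (rule norm_suminf_le [OF le sums_summable [OF g]])
 also have "... = cmod w ^ n * (1 / (1 - cmod w))" using sums_unique [OF g] by simp
 also have "... \<le> cmod w ^ n * 2"
  using assms by (intro mult_left_mono) (auto simp: field_simps)
 finally show ?thesis by (simp add: mult.commute)
qed

text \<open>A coordinate is the jet of \<open>\<i> log (1 + wgen j)\<close>.\<close>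
lemma trig_jet_coord: "trig_jet n (%\<xi>. complex_of_real (\<xi> $ j))"
 unfolding trig_jet_def
proof
 let ?p = "%\<xi> :: real ^ 'a. \<i> * (\<Sum>k<n. (- 1) ^ Suc k / of_nat k * wgen j \<xi> ^ k)"
 show "?p \<in> TP" by (intro TP_scale TP_sum TP_power wgen_TP)
 show "locO n (%\<xi>. complex_of_real (\<xi> $ j) - ?p \<xi>)"
 proof (rule locOI [of "1/2" _ 2])
  fix \<xi> :: "real ^ 'a" assume "norm \<xi> < 1/2"
  then have x: "\<bar>\<xi> $ j\<bar> \<le> 1/2" "\<bar>\<xi> $ j\<bar> \<le> norm \<xi>" using component_le_norm_cart [of \<xi> j] by linarith+
  have w: "cmod (wgen j \<xi>) \<le> \<bar>\<xi> $ j\<bar>" unfolding wgen_exp by (rule exp_minus_one_bounds)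
  have "Ln (1 + wgen j \<xi>) = - (\<i> * of_real (\<xi> $ j))"
  proof -
   have "\<bar>\<xi> $ j\<bar> < pi" using x pi_gt3 by linarith
   then show ?thesis unfolding wgen_exp by (simp add: Ln_exp abs_less_iff)
  qed
  then have "complex_of_real (\<xi> $ j) = \<i> * Ln (1 + wgen j \<xi>)" by simp
  then have "complex_of_real (\<xi> $ j) - ?p \<xi> = \<i> * (Ln (1 + wgen j \<xi>) - (\<Sum>k<n. (- 1) ^ Suc k / of_nat k * wgen j \<xi> ^ k))"
   by (simp only: right_diff_distrib)
  then have "cmod (complex_of_real (\<xi> $ j) - ?p \<xi>) = cmod (Ln (1 + wgen j \<xi>) - (\<Sum>k<n. (- 1) ^ Suc k / of_nat k * wgen j \<xi> ^ k))"
   by (simp only: norm_mult norm_ii mult_1)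
  also have "... \<le> 2 * cmod (wgen j \<xi>) ^ n" using w x by (intro Ln_partial_sum_bound) linarith
  also have "... \<le> 2 * norm \<xi> ^ n" using w x by (intro mult_left_mono power_mono) auto
  finally show "cmod (complex_of_real (\<xi> $ j) - ?p \<xi>) \<le> 2 * norm \<xi> ^ n" .
 qed simp
qed

context bounded_FT begin

lemma trig_jet_FTm: "integrable N c ==> trig_jet n (FTm N X c k)"
proof (induction k arbitrary: c)
 case 0
 have "FTm N X c 0 = (%_. FTm N X c 0 0)" by (simp add: FTm_def fun_eq_iff)
 then show ?case using trig_jet_TP [OF TP_const] by metis
next
 case (Suc k)
 have "trig_jet n (%\<xi>. \<Sum>j\<in>UNIV. of_real (\<xi> $ j) * FTm N X (%w. c w * of_real (X w $ j)) k \<xi>)"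
  by (intro trig_jet_sum trig_jet_mult trig_jet_coord Suc.IH coord_integrable Suc.prems)
 then show ?case unfolding FTm_Suc [OF Suc.prems, symmetric] .
qed

text \<open>The Taylor polynomial arises from the coordinates by sums and products, and every
  coordinate is a jet of a trigonometric polynomial. Boundedness of both functions turns the local
  estimate back into \<open>flat\<close>.\<close>

lemma trig_jet_FT:
 assumes "integrable N c"
 obtains p where "p \<in> TP" "flat n 0 (%\<xi>. FT N X c \<xi> - p \<xi>)"
proof -
 let ?T = "%\<xi>. \<Sum>k<n. (- \<i>) ^ k / fact k * FTm N X c k \<xi>"
 have "trig_jet n ?T"
  by (intro trig_jet_sum trig_jet_mult trig_jet_FTm assms trig_jet_TP TP_const)
 then obtain p where p: "p \<in> TP" "locO n (%\<xi>. ?T \<xi> - p \<xi>)" by (auto simp: trig_jet_def)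
 have "locO n (%\<xi>. (FT N X c \<xi> - ?T \<xi>) + (?T \<xi> - p \<xi>))"
  by (intro locO_add p flat_imp_locO FT_taylor assms)
 then have "locO n (%\<xi>. FT N X c \<xi> - p \<xi>)" by simp
 moreover have "flat 0 0 (%\<xi>. FT N X c \<xi> - p \<xi>)"
  by (intro flat_diff FT_bounded assms TP_flat_0 p)
 ultimately show ?thesis using that [OF p(1)] locO_bounded_imp_flat by blast
qed

lemma FT_isCont_0: assumes "integrable N c" shows "isCont (FT N X c) 0"
proof -
 have "flat 1 0 (%\<xi>. FT N X c \<xi> - (\<Sum>k<1. (- \<i>) ^ k / fact k * FTm N X c k \<xi>))" by (rule FT_taylor [OF assms])
 moreover have "FTm N X c 0 \<xi> = FT N X c 0" for \<xi> by (simp add: FTm_def FT_def)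
 ultimately have "flat 1 0 (%\<xi>. FT N X c \<xi> - FT N X c 0)" by simp
 then obtain C where C: "!!\<xi>. cmod (FT N X c \<xi> - FT N X c 0) \<le> C * norm \<xi>" by (auto simp: flat_def)
 have "((%\<xi>. C * norm (\<xi> :: real ^ 'b)) \<longlongrightarrow> C * norm (0 :: real ^ 'b)) (at 0)" by (intro tendsto_intros)
 then have "((%\<xi> :: real ^ 'b. C * norm \<xi>) \<longlongrightarrow> 0) (at 0)" by simp
 moreover have "\<forall>\<^sub>F \<xi> in at 0. norm (FT N X c \<xi> - FT N X c 0) \<le> C * norm \<xi>"
  using C by (rule always_eventually [OF allI])
 ultimately have "((%\<xi>. FT N X c \<xi> - FT N X c 0) \<longlongrightarrow> 0) (at 0)"
  by (rule Lim_null_comparison [rotated])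
 then show ?thesis unfolding isCont_def by (rule LIM_zero_cancel)
qed

end

lemma TP_vanishing_flat_1:
 assumes "f \<in> TP" "f 0 = 0" shows "flat 1 0 f"
proof -
 obtain F and X :: "int ^ 'a => real ^ 'a" and c R where *: "finite F" "bounded_FT (count_space F) X R"
  "integrable (count_space F) c" "f = FT (count_space F) X c" by (rule TP_as_FT [OF assms(1)])
 have "FTm (count_space F) X c 0 \<xi> = 0" for \<xi> using assms(2) unfolding *(4) by (simp add: FTm_def FT_def)
 then show ?thesis unfolding *(4) bounded_FT.flat_FT_iff [OF *(2,3)] by simp
qed

text \<open>A truncated Neumann series: \<open>r\<close> vanishes at 0, hence is flat of order 1,
  and the remainder is its n-th power.\<close>

lemma TP_inverse_jet:
 assumes p: "p \<in> TP" and "p 0 \<noteq> 0"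
 obtains t where "t \<in> TP" "flat n 0 (%\<xi>. t \<xi> * p \<xi> - 1)"
proof -
 define r where "r \<xi> = 1 - inverse (p 0) * p \<xi>" for \<xi>
 define t where "t \<xi> = inverse (p 0) * (\<Sum>k<n. r \<xi> ^ k)" for \<xi>
 have r: "r \<in> TP" unfolding r_def by (intro TP_diff TP_const TP_scale p)
 have "flat 1 0 r" by (rule TP_vanishing_flat_1 [OF r]) (simp add: r_def assms)
 then have "flat n 0 (%\<xi>. r \<xi> ^ n)" using flat_power [of 1 0 r n] by simp
 then have "flat n 0 (%\<xi>. - 1 * r \<xi> ^ n)" by (rule flat_scale)
 moreover have "t \<xi> * p \<xi> - 1 = - 1 * r \<xi> ^ n" for \<xi>
 proof -
  have "inverse (p 0) * p \<xi> = 1 - r \<xi>" by (simp add: r_def)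
  then have "t \<xi> * p \<xi> = (1 - r \<xi>) * (\<Sum>k<n. r \<xi> ^ k)" by (simp add: t_def mult_ac) 
  also have "... = 1 - r \<xi> ^ n" by (rule one_diff_power_eq [symmetric])
  finally show ?thesis by simp
 qed
 moreover have "t \<in> TP" unfolding t_def by (intro TP_scale TP_sum TP_power r)
 ultimately show ?thesis using that by simp
qed

lemma (in bounded_FT) FT_inverse_jet:
 assumes c: "integrable N c" and nz: "FT N X c 0 \<noteq> 0"
 obtains t where "t \<in> TP" "flat n 0 (%\<xi>. t \<xi> * FT N X c \<xi> - 1)"
proof -
 \<comment> \<open>One order more than requested, so that \<open>p\<close> has the same value at 0
   as the transform also for n = 0.\<close>
 obtain p where p: "p \<in> TP" "flat (Suc n) 0 (%\<xi>. FT N X c \<xi> - p \<xi>)" by (rule trig_jet_FT [OF c])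
 have "p 0 \<noteq> 0" using flat_at [OF p(2)] nz by simp
 then obtain t where t: "t \<in> TP" "flat (Suc n) 0 (%\<xi>. t \<xi> * p \<xi> - 1)" using TP_inverse_jet [OF p(1)] by blast
 have "flat (Suc n) 0 (%\<xi>. (FT N X c \<xi> - p \<xi>) * t \<xi> + (t \<xi> * p \<xi> - 1))"
  by (intro flat_add flat_mult_bounded p t TP_flat_0)
 then have "flat (Suc n) 0 (%\<xi>. t \<xi> * FT N X c \<xi> - 1)" by (simp add: algebra_simps)
 moreover have "flat 0 0 (%\<xi>. t \<xi> * FT N X c \<xi> - 1)"
  by (intro flat_diff flat_mult_bounded flat_const TP_flat_0 [OF t(1)] FT_bounded [OF c])
 ultimately have "flat n 0 (%\<xi>. t \<xi> * FT N X c \<xi> - 1)" by (rule flat_mono) simp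
 then show ?thesis using that t(1) by blast
qed

section \<open>Foundations in Lebesgue measure: change of variables, L2, uniqueness of Fourier
  coefficients\<close>

subsection \<open>Linear change of variables\<close>

text \<open>The library proves the determinant formula for volumes over index types of class \<open>wellorder\<close>
 only; \<open>wo\<close> equips an arbitrary finite index type with a well-order.\<close>

typedef 'a wo = "UNIV :: 'a set" morphisms unwo mkwo by simp

lemma bij_unwo: "bij unwo"
 by (metis bij_def inj_on_def surj_def unwo_inject mkwo_inverse UNIV_I)

instance wo :: (finite) finite
proof
 have "finite (unwo -` (UNIV :: 'a set))"
  by (rule finite_vimageI [OF finite]) (use bij_unwo bij_def in blast)
 then show "finite (UNIV :: 'a wo set)" by simp
qed

instantiation wo :: (finite) linorder
begin

definition wo_rank :: "'a wo => nat" where "wo_rank = (SOME f. inj f)"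
definition less_eq_wo :: "'a wo => 'a wo => bool" where "less_eq_wo x y \<longleftrightarrow> wo_rank x \<le> wo_rank y"
definition less_wo :: "'a wo => 'a wo => bool" where "less_wo x y \<longleftrightarrow> wo_rank x < wo_rank y"

lemma inj_wo_rank: "inj (wo_rank :: 'a wo => nat)"
proof -
 have "\<exists>f :: 'a wo => nat. inj f" using finite_imp_inj_to_nat_seg [OF finite [of UNIV]] by blast
 then show ?thesis unfolding wo_rank_def by (rule someI_ex)
qed

instance
proof
 fix x y z :: "'a wo"
 show "x < y \<longleftrightarrow> x \<le> y \<and> \<not> y \<le> x" by (auto simp: less_wo_def less_eq_wo_def)
 show "x \<le> x" by (simp add: less_eq_wo_def)
 show "x \<le> y ==> y \<le> z ==> x \<le> z" by (simp add: less_eq_wo_def)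
 show "x \<le> y ==> y \<le> x ==> x = y" unfolding less_eq_wo_def by (rule injD [OF inj_wo_rank]) (rule le_antisym)
 show "x \<le> y \<or> y \<le> x" unfolding less_eq_wo_def by (rule nat_le_linear)
qed

end

instance wo :: (finite) wellorder
proof (standard, goal_cases)
 case (1 P a)
 show ?case
 proof (rule measure_induct_rule [of wo_rank P a])
  fix x :: "'a wo" assume "!!y. wo_rank y < wo_rank x ==> P y"
  then show "P x" using 1 [of x] by (simp add: less_wo_def)
 qed
qed

lemma det_reindex:
 fixes A :: "real ^ 'm::finite ^ 'm" and f :: "'n::finite => 'm"
 assumes f: "bij f"
 shows "det (\<chi> i j. A $ f i $ f j :: real ^ 'n ^ 'n) = det A"
proof -
 have surj: "f ` UNIV = UNIV" and inj: "inj f" using f by (auto simp: bij_def)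
 have sgn: "sign (f \<circ> p \<circ> inv f) = sign p" if "p permutes UNIV" for p
 proof -
  have "map_permutation UNIV f p = f \<circ> p \<circ> inv f"
   by (simp add: map_permutation_def restrict_id_def surj fun_eq_iff)
  then show ?thesis using sign_map_permutation [OF inj that] by simp
 qed
 have "det (\<chi> i j. A $ f i $ f j :: real ^ 'n ^ 'n)
  = (\<Sum>p | p permutes (UNIV :: 'n set). of_int (sign p) * (\<Prod>i\<in>UNIV. A $ f i $ f (p i)))"
  by (simp add: det_def)
 also have "... = (\<Sum>q | q permutes (UNIV :: 'm set). of_int (sign q) * (\<Prod>i\<in>UNIV. A $ i $ q i))"
 proof (rule sum.reindex_bij_witness [of _ "%q. inv f \<circ> q \<circ> f" "%p. f \<circ> p \<circ> inv f"])
  fix p assume p: "p \<in> {p. p permutes (UNIV :: 'n set)}"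
  then have bp: "bij p" by (simp add: permutes_bij)
  show "inv f \<circ> (f \<circ> p \<circ> inv f) \<circ> f = p" using inj by (simp add: fun_eq_iff)
  show "f \<circ> p \<circ> inv f \<in> {q. q permutes UNIV}"
   using bij_comp [OF bij_comp [OF bij_imp_bij_inv [OF f] bp] f] by (intro CollectI bij_imp_permutes) (simp_all add: o_assoc)
  have "(\<Prod>i\<in>UNIV. A $ i $ (f \<circ> p \<circ> inv f) i) = (\<Prod>i\<in>UNIV. A $ f i $ (f \<circ> p \<circ> inv f) (f i))"
   by (subst surj [symmetric], subst prod.reindex [OF inj]) simp
  then show "of_int (sign (f \<circ> p \<circ> inv f)) * (\<Prod>i\<in>UNIV. A $ i $ (f \<circ> p \<circ> inv f) i) = of_int (sign p) * (\<Prod>i\<in>UNIV. A $ f i $ f (p i))"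
   using p sgn inj by simp
 next
  fix q assume q: "q \<in> {q. q permutes (UNIV :: 'm set)}"
  then have bq: "bij q" by (simp add: permutes_bij)
  show "f \<circ> (inv f \<circ> q \<circ> f) \<circ> inv f = q" using surj by (simp add: fun_eq_iff surj_f_inv_f)
  show "inv f \<circ> q \<circ> f \<in> {p. p permutes UNIV}"
   using bij_comp [OF bij_comp [OF f bq] bij_imp_bij_inv [OF f]] by (intro CollectI bij_imp_permutes) (simp_all add: o_assoc)
 qed
 finally show ?thesis by (simp add: det_def)
qed

lemma distr_lborel_reindex:
 fixes f :: "'n::finite => 'm::finite"
 assumes f: "bij f"
 shows "distr lborel borel (%x :: real ^ 'm. \<chi> i. x $ f i) = (lborel :: (real ^ 'n) measure)"
proof (rule lborel_eqI [symmetric])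
 let ?h = "%x :: real ^ 'm. (\<chi> i. x $ f i) :: real ^ 'n"
 have [measurable]: "?h \<in> borel \<rightarrow>\<^sub>M borel"
  by (intro borel_measurable_continuous_onI continuous_intros)
 fix l u :: "real ^ 'n" assume le: "!!b. b \<in> Basis ==> l \<bullet> b \<le> u \<bullet> b"
 let ?g = "%x :: real ^ 'n. (\<chi> i. x $ inv f i) :: real ^ 'm"
 have inv: "inv f (f i) = i" "f (inv f j) = j" for i j using f by (auto simp: bij_def surj_f_inv_f)
 have "?h -` box l u = box (?g l) (?g u)"
 proof (intro set_eqI)
  fix x
  have "x \<in> ?h -` box l u \<longleftrightarrow> (\<forall>i. l $ i < x $ f i \<and> x $ f i < u $ i)" by (simp add: mem_box_cart)
  also have "... \<longleftrightarrow> (\<forall>j. l $ inv f j < x $ j \<and> x $ j < u $ inv f j)" using inv by metis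
  finally show "x \<in> ?h -` box l u \<longleftrightarrow> x \<in> box (?g l) (?g u)" by (simp add: mem_box_cart)
 qed
 then have "emeasure (distr lborel borel ?h) (box l u) = emeasure lborel (box (?g l) (?g u))"
  by (simp add: emeasure_distr)
 also have "... = (\<Prod>b\<in>Basis. (?g u - ?g l) \<bullet> b)"
 proof (rule emeasure_lborel_box)
  fix b :: "real ^ 'm" assume "b \<in> Basis"
  then obtain i where "b = axis i 1" by (auto simp: Basis_vec_def)
  then show "?g l \<bullet> b \<le> ?g u \<bullet> b" using le [of "axis (inv f i) 1"] by (simp add: inner_axis)
 qed
 also have "(\<Prod>b\<in>Basis. (?g u - ?g l) \<bullet> b) = (\<Prod>b\<in>Basis. (u - l) \<bullet> b)"
 proof -
  have P: "(\<Prod>b\<in>Basis. x \<bullet> b) = (\<Prod>i\<in>UNIV. x $ i)" for x :: "real ^ 'k::finite"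
  proof -
   have "Basis = (%i. axis i 1 :: real ^ 'k) ` UNIV" by (auto simp: Basis_vec_def)
   moreover have "inj (%i. axis i 1 :: real ^ 'k)" by (auto simp: inj_def axis_eq_axis)
   ultimately have "(\<Prod>b\<in>Basis. x \<bullet> b) = (\<Prod>i\<in>UNIV. x \<bullet> axis i 1)"
    by (intro prod.reindex_cong [of "%i. axis i 1"]) auto
   then show ?thesis by (simp add: inner_axis)
  qed
  have "(\<Prod>i\<in>UNIV. (?g u - ?g l) $ i) = (\<Prod>i\<in>UNIV. (u - l) $ i)"
   by (rule prod.reindex_bij_witness [of _ f "inv f"]) (auto simp: inv)
  then show ?thesis unfolding P .
 qed
 finally show "emeasure (distr lborel borel ?h) (box l u) = (\<Prod>b\<in>Basis. (u - l) \<bullet> b)" .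
qed simp

lemma matrix_inv_mult:
 fixes M :: "real ^ 'n::finite ^ 'n"
 assumes "invertible M" shows "M ** matrix_inv M = mat 1" "matrix_inv M ** M = mat 1"
 using someI_ex [OF assms [unfolded invertible_def]] by (simp_all add: matrix_inv_def)

lemma lborel_matrix_wellorder:
 fixes M :: "real ^ 'n::{finite,wellorder} ^ 'n::_"
 assumes M: "invertible M"
 shows "lborel = density (distr lborel borel (%x. M *v x)) (%_. ennreal \<bar>det M\<bar>)"
proof (rule lborel_eqI)
 let ?N = "matrix_inv M"
 have meas [measurable]: "(%x. M *v x) \<in> borel \<rightarrow>\<^sub>M borel"
  by (intro borel_measurable_continuous_onI linear_continuous_on) (simp add: linear_linear)
 have "det M * det ?N = 1" using matrix_inv_mult [OF M] by (metis det_I det_mul)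
 then have detN: "\<bar>det M\<bar> * \<bar>det ?N\<bar> = 1" by (metis abs_mult abs_one)
 fix l u :: "real ^ 'n::{finite,wellorder}" assume le: "!!b. b \<in> Basis ==> l \<bullet> b \<le> u \<bullet> b"
 have vim: "(%x. M *v x) -` box l u = (%x. ?N *v x) ` box l u"
 proof (intro set_eqI iffI)
  fix x assume "x \<in> (%x. M *v x) -` box l u"
  then show "x \<in> (%x. ?N *v x) ` box l u"
   by (intro image_eqI [of _ _ "M *v x"]) (auto simp: matrix_vector_mul_assoc matrix_inv_mult [OF M])
 next
  fix x assume "x \<in> (%x. ?N *v x) ` box l u"
  then show "x \<in> (%x. M *v x) -` box l u" by (auto simp: matrix_vector_mul_assoc matrix_inv_mult [OF M])
 qed
 have im: "(%x. ?N *v x) ` box l u \<in> lmeasurable" and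
  ms: "measure leb ((%x. ?N *v x) ` box l u) = \<bar>det ?N\<bar> * measure leb (box l u)"
  using measurable_linear_image [of "%x. ?N *v x" "box l u"] measure_linear_image [of "%x. ?N *v x" "box l u"] by auto
 have sb: "(%x. M *v x) -` box l u \<in> sets borel" using measurable_sets [OF meas, of "box l u"] by simp
 have "emeasure lborel ((%x. M *v x) -` box l u) = emeasure leb ((%x. M *v x) -` box l u)"
  using sb by simp
 also have "... = ennreal (\<bar>det ?N\<bar> * measure leb (box l u))"
  unfolding vim ms [symmetric] by (rule emeasure_eq_measure2 [OF im])
 finally have e: "emeasure lborel ((%x. M *v x) -` box l u) = ennreal (\<bar>det ?N\<bar> * measure leb (box l u))" .
 have "emeasure (density (distr lborel borel (%x. M *v x)) (%_. ennreal \<bar>det M\<bar>)) (box l u)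
   = ennreal \<bar>det M\<bar> * emeasure lborel ((%x. M *v x) -` box l u)"
  by (simp add: emeasure_density nn_integral_cmult_indicator emeasure_distr)
 also have "... = ennreal ((\<bar>det M\<bar> * \<bar>det ?N\<bar>) * measure leb (box l u))"
  unfolding e by (simp add: ennreal_mult [symmetric] mult.assoc)
 also have "... = ennreal (measure leb (box l u))" by (simp add: detN)
 also have "... = emeasure lborel (box l u)" 
  using emeasure_lborel_box_finite [of l u] by (simp add: emeasure_eq_ennreal_measure less_top)
 also have "... = (\<Prod>b\<in>Basis. (u - l) \<bullet> b)" using le by (rule emeasure_lborel_box)
 finally show "emeasure (density (distr lborel borel (%x. M *v x)) (%_. ennreal \<bar>det M\<bar>)) (box l u) = (\<Prod>b\<in>Basis. (u - l) \<bullet> b)" .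
qed simp

text \<open>The relabellings \<open>h\<close> and \<open>g\<close> of the coordinates preserve
  Lebesgue measure and the determinant, so the formula is transported from the well-ordered index
  type.\<close>

lemma lborel_matrix:
 fixes M :: "real ^ 'n::finite ^ 'n"
 assumes M: "invertible M"
 shows "lborel = density (distr lborel borel (%x. M *v x)) (%_. ennreal \<bar>det M\<bar>)"
proof -
 define M' :: "real ^ 'n wo ^ 'n wo" where "M' = (\<chi> i j. M $ unwo i $ unwo j)"
 have det: "det M' = det M" unfolding M'_def by (rule det_reindex [OF bij_unwo])
 have invM': "invertible M'" using M by (simp add: invertible_det_nz det)
 define h :: "real ^ 'n => real ^ 'n wo" where "h x = (\<chi> i. x $ unwo i)" for x
 define g :: "real ^ 'n wo => real ^ 'n" where "g x = (\<chi> i. x $ mkwo i)" for x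
 have um: "unwo (mkwo i) = i" for i :: 'n by (simp add: mkwo_inverse)
 have bm: "bij (mkwo :: 'n => 'n wo)"
  by (metis bij_def inj_on_def surj_def mkwo_inverse unwo_inverse UNIV_I)
 have dh: "distr lborel borel h = lborel" unfolding h_def [abs_def] by (rule distr_lborel_reindex [OF bij_unwo])
 have dg: "distr lborel borel g = lborel" unfolding g_def [abs_def] by (rule distr_lborel_reindex [OF bm])
 have [measurable]: "h \<in> borel \<rightarrow>\<^sub>M borel" "g \<in> borel \<rightarrow>\<^sub>M borel"
  unfolding h_def [abs_def] g_def [abs_def] by (intro borel_measurable_continuous_onI continuous_intros)+
 have [measurable]: "(%x. M' *v x) \<in> borel \<rightarrow>\<^sub>M borel"
  by (intro borel_measurable_continuous_onI linear_continuous_on) (simp add: linear_linear)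
 have comp: "M *v x = g (M' *v h x)" for x
 proof -
  have "(\<Sum>j\<in>UNIV. M $ i $ unwo j * x $ unwo j) = (\<Sum>j\<in>UNIV. M $ i $ j * x $ j)" for i
   by (rule sum.reindex_bij_betw [OF bij_unwo])
  then show ?thesis by (simp add: vec_eq_iff g_def h_def M'_def matrix_vector_mult_def um)
 qed
 have "distr lborel borel (%x. M *v x) = distr (distr (distr lborel borel h) borel (%x. M' *v x)) borel g"
  unfolding comp [abs_def] by (simp add: distr_distr o_def)
 also have "... = distr (distr lborel borel (%x. M' *v x)) borel g" by (simp add: dh)
 finally have "density (distr lborel borel (%x. M *v x)) (%_. ennreal \<bar>det M\<bar>)
  = distr (density (distr lborel borel (%x. M' *v x)) (%_. ennreal \<bar>det M'\<bar>)) borel g"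
  by (simp add: density_distr det)
 also have "... = distr lborel borel g" using lborel_matrix_wellorder [OF invM'] by simp
 finally show ?thesis by (simp add: dg)
qed

text \<open>The Borel version passes to completions because the image measure under an invertible
  matrix has the same null sets as Lebesgue measure.\<close>

lemma
 fixes M :: "real ^ 'n::finite ^ 'n"
 assumes M: "invertible M"
 shows lebesgue_matrix: "leb = density (distr leb leb (%x. M *v x)) (%_. ennreal \<bar>det M\<bar>)"
  and lebesgue_matrix_measurable: "(%x. M *v x) \<in> leb \<rightarrow>\<^sub>M leb"
proof -
 let ?T = "%x. M *v x" and ?c = "ennreal \<bar>det M\<bar>"
 have c: "?c > 0" using M by (simp add: invertible_det_nz)
 have [measurable]: "?T \<in> borel \<rightarrow>\<^sub>M borel"
  by (intro borel_measurable_continuous_onI linear_continuous_on) (simp add: linear_linear)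
 have lb: "?T \<in> leb \<rightarrow>\<^sub>M lborel" by (rule measurable_completion) simp
 have "null_sets lborel = null_sets (density (distr lborel borel ?T) (%_. ?c))"
  by (rule arg_cong [OF lborel_matrix [OF M]])
 also have "... = null_sets (distr lborel borel ?T)"
  using c by (auto simp: null_sets_def emeasure_density nn_integral_cmult_indicator)
 also have "distr lborel borel ?T = distr leb lborel ?T"
  by (subst distr_completion) (auto intro: distr_cong)
 finally have eq: "null_sets lborel = null_sets (distr leb lborel ?T)" .
 show "?T \<in> leb \<rightarrow>\<^sub>M leb"
  by (rule completion.measurable_completion2 [OF lb]) (simp add: eq)
 have "leb = completion (density (distr lborel borel ?T) (%_. ?c))"
  using lborel_matrix [OF M] by simp
 also have "... = density (completion (distr lborel borel ?T)) (%_. ?c)"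
  using c by (intro completion_density_eq) auto
 also have "distr lborel borel ?T = distr leb lborel ?T"
  by (subst distr_completion) (auto intro: distr_cong)
 also have "completion (distr leb lborel ?T) = distr leb leb ?T"
  by (rule completion.completion_distr_eq [OF lb]) (simp add: eq)
 finally show "leb = density (distr leb leb ?T) (%_. ?c)" .
qed

lemma
 fixes M :: "real ^ 'n::finite ^ 'n" and f :: "real ^ 'n => 'b::{banach, second_countable_topology}"
 assumes M: "invertible M" and f: "f \<in> Lmeas"
 shows integral_matrix: "\<bar>det M\<bar> *\<^sub>R (LI x. f (M *v x)) = (LI x. f x)"
  and integrable_matrix: "Lint (%x. f (M *v x)) \<longleftrightarrow> Lint f"
  and measurable_matrix: "(%x. f (M *v x)) \<in> Lmeas"
proof -
 have T: "(%x. M *v x) \<in> leb \<rightarrow>\<^sub>M leb" by (rule lebesgue_matrix_measurable [OF M])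
 show "(%x. f (M *v x)) \<in> Lmeas" by (rule measurable_compose [OF T f])
 have d: "\<bar>det M\<bar> > 0" using M by (simp add: invertible_det_nz)
 have fd: "f \<in> borel_measurable (distr leb leb (%x. M *v x))" using f by simp
 have "(LI x. f x) = (\<integral>x. f x \<partial>density (distr leb leb (%x. M *v x)) (%_. ennreal \<bar>det M\<bar>))"
  by (rule arg_cong [OF lebesgue_matrix [OF M]])
 also have "... = \<bar>det M\<bar> *\<^sub>R (LI x. f (M *v x))"
  by (subst integral_density [OF fd]) (auto simp: integral_distr [OF T f])
 finally show "\<bar>det M\<bar> *\<^sub>R (LI x. f (M *v x)) = (LI x. f x)" ..
 have "Lint f \<longleftrightarrow> integrable (density (distr leb leb (%x. M *v x)) (%_. ennreal \<bar>det M\<bar>)) f"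
  by (rule arg_cong [OF lebesgue_matrix [OF M]])
 also have "... \<longleftrightarrow> integrable (distr leb leb (%x. M *v x)) (%x. \<bar>det M\<bar> *\<^sub>R f x)"
  by (rule integrable_density [OF fd]) auto
 also have "... \<longleftrightarrow> integrable (distr leb leb (%x. M *v x)) f"
 proof
  assume "integrable (distr leb leb (%x. M *v x)) (%x. \<bar>det M\<bar> *\<^sub>R f x)"
  then have "integrable (distr leb leb (%x. M *v x)) (%x. (1 / \<bar>det M\<bar>) *\<^sub>R \<bar>det M\<bar> *\<^sub>R f x)"
   by (rule integrable_scaleR_right)
  then show "integrable (distr leb leb (%x. M *v x)) f" using d by simp
 qed (rule integrable_scaleR_right)
 also have "... \<longleftrightarrow> Lint (%x. f (M *v x))"
  by (rule integrable_distr_eq [OF T f])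
 finally show "Lint (%x. f (M *v x)) \<longleftrightarrow> Lint f" ..
qed

lemma
 fixes a :: "real ^ 'n::finite" and f :: "real ^ 'n => 'b::{banach, second_countable_topology}"
 assumes f: "f \<in> Lmeas"
 shows integral_translate: "(LI x. f (x + a)) = (LI x. f x)"
  and integrable_translate: "Lint (%x. f (x + a)) \<longleftrightarrow> Lint f"
  and measurable_translate: "(%x. f (x + a)) \<in> Lmeas"
proof -
 have e: "(%x. a + (\<Sum>j\<in>Basis. (1 * (x \<bullet> j)) *\<^sub>R j)) = (%x. x + a)"
  by (simp add: euclidean_representation add.commute)
 have T: "(%x. x + a) \<in> leb \<rightarrow>\<^sub>M leb"
  using lebesgue_affine_measurable [of "%_. 1" a] unfolding e by simp
 have d: "distr leb leb (%x. x + a) = leb"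
  using lebesgue_affine_euclidean [of "%_. 1" a] unfolding e by (simp add: density_1)
 show "(%x. f (x + a)) \<in> Lmeas" by (rule measurable_compose [OF T f])
 show "(LI x. f (x + a)) = (LI x. f x)"
  using integral_distr [OF T f] by (simp add: d)
 show "Lint (%x. f (x + a)) \<longleftrightarrow> Lint f"
  using integrable_distr_eq [OF T f] by (simp add: d)
qed

lemma AE_matrix:
 fixes M :: "real ^ 'n::finite ^ 'n"
 assumes M: "invertible M" and P: "AE x in leb. P x"
 shows "AE x in leb. P (M *v x)"
proof -
 have d: "\<bar>det M\<bar> > 0" using M by (simp add: invertible_det_nz)
 have "AE x in density (distr leb leb (%x. M *v x)) (%_. ennreal \<bar>det M\<bar>). P x"
  by (rule subst [OF lebesgue_matrix [OF M], of "%N. AE x in N. P x"]) (rule P)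
 then have "AE x in distr leb leb (%x. M *v x). P x"
  using d by (subst (asm) AE_density) auto
 then show ?thesis by (rule AE_distrD [OF lebesgue_matrix_measurable [OF M]])
qed

lemma AE_translate:
 fixes a :: "real ^ 'n::finite"
 assumes P: "AE x in leb. P x" shows "AE x in leb. P (x + a)"
proof -
 have e: "(%x. a + (\<Sum>j\<in>Basis. (1 * (x \<bullet> j)) *\<^sub>R j)) = (%x. x + a)"
  by (simp add: euclidean_representation add.commute)
 have T: "(%x. x + a) \<in> leb \<rightarrow>\<^sub>M leb"
  using lebesgue_affine_measurable [of "%_. 1" a] unfolding e by simp
 have "distr leb leb (%x. x + a) = leb"
  using lebesgue_affine_euclidean [of "%_. 1" a] unfolding e by (simp add: density_1)
 then have "AE x in distr leb leb (%x. x + a). P x" using P by (simp only:)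
 then show ?thesis by (rule AE_distrD [OF T])
qed

subsection \<open>The space \<open>L\<^sub>2\<close>\<close>

lemma borel_measurable_cnj:
 "f \<in> borel_measurable M ==> (%x. cnj (f x)) \<in> borel_measurable M"
 by (rule borel_measurable_continuous_on [of cnj]) (auto intro: continuous_intros)

lemma integrable_indicator_cball: "Lint (indicator (cball a r) :: 'a::euclidean_space => real)"
 using lmeasurable_cball lmeasurable_iff_integrable by blast

lemma L2_meas: "f \<in> L2 ==> f \<in> Lmeas"
 and L2_int: "f \<in> L2 ==> Lint (%x. (cmod (f x))^2)"
 by (auto simp: L2_def)

lemma L2I: "f \<in> Lmeas ==> Lint (%x. (cmod (f x))^2) ==> f \<in> L2"
 by (simp add: L2_def)

lemma L2_dominated:
 assumes "f \<in> Lmeas" "Lint w" "AE x in leb. (cmod (f x))^2 \<le> w x"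
 shows "f \<in> L2"
proof (rule L2I [OF assms(1)], rule Bochner_Integration.integrable_bound [OF assms(2)])
 show "(%x. (cmod (f x))^2) \<in> Lmeas" using assms(1) by measurable
 show "AE x in leb. norm ((cmod (f x))^2) \<le> norm (w x)"
  using assms(3) by eventually_elim auto
qed

lemma sq_sum_le: "(a + b)^2 \<le> 2 * a^2 + 2 * (b :: real)^2"
 using sum_squares_bound [of a b] by (simp add: power2_sum)

lemma L2_add: assumes "f \<in> L2" "g \<in> L2" shows "(%x. f x + g x) \<in> L2"
proof (rule L2_dominated)
 show "(%x. f x + g x) \<in> Lmeas" using assms L2_meas by (intro borel_measurable_add)
 show "Lint (%x. 2 * (cmod (f x))^2 + 2 * (cmod (g x))^2)"
  using L2_int [OF assms(1)] L2_int [OF assms(2)] by auto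
 show "AE x in leb. (cmod (f x + g x))^2 \<le> 2 * (cmod (f x))^2 + 2 * (cmod (g x))^2"
  by (intro AE_I2 order_trans [OF power_mono [OF norm_triangle_ineq] sq_sum_le]) auto
qed

lemma L2_scale: assumes "f \<in> L2" shows "(%x. c * f x) \<in> L2"
 using L2_meas [OF assms] L2_int [OF assms] by (intro L2I) (auto simp: norm_mult power_mult_distrib)

lemma L2_diff: "f \<in> L2 ==> g \<in> L2 ==> (%x. f x - g x) \<in> L2"
 using L2_add [of f "%x. -1 * g x"] L2_scale [of g "-1"] by simp

lemma L2_zero: "(%_. 0) \<in> L2"
 by (rule L2I) auto

lemma L2_sum: "(!!i. i \<in> I ==> f i \<in> L2) ==> (%x. \<Sum>i\<in>I. f i x) \<in> L2"
 by (induction I rule: infinite_finite_induct) (auto intro: L2_add L2_zero)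

lemma L2_norm_fun: "f \<in> L2 ==> (%x. complex_of_real (cmod (f x))) \<in> L2"
 by (auto simp: L2_def)

lemma L2_inner_integrable:
 assumes "f \<in> L2" "g \<in> L2" shows "Lint (%x. f x * cnj (g x))"
proof (rule Bochner_Integration.integrable_bound)
 show "Lint (%x. (cmod (f x))^2 + (cmod (g x))^2)"
  using L2_int [OF assms(1)] L2_int [OF assms(2)] by auto
 show "(%x. f x * cnj (g x)) \<in> Lmeas"
  using assms L2_meas by (intro borel_measurable_times borel_measurable_cnj)
 show "AE x in leb. norm (f x * cnj (g x)) \<le> norm ((cmod (f x))^2 + (cmod (g x))^2)"
 proof (rule AE_I2)
  fix x
  have "2 * cmod (f x) * cmod (g x) \<le> (cmod (f x))^2 + (cmod (g x))^2" by (rule sum_squares_bound)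
  moreover have "0 \<le> cmod (f x) * cmod (g x)" by simp
  ultimately have "cmod (f x) * cmod (g x) \<le> (cmod (f x))^2 + (cmod (g x))^2" by linarith
  then show "norm (f x * cnj (g x)) \<le> norm ((cmod (f x))^2 + (cmod (g x))^2)"
   by (simp add: norm_mult)
 qed
qed

lemma L2_norm_nonneg [simp]: "0 \<le> L2_norm f"
 by (simp add: L2_norm_def)

lemma L2_norm_sq: "(L2_norm f)^2 = (LI x. (cmod (f x))^2)"
 by (simp add: L2_norm_def)

lemma L2_inner_self: "L2_inner f f = complex_of_real ((L2_norm f)^2)"
 unfolding L2_norm_sq L2_inner_def complex_norm_square [symmetric] by (rule integral_complex_of_real)

lemma L2_inner_cnj: "cnj (L2_inner f g) = L2_inner g f"
 unfolding L2_inner_def by (simp add: mult.commute flip: Bochner_Integration.integral_cnj)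

lemma L2_inner_add_left:
 "f \<in> L2 ==> g \<in> L2 ==> h \<in> L2 ==> L2_inner (%x. f x + g x) h = L2_inner f h + L2_inner g h"
 unfolding L2_inner_def by (simp add: distrib_right L2_inner_integrable)

lemma L2_inner_scale_left: "L2_inner (%x. c * f x) h = c * L2_inner f h"
 unfolding L2_inner_def by (simp add: mult.assoc integral_mult_right_zero)

lemma L2_inner_diff_left:
 "f \<in> L2 ==> g \<in> L2 ==> h \<in> L2 ==> L2_inner (%x. f x - g x) h = L2_inner f h - L2_inner g h"
 unfolding L2_inner_def by (simp add: left_diff_distrib L2_inner_integrable)

lemma L2_inner_sum_left:
 assumes "!!i. i \<in> I ==> f i \<in> L2" "h \<in> L2"
 shows "L2_inner (%x. \<Sum>i\<in>I. c i * f i x) h = (\<Sum>i\<in>I. c i * L2_inner (f i) h)"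
proof -
 have "L2_inner (%x. \<Sum>i\<in>I. c i * f i x) h = (LI x. (\<Sum>i\<in>I. c i * (f i x * cnj (h x))))"
  unfolding L2_inner_def by (simp add: sum_distrib_right mult.assoc)
 also have "... = (\<Sum>i\<in>I. LI x. c i * (f i x * cnj (h x)))"
  by (rule Bochner_Integration.integral_sum) (intro integrable_mult_right L2_inner_integrable assms)
 finally show ?thesis by (simp add: L2_inner_def integral_mult_right_zero)
qed

lemma L2_inner_sum_right:
 assumes "!!i. i \<in> I ==> f i \<in> L2" "h \<in> L2"
 shows "L2_inner h (%x. \<Sum>i\<in>I. c i * f i x) = (\<Sum>i\<in>I. cnj (c i) * L2_inner h (f i))"
proof -
 have "L2_inner h (%x. \<Sum>i\<in>I. c i * f i x) = cnj (L2_inner (%x. \<Sum>i\<in>I. c i * f i x) h)"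
  by (simp add: L2_inner_cnj)
 also have "... = (\<Sum>i\<in>I. cnj (c i) * L2_inner h (f i))"
  by (simp add: L2_inner_sum_left [OF assms] L2_inner_cnj)
 finally show ?thesis .
qed

text \<open>Optimizing the weight gives t = b/a; if \<open>a\<close> or \<open>b\<close> is 0 there
  is no optimal t and a limit replaces it. This derives Cauchy-Schwarz from a pointwise
  inequality.\<close>

lemma le_mult_from_weighted:
 fixes a b X :: real
 assumes "a \<ge> 0" "b \<ge> 0" "!!t. t > 0 ==> 2 * X \<le> t * a^2 + b^2 / t"
 shows "X \<le> a * b"
proof (cases "a = 0 \<or> b = 0")
 case False
 then have "a > 0" "b > 0" using assms by auto
 then show ?thesis using assms(3) [of "b / a"] by (simp add: power2_eq_square field_simps)
next
 case True
 have "X \<le> e" if "e > 0" for e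
 proof (cases "a = 0")
  case True
  have "2 * X \<le> b^2 / ((b^2 + 1) / (2 * e))" using assms(3) [of "(b^2 + 1) / (2 * e)"] True that
   by (simp add: add_nonneg_pos)
  also have "... = 2 * e * (b^2 / (b^2 + 1))" by (simp add: field_simps)
  also have "... \<le> 2 * e * 1" using that by (intro mult_left_mono) (auto simp: divide_le_eq add_nonneg_pos)
  finally show ?thesis by simp
 next
  case False
  then have "b = 0" using \<open>a = 0 \<or> b = 0\<close> by simp
  then have "2 * X \<le> (2 * e / (a^2 + 1)) * a^2" using assms(3) [of "2 * e / (a^2 + 1)"] that
   by (simp add: add_nonneg_pos)
  also have "... = 2 * e * (a^2 / (a^2 + 1))" by (simp add: field_simps)
  also have "... \<le> 2 * e * 1" using that by (intro mult_left_mono) (auto simp: divide_le_eq add_nonneg_pos)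
  finally show ?thesis by simp
 qed
 then have "X \<le> 0" by (metis field_le_epsilon add_0)
 then show ?thesis using True by auto
qed

lemma L2_Cauchy_Schwarz_abs:
 assumes "f \<in> L2" "g \<in> L2"
 shows "(LI x. cmod (f x * cnj (g x))) \<le> L2_norm f * L2_norm g"
proof (rule le_mult_from_weighted)
 fix t :: real assume t: "t > 0"
 have "(LI x. 2 * cmod (f x * cnj (g x))) \<le> (LI x. t * (cmod (f x))^2 + (cmod (g x))^2 / t)"
 proof (rule integral_mono)
  show "Lint (%x. 2 * cmod (f x * cnj (g x)))"
   using L2_inner_integrable [OF assms] by auto
  show "Lint (%x. t * (cmod (f x))^2 + (cmod (g x))^2 / t)"
   using L2_int [OF assms(1)] L2_int [OF assms(2)] by auto
  fix x
  have "0 \<le> (t * cmod (f x) - cmod (g x))^2 / t" using t by simp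
  then show "2 * cmod (f x * cnj (g x)) \<le> t * (cmod (f x))^2 + (cmod (g x))^2 / t"
   using t by (simp add: norm_mult power2_eq_square field_simps)
 qed
 then show "2 * (LI x. cmod (f x * cnj (g x))) \<le> t * (L2_norm f)^2 + (L2_norm g)^2 / t"
  using L2_int [OF assms(1)] L2_int [OF assms(2)] by (simp add: L2_norm_sq)
qed auto

lemma L2_Cauchy_Schwarz:
 assumes "f \<in> L2" "g \<in> L2" shows "cmod (L2_inner f g) \<le> L2_norm f * L2_norm g"
 unfolding L2_inner_def
 by (rule order_trans [OF integral_norm_bound L2_Cauchy_Schwarz_abs [OF assms]])

lemma L2_norm_cong_AE: "AE x in leb. f x = g x ==> f \<in> L2 ==> g \<in> L2 ==> L2_norm f = L2_norm g"
 unfolding L2_norm_def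
 by (intro arg_cong [of _ _ sqrt] integral_cong_AE) (auto dest: L2_meas)

lemma L2_inner_cong_AE:
 "AE x in leb. f x = g x ==> f \<in> L2 ==> g \<in> L2 ==> h \<in> L2 ==> L2_inner h f = L2_inner h g"
 unfolding L2_inner_def
 by (intro integral_cong_AE borel_measurable_times borel_measurable_cnj L2_meas) auto

lemma L2_norm_triangle:
 assumes "f \<in> L2" "g \<in> L2" shows "L2_norm (%x. f x + g x) \<le> L2_norm f + L2_norm g"
proof (rule power2_le_imp_le)
 have fg: "(%x. f x + g x) \<in> L2" by (rule L2_add [OF assms])
 have "complex_of_real ((L2_norm (%x. f x + g x))^2) = L2_inner f f + L2_inner g f + (L2_inner f g + L2_inner g g)"
  using L2_inner_add_left [OF assms fg] L2_inner_add_left [OF assms assms(1)] L2_inner_add_left [OF assms assms(2)]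
  unfolding L2_inner_self [symmetric]
  by (metis (no_types, lifting) L2_inner_cnj complex_cnj_add)
 then have "(L2_norm (%x. f x + g x))^2 = Re (L2_inner f f + L2_inner g f + (L2_inner f g + L2_inner g g))"
  by (metis Re_complex_of_real)
 also have "... = (L2_norm f)^2 + Re (L2_inner g f) + (Re (L2_inner f g) + (L2_norm g)^2)"
  by (simp add: L2_inner_self del: of_real_power)
 also have "... \<le> (L2_norm f)^2 + L2_norm g * L2_norm f + (L2_norm f * L2_norm g + (L2_norm g)^2)"
  by (intro add_mono order_refl order_trans [OF complex_Re_le_cmod L2_Cauchy_Schwarz] assms)
 also have "... = (L2_norm f + L2_norm g)^2" by (simp add: power2_sum)
 finally show "(L2_norm (%x. f x + g x))^2 \<le> (L2_norm f + L2_norm g)^2" .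
qed simp

lemma L2_norm_scale: "L2_norm (%x. c * f x) = cmod c * L2_norm f"
 unfolding L2_norm_def by (simp add: norm_mult power_mult_distrib real_sqrt_mult)

lemma L2_norm_minus_commute: "L2_norm (%x. f x - g x) = L2_norm (%x. g x - f x)"
 by (simp add: L2_norm_def norm_minus_commute)

lemma L2_norm_triangle_diff:
 assumes "f \<in> L2" "g \<in> L2" "h \<in> L2"
 shows "L2_norm (%x. f x - h x) \<le> L2_norm (%x. f x - g x) + L2_norm (%x. g x - h x)"
 using L2_norm_triangle [OF L2_diff [OF assms(1,2)] L2_diff [OF assms(2,3)]] by simp

lemma L2_norm_diff_le:
 assumes "f \<in> L2" "g \<in> L2" shows "L2_norm (%x. f x - g x) \<le> L2_norm f + L2_norm g"
 using L2_norm_triangle_diff [OF assms(1) L2_zero assms(2)] L2_norm_scale [of "-1" g] by simp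

lemma L2_translate:
 assumes "f \<in> L2" shows "(%x. f (x + a)) \<in> L2"
proof (rule L2I)
 show "(%x. f (x + a)) \<in> Lmeas" by (rule measurable_translate [OF L2_meas [OF assms]])
 have "(%x. (cmod (f x))^2) \<in> Lmeas" using L2_meas [OF assms] by measurable
 from integrable_translate [OF this, of a] show "Lint (%x. (cmod (f (x + a)))^2)"
  using L2_int [OF assms] by simp
qed

lemma L2_inner_translate:
 assumes "f \<in> L2" "g \<in> L2" shows "L2_inner (%x. f (x + a)) (%x. g (x + a)) = L2_inner f g"
proof -
 have "(%x. f x * cnj (g x)) \<in> Lmeas"
  using L2_meas assms by (intro borel_measurable_times borel_measurable_cnj)
 from integral_translate [OF this, of a] show ?thesis by (simp add: L2_inner_def)
qed

lemma L2_norm_translate: assumes "f \<in> L2" shows "L2_norm (%x. f (x + a)) = L2_norm f"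
proof -
 have "complex_of_real ((L2_norm (%x. f (x + a)))^2) = complex_of_real ((L2_norm f)^2)"
  using L2_inner_translate [OF assms assms, of a] unfolding L2_inner_self .
 then have "(L2_norm (%x. f (x + a)))^2 = (L2_norm f)^2" by (simp only: of_real_eq_iff)
 then show ?thesis by (simp add: power2_eq_iff_nonneg)
qed

lemma L2_matrix:
 fixes M :: "real ^ 'n::finite ^ 'n"
 assumes M: "invertible M" and f: "f \<in> L2" shows "(%x. f (M *v x)) \<in> L2"
proof (rule L2I)
 show "(%x. f (M *v x)) \<in> Lmeas" by (rule measurable_matrix [OF M L2_meas [OF f]])
 have "(%x. (cmod (f x))^2) \<in> Lmeas" using L2_meas [OF f] by measurable
 from integrable_matrix [OF M this] show "Lint (%x. (cmod (f (M *v x)))^2)"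
  using L2_int [OF f] by simp
qed

lemma L2_inner_matrix:
 fixes M :: "real ^ 'n::finite ^ 'n"
 assumes M: "invertible M" and "f \<in> L2" "g \<in> L2"
 shows "of_real \<bar>det M\<bar> * L2_inner (%x. f (M *v x)) (%x. g (M *v x)) = L2_inner f g"
proof -
 have "(%x. f x * cnj (g x)) \<in> Lmeas"
  using L2_meas assms by (intro borel_measurable_times borel_measurable_cnj)
 from integral_matrix [OF M this] show ?thesis by (simp add: L2_inner_def scaleR_conv_of_real)
qed

subsection \<open>Density of Lipschitz functions of bounded support\<close>

definition lipbd :: "(real ^ 'n::finite => complex) => bool" where
 "lipbd g \<longleftrightarrow> (\<exists>L. \<forall>x y. cmod (g x - g y) \<le> L * norm (x - y)) \<and> (\<exists>B. \<forall>x. norm x > B \<longrightarrow> g x = 0)"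

lemma lipbd_add: assumes "lipbd f" "lipbd g" shows "lipbd (%x. f x + g x)"
proof -
 obtain L B where f: "!!x y. cmod (f x - f y) \<le> L * norm (x - y)" "!!x. norm x > B ==> f x = 0"
  using assms(1) by (auto simp: lipbd_def)
 obtain L' B' where g: "!!x y. cmod (g x - g y) \<le> L' * norm (x - y)" "!!x. norm x > B' ==> g x = 0"
  using assms(2) by (auto simp: lipbd_def)
 have "cmod ((f x + g x) - (f y + g y)) \<le> (L + L') * norm (x - y)" for x y
  using f(1) [of x y] g(1) [of x y] norm_diff_triangle_ineq [of "f x" "g x" "f y" "g y"] by (simp add: distrib_right)
 moreover have "norm x > max B B' ==> f x + g x = 0" for x using f(2) g(2) by simp
 ultimately show ?thesis unfolding lipbd_def by blast
qed

lemma lipbd_scale: assumes "lipbd f" shows "lipbd (%x. c * f x)"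
proof -
 obtain L B where f: "!!x y. cmod (f x - f y) \<le> L * norm (x - y)" "!!x. norm x > B ==> f x = 0"
  using assms(1) by (auto simp: lipbd_def)
 have "cmod (c * f x - c * f y) \<le> (cmod c * L) * norm (x - y)" for x y
  unfolding right_diff_distrib [symmetric] norm_mult mult.assoc by (intro mult_left_mono f) auto
 then show ?thesis unfolding lipbd_def using f(2) by (metis mult_zero_right)
qed

lemma lipbd_L2: assumes "lipbd f" shows "f \<in> L2"
proof -
 obtain L B where f: "!!x y. cmod (f x - f y) \<le> L * norm (x - y)" "!!x. norm x > B ==> f x = 0"
  using assms(1) by (auto simp: lipbd_def)
 have "continuous_on UNIV f"
  unfolding continuous_on_iff
 proof (intro ballI allI impI)
  fix x e assume "(e::real) > 0"
  then show "\<exists>d>0. \<forall>y\<in>UNIV. dist y x < d \<longrightarrow> dist (f y) (f x) < e"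
  proof (intro exI [of _ "e / (\<bar>L\<bar> + 1)"] conjI ballI impI)
   fix y assume "dist y x < e / (\<bar>L\<bar> + 1)"
   then have "(\<bar>L\<bar> + 1) * norm (y - x) < e" by (simp add: dist_norm field_simps)
   moreover have "L * norm (y - x) \<le> (\<bar>L\<bar> + 1) * norm (y - x)" by (intro mult_right_mono) auto
   ultimately show "dist (f y) (f x) < e" using f(1) [of y x] by (simp add: dist_norm)
  qed auto
 qed
 then have cont: "f \<in> Lmeas"
  by (intro measurable_completion) (auto intro: borel_measurable_continuous_onI)
 define C where "C = cmod (f 0) + \<bar>L\<bar> * \<bar>B\<bar>"
 show ?thesis
 proof (rule L2_dominated [OF cont])
  show "Lint (%x. C^2 * indicator (cball 0 B) x :: real)"
   by (intro integrable_mult_right integrable_indicator_cball)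
  show "AE x in leb. (cmod (f x))^2 \<le> C^2 * indicator (cball 0 B) x"
  proof (rule AE_I2)
   fix x
   show "(cmod (f x))^2 \<le> C^2 * indicator (cball 0 B) x"
   proof (cases "norm x > B")
    case True then show ?thesis using f(2) by (simp add: indicator_def)
   next
    case False
    have "cmod (f x) \<le> cmod (f 0) + cmod (f x - f 0)" by (rule norm_triangle_sub)
    also have "... \<le> cmod (f 0) + L * norm x" using f(1) [of x 0] by simp
    also have "L * norm x \<le> \<bar>L\<bar> * \<bar>B\<bar>" using False by (intro mult_mono) auto
    finally have "(cmod (f x))^2 \<le> C^2" by (intro power_mono) (auto simp: C_def)
    then show ?thesis using False by (simp add: indicator_def)
   qed
  qed
 qed
qed

lemma L2_dominated_convergence:
 fixes f :: "real ^ 'n::finite => complex"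
 assumes f: "f \<in> Lmeas" and g: "!!i. g i \<in> Lmeas"
  and w: "Lint w" and fw: "!!x. (cmod (f x))^2 \<le> w x" and gw: "!!i x. (cmod (g i x))^2 \<le> w x"
  and lim: "!!x. (%i. g i x) \<longlonglongrightarrow> f x"
 shows "(%i. L2_norm (%x. f x - g i x)) \<longlonglongrightarrow> 0"
proof -
 have "(%i. LI x. (cmod (f x - g i x))^2) \<longlonglongrightarrow> (\<integral>x. 0 \<partial>(leb :: (real ^ 'n) measure))"
 proof (rule Bochner_Integration.integral_dominated_convergence)
  show "(%x. (cmod (f x - g i x))^2) \<in> Lmeas" for i using f g by measurable
  show "Lint (%x. 4 * w x)" using w by auto
  show "AE x in leb. (%i. (cmod (f x - g i x))^2) \<longlonglongrightarrow> 0"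
  proof (rule AE_I2)
   fix x
   have "(%i. (cmod (f x - g i x))^2) \<longlonglongrightarrow> (cmod (f x - f x))^2" by (intro tendsto_intros lim)
   then show "(%i. (cmod (f x - g i x))^2) \<longlonglongrightarrow> 0" by simp
  qed
  show "AE x in leb. norm ((cmod (f x - g i x))^2) \<le> 4 * w x" for i
  proof (rule AE_I2)
   fix x
   have "(cmod (f x - g i x))^2 \<le> (cmod (f x) + cmod (g i x))^2" by (intro power_mono norm_triangle_ineq4) auto
   also have "... \<le> 2 * (cmod (f x))^2 + 2 * (cmod (g i x))^2" by (rule sq_sum_le)
   also have "... \<le> 4 * w x" using fw [of x] gw [of i x] by simp
   finally show "norm ((cmod (f x - g i x))^2) \<le> 4 * w x" by simp
  qed
 qed simp
 from tendsto_real_sqrt [OF this] show ?thesis by (simp add: L2_norm_def)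
qed

definition lipapprox :: "(real ^ 'n::finite => complex) => bool" where
 "lipapprox f \<longleftrightarrow> f \<in> L2 \<and> (\<forall>e>0. \<exists>g. lipbd g \<and> L2_norm (%x. f x - g x) < e)"

lemma lipapproxI:
 assumes "f \<in> L2" "!!i :: nat. lipapprox (g i)" "(%i. L2_norm (%x. f x - g i x)) \<longlonglongrightarrow> 0"
 shows "lipapprox f"
 unfolding lipapprox_def
proof (intro conjI allI impI)
 fix e :: real assume e: "e > 0"
 have "\<forall>\<^sub>F i in sequentially. L2_norm (%x. f x - g i x) < e / 2"
  using assms(3) e by (intro order_tendstoD) auto
 then obtain i where i: "L2_norm (%x. f x - g i x) < e / 2" using eventually_sequentially by auto
 obtain h where h: "lipbd h" "L2_norm (%x. g i x - h x) < e / 2"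
  using assms(2) [of i] e unfolding lipapprox_def by (meson half_gt_zero)
 have "L2_norm (%x. f x - h x) \<le> L2_norm (%x. f x - g i x) + L2_norm (%x. g i x - h x)"
  using assms(1,2) lipbd_L2 [OF h(1)] unfolding lipapprox_def by (intro L2_norm_triangle_diff) auto
 then show "\<exists>g. lipbd g \<and> L2_norm (%x. f x - g x) < e" using h i by (intro exI [of _ h]) auto
qed fact

lemma lipapprox_lipbd: "lipbd f ==> lipapprox f"
 unfolding lipapprox_def using lipbd_L2 by (auto intro!: exI [of _ f] simp: L2_norm_def)

lemma lipapprox_add: assumes "lipapprox f" "lipapprox g" shows "lipapprox (%x. f x + g x)"
 unfolding lipapprox_def
proof (intro conjI allI impI)
 have fg: "f \<in> L2" "g \<in> L2" using assms by (auto simp: lipapprox_def)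
 then show "(%x. f x + g x) \<in> L2" by (rule L2_add)
 fix e :: real assume e: "e > 0"
 obtain f' where f': "lipbd f'" "L2_norm (%x. f x - f' x) < e / 2"
  using assms(1) e unfolding lipapprox_def by (meson half_gt_zero)
 obtain g' where g': "lipbd g'" "L2_norm (%x. g x - g' x) < e / 2"
  using assms(2) e unfolding lipapprox_def by (meson half_gt_zero)
 have "L2_norm (%x. (f x - f' x) + (g x - g' x)) \<le> L2_norm (%x. f x - f' x) + L2_norm (%x. g x - g' x)"
  by (rule L2_norm_triangle [OF L2_diff [OF fg(1) lipbd_L2 [OF f'(1)]] L2_diff [OF fg(2) lipbd_L2 [OF g'(1)]]])
 then have "L2_norm (%x. (f x + g x) - (f' x + g' x)) < e" using f' g' by (simp add: algebra_simps)
 then show "\<exists>h. lipbd h \<and> L2_norm (%x. (f x + g x) - h x) < e" using lipbd_add [OF f'(1) g'(1)] by blast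
qed

lemma lipapprox_scale: assumes "lipapprox f" shows "lipapprox (%x. c * f x)"
 unfolding lipapprox_def
proof (intro conjI allI impI)
 have f: "f \<in> L2" using assms by (auto simp: lipapprox_def)
 then show "(%x. c * f x) \<in> L2" by (rule L2_scale)
 fix e :: real assume e: "e > 0"
 then have "e / (cmod c + 1) > 0" by (simp add: add_nonneg_pos)
 then obtain f' where f': "lipbd f'" "L2_norm (%x. f x - f' x) < e / (cmod c + 1)"
  using assms(1) unfolding lipapprox_def by meson
 have "L2_norm (%x. c * f x - c * f' x) = cmod c * L2_norm (%x. f x - f' x)"
  by (simp add: L2_norm_scale [symmetric] right_diff_distrib)
 also have "... \<le> cmod c * (e / (cmod c + 1))" using f' by (intro mult_left_mono) auto
 also have "... < e"
 proof -
  have "0 < cmod c + 1" by (simp add: add_nonneg_pos)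
  then show ?thesis using e by (simp add: field_simps)
 qed
 finally show "\<exists>g. lipbd g \<and> L2_norm (%x. c * f x - g x) < e" using lipbd_scale [OF f'(1)] by blast
qed

lemma lipapprox_sum: "(!!i. i \<in> I ==> lipapprox (f i)) ==> lipapprox (%x. \<Sum>i\<in>I. f i x)"
proof (induction I rule: infinite_finite_induct)
 have z: "lipbd (%_. 0)" unfolding lipbd_def by (auto intro: exI [of _ 0])
 { case (infinite I) show ?case using lipapprox_lipbd [OF z] infinite by simp }
 { case empty show ?case using lipapprox_lipbd [OF z] by simp }
qed (auto intro: lipapprox_add)

lemma lipapprox_indicator_compact:
 assumes T: "compact T" shows "lipapprox (indicator T :: real ^ 'n::finite => complex)"
proof (cases "T = {}")
 case True
 have "lipbd (%_. 0)" unfolding lipbd_def by (auto intro: exI [of _ 0])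
 moreover have "indicator T = (%_ :: real ^ 'n. 0 :: complex)" using True by (simp add: fun_eq_iff)
 ultimately show ?thesis using lipapprox_lipbd by metis
next
 case False
 obtain B where B: "!!x. x \<in> T ==> norm x \<le> B" using compact_imp_bounded [OF T] by (auto simp: bounded_iff)
 have cl: "closed T" using T by (rule compact_imp_closed)
 \<comment> \<open>Tent functions of width 1/(n+1) around \<open>T\<close>; as \<open>T\<close> is
   closed, they tend pointwise to its indicator.\<close>
 define g where "g n x = complex_of_real (max 0 (1 - real (Suc n) * infdist x T))" for n :: nat and x
 have far: "infdist x T \<ge> 1" if "norm x > B + 1" for x
 proof -
  obtain a where a: "a \<in> T" "infdist x T = dist x a" using infdist_attains_inf [OF cl False] by blast
  have "norm x \<le> norm a + norm (x - a)" by (rule norm_triangle_sub)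
  then show ?thesis using B [OF a(1)] a(2) that by (simp add: dist_norm)
 qed
 have g0: "g n x = 0" if "norm x > B + 1" for n x
 proof -
  have "1 * 1 \<le> real (Suc n) * infdist x T" using far [OF that] by (intro mult_mono) auto
  then show ?thesis by (simp add: g_def)
 qed
 have lg: "lipbd (g n)" for n
  unfolding lipbd_def
 proof (intro conjI exI allI impI)
  fix x y
  have "\<bar>max 0 (1 - real (Suc n) * infdist x T) - max 0 (1 - real (Suc n) * infdist y T)\<bar>
    \<le> \<bar>real (Suc n) * infdist x T - real (Suc n) * infdist y T\<bar>" by linarith
  also have "... = real (Suc n) * \<bar>infdist x T - infdist y T\<bar>" by (simp add: right_diff_distrib [symmetric] abs_mult)
  also have "... \<le> real (Suc n) * norm (x - y)" using infdist_triangle_abs [of x T y] by (intro mult_left_mono) (auto simp: dist_norm)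
  finally show "cmod (g n x - g n y) \<le> real (Suc n) * norm (x - y)"
   unfolding g_def of_real_diff [symmetric] norm_of_real .
 qed (rule g0)
 have gi: "0 \<le> max 0 (1 - real (Suc n) * infdist x T)" "max 0 (1 - real (Suc n) * infdist x T) \<le> 1" for n x
  by (auto simp: infdist_nonneg)
 have meas: "(indicator T :: real ^ 'n => complex) \<in> Lmeas"
  using cl by (intro borel_measurable_indicator) (simp add: borel_closed)
 have bd: "(cmod (indicator T x))^2 \<le> (indicator (cball 0 (B + 1)) x :: real)" for x :: "real ^ 'n"
  using B [of x] by (auto simp: indicator_def)
 have int: "Lint (indicator (cball 0 (B + 1)) :: real ^ 'n => real)"
  by (rule integrable_indicator_cball)
 show ?thesis
 proof (rule lipapproxI [of _ g])
  show "indicator T \<in> L2" by (rule L2_dominated [OF meas int]) (rule AE_I2 [OF bd])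
  show "lipapprox (g i)" for i by (rule lipapprox_lipbd [OF lg])
  show "(%i. L2_norm (%x. indicator T x - g i x)) \<longlonglongrightarrow> 0"
  proof (rule L2_dominated_convergence [OF meas L2_meas [OF lipbd_L2 [OF lg]] int bd])
   fix i x
   show "(cmod (g i x))^2 \<le> indicator (cball 0 (B + 1)) x"
   proof (cases "norm x > B + 1")
    case True then show ?thesis using g0 [OF True] by simp
   next
    case False then show ?thesis using gi [where n = i and x = x] by (auto simp: g_def indicator_def intro!: power_le_one)
   qed
  next
   fix x
   show "(%i. g i x) \<longlonglongrightarrow> indicator T x"
   proof (cases "x \<in> T")
    case True
    then have "g i x = 1" for i by (simp add: g_def)
    then show ?thesis using True by simp
   next
    case False
    then have pos: "infdist x T > 0" using infdist_pos_not_in_closed [OF cl \<open>T \<noteq> {}\<close>] by blast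
    obtain N where N: "1 / infdist x T < real N" using reals_Archimedean2 by blast
    have "g i x = 0" if "i \<ge> N" for i
    proof -
     have "1 < real N * infdist x T" using N pos by (simp add: field_simps)
     also have "... \<le> real (Suc i) * infdist x T" using that pos by (intro mult_right_mono) auto
     finally show ?thesis by (simp add: g_def)
    qed
    then have "\<forall>\<^sub>F i in sequentially. g i x = 0" unfolding eventually_sequentially by blast
    then show ?thesis using False by (simp add: tendsto_eventually)
   qed
  qed
 qed
qed

text \<open>Inner regularity by closed sets, which are compact here since \<open>S\<close> is
  bounded.\<close>

lemma lipapprox_indicator:
 fixes S :: "(real ^ 'n::finite) set"
 assumes S: "S \<in> sets leb" "S \<subseteq> cball 0 B" shows "lipapprox (indicator S :: real ^ 'n => complex)"
proof -
 have "\<exists>T. compact T \<and> T \<subseteq> S \<and> S - T \<in> lmeasurable \<and> emeasure leb (S - T) < ennreal (1 / real (Suc i))" for i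
 proof -
  obtain T where T: "closed T" "T \<subseteq> S" "S - T \<in> lmeasurable" "emeasure leb (S - T) < ennreal (1 / real (Suc i))"
   using sets_lebesgue_inner_closed [OF S(1), of "1 / real (Suc i)"] by auto
  moreover have "bounded T" using T(2) S(2) bounded_cball bounded_subset by blast
  ultimately show ?thesis by (auto simp: compact_eq_bounded_closed)
 qed
 then obtain T where T: "!!i. compact (T i)" "!!i. T i \<subseteq> S" "!!i. S - T i \<in> lmeasurable"
  "!!i. emeasure leb (S - T i) < ennreal (1 / real (Suc i))" by metis
 show ?thesis
 proof (rule lipapproxI [of _ "%i. indicator (T i)"])
  show "indicator S \<in> L2"
  proof (rule L2_dominated)
   show "Lint (indicator (cball 0 B) :: real ^ 'n => real)" by (rule integrable_indicator_cball)
   show "AE x in leb. (cmod (indicator S x))^2 \<le> (indicator (cball 0 B) x :: real)"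
    using S(2) by (intro AE_I2) (auto simp: indicator_def)
  qed (use S(1) in simp)
  show "lipapprox (indicator (T i))" for i by (rule lipapprox_indicator_compact [OF T(1)])
  have eq: "L2_norm (%x. indicator S x - indicator (T i) x) = sqrt (measure leb (S - T i))" for i
  proof -
   have "(cmod (indicator S x - indicator (T i) x))^2 = indicator (S - T i) x" for x
    using T(2) [of i] by (auto simp: indicator_def)
   then show ?thesis by (simp add: L2_norm_def)
  qed
  have "(%i. sqrt (measure leb (S - T i))) \<longlonglongrightarrow> sqrt 0"
  proof (rule tendsto_real_sqrt, rule tendsto_sandwich [of "%_. 0" _ _ "%i. 1 / real (Suc i)"])
   show "\<forall>\<^sub>F i in sequentially. measure leb (S - T i) \<le> 1 / real (Suc i)"
   proof (intro always_eventually allI)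
    fix i
    have "ennreal (measure leb (S - T i)) < ennreal (1 / real (Suc i))"
     using T(4) [of i] emeasure_eq_measure2 [OF T(3) [of i]] by simp
    then show "measure leb (S - T i) \<le> 1 / real (Suc i)" by (simp add: ennreal_less_iff)
   qed
  qed (use LIMSEQ_inverse_real_of_nat in \<open>auto simp: inverse_eq_divide\<close>)
  then show "(%i. L2_norm (%x. indicator S x - indicator (T i) x)) \<longlonglongrightarrow> 0" unfolding eq by simp
 qed
qed

text \<open>Simple functions cut off to growing balls reduce the claim to indicators of bounded
  measurable sets.\<close>

theorem L2_lipapprox:
 assumes f: "f \<in> L2" shows "lipapprox f"
proof -
 have meas: "f \<in> Lmeas" by (rule L2_meas [OF f])
 obtain F where F: "!!i. simple_function leb (F i)" "!!x. (%i. F i x) \<longlonglongrightarrow> f x"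
  "!!i x. cmod (F i x) \<le> 2 * cmod (f x)"
  using borel_measurable_implies_sequence_metric [OF meas, of 0] by auto
 define G where "G i x = F i x * indicator (cball 0 (real i)) x" for i x
 have Gm: "G i \<in> Lmeas" for i
  unfolding G_def [abs_def] using borel_measurable_simple_function [OF F(1)]
  by (intro borel_measurable_times borel_measurable_indicator) auto
 have "lipapprox (G i)" for i
 proof -
  have fin: "finite (F i ` UNIV)" using simple_functionD(1) [OF F(1) [of i]] by simp
  have lv: "F i -` {y} \<in> sets leb" for y using simple_functionD(2) [OF F(1) [of i], of "{y}"] by simp
  have "lipapprox (%x. \<Sum>y\<in>F i ` UNIV. y * indicator (F i -` {y} \<inter> cball 0 (real i)) x)"
   by (intro lipapprox_sum lipapprox_scale lipapprox_indicator [of _ "real i"] sets.Int lv) auto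
  moreover have "(\<Sum>y\<in>F i ` UNIV. y * indicator (F i -` {y} \<inter> cball 0 (real i)) x) = G i x" for x
  proof -
   have "(\<Sum>y\<in>F i ` UNIV. y * indicator (F i -` {y} \<inter> cball 0 (real i)) x) = (\<Sum>y\<in>F i ` UNIV. if y = F i x then G i x else 0)"
    by (intro sum.cong) (auto simp: G_def indicator_def)
   then show ?thesis using fin by simp
  qed
  ultimately show ?thesis by simp
 qed
 moreover have "(%i. L2_norm (%x. f x - G i x)) \<longlonglongrightarrow> 0"
 proof (rule L2_dominated_convergence [OF meas Gm])
  show "Lint (%x. 4 * (cmod (f x))^2)" using L2_int [OF f] by auto
  show "(cmod (f x))^2 \<le> 4 * (cmod (f x))^2" for x by simp
  show "(cmod (G i x))^2 \<le> 4 * (cmod (f x))^2" for i x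
  proof -
   have "cmod (G i x) \<le> 2 * cmod (f x)" using F(3) [of i x] by (simp add: G_def indicator_def)
   then have "(cmod (G i x))^2 \<le> (2 * cmod (f x))^2" by (intro power_mono) auto
   then show ?thesis by (simp add: power_mult_distrib)
  qed
  fix x
  have "\<forall>\<^sub>F i in sequentially. F i x = G i x"
  proof -
   obtain N where "norm x \<le> real N" using real_arch_simple by blast
   then have "F i x = G i x" if "i \<ge> N" for i using that by (simp add: G_def indicator_def)
   then show ?thesis unfolding eventually_sequentially by blast
  qed
  from Lim_transform_eventually [OF F(2) this] show "(%i. G i x) \<longlonglongrightarrow> f x" .
 qed
 ultimately show ?thesis by (rule lipapproxI [OF f])
qed

subsection \<open>Uniqueness of Fourier coefficients\<close>

lemma integrable_mult_bounded:
 fixes f g :: "real ^ 'n::finite => complex"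
 assumes "Lint f" "g \<in> Lmeas" "!!x. cmod (g x) \<le> B"
 shows "Lint (%x. f x * g x)"
proof (rule Bochner_Integration.integrable_bound)
 show "Lint (%x. B * cmod (f x))" using assms by auto
 show "(%x. f x * g x) \<in> Lmeas" using assms by auto
 show "AE x in leb. norm (f x * g x) \<le> norm (B * cmod (f x))"
 proof (rule AE_I2)
  fix x
  have "cmod (f x) * cmod (g x) \<le> cmod (f x) * B" by (intro mult_left_mono assms) auto
  also have "... \<le> \<bar>B\<bar> * cmod (f x)" by (simp add: mult.commute mult_right_mono abs_ge_self)
  finally show "norm (f x * g x) \<le> norm (B * cmod (f x))" by (simp add: norm_mult abs_mult)
 qed
qed

locale fourier_null =
 fixes g :: "real ^ 'n::finite => complex" and L c :: real
 assumes g_int: "Lint g" and L_pos: "L > 0"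
  and supp: "!!x i. g x \<noteq> 0 ==> c < x $ i \<and> x $ i < c + L"
  and coeff: "!!k :: int ^ 'n. (LI x. g x * exp (- (\<i> * of_real (2 * pi / L * (of_lattice k \<bullet> x))))) = 0"
begin

abbreviation E :: "int ^ 'n => real ^ 'n => complex" where
 "E k x \<equiv> exp (- (\<i> * of_real (2 * pi / L * (of_lattice k \<bullet> x))))"

text \<open>Bounded multipliers \<open>f\<close> for which \<open>f g\<close> still has all Fourier
  coefficients zero. The class is closed under linear combinations, multiplication by characters and
  bounded pointwise limits; it is enlarged from the constant 1 until it contains the indicators of
  boxes, up to values outside the support of \<open>g\<close>.\<close>

definition adm :: "(real ^ 'n => complex) => bool" where
 "adm f \<longleftrightarrow> f \<in> Lmeas \<and> (\<exists>B. \<forall>x. cmod (f x) \<le> B) \<and>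
  (\<forall>k. (LI x. g x * (f x * E k x)) = 0)"

lemma E_meas: "E k \<in> Lmeas"
 by (intro measurable_completion borel_measurable_continuous_onI) (auto intro!: continuous_intros)

lemma adm_integrable: assumes "adm f" shows "Lint (%x. g x * (f x * E k x))"
proof -
 obtain B where "!!x. cmod (f x) \<le> B" using assms by (auto simp: adm_def)
 then show ?thesis using assms E_meas
  by (intro integrable_mult_bounded [OF g_int, where B = B]) (auto simp: adm_def norm_mult)
qed

lemma adm_one: "adm (%_. 1)"
 unfolding adm_def using coeff by auto

lemma adm_scale: assumes "adm f" shows "adm (%x. a * f x)"
proof -
 obtain B where B: "!!x. cmod (f x) \<le> B" using assms by (auto simp: adm_def)
 have "(LI x. g x * (a * f x * E k x)) = (LI x. a * (g x * (f x * E k x)))" for k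
  by (simp add: mult_ac)
 then have "(LI x. g x * (a * f x * E k x)) = 0" for k
  using assms by (simp add: integral_mult_right_zero adm_def)
 moreover have "cmod (a * f x) \<le> cmod a * B" for x unfolding norm_mult by (intro mult_left_mono B) auto
 ultimately show ?thesis using assms by (auto simp: adm_def)
qed

lemma adm_add: assumes "adm f" "adm h" shows "adm (%x. f x + h x)"
proof -
 obtain B B' where B: "!!x. cmod (f x) \<le> B" "!!x. cmod (h x) \<le> B'" using assms by (auto simp: adm_def)
 have "(LI x. g x * ((f x + h x) * E k x)) = (LI x. g x * (f x * E k x) + g x * (h x * E k x))" for k
  by (simp add: algebra_simps)
 then have "(LI x. g x * ((f x + h x) * E k x)) = 0" for k
  using assms adm_integrable [OF assms(1)] adm_integrable [OF assms(2)] by (simp add: adm_def)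
 moreover have "cmod (f x + h x) \<le> B + B'" for x by (intro norm_triangle_le add_mono B)
 ultimately show ?thesis using assms by (auto simp: adm_def)
qed

lemma adm_sum: "(!!i. i \<in> I ==> adm (f i)) ==> adm (%x. \<Sum>i\<in>I. f i x)"
 using adm_scale [OF adm_one, of 0]
 by (induction I rule: infinite_finite_induct) (auto intro: adm_add)

lemma adm_E: assumes "adm f" shows "adm (%x. f x * E l x)"
proof -
 obtain B where B: "!!x. cmod (f x) \<le> B" using assms by (auto simp: adm_def)
 have "E l x * E k x = E (l + k) x" for k x
  by (simp add: exp_add [symmetric] of_lattice_add inner_add_left algebra_simps)
 then have "(LI x. g x * (f x * E l x * E k x)) = 0" for k
  using assms by (simp only: mult.assoc) (simp add: adm_def)
 then show ?thesis using assms B E_meas [of l] by (auto simp: adm_def norm_mult)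
qed

lemma adm_limit:
 assumes f: "!!n :: nat. adm (f n)" and B: "!!n x. cmod (f n x) \<le> B" and lim: "!!x. (%n. f n x) \<longlonglongrightarrow> h x"
 shows "adm h"
proof -
 have fm: "f n \<in> Lmeas" for n using f by (auto simp: adm_def)
 have hm: "h \<in> Lmeas" by (rule borel_measurable_LIMSEQ_metric [OF fm lim])
 have "(%n. LI x. g x * (f n x * E k x)) \<longlonglongrightarrow> (LI x. g x * (h x * E k x))" for k
 proof (rule Bochner_Integration.integral_dominated_convergence)
  show "Lint (%x. B * cmod (g x))" using g_int by auto
  show "(%x. g x * (h x * E k x)) \<in> Lmeas"
   using g_int hm E_meas by (intro borel_measurable_times) auto
  show "(%x. g x * (f n x * E k x)) \<in> Lmeas" for n
   using g_int fm E_meas by (intro borel_measurable_times) auto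
  show "AE x in leb. (%n. g x * (f n x * E k x)) \<longlonglongrightarrow> g x * (h x * E k x)"
   by (intro AE_I2 tendsto_intros lim)
  show "AE x in leb. norm (g x * (f n x * E k x)) \<le> B * cmod (g x)" for n
  proof (rule AE_I2)
   fix x
   have "cmod (g x) * cmod (f n x) \<le> cmod (g x) * B" by (intro mult_left_mono B) auto
   then show "norm (g x * (f n x * E k x)) \<le> B * cmod (g x)" by (simp add: norm_mult mult.commute)
  qed
 qed
 then have "(LI x. g x * (h x * E k x)) = 0" for k
  using f LIMSEQ_unique [OF _ tendsto_const] by (fastforce simp: adm_def)
 moreover have "cmod (h x) \<le> B" for x by (rule Lim_bounded [OF tendsto_norm [OF lim], of 0]) (use B in auto)
 ultimately show ?thesis using hm by (auto simp: adm_def)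
qed

text \<open>A combination of three characters with values in [0,1], whose superlevel sets within a
  period are intervals centred at \<open>t\<close>.\<close>

definition raised_cos :: "'n => real => real ^ 'n => real" where
 "raised_cos j t x = (1 + cos (2 * pi / L * (x $ j - t))) / 2"

lemma raised_cos_01: "0 \<le> raised_cos j t x" "raised_cos j t x \<le> 1"
proof -
 have *: "0 \<le> (1 + cos u) / 2 \<and> (1 + cos u) / 2 \<le> 1" for u :: real
 proof -
  have "0 \<le> 1 + cos u" using cos_ge_minus_one [of u] by linarith
  then show ?thesis by simp
 qed
 show "0 \<le> raised_cos j t x" "raised_cos j t x \<le> 1" unfolding raised_cos_def using * by blast+
qed

lemma adm_raised_cos: assumes "adm f" shows "adm (%x. f x * of_real (raised_cos j t x))"
proof -
 define \<alpha> where "\<alpha> = exp (\<i> * of_real (2 * pi / L * t))"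
 have "f x * of_real (raised_cos j t x) = 1 / 2 * f x + (\<alpha> / 4 * (f x * E (axis j 1) x) + inverse \<alpha> / 4 * (f x * E (- axis j 1) x))" for x
 proof -
  have c: "complex_of_real (cos u) = (exp (\<i> * of_real u) + exp (- (\<i> * of_real u))) / 2" for u
   by (simp add: cos_of_real [symmetric] cos_exp_eq)
  have 1: "\<alpha> * E (axis j 1) x = exp (- (\<i> * of_real (2 * pi / L * (x $ j - t))))"
   unfolding \<alpha>_def exp_add [symmetric] of_lattice_axis by (simp add: inner_axis' algebra_simps diff_divide_distrib)
  have 2: "inverse \<alpha> * E (- axis j 1) x = exp (\<i> * of_real (2 * pi / L * (x $ j - t)))"
   unfolding \<alpha>_def exp_minus [symmetric] exp_add [symmetric] of_lattice_uminus of_lattice_axis by (simp add: inner_axis' algebra_simps diff_divide_distrib)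
  have "of_real (raised_cos j t x) = 1 / 2 + (\<alpha> * E (axis j 1) x + inverse \<alpha> * E (- axis j 1) x) / 4"
   unfolding 1 2 raised_cos_def of_real_divide of_real_add c by (simp add: field_simps)
  then show ?thesis by (simp add: algebra_simps)
 qed
 then have e: "(%x. f x * of_real (raised_cos j t x))
   = (%x. 1 / 2 * f x + (\<alpha> / 4 * (f x * E (axis j 1) x) + inverse \<alpha> / 4 * (f x * E (- axis j 1) x)))" by (rule ext)
 show ?thesis unfolding e by (intro adm_add adm_scale adm_E assms)
qed

text \<open>Bernstein polynomials in the raised cosine are admissible, and they converge uniformly
  to any continuous function of it.\<close>

lemma adm_continuous:
 assumes f: "adm f" and h: "continuous_on {0..1} h"
 shows "adm (%x. f x * of_real (h (raised_cos j t x)))"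
proof -
 let ?v = "raised_cos j t"
 have pow: "adm (%x. f x * of_real (?v x) ^ a * (1 - of_real (?v x)) ^ b)" for a b :: nat
 proof -
  have 1: "adm (%x. f x * of_real (?v x) ^ a)" for a
  proof (induction a)
   case (Suc a)
   then show ?case using adm_raised_cos [OF Suc, of j t] by (simp add: mult_ac)
  qed (use f in simp)
  show ?thesis
  proof (induction b)
   case (Suc b)
   from adm_add [OF Suc adm_scale [OF adm_raised_cos [OF Suc, of j t], of "-1"]]
   show ?case by (simp add: algebra_simps)
  qed (use 1 in simp)
 qed
 obtain B where B: "!!x. cmod (f x) \<le> B" using f by (auto simp: adm_def)
 have B0: "0 \<le> B" using B [of 0] norm_ge_zero order_trans by blast
 define P where "P n u = (\<Sum>k\<le>n. h (real k / real n) * Bernstein n k u)" for n u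
 have "\<exists>N. \<forall>u\<in>{0..1}. \<bar>h u - P N u\<bar> < 1 / real (Suc m)" for m
 proof -
  have "0 < 1 / real (Suc m)" by simp
  from Bernstein_Weierstrass [OF h this] obtain N where
   "\<forall>n u. N \<le> n \<and> u \<in> {0..1} \<longrightarrow> \<bar>h u - (\<Sum>k\<le>n. h (real k / real n) * Bernstein n k u)\<bar> < 1 / real (Suc m)" by blast
  then show ?thesis unfolding P_def by (intro exI [of _ N]) blast
 qed
 then obtain N where N: "!!m u. u \<in> {0..1} ==> \<bar>h u - P (N m) u\<bar> < 1 / real (Suc m)" by metis
 have "bounded (h ` {0..1})" using h by (intro compact_imp_bounded compact_continuous_image) auto
 then obtain H where H0: "\<forall>u\<in>{0..1}. \<bar>h u\<bar> \<le> H" by (auto simp: bounded_iff)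
 note H = bspec [OF H0]
 have v01: "?v x \<in> {0..1}" for x using raised_cos_01 by auto
 show ?thesis
 proof (rule adm_limit [where f = "%m x. f x * of_real (P (N m) (?v x))" and B = "B * (H + 1)"])
  fix m
  have "adm (%x. \<Sum>k\<le>N m. of_real (h (real k / real (N m)) * of_nat (N m choose k)) * (f x * of_real (?v x) ^ k * (1 - of_real (?v x)) ^ (N m - k)))"
   by (intro adm_sum adm_scale pow)
  then show "adm (%x. f x * of_real (P (N m) (?v x)))"
   by (simp add: P_def Bernstein_def sum_distrib_left mult_ac)
  fix x
  have "\<bar>P (N m) (?v x)\<bar> \<le> \<bar>h (?v x)\<bar> + \<bar>h (?v x) - P (N m) (?v x)\<bar>" by linarith
  also have "... \<le> H + 1"
  proof (intro add_mono H v01)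
   have "1 / real (Suc m) \<le> 1" by simp
   then show "\<bar>h (?v x) - P (N m) (?v x)\<bar> \<le> 1" using N [OF v01, of x m] by linarith
  qed
  finally show "cmod (f x * of_real (P (N m) (?v x))) \<le> B * (H + 1)"
   unfolding norm_mult norm_of_real using B B0 by (intro mult_mono) auto
 next
  fix x
  have "(%m. P (N m) (?v x) - h (?v x)) \<longlonglongrightarrow> 0"
  proof (rule Lim_null_comparison)
   show "\<forall>\<^sub>F m in sequentially. norm (P (N m) (?v x) - h (?v x)) \<le> 1 / real (Suc m)"
    using N [OF v01, of x] by (intro always_eventually) (auto simp: abs_minus_commute less_imp_le)
   show "(%m. 1 / real (Suc m)) \<longlonglongrightarrow> 0" using LIMSEQ_inverse_real_of_nat by (simp add: inverse_eq_divide)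
  qed
  then have "(%m. P (N m) (?v x)) \<longlonglongrightarrow> h (?v x)" by (simp add: LIM_zero_iff)
  then show "(%m. f x * of_real (P (N m) (?v x))) \<longlonglongrightarrow> f x * of_real (h (?v x))" by (intro tendsto_intros)
 qed
qed

text \<open>Ramps of slope m that start at \<beta> tend pointwise to the indicator of the strict
  superlevel set.\<close>

lemma adm_threshold:
 assumes f: "adm f" shows "adm (%x. f x * (if raised_cos j t x > \<beta> then 1 else 0))"
proof -
 obtain B where B: "!!x. cmod (f x) \<le> B" using f by (auto simp: adm_def)
 have B0: "0 \<le> B" using B [of 0] norm_ge_zero order_trans by blast
 define h where "h m u = max 0 (min 1 (real m * (u - \<beta>)))" for m u
 show ?thesis
 proof (rule adm_limit [where f = "%m x. f x * of_real (h m (raised_cos j t x))" and B = B])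
  fix m
  have "continuous_on {0..1} (h m)" unfolding h_def by (intro continuous_intros)
  then show "adm (%x. f x * of_real (h m (raised_cos j t x)))" by (rule adm_continuous [OF f])
  fix x
  have "\<bar>h m u\<bar> \<le> 1" for u by (auto simp: h_def)
  then have "cmod (f x) * \<bar>h m (raised_cos j t x)\<bar> \<le> B * 1" using B B0 by (intro mult_mono) auto
  then show "cmod (f x * of_real (h m (raised_cos j t x))) \<le> B" by (simp add: norm_mult)
 next
  fix x
  let ?u = "raised_cos j t x"
  have "(%m. h m ?u) \<longlonglongrightarrow> (if ?u > \<beta> then 1 else 0)"
  proof (cases "?u > \<beta>")
   case True
   obtain K where K: "1 / (?u - \<beta>) < real K" using reals_Archimedean2 by blast
   have "h m ?u = 1" if "m \<ge> K" for m
   proof -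
    have "1 < real K * (?u - \<beta>)" using K True by (simp add: field_simps)
    also have "... \<le> real m * (?u - \<beta>)" using that True by (intro mult_right_mono) auto
    finally show ?thesis by (simp add: h_def)
   qed
   then have "\<forall>\<^sub>F m in sequentially. h m ?u = 1" unfolding eventually_sequentially by blast
   then show ?thesis using True by (simp add: tendsto_eventually)
  next
   case False
   then have "real m * (?u - \<beta>) \<le> 0" for m by (intro mult_nonneg_nonpos) auto
   then have "h m ?u = 0" for m unfolding h_def using \<open>!!m. real m * (?u - \<beta>) \<le> 0\<close> [of m] by linarith
   then show ?thesis using False by simp
  qed
  then have "(%m. f x * of_real (h m ?u)) \<longlonglongrightarrow> f x * of_real (if ?u > \<beta> then 1 else 0)" by (intro tendsto_intros)
  then show "(%m. f x * of_real (h m ?u)) \<longlonglongrightarrow> f x * (if ?u > \<beta> then 1 else 0)" by (simp split: if_splits)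
 qed
qed

text \<open>Up to half a period from the centre the cosine decreases with the distance d; beyond, d
  is reflected to L - d, which still exceeds the half-length r because both points lie in the same
  open period.\<close>

lemma interval_via_cos:
 fixes y a b :: real
 assumes "c \<le> a" "a < b" "b \<le> c + L" "c < y" "y < c + L"
 shows "cos (2 * pi / L * (y - (a + b) / 2)) > cos (2 * pi / L * ((b - a) / 2)) \<longleftrightarrow> a < y \<and> y < b"
proof -
 define d where "d = \<bar>y - (a + b) / 2\<bar>"
 define r where "r = (b - a) / 2"
 have r: "0 < r" "r \<le> L / 2" using assms by (auto simp: r_def field_simps)
 have d: "0 \<le> d" "d < L - r" using assms by (auto simp: d_def r_def field_simps abs_if)
 have even: "cos (2 * pi / L * (y - (a + b) / 2)) = cos (2 * pi / L * d)"
  unfolding d_def by (cases "y \<ge> (a + b) / 2") (auto simp: abs_if right_diff_distrib cos_diff mult.commute)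
 have iff: "(a < y \<and> y < b) = (d < r)" by (auto simp: d_def r_def field_simps abs_if)
 have rng: "0 \<le> 2 * pi / L * u \<and> 2 * pi / L * u \<le> pi" if "0 \<le> u" "u \<le> L / 2" for u
  using that L_pos by (auto simp: field_simps)
 have mono: "cos (2 * pi / L * r) < cos (2 * pi / L * u) \<longleftrightarrow> u < r" if "0 \<le> u" "u \<le> L / 2" for u
 proof -
  have "cos (2 * pi / L * r) < cos (2 * pi / L * u) \<longleftrightarrow> 2 * pi / L * u < 2 * pi / L * r"
   using rng [OF that] rng [of r] r by (intro cos_mono_less_eq) auto
  also have "... \<longleftrightarrow> u < r" using L_pos by (simp add: divide_less_cancel mult_less_cancel_left_pos)
  finally show ?thesis .
 qed
 have "cos (2 * pi / L * r) < cos (2 * pi / L * d) \<longleftrightarrow> d < r"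
 proof (cases "d \<le> L / 2")
  case True then show ?thesis using mono d by simp
 next
  case False
  have "2 * pi / L * d = 2 * pi - 2 * pi / L * (L - d)" using L_pos by (simp add: field_simps)
  then have "cos (2 * pi / L * d) = cos (2 * pi / L * (L - d))" by (metis cos_2pi_minus)
  then show ?thesis using mono [of "L - d"] False d r by auto
 qed
 then show ?thesis unfolding even iff r_def .
qed

lemma box_integral_zero: "(LI x. g x * indicator (box a b) x) = 0"
proof -
 \<comment> \<open>The box is clipped to the cube, since \<open>interval_via_cos\<close> describes
   intervals inside one period only; \<open>g\<close> does not see the difference.\<close>
 define a' where "a' i = max (a $ i) c" for i
 define b' where "b' i = min (b $ i) (c + L)" for i
 show ?thesis
 proof (cases "\<forall>i. a' i < b' i")
  case False
  then obtain i where i: "b' i \<le> a' i" by (auto simp: not_less)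
  have z: "g x * indicator (box a b) x = 0" for x
  proof (cases "g x = 0 \<or> x \<notin> box a b")
   case False
   then have "c < x $ i" "x $ i < c + L" "a $ i < x $ i" "x $ i < b $ i" using supp by (auto simp: mem_box_cart)
   then show ?thesis using i by (auto simp: a'_def b'_def)
  qed auto
  show ?thesis unfolding z by simp
 next
  case True
  define w where "w i x = (if raised_cos i ((a' i + b' i) / 2) x > (1 + cos (2 * pi / L * ((b' i - a' i) / 2))) / 2 then 1 else 0 :: complex)" for i x
  have "adm (%x. \<Prod>i\<in>J. w i x)" if "finite J" for J
   using that
  proof (induction J rule: finite_induct)
   case empty show ?case using adm_one by simp
  next
   case (insert i J)
   from adm_threshold [OF insert.IH, of "(1 + cos (2 * pi / L * ((b' i - a' i) / 2))) / 2" i "(a' i + b' i) / 2"]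
   have "adm (%x. (\<Prod>j\<in>J. w j x) * w i x)" by (simp only: w_def)
   then show ?case using insert.hyps by (simp add: mult.commute)
  qed
  then have "adm (%x. \<Prod>i\<in>UNIV. w i x)" by simp
  then have "\<forall>k. (LI x. g x * ((\<Prod>i\<in>UNIV. w i x) * E k x)) = 0" by (simp add: adm_def)
  from spec [OF this, of 0] have z: "(LI x. g x * (\<Prod>i\<in>UNIV. w i x)) = 0" by simp
  have eq: "g x * indicator (box a b) x = g x * (\<Prod>i\<in>UNIV. w i x)" for x
  proof (cases "g x = 0")
   case False
   have wi: "w i x = (if a $ i < x $ i \<and> x $ i < b $ i then 1 else 0)" for i
   proof -
    have s: "c < x $ i" "x $ i < c + L" using supp [OF False] by auto
    have "(raised_cos i ((a' i + b' i) / 2) x > (1 + cos (2 * pi / L * ((b' i - a' i) / 2))) / 2) \<longleftrightarrow> a' i < x $ i \<and> x $ i < b' i"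
     using interval_via_cos [of "a' i" "b' i" "x $ i"] True s by (auto simp: raised_cos_def a'_def b'_def)
    also have "... \<longleftrightarrow> a $ i < x $ i \<and> x $ i < b $ i" using s by (auto simp: a'_def b'_def)
    finally show ?thesis by (simp add: w_def)
   qed
   have "(\<Prod>i\<in>UNIV. w i x) = indicator (box a b) x"
   proof (cases "x \<in> box a b")
    case True then show ?thesis by (simp add: wi mem_box_cart)
   next
    case False
    then obtain i where "\<not> (a $ i < x $ i \<and> x $ i < b $ i)" by (auto simp: mem_box_cart)
    then have "w i x = 0" by (simp add: wi)
    then have "(\<Prod>i\<in>UNIV. w i x) = 0" by (metis UNIV_I finite prod_zero)
    then show ?thesis using False by simp
   qed
   then show ?thesis by simp
  qed simp
  show ?thesis unfolding eq by (rule z)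
 qed
qed

text \<open>Boxes are stable under intersection and generate the Borel sets, and the property
  survives complements and countable disjoint unions; a Lebesgue set differs from a Borel set by a
  null set.\<close>

lemma set_integral_zero:
 assumes "A \<in> sets leb" shows "(LI x. g x * indicator A x) = 0"
proof -
 have intA: "Lint (%x. g x * indicator S x)" if "S \<in> sets leb" for S
  using that by (intro integrable_mult_bounded [OF g_int, where B = 1] borel_measurable_indicator) (auto simp: indicator_def)
 have borel: "(LI x. g x * indicator A x) = 0" if A: "A \<in> sets borel" for A
 proof -
  let ?G = "range (%(a, b). box a b :: (real ^ 'n) set)"
  have sub: "S \<in> sigma_sets UNIV ?G ==> S \<in> sets leb" for S
   by (metis borel_eq_box sets_completionI_sets sets_lborel sets_measure_of top_greatest Pow_UNIV)
  have AS: "A \<in> sigma_sets UNIV ?G" using A by (metis borel_eq_box sets_measure_of top_greatest Pow_UNIV)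
  have IS: "Int_stable ?G" unfolding Int_stable_def by (auto simp: box_Int_box)
  have PS: "?G \<subseteq> Pow UNIV" by simp
  show ?thesis
  proof (rule sigma_sets_induct_disjoint [where P = "%A. (LI x. g x * indicator A x) = 0", OF IS PS AS])
   fix S assume "S \<in> ?G" then show "(LI x. g x * indicator S x) = 0" using box_integral_zero by auto
  next
   show "(LI x. g x * indicator {} x) = 0" by simp
  next
   fix S assume S: "S \<in> sigma_sets UNIV ?G" "(LI x. g x * indicator S x) = 0"
   have "(LI x. g x * indicator (UNIV - S) x) = (LI x. g x - g x * indicator S x)"
    by (intro Bochner_Integration.integral_cong) (auto simp: indicator_def)
   also have "... = (LI x. g x) - 0"
    using Bochner_Integration.integral_diff [OF g_int intA [OF sub [OF S(1)]]] S(2) by simp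
   finally show "(LI x. g x * indicator (UNIV - S) x) = 0" using coeff [of 0] by simp
  next
   fix S :: "nat => (real ^ 'n) set"
   assume S: "disjoint_family S" "range S \<subseteq> sigma_sets UNIV ?G" "!!i. (LI x. g x * indicator (S i) x) = 0"
   have SL: "S i \<in> sets leb" for i using S(2) sub by auto
   have "(%n. LI x. g x * indicator (\<Union>i<n. S i) x) \<longlonglongrightarrow> (LI x. g x * indicator (\<Union>i. S i) x)"
   proof (rule Bochner_Integration.integral_dominated_convergence)
    show "Lint (%x. cmod (g x))" using g_int by auto
    show "(%x. g x * indicator (\<Union>i. S i) x) \<in> Lmeas"
     using g_int SL by (intro borel_measurable_times borel_measurable_indicator) auto
    show "(%x. g x * indicator (\<Union>i<n. S i) x) \<in> Lmeas" for n
     using g_int SL by (intro borel_measurable_times borel_measurable_indicator) auto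
    show "AE x in leb. (%n. g x * indicator (\<Union>i<n. S i) x) \<longlonglongrightarrow> g x * indicator (\<Union>i. S i) x"
     by (intro AE_I2 tendsto_intros LIMSEQ_indicator_UN)
    show "AE x in leb. norm (g x * indicator (\<Union>i<n. S i) x) \<le> cmod (g x)" for n
     by (intro AE_I2) (auto simp: indicator_def)
   qed
   moreover have "(LI x. g x * indicator (\<Union>i<n. S i) x) = 0" for n
   proof -
    have "indicator (\<Union>i<n. S i) x = (\<Sum>i<n. indicator (S i) x :: complex)" for x
     using S(1) by (intro indicator_UN_disjoint) (auto simp: disjoint_family_on_def)
    then have "(LI x. g x * indicator (\<Union>i<n. S i) x) = (LI x. (\<Sum>i<n. g x * indicator (S i) x))"
     by (simp add: sum_distrib_left)
    also have "... = (\<Sum>i<n. LI x. g x * indicator (S i) x)"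
     by (rule Bochner_Integration.integral_sum) (rule intA [OF SL])
    finally show ?thesis by (simp add: S(3))
   qed
   ultimately show "(LI x. g x * indicator (\<Union>i. S i) x) = 0"
    using LIMSEQ_unique [OF _ tendsto_const] by fastforce
  qed
 qed
 obtain S N N' where A: "A = S \<union> N" "N \<subseteq> N'" "N' \<in> null_sets lborel" "S \<in> sets lborel"
  using assms by (rule sets_completionE)
 have "AE x in leb. x \<notin> N'" using A(3) by (intro AE_not_in null_sets_completionI)
 then have "AE x in leb. g x * indicator A x = g x * indicator S x"
  by eventually_elim (use A(1,2) in \<open>auto simp: indicator_def\<close>)
 moreover have "S \<in> sets leb" using A(4) by simp
 ultimately have "(LI x. g x * indicator A x) = (LI x. g x * indicator S x)"
  using intA assms by (intro integral_cong_AE) auto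
 then show ?thesis using borel [of S] A(4) by simp
qed

text \<open>Integrate over the set where the real functional \<open>T\<close> of \<open>g\<close> is
  positive. It is applied to the real and imaginary parts with both signs.\<close>

lemma part_zero:
 assumes T: "bounded_linear (T :: complex => real)"
 shows "AE x in leb. T (g x) \<le> 0"
proof -
 interpret bounded_linear T by fact
 define A where "A = {x. T (g x) > 0}"
 have Tg: "Lint (%x. T (g x))" by (rule integrable_bounded_linear [OF T g_int])
 have A: "A \<in> sets leb" 
  using measurable_sets [OF borel_measurable_integrable [OF Tg], of "{0<..}"] by (simp add: A_def vimage_def)
 have int: "Lint (%x. g x * indicator A x)"
  using A by (intro integrable_mult_bounded [OF g_int, where B = 1] borel_measurable_indicator) (auto simp: indicator_def)
 have eq: "T (g x * indicator A x) = T (g x) * indicator A x" for x by (auto simp: indicator_def zero)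
 have "(LI x. T (g x) * indicator A x) = T (LI x. g x * indicator A x)"
  unfolding eq [symmetric] by (rule integral_bounded_linear [OF T int])
 also have "... = 0" by (simp add: set_integral_zero [OF A] zero)
 finally have "AE x in leb. T (g x) * indicator A x = 0"
  using integrable_bounded_linear [OF T int] unfolding eq
  by (subst (asm) integral_nonneg_eq_0_iff_AE) (auto simp: A_def indicator_def)
 then show ?thesis by eventually_elim (auto simp: A_def indicator_def not_less split: if_splits)
qed

theorem AE_zero: "AE x in leb. g x = 0"
proof -
 have "AE x in leb. Re (g x) \<le> 0" "AE x in leb. - Re (g x) \<le> 0"
  "AE x in leb. Im (g x) \<le> 0" "AE x in leb. - Im (g x) \<le> 0"
  by (intro part_zero bounded_linear_Re bounded_linear_Im bounded_linear_minus)+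
 then show ?thesis by eventually_elim (auto simp: complex_eq_iff)
qed

end

section \<open>The Bessel inequality: decay of differences and almost orthogonality of
  levels\<close>

subsection \<open>Powers of a matrix with spectrum in the unit disc\<close>

lemma perturbed_geometric_tendsto_0:
 fixes x y :: "nat => complex"
 assumes c: "cmod c < 1" and y: "y \<longlonglongrightarrow> 0" and x: "!!n. x (Suc n) = c * x n + y n"
 shows "x \<longlonglongrightarrow> 0"
proof (rule LIMSEQ_I)
 fix e :: real assume e: "e > 0"
 \<comment> \<open>With this threshold e/2 is the fixed point of u \<mapsto> |c| u + d, so the
   perturbation never contributes more than e/2.\<close>
 define d where "d = e * (1 - cmod c) / 2"
 have d: "d > 0" using e c by (simp add: d_def)
 obtain N where N: "!!n. n \<ge> N ==> cmod (y n) < d" using LIMSEQ_D [OF y d] by auto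
 have bound: "cmod (x (N + n)) \<le> cmod c ^ n * cmod (x N) + e / 2" for n
 proof (induction n)
  case (Suc n)
  have "cmod (x (N + Suc n)) \<le> cmod c * cmod (x (N + n)) + cmod (y (N + n))"
   using norm_triangle_ineq [of "c * x (N + n)" "y (N + n)"] by (simp add: x norm_mult)
  also have "... \<le> cmod c * (cmod c ^ n * cmod (x N) + e / 2) + d"
   using Suc N [of "N + n"] by (intro add_mono mult_left_mono) auto
  also have "... = cmod c ^ Suc n * cmod (x N) + e / 2" by (simp add: d_def field_simps)
  finally show ?case .
 qed (use e in simp)
 have "(%n. cmod c ^ n * cmod (x N)) \<longlonglongrightarrow> 0 * cmod (x N)"
  by (intro tendsto_intros LIMSEQ_power_zero) (simp add: c)
 then obtain K where K: "!!n. n \<ge> K ==> cmod c ^ n * cmod (x N) < e / 2"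
  using LIMSEQ_D [of _ 0 "e / 2"] e by fastforce
 have "norm (x n - 0) < e" if "n \<ge> N + K" for n
 proof -
  have "n = N + (n - N)" "n - N \<ge> K" using that by auto
  then show ?thesis using bound [of "n - N"] K [of "n - N"] by simp
 qed
 then show "\<exists>no. \<forall>n\<ge>no. norm (x n - 0) < e" by blast
qed

definition mpow :: "'a::comm_semiring_1 ^ 'n ^ 'n => nat => 'a ^ 'n => 'a ^ 'n" where
 "mpow A n = ((*v) A) ^^ n"

lemma mpow_0 [simp]: "mpow A 0 v = v"
 by (simp add: mpow_def)
lemma mpow_Suc: "mpow A (Suc n) v = A *v mpow A n v"
 by (simp add: mpow_def)
lemma mpow_Suc': "mpow A (Suc n) v = mpow A n (A *v v)"
 by (simp add: mpow_def funpow_swap1)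
lemma mpow_add: "mpow A n (v + w) = mpow A n v + mpow A n w"
 by (induction n) (auto simp: mpow_Suc matrix_vector_right_distrib)
lemma linear_mpow: "linear (mpow A n :: real ^ 'n::finite => real ^ 'n)"
proof (rule linearI)
 show "mpow A n (v + w) = mpow A n v + mpow A n w" for v w :: "real ^ 'n" by (rule mpow_add)
 show "mpow A n (c *\<^sub>R v) = c *\<^sub>R mpow A n v" for c and v :: "real ^ 'n"
  by (induction n) (auto simp: mpow_Suc matrix_vector_mult_scaleR)
qed

lemma mpow_diff: fixes A :: "'a::field ^ 'n ^ 'n" shows "mpow A n (v - w) = mpow A n v - mpow A n w"
 by (induction n) (auto simp: mpow_Suc matrix_vector_mult_diff_distrib)
lemma mpow_smult: fixes A :: "'a::field ^ 'n ^ 'n" shows "mpow A n (c *s v) = c *s mpow A n v"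
 by (induction n) (auto simp: mpow_Suc vector_scalar_commute)

definition pvec :: "complex ^ 'n ^ 'n => complex poly => complex ^ 'n => complex ^ 'n" where
 "pvec A p v = (\<Sum>i\<le>degree p. coeff p i *s mpow A i v)"

lemma pvec_superset: "degree p \<le> n ==> pvec A p v = (\<Sum>i\<le>n. coeff p i *s mpow A i v)"
 unfolding pvec_def by (intro sum.mono_neutral_left) (auto simp: coeff_eq_0)

lemma pvec_factor:
 assumes "q \<noteq> 0"
 shows "pvec A ([:- c, 1:] * q) v = A *v pvec A q v - c *s pvec A q v"
  and "pvec A ([:- c, 1:] * q) v = pvec A q (A *v v - c *s v)"
proof -
 let ?n = "degree q"
 have deg: "degree ([:- c, 1:] * q) \<le> Suc ?n" by (rule order_trans [OF degree_mult_le]) simp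
 have co: "coeff ([:- c, 1:] * q) i = (case i of 0 => 0 | Suc j => coeff q j) - c * coeff q i" for i
  by (simp add: coeff_pCons split: nat.split)
 have "pvec A ([:- c, 1:] * q) v = (\<Sum>i\<le>Suc ?n. coeff ([:- c, 1:] * q) i *s mpow A i v)"
  by (rule pvec_superset [OF deg])
 also have "... = (\<Sum>i\<le>Suc ?n. (case i of 0 => 0 | Suc j => coeff q j) *s mpow A i v) - c *s (\<Sum>i\<le>Suc ?n. coeff q i *s mpow A i v)"
  by (simp only: co vec.scale_left_diff_distrib sum_subtractf vec.scale_sum_right vec.scale_scale)
 also have "(\<Sum>i\<le>Suc ?n. (case i of 0 => 0 | Suc j => coeff q j) *s mpow A i v) = (\<Sum>i\<le>?n. coeff q i *s mpow A (Suc i) v)"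
  by (subst sum.atMost_Suc_shift) simp
 also have "(\<Sum>i\<le>Suc ?n. coeff q i *s mpow A i v) = pvec A q v"
  by (rule pvec_superset [symmetric]) simp
 finally have *: "pvec A ([:- c, 1:] * q) v = (\<Sum>i\<le>?n. coeff q i *s mpow A (Suc i) v) - c *s pvec A q v" .
 have "A *v pvec A q v = (\<Sum>i\<le>?n. coeff q i *s mpow A (Suc i) v)"
  unfolding pvec_def mpow_Suc by (simp add: vec.linear_sum vector_scalar_commute)
 then show "pvec A ([:- c, 1:] * q) v = A *v pvec A q v - c *s pvec A q v" unfolding * by simp
 show "pvec A ([:- c, 1:] * q) v = pvec A q (A *v v - c *s v)"
  unfolding *
  unfolding pvec_def
  by (simp add: mpow_diff mpow_smult mpow_Suc' [symmetric] vec.scale_right_diff_distrib sum_subtractf vec.scale_sum_right mult.commute)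
qed

text \<open>There are more iterates of \<open>v\<close> than dimensions. Either two of them
  coincide, which gives a difference of monomials, or they form a set of too many vectors, which is
  dependent.\<close>

lemma annihilator_exists:
 fixes A :: "complex ^ 'n ^ 'n"
 obtains p where "p \<noteq> 0" "pvec A p v = 0"
proof -
 define N where "N = vec.dim (UNIV :: (complex ^ 'n) set)"
 show ?thesis
 proof (cases "inj_on (%i. mpow A i v) {..N}")
  case False
  then obtain i j where ij: "i \<noteq> j" "mpow A i v = mpow A j v" by (auto simp: inj_on_def)
  define p :: "complex poly" where "p = monom 1 i - monom 1 j"
  have "coeff p i = 1" using ij by (simp add: p_def)
  then have "p \<noteq> 0" by auto
  moreover have "pvec A p v = 0"
  proof -
   have "degree p \<le> i + j" unfolding p_def by (intro degree_diff_le order_trans [OF degree_monom_le]) auto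
   then have "pvec A p v = (\<Sum>k\<le>i + j. coeff p k *s mpow A k v)" by (rule pvec_superset)
   also have "... = (\<Sum>k\<le>i + j. (if k = i then mpow A i v else 0) - (if k = j then mpow A j v else 0))"
    by (intro sum.cong) (auto simp: p_def)
   also have "... = mpow A i v - mpow A j v" by (simp add: sum_subtractf)
   finally show ?thesis using ij by simp
  qed
  ultimately show ?thesis by (rule that)
 next
  case True
  let ?S = "(%i. mpow A i v) ` {..N}"
  have "card ?S = Suc N" using card_image [OF True] by simp
  moreover have "vec.dim ?S \<le> N" unfolding N_def by (rule vec.dim_subset) simp
  ultimately have "vec.dependent ?S" by (intro vec.dependent_biggerset_general) simp
  then obtain u w where u: "w \<in> ?S" "u w \<noteq> 0" "(\<Sum>x\<in>?S. u x *s x) = 0"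
   using vec.dependent_finite [of ?S] by auto
  define p where "p = (\<Sum>i\<le>N. monom (u (mpow A i v)) i)"
  have co: "coeff p i = (if i \<le> N then u (mpow A i v) else 0)" for i
   by (simp add: p_def coeff_sum)
  show ?thesis
  proof (rule that)
   show "p \<noteq> 0" using u(1,2) co by (metis (no_types, lifting) atMost_iff coeff_0 imageE)
   have "degree p \<le> N" by (intro degree_le) (auto simp: co)
   then have "pvec A p v = (\<Sum>i\<le>N. u (mpow A i v) *s mpow A i v)" by (simp add: pvec_superset co)
   also have "... = (\<Sum>x\<in>?S. u x *s x)" using True by (simp add: sum.reindex)
   finally show "pvec A p v = 0" using u(3) by simp
  qed
 qed
qed

text \<open>Induction on the degree of an annihilating polynomial replaces the Jordan form. Split
  off a root c. If |c| < 1, the vector (A - c)v is annihilated by the quotient q, and v satisfies a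
  geometric recursion with a perturbation tending to 0. Otherwise q(A)v would be an eigenvector for
  c, so it is 0 and q annihilates v.\<close>

lemma mpow_tendsto_0:
 fixes A :: "complex ^ 'n ^ 'n"
 assumes ev: "!!c. is_eigenvalue A c ==> cmod c < 1"
 shows "(%n. mpow A n v $ i) \<longlonglongrightarrow> 0"
proof -
 have "p \<noteq> 0 ==> pvec A p v = 0 ==> (%n. mpow A n v $ i) \<longlonglongrightarrow> 0" for p v
 proof (induction "degree p" arbitrary: p v)
  case 0
  then have "coeff p 0 *s v = 0" by (simp add: pvec_def)
  moreover have "coeff p 0 \<noteq> 0" using 0 by (metis leading_coeff_0_iff)
  ultimately have "v = 0" by simp
  then have "mpow A n v = 0" for n by (induction n) (auto simp: mpow_Suc)
  then show ?case by simp
 next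
  case (Suc d)
  have "\<not> constant (poly p)" using Suc.hyps(2) constant_degree [of p] by simp
  then obtain c where "poly p c = 0" using fundamental_theorem_of_algebra by blast
  then obtain q where q: "p = [:- c, 1:] * q" by (auto simp: poly_eq_0_iff_dvd)
  have q0: "q \<noteq> 0" using Suc.prems q by auto
  have dq: "d = degree q" using Suc.hyps(2) q0 unfolding q by (subst (asm) degree_mult_eq) auto
  show ?case
  proof (cases "cmod c < 1")
   case True
   define w where "w = A *v v - c *s v"
   have "pvec A q w = 0" using Suc.prems(2) pvec_factor(2) [OF q0] unfolding q w_def by metis
   from Suc.hyps(1) [OF dq q0 this] have "(%n. mpow A n w $ i) \<longlonglongrightarrow> 0" .
   then show ?thesis
   proof (rule perturbed_geometric_tendsto_0 [OF True])
    fix n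
    have "mpow A (Suc n) v = c *s mpow A n v + mpow A n w"
     by (simp add: w_def mpow_diff mpow_smult mpow_Suc')
    then show "mpow A (Suc n) v $ i = c * mpow A n v $ i + mpow A n w $ i" by simp
   qed
  next
   case False
   then have "\<not> is_eigenvalue A c" using ev by blast
   moreover have "A *v pvec A q v = c *s pvec A q v"
    using Suc.prems(2) pvec_factor(1) [OF q0, of A c v] unfolding q by simp
   ultimately have "pvec A q v = 0" unfolding is_eigenvalue_def by blast
   then show ?thesis by (rule Suc.hyps(1) [OF dq q0])
  qed
 qed
 then show ?thesis using annihilator_exists [of A v] by metis
qed

definition cvec :: "real ^ 'n => complex ^ 'n" where
 "cvec x = (\<chi> i. complex_of_real (x $ i))"

lemma cvec_mult: "map_matrix complex_of_real A *v cvec x = cvec (A *v x)"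
 by (simp add: vec_eq_iff cvec_def map_matrix_def matrix_vector_mult_def)

lemma dilation_invertible:
 fixes M :: "real ^ 'n::finite ^ 'n"
 assumes "dilation_matrix M" shows "invertible M"
proof -
 have "x = 0" if "M *v x = 0" for x
 proof (rule ccontr)
  assume "x \<noteq> 0"
  then have "cvec x \<noteq> 0" by (auto simp: cvec_def vec_eq_iff)
  moreover have "map_matrix complex_of_real M *v cvec x = 0 *s cvec x"
   using that by (simp add: cvec_mult) (simp add: cvec_def vec_eq_iff)
  ultimately have "is_eigenvalue (map_matrix complex_of_real M) 0" unfolding is_eigenvalue_def by blast
  then have "cmod 0 > 1" using assms unfolding dilation_matrix_def by blast
  then show False by simp
 qed
 then show ?thesis using matrix_left_invertible_ker [of M] by (simp add: invertible_left_inverse)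
qed

lemma dilation_inverse_powers:
 fixes M :: "real ^ 'n::finite ^ 'n"
 assumes M: "dilation_matrix M" shows "(%n. mpow (matrix_inv M) n x) \<longlonglongrightarrow> 0"
proof -
 let ?A = "map_matrix complex_of_real M" and ?B = "map_matrix complex_of_real (matrix_inv M)"
 have inv: "invertible M" by (rule dilation_invertible [OF M])
 have AB: "?A *v (?B *v v) = v" for v
 proof -
  have "?A ** ?B = map_matrix complex_of_real (M ** matrix_inv M)"
   by (simp add: vec_eq_iff map_matrix_def matrix_matrix_mult_def)
  also have "... = mat 1" unfolding matrix_inv_mult [OF inv] by (simp add: vec_eq_iff map_matrix_def mat_def)
  finally show ?thesis by (simp add: matrix_vector_mul_assoc)
 qed
 have ev: "cmod c < 1" if eig: "is_eigenvalue ?B c" for c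
 proof -
  obtain v where v: "v \<noteq> 0" "?B *v v = c *s v" using eig by (auto simp: is_eigenvalue_def)
  have e: "v = c *s (?A *v v)" using AB [of v] unfolding v(2) by (simp add: vector_scalar_commute)
  then have c0: "c \<noteq> 0" using v(1) by auto
  have "?A *v v = (1 / c) *s (c *s (?A *v v))" using c0 by simp
  also have "... = (1 / c) *s v" using e by simp
  finally have "is_eigenvalue ?A (1 / c)" unfolding is_eigenvalue_def using v(1) by blast
  then have "cmod (1 / c) > 1" using M unfolding dilation_matrix_def by blast
  then show ?thesis using c0 by (simp add: norm_divide field_simps)
 qed
 have mc: "mpow ?B n (cvec x) = cvec (mpow (matrix_inv M) n x)" for n
  by (induction n) (auto simp: mpow_Suc cvec_mult)
 show ?thesis
 proof (rule vec_tendstoI)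
  fix i
  have "(%n. mpow ?B n (cvec x) $ i) \<longlonglongrightarrow> 0" by (rule mpow_tendsto_0 [OF ev])
  then have "(%n. complex_of_real (mpow (matrix_inv M) n x $ i)) \<longlonglongrightarrow> complex_of_real 0"
   unfolding mc by (simp add: cvec_def)
  then show "(%n. mpow (matrix_inv M) n x $ i) \<longlonglongrightarrow> 0 $ i" unfolding tendsto_of_real_iff by simp
 qed
qed

subsection \<open>Geometric decay in finite-dimensional spaces\<close>

text \<open>A form of echelon basis in which an element of \<open>W\<close> has its own values on
  the pivots \<open>P\<close> as coefficients; small values thus mean small coefficients.\<close>

lemma echelon_basis:
 fixes W :: "('k => complex) set"
 assumes "finite F" "!!w k. w \<in> W ==> k \<notin> F ==> w k = 0"
  "!!w v. w \<in> W ==> v \<in> W ==> (%k. w k + v k) \<in> W" "!!w c. w \<in> W ==> (%k. c * w k) \<in> W"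
 shows "\<exists>P b. P \<subseteq> F \<and> (\<forall>p\<in>P. b p \<in> W) \<and> (\<forall>w\<in>W. \<forall>k. w k = (\<Sum>p\<in>P. w p * b p k))"
 using assms
proof (induction F arbitrary: W rule: finite_induct)
 case empty
 then show ?case by (intro exI [of _ "{}"]) auto
next
 case (insert x F)
 let ?V = "{w \<in> W. w x = 0}"
 have "\<exists>P b. P \<subseteq> F \<and> (\<forall>p\<in>P. b p \<in> ?V) \<and> (\<forall>w\<in>?V. \<forall>k. w k = (\<Sum>p\<in>P. w p * b p k))"
 proof (rule insert.IH)
  fix w k assume "w \<in> ?V" "k \<notin> F" then show "w k = 0" using insert.prems(1) [of w k] by auto
 qed (use insert.prems in auto)
 then obtain P b where P: "P \<subseteq> F" "!!p. p \<in> P ==> b p \<in> ?V" "!!w k. w \<in> ?V ==> w k = (\<Sum>p\<in>P. w p * b p k)" by blast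
 show ?case
 proof (cases "\<forall>w\<in>W. w x = 0")
  case True
  then have "W = ?V" by auto
  then show ?thesis using P by (intro exI [of _ P] exI [of _ b]) auto
 next
  case False
  then obtain w1 where w1: "w1 \<in> W" "w1 x \<noteq> 0" by blast
  define w0 where "w0 = (%k. (1 / w1 x) * w1 k)"
  have w0: "w0 \<in> W" "w0 x = 1" unfolding w0_def using insert.prems(3) [OF w1(1), of "1 / w1 x"] w1(2) by auto
  have xP: "x \<notin> P" using P(1) insert.hyps by auto
  have finP: "finite P" using P(1) insert.hyps finite_subset by blast
  define z where "z = (%k. w0 k - (\<Sum>p\<in>P. w0 p * b p k))"
  have sW: "(%k. \<Sum>p\<in>Q. w0 p * b p k) \<in> W" if "Q \<subseteq> P" for Q
   using finite_subset [OF that finP] that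
  proof (induction Q rule: finite_induct)
   case empty
   have "(%k. 0 * w0 k) \<in> W" by (rule insert.prems(3) [OF w0(1)])
   then show ?case by simp
  next
   case (insert p Q)
   then show ?case using insert.prems P(2) by (auto intro!: \<open>!!w v. w \<in> W ==> v \<in> W ==> (%k. w k + v k) \<in> W\<close> \<open>!!w c. w \<in> W ==> (%k. c * w k) \<in> W\<close>)
  qed
  have zW: "z \<in> W"
   using insert.prems(2) [OF w0(1) insert.prems(3) [OF sW [OF order_refl], of "-1"]] by (simp add: z_def)
  show ?thesis
  proof (intro exI [of _ "insert x P"] exI [of _ "b(x := z)"] conjI ballI allI)
   show "insert x P \<subseteq> insert x F" using P(1) by auto
   show "(b(x := z)) p \<in> W" if "p \<in> insert x P" for p using that zW P(2) xP by auto
   fix w k assume w: "w \<in> W"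
   let ?u = "%k. w k + (- w x) * w0 k"
   have "?u \<in> ?V" using insert.prems(2) [OF w insert.prems(3) [OF w0(1), of "- w x"]] w0(2) by simp
   from P(3) [OF this, of k] have "w k = w x * w0 k + (\<Sum>p\<in>P. (w p + (- w x) * w0 p) * b p k)" by (simp add: algebra_simps)
   also have "... = w x * z k + (\<Sum>p\<in>P. w p * b p k)"
    by (simp add: z_def algebra_simps sum.distrib sum_distrib_left sum_subtractf)
   also have "... = (\<Sum>p\<in>insert x P. w p * (b(x := z)) p k)"
   proof -
    have "(\<Sum>p\<in>P. w p * b p k) = (\<Sum>p\<in>P. w p * (b(x := z)) p k)" using xP by (intro sum.cong) auto
    then show ?thesis using xP finP by simp
   qed
   finally show "w k = (\<Sum>p\<in>insert x P. w p * (b(x := z)) p k)" .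
  qed
 qed
qed

text \<open>\<open>T\<close> itself need not respect the support \<open>F\<close>, but the span
  \<open>W\<close> of the orbit lies in a finite-dimensional space. The powers of \<open>T\<close>
  tend to 0 on a finite spanning family of \<open>W\<close>, so one power contracts the sum norm on
  all of \<open>W\<close>. The factor 1/4 becomes 1/2 for L2 norms, whose squares are among the
  correlations.\<close>

lemma orbit_contraction:
 fixes u :: "nat => 'k => complex" and T :: "('k => complex) => 'k => complex"
 assumes F: "finite F" "!!n k. k \<notin> F ==> u n k = 0"
  and T: "!!n. u (Suc n) = T (u n)"
  and Tadd: "!!w v. T (%k. w k + v k) = (%k. T w k + T v k)" and Tscale: "!!c w. T (%k. c * w k) = (%k. c * T w k)"
  and lim: "!!k. (%n. u n k) \<longlonglongrightarrow> 0"
 shows "\<exists>N\<ge>1. \<forall>n. (\<Sum>k\<in>F. cmod (u (n + N) k)) \<le> (1 / 4) * (\<Sum>k\<in>F. cmod (u n k))"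
proof -
 have T0: "T (%_. 0) = (%_. 0)" using Tscale [of 0 "%_. 0"] by simp
 have Tsum: "T (%k. \<Sum>i\<in>I. c i * w i k) = (%k. \<Sum>i\<in>I. c i * T (w i) k)" if "finite I" for I :: "'i set" and c w
  using that by (induction I rule: finite_induct) (auto simp: T0 Tadd Tscale)
 have TNsum: "(T ^^ N) (%k. \<Sum>i\<in>I. c i * w i k) = (%k. \<Sum>i\<in>I. c i * (T ^^ N) (w i) k)" if "finite I" for I :: "'i set" and c w N
  by (induction N) (auto simp: Tsum [OF that])
 have Tu: "(T ^^ N) (u n) = u (n + N)" for N n
  by (induction N) (auto simp: T)
 define W where "W = {w. \<exists>J c. w = (%k. \<Sum>j<J::nat. c j * u j k)}"
 have Wmem: "u n \<in> W" for n
 proof -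
  have "u n = (%k. \<Sum>j<Suc n. (if j = n then 1 else 0) * u j k)" by (rule ext) (simp add: if_distrib [of "%x. x * _"] cong: if_cong)
  then show ?thesis unfolding W_def by (intro CollectI exI)
 qed
 have Wlim: "(%N. (T ^^ N) w k) \<longlonglongrightarrow> 0" if wW: "w \<in> W" for w k
 proof -
  obtain J c where w: "w = (%k. \<Sum>j<J::nat. c j * u j k)" using wW by (auto simp: W_def)
  have "(%N. \<Sum>j<J. c j * u (j + N) k) \<longlonglongrightarrow> (\<Sum>j<J. c j * 0)"
  proof (intro tendsto_intros)
   fix j show "(%N. u (j + N) k) \<longlonglongrightarrow> 0" using LIMSEQ_ignore_initial_segment [OF lim [of k], of j] by (simp add: add.commute)
  qed
  then show ?thesis by (simp add: w TNsum Tu)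
 qed
 have "\<exists>P b. P \<subseteq> F \<and> (\<forall>p\<in>P. b p \<in> W) \<and> (\<forall>w\<in>W. \<forall>k. w k = (\<Sum>p\<in>P. w p * b p k))"
 proof (rule echelon_basis [OF F(1)])
  fix w k assume "w \<in> W" "k \<notin> F" then show "w k = 0" using F(2) by (auto simp: W_def)
 next
  fix w v assume "w \<in> W" "v \<in> W"
  then obtain J c J' c' where w: "w = (%k. \<Sum>j<J::nat. c j * u j k)" "v = (%k. \<Sum>j<J'::nat. c' j * u j k)" by (auto simp: W_def)
  have ext: "(\<Sum>j<J. c j * u j k) = (\<Sum>j<max J J'. (if j < J then c j else 0) * u j k)" if "J \<le> max J J'" for J c k and J' :: nat
   using that by (intro sum.mono_neutral_cong_left) auto
  have "(%k. w k + v k) = (%k. \<Sum>j<max J J'. ((if j < J then c j else 0) + (if j < J' then c' j else 0)) * u j k)"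
   using ext [of J J' c] ext [of J' J c'] unfolding w by (auto simp: distrib_right sum.distrib max.commute fun_eq_iff)
  then show "(%k. w k + v k) \<in> W" unfolding W_def by (intro CollectI exI)
 next
  fix w c assume "w \<in> W"
  then obtain J d where w: "w = (%k. \<Sum>j<J::nat. d j * u j k)" by (auto simp: W_def)
  have "(%k. c * w k) = (%k. \<Sum>j<J. (c * d j) * u j k)" by (simp add: w sum_distrib_left mult.assoc)
  then show "(%k. c * w k) \<in> W" unfolding W_def by (intro CollectI exI)
 qed
 then obtain P b where P: "P \<subseteq> F" "!!p. p \<in> P ==> b p \<in> W" "!!w k. w \<in> W ==> w k = (\<Sum>p\<in>P. w p * b p k)" by blast
 have finP: "finite P" using finite_subset [OF P(1) F(1)] .
 \<comment> \<open>Summing this bound over \<open>F\<close> costs a factor \<open>card F\<close> and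
   leaves at most 1/4.\<close>
 define e where "e = 1 / (4 * real (card F + 1))"
 have e: "e > 0" by (simp add: e_def)
 have "\<forall>\<^sub>F N in sequentially. \<forall>p\<in>P. \<forall>k\<in>F. cmod ((T ^^ N) (b p) k) < e"
 proof (intro eventually_ball_finite ballI finP F(1))
  fix p k assume "p \<in> P"
  then have "(%N. (T ^^ N) (b p) k) \<longlonglongrightarrow> 0" by (intro Wlim P)
  then show "\<forall>\<^sub>F N in sequentially. cmod ((T ^^ N) (b p) k) < e"
   using e by (metis tendsto_norm_zero order_tendstoD(2))
 qed
 then obtain N0 where N0: "!!N p k. N \<ge> N0 ==> p \<in> P ==> k \<in> F ==> cmod ((T ^^ N) (b p) k) < e"
  unfolding eventually_sequentially by blast
 define N where "N = max N0 1"
 have small: "cmod ((T ^^ N) (b p) k) \<le> e" if "p \<in> P" "k \<in> F" for p k using N0 [OF _ that, of N] by (simp add: N_def)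
 show ?thesis
 proof (intro exI [of _ N] conjI allI)
  show "N \<ge> 1" by (simp add: N_def)
  fix n
  have un: "u n = (%k. \<Sum>p\<in>P. u n p * b p k)" by (rule ext) (rule P(3) [OF Wmem])
  have uN: "u (n + N) = (%k. \<Sum>p\<in>P. u n p * (T ^^ N) (b p) k)"
   unfolding Tu [symmetric] by (subst un) (rule TNsum [OF finP])
  have "(\<Sum>k\<in>F. cmod (u (n + N) k)) \<le> (\<Sum>k\<in>F. \<Sum>p\<in>P. cmod (u n p) * e)"
  proof (rule sum_mono)
   fix k assume k: "k \<in> F"
   have "cmod (u (n + N) k) \<le> (\<Sum>p\<in>P. cmod (u n p * (T ^^ N) (b p) k))" unfolding uN by (rule norm_sum)
   also have "... \<le> (\<Sum>p\<in>P. cmod (u n p) * e)"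
    unfolding norm_mult using small k by (intro sum_mono mult_left_mono) auto
   finally show "cmod (u (n + N) k) \<le> (\<Sum>p\<in>P. cmod (u n p) * e)" .
  qed
  also have "... = (real (card F) * e) * (\<Sum>p\<in>P. cmod (u n p))" by (simp add: sum_distrib_left mult_ac)
  also have "... \<le> (1 / 4) * (\<Sum>k\<in>F. cmod (u n k))"
  proof (intro mult_mono sum_mono2 F(1) P(1))
   show "real (card F) * e \<le> 1 / 4" by (simp add: e_def field_simps)
  qed (auto intro: sum_nonneg)
  finally show "(\<Sum>k\<in>F. cmod (u (n + N) k)) \<le> (1 / 4) * (\<Sum>k\<in>F. cmod (u n k))" .
 qed
qed

text \<open>A partial sum is at most the sum of the first N terms plus half of itself.\<close>

lemma summable_contracting:
 fixes y :: "nat => real"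
 assumes "!!n. 0 \<le> y n" "!!n. y (n + N) \<le> (1 / 2) * y n"
 shows "summable y"
proof (rule summableI_nonneg_bounded)
 fix n
 have "(\<Sum>i<n. y i) \<le> (\<Sum>i<n + N. y i)" using assms(1) by (intro sum_mono2) auto
 also have "... = (\<Sum>i<N. y i) + (\<Sum>i<n. y (i + N))"
  by (induction n) auto
 also have "(\<Sum>i<n. y (i + N)) \<le> (\<Sum>i<n. (1 / 2) * y i)" by (intro sum_mono assms)
 also have "... = (1 / 2) * (\<Sum>i<n. y i)" by (rule sum_distrib_left [symmetric])
 finally show "(\<Sum>i<n. y i) \<le> 2 * (\<Sum>i<N. y i)" by simp
qed (use assms in auto)

subsection \<open>Functions of bounded support\<close>

text \<open>Vanishing is required at every point, not almost everywhere, so that products of shifts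
  can be discarded pointwise.\<close>

definition bsupp :: "real => (real ^ 'n::finite => complex) => bool" where
 "bsupp R f \<longleftrightarrow> (\<forall>x. norm x > R \<longrightarrow> f x = 0)"

lemma bsuppD: "bsupp R f ==> f x \<noteq> 0 ==> norm x \<le> R"
 unfolding bsupp_def by (meson not_le)

lemma L2_inner_nonzeroE:
 assumes "L2_inner f g \<noteq> 0" obtains x where "f x \<noteq> 0" "g x \<noteq> 0"
proof -
 have "\<exists>x. f x * cnj (g x) \<noteq> 0"
 proof (rule ccontr)
  assume "\<not> ?thesis"
  then have "(%x. f x * cnj (g x)) = (%_. 0)" by blast
  then show False using assms by (simp only: L2_inner_def) simp
 qed
 then show ?thesis using that by auto
qed

lemma L2_bsupp_integrable:
 fixes f :: "real ^ 'n::finite => complex"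
 assumes f: "f \<in> L2" and R: "bsupp R f" shows "Lint f"
proof (rule Bochner_Integration.integrable_bound)
 show "Lint (%x. indicator (cball 0 R) x + (cmod (f x))^2)"
  using L2_int [OF f] integrable_indicator_cball by (intro Bochner_Integration.integrable_add)
 show "AE x in leb. norm (f x) \<le> norm (indicator (cball 0 R) x + (cmod (f x))^2)"
 proof (rule AE_I2)
  fix x
  show "norm (f x) \<le> norm (indicator (cball 0 R) x + (cmod (f x))^2)"
  proof (cases "f x = 0")
   case False
   have "0 \<le> (cmod (f x) - 1 / 2)^2" by simp
   then have "cmod (f x) \<le> 1 + (cmod (f x))^2" by (simp add: power2_eq_square field_simps)
   then show ?thesis using bsuppD [OF R False] by (simp add: indicator_def)
  qed simp
 qed
qed (rule L2_meas [OF f])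

text \<open>The identity is cut off because \<open>bounded_FT\<close> asks for bounded positions;
  functions supported in the ball do not see the cutoff.\<close>

lemma bounded_FT_lebesgue:
 assumes "0 \<le> R"
 shows "bounded_FT leb (%x :: real ^ 'n::finite. if norm x \<le> R then x else 0) R"
proof
 have "(%x :: real ^ 'n. if norm x \<le> R then x else 0) \<in> borel_measurable borel" by measurable
 then show "(%x :: real ^ 'n. if norm x \<le> R then x else 0) \<in> Lmeas"
  by (intro measurable_completion) simp
qed (use assms in auto)

lemma fourier_as_FT:
 assumes "bsupp R f" shows "fourier f = FT leb (%x. if norm x \<le> R then x else 0) f"
proof
 fix \<xi>
 show "fourier f \<xi> = FT leb (%x. if norm x \<le> R then x else 0) f \<xi>"
  unfolding fourier_def FT_def
 proof (rule Bochner_Integration.integral_cong [OF refl])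
  fix x
  show "f x * exp (- (\<i> * complex_of_real (x \<bullet> \<xi>))) = f x * exp (- (\<i> * complex_of_real ((if norm x \<le> R then x else 0) \<bullet> \<xi>)))"
   using bsuppD [OF assms, of x] by (cases "f x = 0") auto
 qed
qed

lemma integrable_exp_mult:
 fixes f :: "real ^ 'n::finite => complex"
 assumes "Lint f" shows "Lint (%x. f x * exp (- (\<i> * complex_of_real (x \<bullet> \<xi>))))"
proof (rule Bochner_Integration.integrable_bound [OF assms])
 have "(%x :: real ^ 'n. exp (- (\<i> * complex_of_real (x \<bullet> \<xi>)))) \<in> Lmeas"
  by (intro measurable_completion borel_measurable_continuous_onI) (auto intro!: continuous_intros)
 then show "(%x. f x * exp (- (\<i> * complex_of_real (x \<bullet> \<xi>)))) \<in> Lmeas"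
  using assms by (intro borel_measurable_times) auto
qed (auto simp: norm_mult)

lemma fourier_unique:
 fixes f :: "real ^ 'n::finite => complex"
 assumes f: "f \<in> L2" and R: "bsupp R f" "0 \<le> R" and z: "!!\<xi>. fourier f \<xi> = 0"
 shows "AE x in leb. f x = 0"
proof (rule fourier_null.AE_zero)
 \<comment> \<open>The period 2R + 2 places the support strictly inside the open cube.\<close>
 show "fourier_null f (2 * R + 2) (- (R + 1))"
 proof
  show "Lint f" by (rule L2_bsupp_integrable [OF f R(1)])
  show "0 < 2 * R + 2" using R by simp
  fix x i assume "f x \<noteq> 0"
  then have "\<bar>x $ i\<bar> \<le> R" using bsuppD [OF R(1)] component_le_norm_cart [of x i] by fastforce
  then show "- (R + 1) < x $ i \<and> x $ i < - (R + 1) + (2 * R + 2)" by linarith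
 next
  fix k :: "int ^ 'n"
  show "(LI x. f x * exp (- (\<i> * complex_of_real (2 * pi / (2 * R + 2) * (of_lattice k \<bullet> x))))) = 0"
   using z [of "(2 * pi / (2 * R + 2)) *\<^sub>R of_lattice k"] by (simp add: fourier_def inner_commute)
 qed
qed

lemma fourier_translate:
 fixes f :: "real ^ 'n::finite => complex"
 assumes "Lint f"
 shows "fourier (%x. f (x - a)) \<xi> = exp (- (\<i> * complex_of_real (a \<bullet> \<xi>))) * fourier f \<xi>"
proof -
 have "fourier (%x. f (x - a)) \<xi> = (LI x. f ((x + - a)) * exp (- (\<i> * complex_of_real ((x + - a) \<bullet> \<xi>))) * exp (- (\<i> * complex_of_real (a \<bullet> \<xi>))))"
  unfolding fourier_def by (simp add: mult.assoc exp_add [symmetric] inner_diff_left algebra_simps)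
 also have "... = (LI x. f x * exp (- (\<i> * complex_of_real (x \<bullet> \<xi>))) * exp (- (\<i> * complex_of_real (a \<bullet> \<xi>))))"
  by (rule integral_translate) (use integrable_exp_mult [OF assms] in auto)
 also have "... = exp (- (\<i> * complex_of_real (a \<bullet> \<xi>))) * fourier f \<xi>"
  unfolding fourier_def by (simp add: integral_mult_left_zero mult.commute)
 finally show ?thesis .
qed

lemma fourier_sum:
 fixes f :: "'i => real ^ 'n::finite => complex"
 assumes "!!i. i \<in> I ==> Lint (f i)"
 shows "fourier (%x. \<Sum>i\<in>I. c i * f i x) \<xi> = (\<Sum>i\<in>I. c i * fourier (f i) \<xi>)"
proof -
 have "fourier (%x. \<Sum>i\<in>I. c i * f i x) \<xi> = (LI x. (\<Sum>i\<in>I. c i * (f i x * exp (- (\<i> * complex_of_real (x \<bullet> \<xi>))))))"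
  unfolding fourier_def by (simp add: sum_distrib_right mult.assoc)
 also have "... = (\<Sum>i\<in>I. LI x. c i * (f i x * exp (- (\<i> * complex_of_real (x \<bullet> \<xi>)))))"
  by (rule Bochner_Integration.integral_sum) (intro integrable_mult_right integrable_exp_mult assms)
 finally show ?thesis by (simp add: fourier_def integral_mult_right_zero)
qed

lemma fourier_diff:
 fixes f :: "real ^ 'n::finite => complex"
 assumes "Lint f" "Lint g"
 shows "fourier (%x. f x - g x) \<xi> = fourier f \<xi> - fourier g \<xi>"
 unfolding fourier_def by (simp add: left_diff_distrib integrable_exp_mult assms)

lemma (in integer_matrix) fourier_matrix:
 assumes "Lint f"
 shows "fourier (%x. of_real \<bar>det M\<bar> * f (M *v x)) \<xi> = fourier f (MTi *v \<xi>)"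
proof -
 let ?F = "%y. f y * exp (- (\<i> * complex_of_real (y \<bullet> (MTi *v \<xi>))))"
 have i: "(M *v x) \<bullet> (MTi *v \<xi>) = x \<bullet> \<xi>" for x
 proof -
  have "(M *v x) \<bullet> (MTi *v \<xi>) = x \<bullet> (MT *v (MTi *v \<xi>))"
   by (metis dot_lmul_matrix inner_commute transpose_matrix_vector)
  then show ?thesis by simp
 qed
 have "fourier f (MTi *v \<xi>) = \<bar>det M\<bar> *\<^sub>R (LI x. ?F (M *v x))"
  unfolding fourier_def by (rule integral_matrix [OF invM, symmetric]) (use integrable_exp_mult [OF assms] in auto)
 also have "... = fourier (%x. of_real \<bar>det M\<bar> * f (M *v x)) \<xi>"
  unfolding fourier_def i by (simp add: mult.assoc scaleR_conv_of_real integral_mult_right_zero)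
 finally show ?thesis ..
qed

subsection \<open>Bessel families\<close>

lemma norm_sum_squared_le: "(cmod (\<Sum>k\<in>S. a k))^2 \<le> real (card S) * (\<Sum>k\<in>S. (cmod (a k))^2)"
proof -
 have "(cmod (\<Sum>k\<in>S. a k))^2 \<le> (\<Sum>k\<in>S. cmod (a k) * 1)^2" by (intro power_mono) (auto intro: norm_sum)
 also have "... \<le> (\<Sum>k\<in>S. (cmod (a k))^2) * (\<Sum>k\<in>S. 1^2)" by (rule Cauchy_Schwarz_ineq_sum)
 finally show ?thesis by (simp add: mult.commute)
qed

lemma cmod_sum_mult_le: "(cmod (\<Sum>k\<in>S. a k * b k))^2 \<le> (\<Sum>k\<in>S. (cmod (a k))^2) * (\<Sum>k\<in>S. (cmod (b k))^2)"
proof -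
 have "cmod (\<Sum>k\<in>S. a k * b k) \<le> (\<Sum>k\<in>S. cmod (a k) * cmod (b k))" by (rule order_trans [OF norm_sum]) (simp add: norm_mult)
 then have "(cmod (\<Sum>k\<in>S. a k * b k))^2 \<le> (\<Sum>k\<in>S. cmod (a k) * cmod (b k))^2" by (intro power_mono) auto
 also have "... \<le> (\<Sum>k\<in>S. (cmod (a k))^2) * (\<Sum>k\<in>S. (cmod (b k))^2)" by (rule Cauchy_Schwarz_ineq_sum)
 finally show ?thesis .
qed

lemma square_absorb: fixes A B :: real assumes "A^2 \<le> B * A" "0 \<le> B" shows "A \<le> B"
 using assms by (cases "A \<le> 0") (auto simp: power2_eq_square)

text \<open>Synthesis and analysis are adjoint, so they share their bound: test the former with the
  coefficients of \<open>f\<close> itself and cancel one factor of their square sum.\<close>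

lemma synthesis_imp_analysis:
 assumes g: "!!i. i \<in> F ==> g i \<in> L2" and f: "f \<in> L2"
  and syn: "!!c. (L2_norm (%x. \<Sum>i\<in>F. c i * g i x))^2 \<le> C * (\<Sum>i\<in>F. (cmod (c i))^2)" and C: "0 \<le> C"
 shows "(\<Sum>i\<in>F. (cmod (L2_inner f (g i)))^2) \<le> C * (L2_norm f)^2"
proof -
 define A where "A = (\<Sum>i\<in>F. (cmod (L2_inner f (g i)))^2)"
 have A0: "0 \<le> A" unfolding A_def by (intro sum_nonneg) auto
 let ?S = "%x. \<Sum>i\<in>F. L2_inner f (g i) * g i x"
 have S: "?S \<in> L2" by (intro L2_sum L2_scale g)
 have "complex_of_real A = L2_inner f ?S"
  using L2_inner_sum_right [where c = "%i. L2_inner f (g i)" and I = F and f = g and h = f] g f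
  by (simp add: A_def complex_norm_square mult.commute del: of_real_power)
 then have "A = cmod (L2_inner f ?S)" using A0 by (metis abs_of_nonneg norm_of_real)
 also have "... \<le> L2_norm f * L2_norm ?S" by (rule L2_Cauchy_Schwarz [OF f S])
 finally have "A^2 \<le> (L2_norm f * L2_norm ?S)^2" using A0 by (intro power_mono)
 also have "... = (L2_norm f)^2 * (L2_norm ?S)^2" by (rule power_mult_distrib)
 also have "... \<le> (L2_norm f)^2 * (C * A)" unfolding A_def by (intro mult_left_mono syn) auto
 finally have "A^2 \<le> (C * (L2_norm f)^2) * A" by (simp add: mult_ac)
 then show ?thesis unfolding A_def [symmetric] by (rule square_absorb) (use C in auto)
qed

text \<open>The converse direction, needed for partial sums of the expansion once the Bessel
  inequality for the whole system is known.\<close>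

lemma analysis_imp_synthesis:
 assumes g: "!!i. i \<in> F ==> g i \<in> L2"
  and an: "!!f. f \<in> L2 ==> (\<Sum>i\<in>F. (cmod (L2_inner f (g i)))^2) \<le> C * (L2_norm f)^2" and C: "0 \<le> C"
 shows "(L2_norm (%x. \<Sum>i\<in>F. c i * g i x))^2 \<le> C * (\<Sum>i\<in>F. (cmod (c i))^2)"
proof -
 define S where "S = (%x. \<Sum>i\<in>F. c i * g i x)"
 define v where "v i = L2_inner (g i) S" for i
 have S: "S \<in> L2" unfolding S_def by (intro L2_sum L2_scale g)
 have "complex_of_real ((L2_norm S)^2) = L2_inner (%x. \<Sum>i\<in>F. c i * g i x) S"
  unfolding L2_inner_self [symmetric] S_def ..
 also have "... = (\<Sum>i\<in>F. c i * v i)"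
  unfolding v_def by (rule L2_inner_sum_left [OF g S])
 finally have "cmod (complex_of_real ((L2_norm S)^2)) = cmod (\<Sum>i\<in>F. c i * v i)" by (rule arg_cong)
 then have "(L2_norm S)^2 = cmod (\<Sum>i\<in>F. c i * v i)" unfolding norm_of_real by simp
 then have "((L2_norm S)^2)^2 \<le> (\<Sum>i\<in>F. (cmod (c i))^2) * (\<Sum>i\<in>F. (cmod (v i))^2)"
  using cmod_sum_mult_le [of c v F] by metis
 also have "... \<le> (\<Sum>i\<in>F. (cmod (c i))^2) * (C * (L2_norm S)^2)"
 proof (intro mult_left_mono sum_nonneg)
  have "cmod (v i) = cmod (L2_inner S (g i))" for i unfolding v_def by (metis L2_inner_cnj complex_mod_cnj)
  then show "(\<Sum>i\<in>F. (cmod (v i))^2) \<le> C * (L2_norm S)^2" using an [OF S] by simp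
 qed auto
 finally have "((L2_norm S)^2)^2 \<le> (C * (\<Sum>i\<in>F. (cmod (c i))^2)) * (L2_norm S)^2" by (simp only: mult_ac)
 then show ?thesis unfolding S_def [symmetric] by (rule square_absorb) (intro mult_nonneg_nonneg sum_nonneg C zero_le_power2)
qed

lemma shift_L2: "f \<in> L2 ==> shift f k \<in> L2"
 using L2_translate [of f "- of_lattice k"] by (simp add: shift_def)

lemma shift_norm: "f \<in> L2 ==> L2_norm (shift f k) = L2_norm f"
 using L2_norm_translate [of f "- of_lattice k"] by (simp add: shift_def)

lemma shift_inner:
 assumes "f \<in> L2" "g \<in> L2" shows "L2_inner (shift f k) (shift g l) = L2_inner f (shift g (l - k))"
proof -
 have "L2_inner (%x. shift f k (x + of_lattice k)) (%x. shift g l (x + of_lattice k)) = L2_inner (shift f k) (shift g l)"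
  by (rule L2_inner_translate [OF shift_L2 [OF assms(1)] shift_L2 [OF assms(2)]])
 then show ?thesis by (simp add: shift_def of_lattice_diff algebra_simps)
qed

text \<open>Bounds the number of lattice translates of a ball of radius \<open>R\<close> that share
  a point; the type argument only fixes the dimension.\<close>

definition overlap :: "'n::finite itself => real => real" where
 "overlap T R = real (card {l :: int ^ 'n. norm (of_lattice l) \<le> 2 * R})"

lemma overlap_card:
 fixes x :: "real ^ 'n::finite"
 assumes "finite K" "!!k. k \<in> K ==> norm (x - of_lattice k) \<le> R"
 shows "real (card K) \<le> overlap TYPE('n) R"
proof (cases "K = {}")
 case False
 then obtain k0 where k0: "k0 \<in> K" by blast
 have "K \<subseteq> (%l. k0 + l) ` {l :: int ^ 'n. norm (of_lattice l) \<le> 2 * R}"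
 proof
  fix k assume k: "k \<in> K"
  have "norm (of_lattice (k - k0)) = norm ((x - of_lattice k0) - (x - of_lattice k))" by (simp add: of_lattice_diff)
  also have "... \<le> R + R" by (rule order_trans [OF norm_triangle_ineq4]) (intro add_mono assms k k0)
  finally show "k \<in> (%l. k0 + l) ` {l. norm (of_lattice l) \<le> 2 * R}" by (intro image_eqI [of _ _ "k - k0"]) auto
 qed
 then have "card K \<le> card ((%l. k0 + l) ` {l :: int ^ 'n. norm (of_lattice l) \<le> 2 * R})"
  by (intro card_mono finite_imageI finite_lattice_ball)
 also have "... \<le> card {l :: int ^ 'n. norm (of_lattice l) \<le> 2 * R}" by (intro card_image_le finite_lattice_ball)
 finally show ?thesis by (simp add: overlap_def)
qed (simp add: overlap_def)

text \<open>At each point at most \<open>overlap\<close> many shifts are nonzero, so Cauchy-Schwarz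
  is applied pointwise before integrating.\<close>

lemma bessel_shift:
 fixes h :: "real ^ 'n::finite => complex"
 assumes h: "h \<in> L2" and R: "bsupp R h" and K: "finite K"
 shows "(L2_norm (%x. \<Sum>k\<in>K. c k * shift h k x))^2 \<le> overlap TYPE('n) R * (L2_norm h)^2 * (\<Sum>k\<in>K. (cmod (c k))^2)"
proof -
 let ?N = "overlap TYPE('n) R"
 have pt: "(cmod (\<Sum>k\<in>K. c k * shift h k x))^2 \<le> ?N * (\<Sum>k\<in>K. (cmod (c k))^2 * (cmod (shift h k x))^2)" for x
 proof -
  define S where "S = {k \<in> K. shift h k x \<noteq> 0}"
  have S: "finite S" "S \<subseteq> K" using K by (auto simp: S_def)
  have "(\<Sum>k\<in>K. c k * shift h k x) = (\<Sum>k\<in>S. c k * shift h k x)"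
   using K by (intro sum.mono_neutral_right) (auto simp: S_def)
  then have "(cmod (\<Sum>k\<in>K. c k * shift h k x))^2 \<le> real (card S) * (\<Sum>k\<in>S. (cmod (c k * shift h k x))^2)"
   using norm_sum_squared_le by metis
  also have "... \<le> ?N * (\<Sum>k\<in>K. (cmod (c k * shift h k x))^2)"
  proof (intro mult_mono sum_mono2 K S)
   show "real (card S) \<le> ?N" by (rule overlap_card [OF S(1)]) (auto simp: S_def shift_def intro: bsuppD [OF R])
  qed (auto simp: overlap_def intro: sum_nonneg)
  finally show ?thesis by (simp add: norm_mult power_mult_distrib)
 qed
 have int: "Lint (%x. (cmod (c k))^2 * (cmod (shift h k x))^2)" for k
  by (intro integrable_mult_right L2_int shift_L2 h)
 have "(L2_norm (%x. \<Sum>k\<in>K. c k * shift h k x))^2 \<le> (LI x. ?N * (\<Sum>k\<in>K. (cmod (c k))^2 * (cmod (shift h k x))^2))"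
  unfolding L2_norm_sq
 proof (rule integral_mono [OF _ _ pt])
  show "Lint (%x. (cmod (\<Sum>k\<in>K. c k * shift h k x))^2)" by (intro L2_int L2_sum L2_scale shift_L2 h)
  show "Lint (%x. ?N * (\<Sum>k\<in>K. (cmod (c k))^2 * (cmod (shift h k x))^2))"
   by (intro integrable_mult_right Bochner_Integration.integrable_sum int)
 qed
 also have "... = ?N * (\<Sum>k\<in>K. LI x. (cmod (c k))^2 * (cmod (shift h k x))^2)"
  by (simp only: integral_mult_right_zero [where c = ?N] Bochner_Integration.integral_sum [OF int])
 also have "... = ?N * (\<Sum>k\<in>K. (cmod (c k))^2 * (LI x. (cmod (shift h k x))^2))"
  unfolding integral_mult_right_zero ..
 also have "... = ?N * (\<Sum>k\<in>K. (cmod (c k))^2 * (L2_norm h)^2)"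
  unfolding L2_norm_sq [symmetric] shift_norm [OF h] ..
 also have "... = ?N * (L2_norm h)^2 * (\<Sum>k\<in>K. (cmod (c k))^2)"
  by (metis (no_types) mult.assoc mult.commute sum_distrib_right)
 finally show ?thesis .
qed

text \<open>Clear for Lipschitz functions of bounded support; density extends it, as translations
  are isometries.\<close>

lemma L2_translation_continuous:
 fixes f :: "real ^ 'n::finite => complex"
 assumes f: "f \<in> L2" and h: "h \<longlonglongrightarrow> 0"
 shows "(%n. L2_norm (%x. f (x - h n) - f x)) \<longlonglongrightarrow> 0"
proof (rule LIMSEQ_I)
 fix e :: real assume e: "e > 0"
 obtain g where g: "lipbd g" "L2_norm (%x. f x - g x) < e / 4"
  using L2_lipapprox [OF f] e unfolding lipapprox_def by (metis zero_less_divide_iff zero_less_numeral)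
 have gL: "g \<in> L2" by (rule lipbd_L2 [OF g(1)])
 obtain L B where L: "!!x y. cmod (g x - g y) \<le> L * norm (x - y)" and B: "!!x. norm x > B ==> g x = 0"
  using g(1) by (auto simp: lipbd_def)
 define V where "V = measure leb (cball (0 :: real ^ 'n) (B + 1))"
 have bd: "L2_norm (%x. g (x - v) - g x) \<le> \<bar>L\<bar> * norm v * sqrt V" if "norm v \<le> 1" for v
 proof -
  have "(L2_norm (%x. g (x - v) - g x))^2 \<le> (LI x. (\<bar>L\<bar> * norm v)^2 * indicator (cball (0 :: real ^ 'n) (B + 1)) x)"
   unfolding L2_norm_sq
  proof (rule integral_mono)
   show "Lint (%x. (cmod (g (x - v) - g x))^2)"
    using L2_translate [OF gL, of "- v"] by (intro L2_int L2_diff gL) simp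
   show "Lint (%x. (\<bar>L\<bar> * norm v)^2 * indicator (cball 0 (B + 1)) x :: real)"
    by (intro integrable_mult_right integrable_indicator_cball)
   fix x
   show "(cmod (g (x - v) - g x))^2 \<le> (\<bar>L\<bar> * norm v)^2 * indicator (cball 0 (B + 1)) x"
   proof (cases "norm x \<le> B + 1")
    case True
    have "cmod (g (x - v) - g x) \<le> L * norm v" using L [of "x - v" x] by simp
    also have "... \<le> \<bar>L\<bar> * norm v" by (intro mult_right_mono) auto
    finally have "(cmod (g (x - v) - g x))^2 \<le> (\<bar>L\<bar> * norm v)^2" by (intro power_mono) auto
    then show ?thesis using True by (simp add: indicator_def)
   next
    case False
    have "norm x \<le> norm (x - v) + norm v" by (metis norm_triangle_sub add.commute)
    then have "norm (x - v) > B" using False that by linarith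
    then show ?thesis using B [of "x - v"] B [of x] False by simp
   qed
  qed
  also have "... = (\<bar>L\<bar> * norm v * sqrt V)^2" by (simp add: V_def power_mult_distrib)
  finally show ?thesis by (rule power2_le_imp_le) (simp add: V_def)
 qed
 have "(%n. \<bar>L\<bar> * norm (h n) * sqrt V) \<longlonglongrightarrow> \<bar>L\<bar> * norm (0 :: real ^ 'n) * sqrt V" by (intro tendsto_intros h)
 then have "(%n. \<bar>L\<bar> * norm (h n) * sqrt V) \<longlonglongrightarrow> 0" by simp
 then have "\<forall>\<^sub>F n in sequentially. \<bar>L\<bar> * norm (h n) * sqrt V < e / 2" using e by (intro order_tendstoD(2)) auto
 moreover have "\<forall>\<^sub>F n in sequentially. norm (h n) < 1"
  using tendsto_norm [OF h] by (intro order_tendstoD(2)) auto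
 ultimately have "\<forall>\<^sub>F n in sequentially. norm (L2_norm (%x. f (x - h n) - f x) - 0) < e"
 proof eventually_elim
  case (elim n)
  let ?v = "h n"
  have fv: "(%x. f (x - ?v)) \<in> L2" "(%x. g (x - ?v)) \<in> L2"
   using L2_translate [OF f, of "- ?v"] L2_translate [OF gL, of "- ?v"] by simp_all
  have "L2_norm (%x. f (x - ?v) - f x) \<le> L2_norm (%x. f (x - ?v) - g (x - ?v)) + L2_norm (%x. g (x - ?v) - f x)"
   by (rule L2_norm_triangle_diff [OF fv f])
  also have "L2_norm (%x. f (x - ?v) - g (x - ?v)) = L2_norm (%x. f x - g x)"
   using L2_norm_translate [OF L2_diff [OF f gL], of "- ?v"] by simp
  also have "L2_norm (%x. g (x - ?v) - f x) \<le> L2_norm (%x. g (x - ?v) - g x) + L2_norm (%x. g x - f x)"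
   by (rule L2_norm_triangle_diff [OF fv(2) gL f])
  also have "L2_norm (%x. g x - f x) = L2_norm (%x. f x - g x)" by (rule L2_norm_minus_commute)
  finally have "L2_norm (%x. f (x - ?v) - f x) < e" using g(2) bd [of ?v] elim by linarith
  then show ?case by simp
 qed
 then show "\<exists>no. \<forall>n\<ge>no. norm (L2_norm (%x. f (x - h n) - f x) - 0) < e"
  unfolding eventually_sequentially .
qed

context integer_matrix begin

abbreviation "D \<equiv> \<bar>det M\<bar>"

lemma D_pos: "D > 0"
 using invM by (simp add: invertible_det_nz)

lemma sqrt_D_mult: "of_real (sqrt D) * (of_real (sqrt D) * z) = of_real D * (z :: complex)"
proof -
 have "complex_of_real (sqrt D) * of_real (sqrt D) = of_real D" unfolding of_real_mult [symmetric] by simp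
 then show ?thesis by (metis mult.assoc)
qed

text \<open>Normalized to be an isometry of L2, so that inner products between levels j and j + n
  reduce to levels 0 and n.\<close>

definition dil :: "(real ^ 'n => complex) => real ^ 'n => complex" where
 "dil f = (%x. of_real (sqrt D) * f (M *v x))"

lemma dil_L2: "f \<in> L2 ==> dil f \<in> L2"
 unfolding dil_def by (intro L2_scale L2_matrix invM)

lemma dil_inner:
 assumes "f \<in> L2" "g \<in> L2" shows "L2_inner (dil f) (dil g) = L2_inner f g"
proof -
 have "L2_inner (dil f) (dil g) = (of_real (sqrt D) * of_real (sqrt D)) * L2_inner (%x. f (M *v x)) (%x. g (M *v x))"
  unfolding dil_def L2_inner_scale_left
  using L2_inner_cnj L2_inner_scale_left [of "of_real (sqrt D)" "%x. g (M *v x)" "%x. f (M *v x)"]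
  by (metis (no_types, lifting) complex_cnj_complex_of_real complex_cnj_mult mult.assoc)
 also have "of_real (sqrt D) * of_real (sqrt D) = complex_of_real D"
  unfolding of_real_mult [symmetric] by simp
 finally show ?thesis using L2_inner_matrix [OF invM assms] by simp
qed

lemma dil_pow_L2: "f \<in> L2 ==> (dil ^^ j) f \<in> L2"
 by (induction j) (auto intro: dil_L2)

lemma dil_pow_inner: "f \<in> L2 ==> g \<in> L2 ==> L2_inner ((dil ^^ j) f) ((dil ^^ j) g) = L2_inner f g"
 by (induction j) (auto simp: dil_inner dil_pow_L2)

lemma dil_pow_norm: assumes "f \<in> L2" shows "L2_norm ((dil ^^ j) f) = L2_norm f"
proof -
 have "complex_of_real ((L2_norm ((dil ^^ j) f))^2) = complex_of_real ((L2_norm f)^2)"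
  unfolding L2_inner_self [symmetric] by (rule dil_pow_inner [OF assms assms])
 then have "(L2_norm ((dil ^^ j) f))^2 = (L2_norm f)^2" by (simp only: of_real_eq_iff)
 then show ?thesis by (simp add: power2_eq_iff_nonneg)
qed

lemma dil_pow_sum: "(dil ^^ j) (%x. \<Sum>i\<in>I. c i * f i x) = (%x. \<Sum>i\<in>I. c i * (dil ^^ j) (f i) x)"
 by (induction j) (auto simp: dil_def sum_distrib_left mult.left_commute)

lemma dilate_shift_0: "dilate_shift M f 0 k = shift f k"
 using D_pos by (simp add: dilate_shift_def shift_def)

lemma dilate_shift_Suc: "dilate_shift M f (Suc j) k = dil (dilate_shift M f j k)"
proof -
 have "D powr (real (Suc j) / 2) = D powr (real j / 2 + 1 / 2)" by (simp add: add_divide_distrib add.commute)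
 also have "... = D powr (real j / 2) * sqrt D" using D_pos by (simp add: powr_add powr_half_sqrt)
 finally show ?thesis
  unfolding dilate_shift_def dil_def by (simp add: funpow_swap1 mult_ac)
qed

lemma dilate_shift_dil: "dilate_shift M f (j + n) k = (dil ^^ j) (dilate_shift M f n k)"
 by (induction j) (auto simp: dilate_shift_Suc)

lemma dilate_shift_dil0: "dilate_shift M f j k = (dil ^^ j) (shift f k)"
 using dilate_shift_dil [of f j 0 k] by (simp add: dilate_shift_0)

lemma dilate_shift_L2: "f \<in> L2 ==> dilate_shift M f j k \<in> L2"
 unfolding dilate_shift_dil0 by (intro dil_pow_L2 shift_L2)

lemma bessel_level:
 assumes h: "h \<in> L2" and R: "bsupp R h" and K: "finite K"
 shows "(L2_norm (%x. \<Sum>k\<in>K. c k * dilate_shift M h j k x))^2 \<le> overlap TYPE('n) R * (L2_norm h)^2 * (\<Sum>k\<in>K. (cmod (c k))^2)"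
proof -
 have "(%x. \<Sum>k\<in>K. c k * dilate_shift M h j k x) = (dil ^^ j) (%x. \<Sum>k\<in>K. c k * shift h k x)"
  unfolding dil_pow_sum dilate_shift_dil0 ..
 then have "L2_norm (%x. \<Sum>k\<in>K. c k * dilate_shift M h j k x) = L2_norm (%x. \<Sum>k\<in>K. c k * shift h k x)"
  using dil_pow_norm [of "%x. \<Sum>k\<in>K. c k * shift h k x" j] by (simp add: L2_sum L2_scale shift_L2 h)
 then show ?thesis using bessel_shift [OF h R K] by simp
qed

end

subsection \<open>Differences of translates\<close>

lemma shift_shift: "shift (shift f k) l = shift f (k + l)"
 by (simp add: shift_def of_lattice_add algebra_simps)

lemma L2_inner_diff_right:
 assumes "f \<in> L2" "g \<in> L2" "h \<in> L2"
 shows "L2_inner h (%x. f x - g x) = L2_inner h f - L2_inner h g"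
proof -
 have "L2_inner h (%x. f x - g x) = cnj (L2_inner (%x. f x - g x) h)" by (rule L2_inner_cnj [symmetric])
 also have "... = L2_inner h f - L2_inner h g" unfolding L2_inner_diff_left [OF assms] by (simp add: L2_inner_cnj)
 finally show ?thesis .
qed

lemma L2_inner_cong_AE2:
 assumes "AE x in leb. f x = f' x" "AE x in leb. g x = g' x" "f \<in> L2" "f' \<in> L2" "g \<in> L2" "g' \<in> L2"
 shows "L2_inner f g = L2_inner f' g'"
proof -
 have "L2_inner f g = cnj (L2_inner g f)" by (rule L2_inner_cnj [symmetric])
 also have "... = cnj (L2_inner g f')" by (rule arg_cong [OF L2_inner_cong_AE [OF assms(1,3,4,5)]])
 also have "... = L2_inner f' g" by (rule L2_inner_cnj)
 also have "... = L2_inner f' g'" by (rule L2_inner_cong_AE [OF assms(2,5,6,4)])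
 finally show ?thesis .
qed

definition tdiff :: "(real ^ 'n => complex) => real ^ 'n => real ^ 'n => complex" where
 "tdiff f v = (%x. f (x - v) - f x)"

lemma tdiff_L2: "f \<in> L2 ==> tdiff f v \<in> L2"
 using L2_translate [of f "- v"] by (simp add: tdiff_def L2_diff)

lemma tdiff_bsupp:
 fixes f :: "real ^ 'n::finite => complex"
 assumes f: "bsupp R f" and v: "norm v \<le> Y" shows "bsupp (R + Y) (tdiff f v)"
 unfolding bsupp_def
proof (intro allI impI)
 fix x :: "real ^ 'n" assume x: "norm x > R + Y"
 have 1: "norm x \<le> norm (x - v) + norm v" using norm_triangle_ineq [of "x - v" v] by simp
 have 2: "norm (x - v) > R" using x v 1 by linarith
 have 3: "norm x > R" using x v norm_ge_zero [of v] by linarith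
 show "tdiff f v x = 0" using f 2 3 by (simp add: tdiff_def bsupp_def)
qed

lemma tdiff_sum: "tdiff (%x. \<Sum>i\<in>I. c i * f i x) v = (%x. \<Sum>i\<in>I. c i * tdiff (f i) v x)"
 by (simp add: tdiff_def sum_subtractf right_diff_distrib)

lemma tdiff_shift: "tdiff (shift f k) v = shift (tdiff f v) k"
 by (simp add: tdiff_def shift_def diff_diff_eq add.commute)

lemma tdiff_inner:
 assumes f: "f \<in> L2" and g: "g \<in> L2" shows "L2_inner f (tdiff g v) = L2_inner (tdiff f (- v)) g"
proof -
 have t: "(%x. f (x + v)) \<in> L2" "(%x. g (x - v)) \<in> L2"
  using L2_translate [OF f, of v] L2_translate [OF g, of "- v"] by simp_all
 have "L2_inner f (tdiff g v) = L2_inner f (%x. g (x - v)) - L2_inner f g"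
  unfolding tdiff_def by (rule L2_inner_diff_right [OF t(2) g f])
 also have "L2_inner f (%x. g (x - v)) = L2_inner (%x. f (x + v)) g"
  using L2_inner_translate [OF f t(2), of v] by simp
 also have "... - L2_inner f g = L2_inner (tdiff f (- v)) g"
  unfolding tdiff_def using L2_inner_diff_left [OF t(1) f g] by simp
 finally show ?thesis .
qed

lemma tdiff_norm_le: "f \<in> L2 ==> L2_norm (tdiff f v) \<le> 2 * L2_norm f"
 using L2_norm_diff_le [OF L2_translate [of f "- v"], of f] L2_norm_translate [of f "- v"] by (simp add: tdiff_def)

lemma tdiff_norm_uminus: assumes "f \<in> L2" shows "L2_norm (tdiff f (- v)) = L2_norm (tdiff f v)"
 using L2_norm_translate [OF tdiff_L2 [OF assms, of "- v"], of "- v"]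
 by (simp add: tdiff_def L2_norm_minus_commute)

lemma tdiff_tdiff: "tdiff (tdiff f y) v = tdiff (tdiff f v) y"
 by (simp add: tdiff_def diff_diff_eq add.commute) (simp add: algebra_simps)

lemma shift_inner_eq_0:
 assumes f: "bsupp R f" and g: "bsupp R g" and k: "norm (of_lattice k) > 2 * R"
 shows "L2_inner f (shift g k) = 0"
proof -
 have z: "f x * cnj (shift g k x) = 0" for x
 proof (rule ccontr)
  assume "f x * cnj (shift g k x) \<noteq> 0"
  then have nz: "f x \<noteq> 0" "g (x - of_lattice k) \<noteq> 0" by (auto simp: shift_def)
  have 1: "norm x \<le> R" by (rule bsuppD [OF f nz(1)])
  have 2: "norm (x - of_lattice k) \<le> R" by (rule bsuppD [OF g nz(2)])
  have "norm (of_lattice k) \<le> norm x + norm (x - of_lattice k)"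
   using norm_triangle_ineq4 [of x "x - of_lattice k"] by simp
  then show False using 1 2 k by linarith
 qed
 show ?thesis unfolding L2_inner_def z by simp
qed

context integer_matrix begin

abbreviation "Mi \<equiv> matrix_inv M"

lemma M_Mi [simp]: "M *v (Mi *v x) = x" and Mi_M [simp]: "Mi *v (M *v x) = x"
proof -
 have "M ** Mi = mat 1 \<and> Mi ** M = mat 1"
  using invM unfolding invertible_def matrix_inv_def by (rule someI_ex)
 then show "M *v (Mi *v x) = x" "Mi *v (M *v x) = x" by (simp_all add: matrix_vector_mul_assoc)
qed

lemma mpow_M_Mi [simp]: "mpow M n (mpow Mi n x) = x"
proof (induction n)
 case (Suc n)
 have "mpow M (Suc n) (mpow Mi (Suc n) x) = mpow M n (M *v (Mi *v mpow Mi n x))"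
  by (simp only: mpow_Suc' [of M] mpow_Suc [of Mi])
 then show ?case using Suc by simp
qed simp

lemma mpow_Mi_M [simp]: "mpow Mi n (mpow M n x) = x"
proof (induction n)
 case (Suc n)
 have "mpow Mi (Suc n) (mpow M (Suc n) x) = mpow Mi n (Mi *v (M *v mpow M n x))"
  by (simp only: mpow_Suc' [of Mi] mpow_Suc [of M])
 then show ?case using Suc by simp
qed simp

lemma inj_zmul: "inj (zmul M)"
proof (rule injI)
 fix k l assume "zmul M k = zmul M l"
 then have "M *v of_lattice k = M *v of_lattice l" by (metis of_lattice_zmul intM)
 then have "of_lattice k = of_lattice l" by (metis Mi_M)
 then show "k = l" by simp
qed

lemma shift_dil: "shift (dil g) k = dil (shift g (zmul M k))"
 by (simp add: shift_def dil_def of_lattice_zmul [OF intM] matrix_vector_mult_diff_distrib)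

lemma dil_AE: "AE x in leb. f x = g x ==> AE x in leb. dil f x = dil g x"
 using AE_matrix [OF invM, of "%x. f x = g x"] by (simp add: dil_def)

lemma shift_AE: "AE x in leb. f x = g x ==> AE x in leb. shift f k x = shift g k x"
 using AE_translate [of "%x. f x = g x" "- of_lattice k"] by (simp add: shift_def)

lemma tdiff_AE:
 assumes "AE x in leb. f x = g x" shows "AE x in leb. tdiff f v x = tdiff g v x"
 using assms AE_translate [OF assms, of "- v"] by eventually_elim (simp add: tdiff_def)

lemma tdiff_dil: "tdiff (dil g) (Mi *v v) = dil (tdiff g v)"
 by (simp add: tdiff_def dil_def matrix_vector_mult_diff_distrib right_diff_distrib)

lemma dilate_shift_eq: "dilate_shift M f n k x = of_real (D powr (real n / 2)) * f (mpow M n x - of_lattice k)"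
 by (simp add: dilate_shift_def mpow_def)

lemma dilate_shift_tdiff: "dilate_shift M (tdiff f v) n k = tdiff (dilate_shift M f n k) (mpow Mi n v)"
 by (simp add: fun_eq_iff dilate_shift_eq tdiff_def mpow_diff right_diff_distrib diff_diff_eq add.commute)

lemma shift_sum: "shift (%x. \<Sum>i\<in>I. c i * f i x) k = (%x. \<Sum>i\<in>I. c i * shift (f i) k x)"
 by (simp add: shift_def)

text \<open>The autocorrelations of \<open>f\<close> on the lattice arise from those of
  \<open>g\<close> by the transition operator of the mask \<open>d\<close>, which depends on
  \<open>d\<close> alone.\<close>

lemma refinement_inner:
 assumes f: "f \<in> L2" and g: "g \<in> L2" and eq: "AE x in leb. f x = dil (%x. \<Sum>l\<in>S. d l * shift g l x) x"
 shows "L2_inner f (shift f k) = (\<Sum>l\<in>S. \<Sum>l'\<in>S. d l * cnj (d l') * L2_inner g (shift g (zmul M k + l' - l)))"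
proof -
 define G where "G = (%x. \<Sum>l\<in>S. d l * shift g l x)"
 have G: "G \<in> L2" unfolding G_def by (intro L2_sum L2_scale shift_L2 g)
 have e: "AE x in leb. f x = dil G x" using eq by (simp add: G_def)
 have "L2_inner f (shift f k) = L2_inner (dil G) (shift (dil G) k)"
  by (rule L2_inner_cong_AE2 [OF e shift_AE [OF e]]) (intro f dil_L2 G shift_L2)+
 also have "... = L2_inner G (shift G (zmul M k))" unfolding shift_dil by (intro dil_inner G shift_L2)
 also have "... = (\<Sum>l\<in>S. d l * L2_inner (shift g l) (shift G (zmul M k)))"
  by (subst G_def, rule L2_inner_sum_left) (intro shift_L2 g G)+
 also have "... = (\<Sum>l\<in>S. d l * (\<Sum>l'\<in>S. cnj (d l') * L2_inner (shift g l) (shift (shift g l') (zmul M k))))"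
  unfolding G_def shift_sum by (intro sum.cong refl arg_cong [of _ _ "(*) _"] L2_inner_sum_right shift_L2 g)
 also have "... = (\<Sum>l\<in>S. \<Sum>l'\<in>S. d l * cnj (d l') * L2_inner g (shift g (zmul M k + l' - l)))"
  unfolding shift_shift shift_inner [OF g g] by (simp add: sum_distrib_left mult.assoc add.commute)
 finally show ?thesis .
qed

end

subsection \<open>Refinable functions\<close>

text \<open>The square root here and the one in \<open>dil\<close> combine to \<phi>(x) = |det M|
  \<Sum> a(l) \<phi>(Mx - l). Contraction of M^{-n} is assumed pointwise, which is all that the
  eigenvalues give at once.\<close>

locale refinable = integer_matrix M for M :: "real ^ 'n::finite ^ 'n" +
 fixes a :: "int ^ 'n => complex" and \<phi> :: "real ^ 'n => complex" and R :: real
 assumes contr: "!!x. (%n. mpow (matrix_inv M) n x) \<longlonglongrightarrow> 0"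
  and a: "a \<in> l0" and \<phi>: "\<phi> \<in> L2" and R: "bsupp R \<phi>" "0 \<le> R"
  and refine: "AE x in leb. \<phi> x = dil (%x. \<Sum>l | a l \<noteq> 0. of_real (sqrt \<bar>det M\<bar>) * a l * shift \<phi> l x) x"
begin

lemma contr_bounded: obtains Y where "0 \<le> Y" "!!n. norm (mpow Mi n y) \<le> Y"
proof -
 have "Bseq (%n. mpow Mi n y)" by (rule convergent_imp_Bseq) (rule convergentI [OF contr])
 then obtain Y where "0 < Y" "!!n. norm (mpow Mi n y) \<le> Y" unfolding Bseq_def by blast
 then show ?thesis using that [of Y] by auto
qed

text \<open>The refinement equation carries differences of step M^{-n}y to those of step M^{-n-1}y
  with the same mask for every n, so the correlations are an orbit of one fixed operator.\<close>

lemma tdiff_refine: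
 "AE x in leb. tdiff \<phi> (mpow Mi (Suc n) y) x
  = dil (%x. \<Sum>l | a l \<noteq> 0. of_real (sqrt \<bar>det M\<bar>) * a l * shift (tdiff \<phi> (mpow Mi n y)) l x) x"
 using tdiff_AE [OF refine, of "mpow Mi (Suc n) y"]
 unfolding mpow_Suc tdiff_dil tdiff_sum tdiff_shift .

text \<open>The correlations of the differences with their integer shifts evolve by a fixed linear map on a
 finite-dimensional space, and tend to zero; hence they decay geometrically.\<close>
theorem summable_tdiff: "summable (%n. L2_norm (tdiff \<phi> (mpow Mi n y)))"
proof -
 obtain Y where Y: "0 \<le> Y" "!!n. norm (mpow Mi n y) \<le> Y" using contr_bounded by blast
 define \<Delta> where "\<Delta> n = tdiff \<phi> (mpow Mi n y)" for n
 define u where "u n k = L2_inner (\<Delta> n) (shift (\<Delta> n) k)" for n k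
 define F where "F = {k :: int ^ 'n. norm (of_lattice k) \<le> 2 * (R + Y)}"
 let ?S = "{l. a l \<noteq> 0}" and ?d = "%l. of_real (sqrt \<bar>det M\<bar>) * a l"
 define T where "T w k = (\<Sum>l\<in>?S. \<Sum>l'\<in>?S. ?d l * cnj (?d l') * w (zmul M k + l' - l))" for w :: "int ^ 'n => complex" and k
 have \<Delta>: "\<Delta> n \<in> L2" for n unfolding \<Delta>_def by (rule tdiff_L2 [OF \<phi>])
 have lim: "(%n. L2_norm (\<Delta> n)) \<longlonglongrightarrow> 0"
  unfolding \<Delta>_def tdiff_def by (rule L2_translation_continuous [OF \<phi> contr])
 have F: "finite F" unfolding F_def by (rule finite_lattice_ball)
 have "\<exists>N\<ge>1. \<forall>n. (\<Sum>k\<in>F. cmod (u (n + N) k)) \<le> (1 / 4) * (\<Sum>k\<in>F. cmod (u n k))"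
 proof (rule orbit_contraction [OF F, where T = T])
  fix n k assume "k \<notin> F"
  then have "norm (of_lattice k) > 2 * (R + Y)" by (simp add: F_def)
  then show "u n k = 0" unfolding u_def \<Delta>_def using shift_inner_eq_0 [OF tdiff_bsupp tdiff_bsupp] R Y by blast
 next
  fix n
  have "u (Suc n) k = T (u n) k" for k
   unfolding u_def T_def \<Delta>_def by (rule refinement_inner [OF tdiff_L2 [OF \<phi>] tdiff_L2 [OF \<phi>] tdiff_refine])
  then show "u (Suc n) = T (u n)" by (rule ext)
 next
  fix k
  have "cmod (u n k) \<le> L2_norm (\<Delta> n) * L2_norm (\<Delta> n)" for n
   using L2_Cauchy_Schwarz [OF \<Delta> shift_L2 [OF \<Delta>], of n n k] by (simp add: u_def shift_norm [OF \<Delta>])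
  moreover have "(%n. L2_norm (\<Delta> n) * L2_norm (\<Delta> n)) \<longlonglongrightarrow> 0" using tendsto_mult [OF lim lim] by simp
  ultimately show "(%n. u n k) \<longlonglongrightarrow> 0" by (intro Lim_null_comparison [of "%n. u n k"]) auto
 qed (simp_all add: T_def fun_eq_iff distrib_left sum.distrib sum_distrib_left mult_ac)
 then obtain N where N: "!!n. (\<Sum>k\<in>F. cmod (u (n + N) k)) \<le> (1 / 4) * (\<Sum>k\<in>F. cmod (u n k))" by blast
 \<comment> \<open>The correlation at shift 0 is the square of the norm, so the root of the sum of
   all correlations dominates the norm; it inherits the contraction with factor 1/2.\<close>
 define z where "z n = sqrt (\<Sum>k\<in>F. cmod (u n k))" for n
 have "summable z"
 proof (rule summable_contracting)
  fix n show "0 \<le> z n" by (simp add: z_def sum_nonneg)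
  have "z (n + N) \<le> sqrt ((1 / 4) * (\<Sum>k\<in>F. cmod (u n k)))" unfolding z_def by (intro real_sqrt_le_mono N)
  also have "... = (1 / 2) * z n" unfolding z_def real_sqrt_mult by (simp add: real_sqrt_divide)
  finally show "z (n + N) \<le> (1 / 2) * z n" .
 qed
 then show ?thesis unfolding \<Delta>_def [symmetric]
 proof (rule summable_comparison_test_ev [rotated], intro always_eventually allI)
  fix n
  have "0 \<in> F" using R Y by (simp add: F_def)
  then have "cmod (u n 0) \<le> (\<Sum>k\<in>F. cmod (u n k))" by (intro member_le_sum F) auto
  moreover have "cmod (u n 0) = (L2_norm (\<Delta> n))^2" by (simp add: u_def shift_def L2_inner_self norm_power)
  ultimately show "norm (L2_norm (\<Delta> n)) \<le> z n" unfolding z_def by (simp add: real_le_rsqrt)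
 qed
qed

definition decay :: "real ^ 'n => nat => real" where
 "decay y n = L2_norm (tdiff \<phi> (mpow Mi n y))"

lemma decay_nonneg: "0 \<le> decay y n"
 by (simp add: decay_def)

text \<open>The finer function is a difference with a small step, which is moved to the coarser one.\<close>
lemma almost_orthogonal:
 obtains C where "0 \<le> C" and
  "!!i n K L c d. finite K ==> finite L ==>
   cmod (L2_inner (%x. \<Sum>k\<in>K. c k * dilate_shift M (tdiff \<phi> y) i k x) (%x. \<Sum>l\<in>L. d l * dilate_shift M (tdiff \<phi> y) (i + n) l x))
   \<le> C * decay y n * (sqrt (\<Sum>k\<in>K. (cmod (c k))^2) * sqrt (\<Sum>l\<in>L. (cmod (d l))^2))"
proof -
 obtain Y where Y: "0 \<le> Y" "!!n. norm (mpow Mi n y) \<le> Y" using contr_bounded by blast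
 define O1 where "O1 = sqrt (overlap TYPE('n) (R + Y + Y))"
 define O2 where "O2 = sqrt (overlap TYPE('n) R)"
 have O: "0 \<le> O1" "0 \<le> O2" by (auto simp: O1_def O2_def overlap_def)
 \<comment> \<open>\<open>O1\<close> and \<open>O2\<close> come from the Bessel bounds for the
   shifts of the second difference of \<phi> and of \<phi> itself.\<close>
 define C where "C = 2 * O1 * O2 * L2_norm \<phi>"
 let ?\<eta> = "tdiff \<phi> y"
 have \<eta>: "?\<eta> \<in> L2" by (rule tdiff_L2 [OF \<phi>])
 have ny: "norm y \<le> Y" using Y(2) [of 0] by simp
 have main: "cmod (L2_inner (%x. \<Sum>k\<in>K. c k * dilate_shift M ?\<eta> i k x) (%x. \<Sum>l\<in>L. d l * dilate_shift M ?\<eta> (i + n) l x))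
   \<le> C * decay y n * (sqrt (\<Sum>k\<in>K. (cmod (c k))^2) * sqrt (\<Sum>l\<in>L. (cmod (d l))^2))"
  if K: "finite K" and L: "finite L" for i n K L c d
 proof -
  define h where "h = mpow Mi n y"
  define A where "A = (%x. \<Sum>k\<in>K. c k * shift ?\<eta> k x)"
  define E where "E = (%x. \<Sum>l\<in>L. d l * dilate_shift M \<phi> n l x)"
  have AE: "A \<in> L2" "E \<in> L2" unfolding A_def E_def by (intro L2_sum L2_scale shift_L2 dilate_shift_L2 \<phi> \<eta>)+
  have A': "(%x. \<Sum>k\<in>K. c k * dilate_shift M ?\<eta> i k x) = (dil ^^ i) A"
   unfolding A_def dil_pow_sum dilate_shift_dil0 ..
  have E': "(%x. \<Sum>l\<in>L. d l * dilate_shift M ?\<eta> (i + n) l x) = (dil ^^ i) (tdiff E h)"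
   unfolding E_def tdiff_sum dil_pow_sum dilate_shift_dil dilate_shift_tdiff h_def ..
  have "L2_inner ((dil ^^ i) A) ((dil ^^ i) (tdiff E h)) = L2_inner (tdiff A (- h)) E"
   by (simp add: dil_pow_inner AE tdiff_L2 tdiff_inner)
  then have "cmod (L2_inner ((dil ^^ i) A) ((dil ^^ i) (tdiff E h))) \<le> L2_norm (tdiff A (- h)) * L2_norm E"
   using L2_Cauchy_Schwarz [OF tdiff_L2 [OF AE(1)] AE(2)] by simp
  also have "... \<le> (O1 * (2 * decay y n) * sqrt (\<Sum>k\<in>K. (cmod (c k))^2)) * (O2 * L2_norm \<phi> * sqrt (\<Sum>l\<in>L. (cmod (d l))^2))"
  proof (intro mult_mono)
   let ?\<kappa> = "tdiff ?\<eta> (- h)"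
   have \<kappa>: "?\<kappa> \<in> L2" by (rule tdiff_L2 [OF \<eta>])
   have "bsupp (R + Y + Y) ?\<kappa>" by (intro tdiff_bsupp R ny) (simp add: h_def Y)
   from bessel_shift [OF \<kappa> this K, of c]
   have "(L2_norm (tdiff A (- h)))^2 \<le> overlap TYPE('n) (R + Y + Y) * (L2_norm ?\<kappa>)^2 * (\<Sum>k\<in>K. (cmod (c k))^2)"
    unfolding A_def tdiff_sum tdiff_shift .
   then have "L2_norm (tdiff A (- h)) \<le> sqrt (overlap TYPE('n) (R + Y + Y) * (L2_norm ?\<kappa>)^2 * (\<Sum>k\<in>K. (cmod (c k))^2))"
    by (rule real_le_rsqrt)
   also have "... = O1 * L2_norm ?\<kappa> * sqrt (\<Sum>k\<in>K. (cmod (c k))^2)" by (simp add: real_sqrt_mult O1_def)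
   \<comment> \<open>The two differences commute: the one with step y is estimated trivially by the
     factor 2, the one with the small step gives the decay.\<close>
   also have "L2_norm ?\<kappa> \<le> 2 * decay y n"
    unfolding tdiff_tdiff [of \<phi> y] decay_def h_def [symmetric] tdiff_norm_uminus [OF \<phi>, of h, symmetric]
    by (rule tdiff_norm_le [OF tdiff_L2 [OF \<phi>]])
   finally show "L2_norm (tdiff A (- h)) \<le> O1 * (2 * decay y n) * sqrt (\<Sum>k\<in>K. (cmod (c k))^2)"
    using O by (simp add: mult_left_mono mult_right_mono sum_nonneg)
   have "(L2_norm E)^2 \<le> overlap TYPE('n) R * (L2_norm \<phi>)^2 * (\<Sum>l\<in>L. (cmod (d l))^2)"
    unfolding E_def by (rule bessel_level [OF \<phi> R(1) L])
   then have "L2_norm E \<le> sqrt (overlap TYPE('n) R * (L2_norm \<phi>)^2 * (\<Sum>l\<in>L. (cmod (d l))^2))"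
    by (rule real_le_rsqrt)
   then show "L2_norm E \<le> O2 * L2_norm \<phi> * sqrt (\<Sum>l\<in>L. (cmod (d l))^2)" by (simp add: real_sqrt_mult O2_def)
  qed (use O in \<open>auto intro!: mult_nonneg_nonneg decay_nonneg real_sqrt_ge_zero sum_nonneg\<close>)
  also have "... = C * decay y n * (sqrt (\<Sum>k\<in>K. (cmod (c k))^2) * sqrt (\<Sum>l\<in>L. (cmod (d l))^2))"
   by (simp add: C_def mult_ac)
  finally show ?thesis unfolding A' E' .
 qed
 have "0 \<le> C" unfolding C_def by (intro mult_nonneg_nonneg O) auto
 then show ?thesis using that main by blast
qed

end

subsection \<open>Schur's test\<close>

lemma summable_distance_sum:
 fixes \<tau> :: "nat => real"
 assumes "summable \<tau>" "!!n. 0 \<le> \<tau> n"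
 shows "(\<Sum>j<J. \<tau> (if i \<le> j then j - i else i - j)) \<le> 2 * suminf \<tau>"
proof -
 have part: "(\<Sum>j\<in>A. \<tau> (g j)) \<le> suminf \<tau>" if "finite A" "inj_on g A" for A :: "nat set" and g
 proof -
  have "(\<Sum>j\<in>A. \<tau> (g j)) = (\<Sum>n\<in>g ` A. \<tau> n)" using that by (simp add: sum.reindex)
  also have "... \<le> suminf \<tau>" using assms that by (intro sum_le_suminf) auto
  finally show ?thesis .
 qed
 have "(\<Sum>j<J. \<tau> (if i \<le> j then j - i else i - j))
   = (\<Sum>j\<in>{..<J} \<inter> {j. i \<le> j}. \<tau> (j - i)) + (\<Sum>j\<in>{..<J} \<inter> - {j. i \<le> j}. \<tau> (i - j))"
  by (subst sum.If_cases [symmetric]) (auto intro: sum.cong)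
 also have "... \<le> suminf \<tau> + suminf \<tau>"
  by (intro add_mono part) (auto simp: inj_on_def)
 finally show ?thesis by simp
qed

text \<open>Split s_i s_j \<le> (s_i^2 + s_j^2)/2 and sum over rows. Each distance |i - j| occurs at
  most twice in a row, whence the factor 2.\<close>

lemma schur_test:
 fixes G :: "nat => real ^ 'n::finite => complex" and s :: "nat => real"
 assumes G: "!!j. j < J ==> G j \<in> L2" and \<tau>: "summable \<tau>" "!!n. 0 \<le> \<tau> n" and s: "!!j. 0 \<le> s j"
  and le: "!!i n. i + n < J ==> cmod (L2_inner (G i) (G (i + n))) \<le> \<tau> n * (s i * s (i + n))"
 shows "(L2_norm (%x. \<Sum>j<J. G j x))^2 \<le> 2 * suminf \<tau> * (\<Sum>j<J. (s j)^2)"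
proof -
 define t where "t i j = \<tau> (if i \<le> j then j - i else i - j)" for i j :: nat
 have t_sym: "t i j = t j i" for i j by (auto simp: t_def)
 have t0: "0 \<le> t i j" for i j by (simp add: t_def \<tau>)
 have b: "cmod (L2_inner (G i) (G j)) \<le> t i j * (((s i)^2 + (s j)^2) / 2)" if ij: "i < J" "j < J" for i j
 proof -
  have *: "cmod (L2_inner (G i) (G j)) \<le> t i j * (s i * s j)" if o: "i \<le> j" "j < J" for i j
   using le [of i "j - i"] o by (simp add: t_def)
  have "cmod (L2_inner (G i) (G j)) \<le> t i j * (s i * s j)"
  proof (cases "i \<le> j")
   case False
   have "cmod (L2_inner (G i) (G j)) = cmod (L2_inner (G j) (G i))" by (metis L2_inner_cnj complex_mod_cnj)
   also have "... \<le> t j i * (s j * s i)" using * [of j i] False ij by simp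
   finally show ?thesis by (simp add: t_sym [of j i] mult.commute)
  qed (use * ij in auto)
  also have "... \<le> t i j * (((s i)^2 + (s j)^2) / 2)"
   using sum_squares_bound [of "s i" "s j"] by (intro mult_left_mono t0) simp
  finally show ?thesis .
 qed
 have row: "(\<Sum>j<J. t i j) \<le> 2 * suminf \<tau>" for i unfolding t_def by (rule summable_distance_sum [OF \<tau>])
 have S: "(%x. \<Sum>j<J. G j x) \<in> L2" by (intro L2_sum G) auto
 have "complex_of_real ((L2_norm (%x. \<Sum>j<J. G j x))^2) = (\<Sum>i<J. \<Sum>j<J. L2_inner (G i) (G j))"
  using L2_inner_sum_left [of "{..<J}" G "%x. \<Sum>j<J. G j x" "%_. 1"] L2_inner_sum_right [of "{..<J}" G _ "%_. 1"] G S
  unfolding L2_inner_self [symmetric] by simp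
 then have "cmod (complex_of_real ((L2_norm (%x. \<Sum>j<J. G j x))^2)) = cmod (\<Sum>i<J. \<Sum>j<J. L2_inner (G i) (G j))" by (rule arg_cong)
 then have "(L2_norm (%x. \<Sum>j<J. G j x))^2 = cmod (\<Sum>i<J. \<Sum>j<J. L2_inner (G i) (G j))"
  unfolding norm_of_real by simp
 also have "... \<le> (\<Sum>i<J. \<Sum>j<J. cmod (L2_inner (G i) (G j)))"
  by (intro order_trans [OF norm_sum] sum_mono norm_sum)
 also have "... \<le> (\<Sum>i<J. \<Sum>j<J. t i j * (((s i)^2 + (s j)^2) / 2))"
  by (intro sum_mono b) auto
 also have "... = (\<Sum>i<J. \<Sum>j<J. t i j * (s i)^2 / 2) + (\<Sum>i<J. \<Sum>j<J. t i j * (s j)^2 / 2)"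
  by (simp add: sum.distrib [symmetric] add_divide_distrib distrib_left)
 also have "(\<Sum>i<J. \<Sum>j<J. t i j * (s j)^2 / 2) = (\<Sum>i<J. \<Sum>j<J. t i j * (s i)^2 / 2)"
  by (subst sum.swap) (simp add: t_sym)
 also have "(\<Sum>i<J. \<Sum>j<J. t i j * (s i)^2 / 2) + (\<Sum>i<J. \<Sum>j<J. t i j * (s i)^2 / 2) = (\<Sum>i<J. (\<Sum>j<J. t i j) * (s i)^2)"
  by (simp add: sum.distrib [symmetric] sum_distrib_right)
 also have "... \<le> (\<Sum>i<J. 2 * suminf \<tau> * (s i)^2)" by (intro sum_mono mult_right_mono row) auto
 finally show ?thesis by (simp add: sum_distrib_left)
qed

context refinable begin

text \<open>\<open>almost_orthogonal\<close> already contains the estimate over the shifts within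
  two levels; its factor \<open>decay y n\<close> is summable in the distance n of the levels, as
  Schur's test requires.\<close>

lemma bessel_tdiff:
 "\<exists>B\<ge>0. \<forall>f\<in>L2. \<forall>J K. finite K \<longrightarrow>
  (\<Sum>j<J. \<Sum>k\<in>K. (cmod (L2_inner f (dilate_shift M (tdiff \<phi> y) j k)))^2) \<le> B * (L2_norm f)^2"
proof -
 let ?\<eta> = "tdiff \<phi> y"
 have \<eta>: "?\<eta> \<in> L2" by (rule tdiff_L2 [OF \<phi>])
 obtain C where C: "0 \<le> C" "!!i n K L c d. finite K ==> finite L ==>
   cmod (L2_inner (%x. \<Sum>k\<in>K. c k * dilate_shift M ?\<eta> i k x) (%x. \<Sum>l\<in>L. d l * dilate_shift M ?\<eta> (i + n) l x))
   \<le> C * decay y n * (sqrt (\<Sum>k\<in>K. (cmod (c k))^2) * sqrt (\<Sum>l\<in>L. (cmod (d l))^2))"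
  using almost_orthogonal by blast
 define \<tau> where "\<tau> n = C * decay y n" for n
 have \<tau>: "summable \<tau>" "!!n. 0 \<le> \<tau> n"
  unfolding \<tau>_def decay_def by (intro summable_mult summable_tdiff, intro mult_nonneg_nonneg C L2_norm_nonneg)
 define B where "B = 2 * suminf \<tau>"
 have B: "0 \<le> B" unfolding B_def using suminf_nonneg [OF \<tau>] by simp
 have "(\<Sum>j<J. \<Sum>k\<in>K. (cmod (L2_inner f (dilate_shift M ?\<eta> j k)))^2) \<le> B * (L2_norm f)^2"
  if f: "f \<in> L2" and K: "finite K" for f J K
 proof -
  have "(\<Sum>p\<in>{..<J} \<times> K. (cmod (L2_inner f (case p of (j, k) => dilate_shift M ?\<eta> j k)))^2) \<le> B * (L2_norm f)^2"
  proof (rule synthesis_imp_analysis [OF _ f _ B])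
   fix p show "(case p of (j, k) => dilate_shift M ?\<eta> j k) \<in> L2" by (auto split: prod.split intro: dilate_shift_L2 \<eta>)
  next
   fix c :: "nat \<times> (int ^ 'n) => complex"
   define G where "G j = (%x. \<Sum>k\<in>K. c (j, k) * dilate_shift M ?\<eta> j k x)" for j
   define s where "s j = sqrt (\<Sum>k\<in>K. (cmod (c (j, k)))^2)" for j
   have "(L2_norm (%x. \<Sum>j<J. G j x))^2 \<le> 2 * suminf \<tau> * (\<Sum>j<J. (s j)^2)"
   proof (rule schur_test [OF _ \<tau>])
    fix j show "G j \<in> L2" unfolding G_def by (intro L2_sum L2_scale dilate_shift_L2 \<eta>)
    show "0 \<le> s j" by (simp add: s_def sum_nonneg)
   next
    fix i n show "cmod (L2_inner (G i) (G (i + n))) \<le> \<tau> n * (s i * s (i + n))"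
     unfolding G_def s_def \<tau>_def by (rule C(2) [OF K K])
   qed
   moreover have "(%x. \<Sum>j<J. G j x) = (%x. \<Sum>p\<in>{..<J} \<times> K. c p * (case p of (j, k) => dilate_shift M ?\<eta> j k) x)"
    unfolding G_def by (simp add: sum.cartesian_product split_beta)
   moreover have "(\<Sum>j<J. (s j)^2) = (\<Sum>p\<in>{..<J} \<times> K. (cmod (c p))^2)"
    unfolding s_def by (simp add: sum_nonneg sum.cartesian_product split_beta)
   ultimately show "(L2_norm (%x. \<Sum>p\<in>{..<J} \<times> K. c p * (case p of (j, k) => dilate_shift M ?\<eta> j k) x))^2
     \<le> B * (\<Sum>p\<in>{..<J} \<times> K. (cmod (c p))^2)" by (simp add: B_def)
  qed
  then show ?thesis by (simp add: sum.cartesian_product split_beta)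
 qed
 then show ?thesis using B by blast
qed

text \<open>This is |det M| \<Sum> b(n) \<phi>(Mx - n), the function whose transform is that of
  \<phi> times that of \<open>b\<close>, both taken at M^{-T}\<xi>.\<close>

definition wavelet :: "(int ^ 'n => complex) => real ^ 'n => complex" where
 "wavelet b = dil (%x. \<Sum>n | b n \<noteq> 0. of_real (sqrt \<bar>det M\<bar>) * b n * shift \<phi> n x)"

lemma wavelet_L2: "wavelet b \<in> L2"
 unfolding wavelet_def by (intro dil_L2 L2_sum L2_scale shift_L2 \<phi>)

lemma dilate_shift_wavelet:
 "dilate_shift M (wavelet b) j k
  = (%x. \<Sum>n | b n \<noteq> 0. of_real (sqrt \<bar>det M\<bar>) * b n * dilate_shift M \<phi> (Suc j) (zmul M k + n) x)"
proof -
 have "dilate_shift M (wavelet b) j k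
   = (dil ^^ Suc j) (%x. \<Sum>n | b n \<noteq> 0. of_real (sqrt \<bar>det M\<bar>) * b n * shift \<phi> (zmul M k + n) x)"
  unfolding dilate_shift_dil0 wavelet_def shift_dil shift_sum shift_shift by (simp add: funpow_swap1 add.commute)
 then show ?thesis unfolding dil_pow_sum dilate_shift_dil0 .
qed

text \<open>Because the coefficients sum to 0, the unshifted term \<phi>(Mx) may be subtracted from
  every summand. This leaves differences of \<phi> by the lattice vectors n, one level higher and at
  shifts from M Z^d only.\<close>

lemma bessel_wavelet:
 assumes b: "b \<in> l0" and b0: "(\<Sum>n | b n \<noteq> 0. b n) = 0"
 shows "\<exists>B\<ge>0. \<forall>f\<in>L2. \<forall>J K. finite K \<longrightarrow>
  (\<Sum>j<J. \<Sum>k\<in>K. (cmod (L2_inner f (dilate_shift M (wavelet b) j k)))^2) \<le> B * (L2_norm f)^2"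
proof -
 let ?S = "{n. b n \<noteq> 0}"
 have S: "finite ?S" using b by (simp add: l0_def)
 have "\<forall>n. \<exists>B\<ge>0. \<forall>f\<in>L2. \<forall>J K. finite K \<longrightarrow>
  (\<Sum>j<J. \<Sum>k\<in>K. (cmod (L2_inner f (dilate_shift M (tdiff \<phi> (of_lattice n)) j k)))^2) \<le> B * (L2_norm f)^2"
  by (intro allI bessel_tdiff)
 then obtain B where B: "!!n. 0 \<le> B n" "!!n f J K. f \<in> L2 ==> finite K ==>
  (\<Sum>j<J. \<Sum>k\<in>K. (cmod (L2_inner f (dilate_shift M (tdiff \<phi> (of_lattice n)) j k)))^2) \<le> B n * (L2_norm f)^2"
  unfolding choice_iff by blast
 let ?e = "%n j k. dilate_shift M (tdiff \<phi> (of_lattice n)) (Suc j) (zmul M k)"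
 have eL: "?e n j k \<in> L2" for n j k by (intro dilate_shift_L2 tdiff_L2 \<phi>)
 define \<beta> where "\<beta> n = complex_of_real (sqrt \<bar>det M\<bar>) * b n" for n
 have \<psi>: "dilate_shift M (wavelet b) j k = (%x. \<Sum>n\<in>?S. \<beta> n * ?e n j k x)" for j k
 proof
  fix x
  have "tdiff (shift \<phi> 0) (of_lattice n) = (%x. shift \<phi> n x - shift \<phi> 0 x)" for n by (simp add: tdiff_def shift_def)
  then have e: "?e n j k x = dilate_shift M \<phi> (Suc j) (zmul M k + n) x - dilate_shift M \<phi> (Suc j) (zmul M k) x" for n
   by (simp add: dilate_shift_eq tdiff_def of_lattice_add algebra_simps)
  have "(\<Sum>n\<in>?S. \<beta> n) = 0" using b0 by (simp add: \<beta>_def sum_distrib_left [symmetric])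
  then show "dilate_shift M (wavelet b) j k x = (\<Sum>n\<in>?S. \<beta> n * ?e n j k x)"
   unfolding dilate_shift_wavelet e by (simp add: \<beta>_def [symmetric] right_diff_distrib sum_subtractf sum_distrib_right [symmetric])
 qed
 define T where "T = real (card ?S) * (\<Sum>n\<in>?S. (cmod (\<beta> n))^2 * B n)"
 have "0 \<le> T" unfolding T_def by (intro mult_nonneg_nonneg sum_nonneg B) auto
 moreover have "(\<Sum>j<J. \<Sum>k\<in>K. (cmod (L2_inner f (dilate_shift M (wavelet b) j k)))^2) \<le> T * (L2_norm f)^2"
  if f: "f \<in> L2" and K: "finite K" for f J K
 proof -
  have one: "(\<Sum>j<J. \<Sum>k\<in>K. (cmod (L2_inner f (?e n j k)))^2) \<le> B n * (L2_norm f)^2" for n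
  proof -
   let ?g = "%j. \<Sum>k\<in>zmul M ` K. (cmod (L2_inner f (dilate_shift M (tdiff \<phi> (of_lattice n)) j k)))^2"
   have "(\<Sum>j<J. \<Sum>k\<in>K. (cmod (L2_inner f (?e n j k)))^2) = (\<Sum>j<J. ?g (Suc j))"
    by (simp add: sum.reindex inj_on_subset [OF inj_zmul])
   also have "... = (\<Sum>j\<in>Suc ` {..<J}. ?g j)" by (simp add: sum.reindex)
   also have "... \<le> (\<Sum>j<Suc J. ?g j)" by (intro sum_mono2) (auto intro: sum_nonneg)
   also have "... \<le> B n * (L2_norm f)^2" by (intro B f finite_imageI K)
   finally show ?thesis .
  qed
  have "(\<Sum>j<J. \<Sum>k\<in>K. (cmod (L2_inner f (dilate_shift M (wavelet b) j k)))^2)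
    \<le> (\<Sum>j<J. \<Sum>k\<in>K. real (card ?S) * (\<Sum>n\<in>?S. (cmod (\<beta> n))^2 * (cmod (L2_inner f (?e n j k)))^2))"
  proof (intro sum_mono)
   fix j k
   have "L2_inner f (dilate_shift M (wavelet b) j k) = (\<Sum>n\<in>?S. cnj (\<beta> n) * L2_inner f (?e n j k))"
    unfolding \<psi> by (rule L2_inner_sum_right [OF eL f])
   then have "(cmod (L2_inner f (dilate_shift M (wavelet b) j k)))^2 \<le> real (card ?S) * (\<Sum>n\<in>?S. (cmod (cnj (\<beta> n) * L2_inner f (?e n j k)))^2)"
    by (simp only: norm_sum_squared_le)
   then show "(cmod (L2_inner f (dilate_shift M (wavelet b) j k)))^2 \<le> real (card ?S) * (\<Sum>n\<in>?S. (cmod (\<beta> n))^2 * (cmod (L2_inner f (?e n j k)))^2)"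
    by (simp only: norm_mult complex_mod_cnj power_mult_distrib)
  qed
  also have "... = real (card ?S) * (\<Sum>j<J. \<Sum>k\<in>K. \<Sum>n\<in>?S. (cmod (\<beta> n))^2 * (cmod (L2_inner f (?e n j k)))^2)"
   by (simp only: sum_distrib_left [of "real (card ?S)"])
  also have "(\<Sum>j<J. \<Sum>k\<in>K. \<Sum>n\<in>?S. (cmod (\<beta> n))^2 * (cmod (L2_inner f (?e n j k)))^2)
    = (\<Sum>n\<in>?S. \<Sum>j<J. \<Sum>k\<in>K. (cmod (\<beta> n))^2 * (cmod (L2_inner f (?e n j k)))^2)"
   unfolding sum.swap [where A = K] by (rule sum.swap)
  also have "... = (\<Sum>n\<in>?S. (cmod (\<beta> n))^2 * (\<Sum>j<J. \<Sum>k\<in>K. (cmod (L2_inner f (?e n j k)))^2))"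
   by (simp only: sum_distrib_left)
  also have "real (card ?S) * ... \<le> real (card ?S) * (\<Sum>n\<in>?S. (cmod (\<beta> n))^2 * (B n * (L2_norm f)^2))"
   by (intro mult_left_mono sum_mono one) auto
  also have "... = T * (L2_norm f)^2" unfolding T_def by (simp add: sum_distrib_right mult.assoc)
  finally show ?thesis .
 qed
 ultimately show ?thesis by blast
qed

end

section \<open>Tiling, Poisson summation and the partition of unity behind the approximation\<close>

subsection \<open>Tiling by the unit cube\<close>

lemma AE_non_integer: "AE x :: real ^ 'n::finite in leb. \<forall>i. \<forall>z::int. x $ i \<noteq> of_int z"
proof -
 have "AE x :: real ^ 'n in leb. x $ i \<noteq> of_int z" for i and z :: int
 proof -
  have "negligible {x :: real ^ 'n. x $ i = of_int z}" by (simp add: cart_eq_inner_axis negligible_standard_hyperplane)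
  then have "{x :: real ^ 'n. x $ i = of_int z} \<in> null_sets leb" by (simp add: negligible_iff_null_sets)
  then show ?thesis by (auto dest: AE_not_in)
 qed
 then have "\<forall>p\<in>(UNIV :: ('n \<times> int) set). AE x :: real ^ 'n in leb. x $ fst p \<noteq> of_int (snd p)" by blast
 then have "AE x :: real ^ 'n in leb. \<forall>p\<in>(UNIV :: ('n \<times> int) set). x $ fst p \<noteq> of_int (snd p)"
  by (subst AE_ball_countable) (auto simp: UNIV_Times_UNIV [symmetric] simp del: UNIV_Times_UNIV intro!: countable_SIGMA countable_finite)
 then show ?thesis by (rule AE_mp) (auto intro!: AE_I2)
qed

abbreviation unit_box :: "(real ^ 'n::finite) set" where "unit_box \<equiv> box 0 1"

lemma unique_tile:
 fixes x :: "real ^ 'n::finite"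
 assumes x: "\<forall>i. \<forall>z::int. x $ i \<noteq> of_int z" shows "\<exists>!l. x + of_lattice l \<in> unit_box"
proof (rule ex1I)
 have "of_int \<lfloor>x $ i\<rfloor> < x $ i \<and> x $ i < of_int \<lfloor>x $ i\<rfloor> + 1" for i
 proof -
  have "x $ i \<noteq> of_int \<lfloor>x $ i\<rfloor>" using x by blast
  then show ?thesis using floor_correct [of "x $ i"] by linarith
 qed
 then show "x + of_lattice (\<chi> i. - \<lfloor>x $ i\<rfloor>) \<in> unit_box" by (simp add: mem_box_cart less_diff_eq diff_less_eq add.commute)
next
 fix l assume "x + of_lattice l \<in> unit_box"
 then have "0 < x $ i + of_int (l $ i)" "x $ i + of_int (l $ i) < 1" for i by (auto simp: mem_box_cart)
 then have "\<lfloor>x $ i\<rfloor> = - (l $ i)" for i by (smt (verit) floor_unique of_int_minus)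
 then show "l = (\<chi> i. - \<lfloor>x $ i\<rfloor>)" by (simp add: vec_eq_iff)
qed

lemma norm_unit_cube:
 fixes x :: "real ^ 'n::finite"
 assumes "!!i. 0 \<le> x $ i \<and> x $ i \<le> 1" shows "norm x \<le> real CARD('n)"
proof -
 have "norm x \<le> (\<Sum>i\<in>UNIV. \<bar>x $ i\<bar>)" by (rule norm_le_l1_cart)
 also have "... \<le> (\<Sum>i\<in>(UNIV :: 'n set). 1)" using assms by (intro sum_mono) auto
 finally show ?thesis by simp
qed

lemma norm_unit_box: "x \<in> unit_box ==> norm x \<le> real CARD('n)" for x :: "real ^ 'n::finite"
 by (rule norm_unit_cube) (auto simp: mem_box_cart less_imp_le)

text \<open>Contains every integer vector that can carry a point of the ball of radius
  \<open>R\<close> into the unit box.\<close>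

definition tile :: "real => (int ^ 'n::finite) set" where
 "tile R = {l. norm (of_lattice l) \<le> R + real CARD('n)}"

lemma finite_tile: "finite (tile R)"
 unfolding tile_def by (rule finite_lattice_ball)

lemma tile_sum:
 fixes y :: "real ^ 'n::finite"
 assumes y: "\<forall>i. \<forall>z::int. y $ i \<noteq> of_int z" and R: "norm y \<le> R"
 shows "(\<Sum>l\<in>tile R. indicator unit_box (y + of_lattice l)) = (1::complex)"
  and "(\<Sum>l\<in>tile R. indicator unit_box (y - of_lattice l)) = (1::complex)"
proof -
 obtain l0 where l0': "!!l. y + of_lattice l \<in> unit_box \<longleftrightarrow> l = l0"
  using unique_tile [OF y] by blast
 have l0: "y + of_lattice l0 \<in> unit_box" by (simp add: l0')
 have "norm (of_lattice l0) \<le> norm (y + of_lattice l0) + norm y"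
  using norm_triangle_ineq4 [of "y + of_lattice l0" y] by simp
 then have t: "l0 \<in> tile R" using norm_unit_box [OF l0] R by (simp add: tile_def)
 have "(\<Sum>l\<in>tile R. indicator unit_box (y + of_lattice l)) = (\<Sum>l\<in>tile R. if l = l0 then 1 else (0::complex))"
  by (intro sum.cong) (simp_all add: indicator_def l0')
 then show 1: "(\<Sum>l\<in>tile R. indicator unit_box (y + of_lattice l)) = (1::complex)" using t by (simp add: finite_tile)
 have "(\<Sum>l\<in>tile R. indicator unit_box (y - of_lattice l)) = (\<Sum>l\<in>tile R. indicator unit_box (y + of_lattice l) :: complex)"
  by (rule sum.reindex_bij_witness [where i = uminus and j = uminus]) (auto simp: tile_def of_lattice_uminus)
 then show "(\<Sum>l\<in>tile R. indicator unit_box (y - of_lattice l)) = (1::complex)" using 1 by simp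
qed

lemma box_meas: "(%x :: real ^ 'n::finite. indicator unit_box (x + v) :: complex) \<in> Lmeas"
proof -
 have "(%x :: real ^ 'n. indicator unit_box x :: complex) \<in> Lmeas"
  by (intro measurable_completion borel_measurable_indicator) auto
 then show ?thesis by (rule measurable_translate)
qed

lemma box_integrable: "Lint (%x :: real ^ 'n::finite. indicator unit_box (x + v) :: complex)"
proof -
 have b: "(%x :: real ^ 'n. indicator unit_box x :: complex) \<in> Lmeas" using box_meas [of 0] by simp
 have "Lint (indicator unit_box :: real ^ 'n => real)"
  by (intro integrable_real_indicator) (auto simp: emeasure_lborel_box_eq)
 then have "Lint (%x :: real ^ 'n. complex_of_real (indicator unit_box x) :: complex)" by (simp only: complex_of_real_integrable_eq)
 then have "Lint (%x :: real ^ 'n. indicator unit_box x :: complex)" by (simp add: indicator_def of_bool_def if_distrib cong: if_cong)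
 then show ?thesis using integrable_translate [OF b, of v] by simp
qed

lemma box_integral: "(\<integral>x. indicator unit_box x \<partial>(leb :: (real ^ 'n::finite) measure)) = (1::complex)"
proof -
 have "(\<integral>x. indicator unit_box x \<partial>(leb :: (real ^ 'n) measure)) = (\<integral>x. complex_of_real (indicator unit_box x) \<partial>(leb :: (real ^ 'n) measure))"
  by (rule Bochner_Integration.integral_cong) (auto simp: indicator_def)
 also have "... = complex_of_real (measure leb (unit_box :: (real ^ 'n) set))"
  unfolding integral_complex_of_real by simp
 also have "measure leb (unit_box :: (real ^ 'n) set) = 1"
 proof -
  have "(1 :: real ^ 'n) \<bullet> b = 1" if "b \<in> Basis" for b
   using that by (auto simp: Basis_vec_def inner_axis)
  then show ?thesis by (simp add: measure_lborel_box_eq)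
 qed
 finally show ?thesis by simp
qed

text \<open>A periodic factor lets the integral over the space be folded into the unit box, where
  \<open>h\<close> appears periodized.\<close>

lemma integral_tile:
 fixes h E :: "real ^ 'n::finite => complex"
 assumes h: "Lint h" "bsupp R h" and E: "E \<in> Lmeas" "!!x. cmod (E x) \<le> B"
  and per: "!!x l. E (x + of_lattice l) = E x"
 shows "(LI x. h x * E x) = (LI x. (\<Sum>l\<in>tile R. h (x - of_lattice l)) * (indicator unit_box x * E x))"
proof -
 have i: "Lint (%y. h y * (indicator unit_box (y + of_lattice l) * E y))" for l
  using E(2) order_trans [OF norm_ge_zero E(2)]
  by (intro integrable_mult_bounded [where B = B] h borel_measurable_times box_meas E) (auto simp: norm_mult indicator_def)
 have tr: "(LI x. h (x - of_lattice l) * (indicator unit_box x * E x)) = (LI y. h y * (indicator unit_box (y + of_lattice l) * E y))"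
  and ti: "Lint (%x. h (x - of_lattice l) * (indicator unit_box x * E x))" for l
 proof -
  have m: "(%y. h y * (indicator unit_box (y + of_lattice l) * E y)) \<in> Lmeas" using i by auto
  have e: "E (x - of_lattice l) = E x" for x using per [of "x - of_lattice l" l] by simp
  show "(LI x. h (x - of_lattice l) * (indicator unit_box x * E x)) = (LI y. h y * (indicator unit_box (y + of_lattice l) * E y))"
   using integral_translate [OF m, of "- of_lattice l"] by (simp add: e)
  show "Lint (%x. h (x - of_lattice l) * (indicator unit_box x * E x))"
   using integrable_translate [OF m, of "- of_lattice l"] i [of l] by (simp add: e)
 qed
 have "(LI x. (\<Sum>l\<in>tile R. h (x - of_lattice l)) * (indicator unit_box x * E x))
   = (\<Sum>l\<in>tile R. LI x. h (x - of_lattice l) * (indicator unit_box x * E x))"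
  unfolding sum_distrib_right by (rule Bochner_Integration.integral_sum [OF ti])
 also have "... = (LI y. (\<Sum>l\<in>tile R. h y * (indicator unit_box (y + of_lattice l) * E y)))"
  unfolding tr by (rule Bochner_Integration.integral_sum [OF i, symmetric])
 also have "... = (LI x. h x * E x)"
 proof (rule integral_cong_AE)
  show "(%y. \<Sum>l\<in>tile R. h y * (indicator unit_box (y + of_lattice l) * E y)) \<in> Lmeas"
   using i by (intro borel_measurable_sum) auto
  show "(%x. h x * E x) \<in> Lmeas" using h E by auto
  show "AE y in leb. (\<Sum>l\<in>tile R. h y * (indicator unit_box (y + of_lattice l) * E y)) = h y * E y"
   using AE_non_integer
  proof eventually_elim
   case (elim y)
   show ?case
   proof (cases "h y = 0")
    case False
    have "(\<Sum>l\<in>tile R. h y * (indicator unit_box (y + of_lattice l) * E y)) = h y * (\<Sum>l\<in>tile R. indicator unit_box (y + of_lattice l)) * E y"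
     by (simp add: sum_distrib_left sum_distrib_right mult.assoc)
    then show ?thesis unfolding tile_sum(1) [OF elim bsuppD [OF h(2) False]] by simp
   qed simp
  qed
 qed
 finally show ?thesis ..
qed

lemma ek_meas: "(%x. ek k (tp x)) \<in> Lmeas"
 unfolding ek_def by (intro measurable_completion borel_measurable_continuous_onI) (auto intro!: continuous_intros)

lemma ek_per: "ek k (tp (x + of_lattice l)) = ek k (tp x)"
 by (simp add: scaleR_add_right ek_plus ek_lattice)

lemma fourier_lattice: "fourier f (tp (of_lattice k)) = (LI x. f x * ek k (tp x))"
 by (simp add: fourier_def ek_def inner_commute)

text \<open>A translation by half a period changes the sign of the character but not the periodization of the cube.\<close>
lemma box_character:
 fixes k :: "int ^ 'n::finite"
 assumes "k \<noteq> 0" shows "(LI x. indicator unit_box x * ek k (tp x)) = 0"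
proof -
 let ?E = "%x. ek k (tp x)"
 obtain j where j: "k $ j \<noteq> 0" using assms by (auto simp: vec_eq_iff)
 define v :: "real ^ 'n" where "v = axis j (1 / (2 * of_int (k $ j)))"
 have "ek k (tp v) = exp (- (\<i> * of_real pi))"
  using j by (simp add: ek_def v_def inner_axis)
 then have v: "?E (x + v) = - ?E x" for x by (simp add: scaleR_add_right ek_plus exp_minus)
 define h where "h = (%x. indicator unit_box (x + v) :: complex)"
 define r where "r = real CARD('n) + norm v"
 have h: "bsupp r h" unfolding bsupp_def
 proof (intro allI impI)
  fix x :: "real ^ 'n" assume "norm x > r"
  then have "norm (x + v) > real CARD('n)" using norm_triangle_ineq4 [of "x + v" v] by (simp add: r_def)
  then show "h x = 0" using norm_unit_box [of "x + v"] by (auto simp: h_def indicator_def)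
 qed
 let ?I = "LI x. indicator unit_box x * ?E x"
 have mE: "?E \<in> Lmeas" by (rule ek_meas)
 have m: "(%x. indicator unit_box x * ?E x) \<in> Lmeas"
  using box_meas [of 0] by (intro borel_measurable_times ek_meas) simp
 have "?I = (LI x. indicator unit_box (x + v) * ?E (x + v))"
  by (rule integral_translate [OF m, symmetric])
 also have "... = - (LI x. h x * ?E x)" unfolding v h_def by simp
 also have "(LI x. h x * ?E x) = (LI x. (\<Sum>l\<in>tile r. h (x - of_lattice l)) * (indicator unit_box x * ?E x))"
  by (rule integral_tile [where B = 1, OF _ h mE _ ek_per]) (auto simp: h_def box_integrable)
 also have "... = ?I"
 proof (rule integral_cong_AE [OF _ m])
  have "(%x. h (x - of_lattice l)) \<in> Lmeas" for l
   using box_meas [of "v - of_lattice l"] by (simp add: h_def algebra_simps)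
  then show "(%x. (\<Sum>l\<in>tile r. h (x - of_lattice l)) * (indicator unit_box x * ?E x)) \<in> Lmeas"
   by (intro borel_measurable_times [OF _ m] borel_measurable_sum)
  show "AE x in leb. (\<Sum>l\<in>tile r. h (x - of_lattice l)) * (indicator unit_box x * ?E x) = indicator unit_box x * ?E x"
   using AE_translate [OF AE_non_integer, of v]
  proof eventually_elim
   case (elim x)
   show ?case
   proof (cases "x \<in> unit_box")
    case True
    have "norm (x + v) \<le> r" unfolding r_def using norm_unit_box [OF True] norm_triangle_ineq [of x v] by linarith
    from tile_sum(2) [OF elim this] show ?thesis by (simp add: h_def algebra_simps)
   qed simp
  qed
 qed
 finally show ?thesis by simp
qed

text \<open>The periodization of \<open>f\<close> has the values of the transform at 2\<pi>k as
  Fourier coefficients. After subtracting the constant \<open>fourier f 0\<close> all coefficients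
  on the unit box are 0, and uniqueness applies.\<close>

lemma poisson:
 fixes f :: "real ^ 'n::finite => complex"
 assumes f: "Lint f" "bsupp R f" and z: "!!k. k \<noteq> 0 ==> fourier f (tp (of_lattice k)) = 0"
 shows "AE x in leb. x \<in> unit_box \<longrightarrow> (\<Sum>l\<in>tile R. f (x - of_lattice l)) = fourier f 0"
proof -
 define s where "s x = (\<Sum>l\<in>tile R. f (x - of_lattice l))" for x
 have fl: "Lint (%x. f (x - of_lattice l))" for l
  using integrable_translate [of f "- of_lattice l"] f by simp
 have s: "Lint s" unfolding s_def by (intro Bochner_Integration.integrable_sum fl)
 have b0: "(%x :: real ^ 'n. indicator unit_box x :: complex) \<in> Lmeas"
  "Lint (%x :: real ^ 'n. indicator unit_box x :: complex)"
  using box_meas [of 0] box_integrable [of 0] by simp_all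
 define g where "g x = s x * indicator unit_box x - fourier f 0 * indicator unit_box x" for x
 have sb: "Lint (%x. s x * indicator unit_box x)"
  by (rule integrable_mult_bounded [where B = 1, OF s b0(1)]) (simp add: indicator_def)
 have g: "Lint g" unfolding g_def using sb b0(2) by (intro Bochner_Integration.integrable_diff) auto
 have "AE x in leb. g x = 0"
 proof (rule fourier_null.AE_zero [where L = 1 and c = 0])
  show "fourier_null g 1 0"
  proof
   show "Lint g" by (rule g)
   fix x i assume "g x \<noteq> 0"
   then have "x \<in> unit_box" by (auto simp: g_def indicator_def split: if_splits)
   then show "0 < x $ i \<and> x $ i < 0 + 1" by (simp add: mem_box_cart)
  next
   fix k :: "int ^ 'n"
   let ?E = "%x. ek k (tp x)"
   have i1: "Lint (%x. s x * indicator unit_box x * ?E x)" "Lint (%x. fourier f 0 * (indicator unit_box x * ?E x))"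
    using b0 by (auto intro!: integrable_mult_bounded [where B = 1] integrable_mult_right sb ek_meas)
   have "(LI x. g x * exp (- (\<i> * complex_of_real (2 * pi / 1 * (of_lattice k \<bullet> x))))) = (LI x. s x * indicator unit_box x * ?E x - fourier f 0 * (indicator unit_box x * ?E x))"
    by (simp add: g_def ek_def left_diff_distrib mult.assoc)
   also have "... = (LI x. s x * indicator unit_box x * ?E x) - (LI x. fourier f 0 * (indicator unit_box x * ?E x))"
    by (rule Bochner_Integration.integral_diff [OF i1])
   also have "(LI x. s x * indicator unit_box x * ?E x) = (LI x. f x * ?E x)"
    unfolding s_def mult.assoc by (rule integral_tile [where B = 1, OF f ek_meas _ ek_per, symmetric]) simp
   also have "... = fourier f (tp (of_lattice k))" by (rule fourier_lattice [symmetric])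
   also have "(LI x. fourier f 0 * (indicator unit_box x * ?E x)) = fourier f 0 * (LI x. indicator unit_box x * ?E x)"
    by (rule integral_mult_right_zero)
   also have "... = fourier f (tp (of_lattice k))"
    by (cases "k = 0") (simp_all add: box_integral box_character z)
   finally show "(LI x. g x * exp (- (\<i> * complex_of_real (2 * pi / 1 * (of_lattice k \<bullet> x))))) = 0" by simp
  qed simp
 qed
 then show ?thesis by eventually_elim (auto simp: g_def s_def)
qed

text \<open>The set \<open>K\<close> is quantified inside the almost-everywhere statement since its
  later choice, all k with a nonzero term, depends on the point. Countably many translates of the
  unit box reach almost every point.\<close>

lemma poisson_everywhere:
 fixes f :: "real ^ 'n::finite => complex"
 assumes f: "Lint f" "bsupp R f" and z: "!!k. k \<noteq> 0 ==> fourier f (tp (of_lattice k)) = 0"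
 shows "AE x in leb. \<forall>K. finite K \<longrightarrow> {k. f (x - of_lattice k) \<noteq> 0} \<subseteq> K \<longrightarrow> (\<Sum>k\<in>K. f (x - of_lattice k)) = fourier f 0"
proof -
 have ci: "countable (UNIV :: (int ^ 'n) set)"
 proof -
  have "(UNIV :: (int ^ 'n) set) = (\<Union>n::nat. {l. norm (of_lattice l) \<le> real n})"
   using real_arch_simple by auto
  also have "countable ..." by (intro countable_UN countableI_type countable_finite finite_lattice_ball)
  finally show ?thesis .
 qed
 let ?P = "%x. x \<in> unit_box \<longrightarrow> (\<Sum>l\<in>tile R. f (x - of_lattice l)) = fourier f 0"
 have "AE x in leb. \<forall>l\<in>UNIV. ?P (x + of_lattice l)"
  by (subst AE_ball_countable [OF ci]) (intro ballI AE_translate [of ?P] poisson [OF f z])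
 then show ?thesis using AE_non_integer
 proof eventually_elim
  case (elim x)
  show ?case
  proof (intro allI impI)
   fix K assume K: "finite K" "{k. f (x - of_lattice k) \<noteq> 0} \<subseteq> K"
   obtain l where l: "x + of_lattice l \<in> unit_box" using unique_tile [OF elim(2)] by blast
   have "(\<Sum>k\<in>K. f (x - of_lattice k)) = (\<Sum>k\<in>(%t. t - l) ` tile R. f (x - of_lattice k))"
   proof (rule sum.mono_neutral_cong)
    show "finite ((%t. t - l) ` tile R)" by (intro finite_imageI finite_tile)
    fix k assume "k \<in> K - (%t. t - l) ` tile R"
    show "f (x - of_lattice k) = 0"
    proof (rule ccontr)
     assume "f (x - of_lattice k) \<noteq> 0"
     then have 1: "norm (x - of_lattice k) \<le> R" by (rule bsuppD [OF f(2)])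
     have "of_lattice (k + l) = (x + of_lattice l) - (x - of_lattice k)" by (simp add: of_lattice_add)
     then have "norm (of_lattice (k + l)) \<le> norm (x + of_lattice l) + norm (x - of_lattice k)" by (metis norm_triangle_ineq4)
     then have "k + l \<in> tile R" using 1 norm_unit_box [OF l] by (simp add: tile_def)
     then have "k \<in> (%t. t - l) ` tile R" by (intro image_eqI [of _ _ "k + l"]) auto
     then show False using \<open>k \<in> K - _\<close> by blast
    qed
   qed (use K in auto)
   also have "... = (\<Sum>t\<in>tile R. f ((x + of_lattice l) - of_lattice t))"
    by (subst sum.reindex) (auto simp: inj_on_def of_lattice_diff algebra_simps)
   also have "... = fourier f 0" using elim(1) l by blast
   finally show "(\<Sum>k\<in>K. f (x - of_lattice k)) = fourier f 0" .
  qed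
 qed
qed

lemma matrix_vector_norm_bound:
 fixes A :: "real ^ 'n::finite ^ 'm::finite"
 obtains C where "0 \<le> C" "!!x. norm (A *v x) \<le> C * norm x"
proof -
 have "bounded_linear ((*v) A)" by (rule matrix_vector_mul_bounded_linear)
 then obtain C where "0 < C" "!!x. norm (A *v x) \<le> norm x * C" using bounded_linear.pos_bounded by blast
 then show ?thesis using that [of C] by (simp add: mult.commute)
qed

context integer_matrix begin

lemma Omega_norm: "\<omega> \<in> Omega M ==> norm \<omega> \<le> real CARD('n)"
 by (rule norm_unit_cube) (auto simp: Omega_def less_imp_le)

text \<open>The translates of the preimage of the unit box under the transpose, by the elements of \<open>\<Omega>\<close> and by integers, tile the space.\<close>
theorem card_Omega: "real (card (Omega M)) = \<bar>det M\<bar>"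
proof -
 let ?Q = "unit_box :: (real ^ 'n) set"
 define g :: "real ^ 'n => complex" where "g x = indicator unit_box (MT *v x)" for x
 define h where "h x = (\<Sum>\<omega>\<in>Omega M. g (x - \<omega>))" for x
 obtain C where C: "0 \<le> C" "!!x. norm (MTi *v x) \<le> C * norm x" using matrix_vector_norm_bound [of MTi] by blast
 define R where "R = C * real CARD('n) + real CARD('n)"
 have gR: "norm x \<le> C * real CARD('n)" if "g x \<noteq> 0" for x
 proof -
  have "MT *v x \<in> ?Q" using that by (auto simp: g_def indicator_def split: if_splits)
  then have "C * norm (MT *v x) \<le> C * real CARD('n)" by (intro mult_left_mono norm_unit_box C)
  then show ?thesis using C(2) [of "MT *v x"] by simp
 qed
 have hR: "norm x \<le> R" if o: "\<omega> \<in> Omega M" and nz: "g (x - \<omega>) \<noteq> 0" for x \<omega>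
 proof -
  have "norm x \<le> norm (x - \<omega>) + norm \<omega>" using norm_triangle_ineq [of "x - \<omega>" \<omega>] by simp
  then show ?thesis using gR [OF nz] Omega_norm [OF o] unfolding R_def by linarith
 qed
 have hb: "bsupp R h" unfolding bsupp_def h_def
  by (intro allI impI sum.neutral ballI) (meson hR not_le)
 have b0: "(%x :: real ^ 'n. indicator unit_box x :: complex) \<in> Lmeas"
  "Lint (%x :: real ^ 'n. indicator unit_box x :: complex)"
  using box_meas [of 0] box_integrable [of 0] by simp_all
 have gi: "Lint g" unfolding g_def using integrable_matrix [OF invMT b0(1)] b0(2) by simp
 have gI: "complex_of_real \<bar>det M\<bar> * (LI x. g x) = 1"
  using integral_matrix [OF invMT b0(1)] by (simp add: g_def box_integral scaleR_conv_of_real)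
 have gt: "Lint (%x. g (x - \<omega>))" "(LI x. g (x - \<omega>)) = (LI x. g x)" for \<omega>
  using integrable_translate [of g "- \<omega>"] integral_translate [of g "- \<omega>"] gi by simp_all
 have hi: "Lint h" unfolding h_def by (intro Bochner_Integration.integrable_sum gt)
 have "of_nat (card (Omega M)) * (LI x. g x) = (\<Sum>\<omega>\<in>Omega M. LI x. g (x - \<omega>))"
  unfolding gt by simp
 also have "... = (LI x. h x * 1)"
  unfolding h_def mult_1_right by (rule Bochner_Integration.integral_sum [OF gt(1), symmetric])
 also have "... = (LI x. (\<Sum>l\<in>tile R. h (x - of_lattice l)) * (indicator unit_box x * 1))"
  by (rule integral_tile [where B = 1, OF hi hb]) auto
 also have "... = (\<integral>x. indicator unit_box x \<partial>(leb :: (real ^ 'n) measure))"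
 proof (rule integral_cong_AE [OF _ b0(1)])
  have "(%x. h (x - of_lattice l)) \<in> Lmeas" for l
   using measurable_translate [of h "- of_lattice l"] hi by simp
  then show "(%x. (\<Sum>l\<in>tile R. h (x - of_lattice l)) * (indicator unit_box x * 1)) \<in> Lmeas"
   using b0 by (intro borel_measurable_times borel_measurable_sum) auto
  show "AE x in leb. (\<Sum>l\<in>tile R. h (x - of_lattice l)) * (indicator unit_box x * 1) = indicator unit_box x"
   using AE_matrix [OF invMT AE_non_integer]
  proof eventually_elim
   case (elim x)
   show ?case
   proof (cases "x \<in> ?Q")
    case True
    obtain n0 where n0: "!!n. MT *v x + of_lattice n \<in> ?Q \<longleftrightarrow> n = n0"
     using unique_tile [OF elim] by blast
    \<comment> \<open>If \<open>n0\<close> moves M^T x into the unit box, the only pair (l,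
      \<omega>) that contributes is the decomposition of M^{-T}(-n0).\<close>
    obtain \<omega>0 l0 where o: "\<omega>0 \<in> Omega M" "MTi *v of_lattice (- n0) = \<omega>0 + of_lattice l0" by (rule Omega_frac)
    have key: "g (x - of_lattice l - \<omega>) = (if l = l0 \<and> \<omega> = \<omega>0 then 1 else 0)" if w: "\<omega> \<in> Omega M" for l \<omega>
    proof -
     obtain p where p: "MT *v \<omega> = of_lattice p" by (rule Omega_lattice [OF w])
     define q where "q = - (zmul MT l + p)"
     have e: "MT *v (x - of_lattice l - \<omega>) = MT *v x + of_lattice q"
      unfolding q_def of_lattice_uminus of_lattice_add of_lattice_zmul [OF intmat_transpose [OF intM]] p [symmetric]
      by (simp add: matrix_vector_mult_diff_distrib)
     have qe: "MTi *v of_lattice (- q) = of_lattice l + \<omega>"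
      unfolding q_def minus_minus of_lattice_add of_lattice_zmul [OF intmat_transpose [OF intM]] p [symmetric]
      by (simp add: matrix_vector_right_distrib)
     have "q = n0 \<longleftrightarrow> l = l0 \<and> \<omega> = \<omega>0"
     proof
      assume "q = n0"
      then have "\<omega> - \<omega>0 = of_lattice (l0 - l)" using qe o(2) by (simp add: of_lattice_diff algebra_simps)
      then have "\<omega> = \<omega>0" by (rule Omega_diff_lattice [OF w o(1)])
      then show "l = l0 \<and> \<omega> = \<omega>0" using \<open>\<omega> - \<omega>0 = of_lattice (l0 - l)\<close> by (simp add: of_lattice_diff)
     next
      assume "l = l0 \<and> \<omega> = \<omega>0"
      then have "MTi *v of_lattice (- q) = MTi *v of_lattice (- n0)" using qe o(2) by simp
      then have "of_lattice (- q) = of_lattice (- n0)" by (metis MT_MTi)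
      then show "q = n0" by simp
     qed
     then show ?thesis unfolding g_def e by (simp add: indicator_def n0)
    qed
    have "norm (x - of_lattice l0) \<le> R" using key [OF o(1), of l0] by (intro hR [OF o(1)]) simp
    then have "l0 \<in> tile R" using norm_unit_box [OF True] norm_triangle_ineq4 [of x "x - of_lattice l0"] by (simp add: tile_def)
    have "(\<Sum>l\<in>tile R. h (x - of_lattice l)) = (\<Sum>l\<in>tile R. if l = l0 then 1 else 0)"
    proof (rule sum.cong [OF refl])
     fix l
     have "h (x - of_lattice l) = (\<Sum>\<omega>\<in>Omega M. if \<omega> = \<omega>0 then (if l = l0 then 1 else 0) else 0)"
      unfolding h_def using key by (intro sum.cong) auto
     then show "h (x - of_lattice l) = (if l = l0 then 1 else 0)" using o(1) by (simp add: finite_Omega)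
    qed
    then show ?thesis using \<open>l0 \<in> tile R\<close> by (simp add: finite_tile)
   qed simp
  qed
 qed
 also have "... = 1" by (rule box_integral)
 finally have "of_nat (card (Omega M)) * (LI x. g x) = 1" .
 with gI have "complex_of_real (real (card (Omega M))) = complex_of_real \<bar>det M\<bar>"
  by (metis mult_cancel_right mult_zero_right of_real_of_nat_eq zero_neq_one)
 then show ?thesis by (simp only: of_real_eq_iff)
qed

lemma Mi_adjoint: "(MTi *v x) \<bullet> z = x \<bullet> (Mi *v z)"
proof -
 have "(MTi *v x) \<bullet> (M *v (Mi *v z)) = (MT *v (MTi *v x)) \<bullet> (Mi *v z)"
  by (metis dot_lmul_matrix inner_commute transpose_matrix_vector)
 then show ?thesis by simp
qed

lemma mpow_adjoint: "(mpow MTi n x) \<bullet> z = x \<bullet> (mpow Mi n z)"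
proof (induction n arbitrary: z)
 case (Suc n)
 show ?case unfolding mpow_Suc [of MTi] mpow_Suc' [of Mi] Mi_adjoint by (rule Suc)
qed simp

end

context refinable begin

lemma contr_MTi: "(%n. mpow MTi n x) \<longlonglongrightarrow> 0"
proof (rule vec_tendstoI)
 fix i
 have "(%n. x \<bullet> mpow Mi n (axis i 1)) \<longlonglongrightarrow> x \<bullet> 0" by (intro tendsto_intros contr)
 then show "(%n. mpow MTi n x $ i) \<longlonglongrightarrow> 0 $ i"
  unfolding mpow_adjoint [symmetric] by (simp add: inner_axis)
qed

text \<open>If the transform is nonzero at 2\<pi>k, refinement forces M^{-T}k to be a lattice vector
  with the same property, because \<open>a\<close> vanishes at the other classes of \<Omega>.
  Iteration leads to a lattice vector of norm less than 1, so k = 0.\<close>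

lemma fourier_lattice_zero:
 assumes f: "!!\<xi>. fourier \<phi> (MT *v \<xi>) = filter_hat a \<xi> * fourier \<phi> \<xi>"
  and az: "!!\<omega>. \<omega> \<in> Omega M ==> \<omega> \<noteq> 0 ==> filter_hat a (tp \<omega>) = 0" and k: "k \<noteq> 0"
 shows "fourier \<phi> (tp (of_lattice k)) = 0"
proof (rule ccontr)
 let ?nz = "%k. fourier \<phi> (tp (of_lattice k)) \<noteq> 0"
 have step: "\<exists>k'. ?nz k' \<and> MTi *v of_lattice k = of_lattice k'" if nz: "?nz k" for k
 proof -
  obtain \<omega> l where o: "\<omega> \<in> Omega M" "MTi *v of_lattice k = \<omega> + of_lattice l" by (rule Omega_frac)
  let ?x = "tp (\<omega> + of_lattice l)"
  have "tp (of_lattice k) = MT *v ?x"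
   unfolding o(2) [symmetric] by (simp add: matrix_vector_mult_scaleR)
  then have p: "filter_hat a ?x * fourier \<phi> ?x \<noteq> 0" using nz f [of ?x] by simp
  have "filter_hat a ?x = filter_hat a (tp \<omega>)"
   using TP_periodic [of "filter_hat a" "tp \<omega>" l] a by (simp add: scaleR_add_right TP_def)
  then have "\<omega> = 0" using p az [OF o(1)] by auto
  then show ?thesis using p o(2) by (intro exI [of _ l]) auto
 qed
 assume nz: "?nz k"
 have "\<exists>k'. ?nz k' \<and> mpow MTi n (of_lattice k) = of_lattice k'" for n
  by (induction n) (use nz step in \<open>auto simp: mpow_Suc\<close>)
 then obtain K where K: "!!n. mpow MTi n (of_lattice k) = of_lattice (K n)" by metis
 have "\<forall>\<^sub>F n in sequentially. norm (mpow MTi n (of_lattice k)) < 1"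
  using tendsto_norm [OF contr_MTi [of "of_lattice k"]] by (intro order_tendstoD(2)) auto
 then obtain n where n: "norm (mpow MTi n (of_lattice k)) < 1" unfolding eventually_sequentially by blast
 have "K n $ i = 0" for i
 proof -
  have "\<bar>real_of_int (K n $ i)\<bar> < 1" using n component_le_norm_cart [of "of_lattice (K n)" i] unfolding K by simp
  then show ?thesis by linarith
 qed
 then have "K n = 0" by (simp add: vec_eq_iff)
 then have "mpow MTi n (of_lattice k) = 0" using K [of n] by simp
 moreover have "x = 0" if "mpow MTi n x = 0" for x n
  using that
 proof (induction n)
  case (Suc n)
  then have "MT *v (MTi *v mpow MTi n x) = 0" by (simp add: mpow_Suc)
  then show ?case using Suc.IH by simp
 qed simp
 ultimately have "of_lattice k = 0" by blast
 then show False using k by (metis of_lattice_0 of_lattice_eq_iff)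
qed

end

section \<open>From the filter identity to the telescoping of the coarse operators\<close>

subsection \<open>Bounded supports\<close>

definition bdsupp :: "(real ^ 'n::finite => complex) => bool" where
 "bdsupp f \<longleftrightarrow> (\<exists>r\<ge>0. bsupp r f)"

lemma bsupp_mono: "bsupp r f ==> r \<le> r' ==> bsupp r' f"
 by (simp add: bsupp_def)

lemma bdsuppI: "bsupp r f ==> bdsupp f"
 unfolding bdsupp_def by (intro exI [of _ "max 0 r"]) (auto intro: bsupp_mono)

lemma bdsupp_scale: "bdsupp f ==> bdsupp (%x. c * f x)"
 by (auto simp: bdsupp_def bsupp_def)

lemma bdsupp_add: assumes "bdsupp f" "bdsupp g" shows "bdsupp (%x. f x + g x)"
proof -
 obtain r r' where "bsupp r f" "bsupp r' g" using assms by (auto simp: bdsupp_def)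
 then have "bsupp (max r r') (%x. f x + g x)" by (auto simp: bsupp_def)
 then show ?thesis by (rule bdsuppI)
qed

lemma bdsupp_diff: "bdsupp f ==> bdsupp g ==> bdsupp (%x. f x - g x)"
 using bdsupp_add [of f "%x. -1 * g x"] bdsupp_scale [of g "-1"] by simp

lemma bdsupp_sum: "(!!i. i \<in> I ==> bdsupp (f i)) ==> bdsupp (%x. \<Sum>i\<in>I. f i x)"
proof (induction I rule: infinite_finite_induct)
 case (insert i I)
 then show ?case using bdsupp_add [of "f i" "%x. \<Sum>i\<in>I. f i x"] by simp
qed (auto simp: bdsupp_def bsupp_def)

lemma bdsupp_shift:
 fixes f :: "real ^ 'n::finite => complex"
 assumes "bdsupp f" shows "bdsupp (shift f k)"
proof -
 obtain r where r: "bsupp r f" using assms by (auto simp: bdsupp_def)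
 have "bsupp (r + norm (of_lattice k)) (shift f k)"
  unfolding bsupp_def
 proof (intro allI impI)
  fix x :: "real ^ 'n" assume x: "norm x > r + norm (of_lattice k)"
  have "norm x \<le> norm (x - of_lattice k) + norm (of_lattice k)" using norm_triangle_ineq [of "x - of_lattice k" "of_lattice k"] by simp
  then have "norm (x - of_lattice k) > r" using x by linarith
  then show "shift f k x = 0" using r by (simp add: shift_def bsupp_def)
 qed
 then show ?thesis by (rule bdsuppI)
qed

lemma bdsupp_integrable: "f \<in> L2 ==> bdsupp f ==> Lint f"
 unfolding bdsupp_def using L2_bsupp_integrable by blast

lemma fourier_unique2:
 assumes f: "f \<in> L2" "bdsupp f" and g: "g \<in> L2" "bdsupp g" and e: "!!\<xi>. fourier f \<xi> = fourier g \<xi>"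
 shows "AE x in leb. f x = g x"
proof -
 have "bdsupp (%x. f x - g x)" by (rule bdsupp_diff [OF f(2) g(2)])
 then obtain r where r: "0 \<le> r" "bsupp r (%x. f x - g x)" by (auto simp: bdsupp_def)
 have "fourier (%x. f x - g x) \<xi> = 0" for \<xi>
  using e by (simp add: fourier_diff bdsupp_integrable f g)
 then have "AE x in leb. f x - g x = 0" by (rule fourier_unique [OF L2_diff [OF f(1) g(1)] r(2,1)])
 then show ?thesis by simp
qed

lemma fourier_comb:
 assumes "Lint \<phi>"
 shows "fourier (%x. \<Sum>n | u n \<noteq> 0. u n * shift \<phi> n x) \<xi> = filter_hat u \<xi> * fourier \<phi> \<xi>"
proof -
 have i: "Lint (shift \<phi> n)" for n
  using integrable_translate [of \<phi> "- of_lattice n"] assms by (simp add: shift_def)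
 have s: "fourier (shift \<phi> n) \<xi> = exp (- (\<i> * complex_of_real (of_lattice n \<bullet> \<xi>))) * fourier \<phi> \<xi>" for n
  unfolding shift_def by (rule fourier_translate [OF assms])
 show ?thesis unfolding fourier_sum [OF i] s filter_hat_def sum_distrib_right by (simp add: mult.assoc)
qed

context integer_matrix begin

lemma bdsupp_dil: assumes "bdsupp f" shows "bdsupp (dil f)"
proof -
 obtain r where r: "bsupp r f" using assms by (auto simp: bdsupp_def)
 obtain C where C: "0 \<le> C" "!!x. norm (Mi *v x) \<le> C * norm x" using matrix_vector_norm_bound [of Mi] by blast
 have "bsupp (C * r) (dil f)"
  unfolding bsupp_def
 proof (intro allI impI, rule ccontr)
  fix x assume x: "norm x > C * r" "dil f x \<noteq> 0"
  then have "norm (M *v x) \<le> r" by (intro bsuppD [OF r]) (auto simp: dil_def)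
  then have "C * norm (M *v x) \<le> C * r" by (intro mult_left_mono C)
  then show False using C(2) [of "M *v x"] x(1) by simp
 qed
 then show ?thesis by (rule bdsuppI)
qed

lemma fourier_dil_comb:
 assumes "Lint \<phi>"
 shows "fourier (dil (%x. \<Sum>n | u n \<noteq> 0. of_real (sqrt D) * u n * shift \<phi> n x)) \<xi> = filter_hat u (MTi *v \<xi>) * fourier \<phi> (MTi *v \<xi>)"
proof -
 let ?g = "%x. \<Sum>n | u n \<noteq> 0. u n * shift \<phi> n x"
 have i: "Lint (shift \<phi> n)" for n
  using integrable_translate [of \<phi> "- of_lattice n"] assms by (simp add: shift_def)
 have g: "Lint ?g" by (intro Bochner_Integration.integrable_sum integrable_mult_right i)
 have "complex_of_real (sqrt D) * (\<Sum>n | u n \<noteq> 0. of_real (sqrt D) * u n * shift \<phi> n y) = of_real D * ?g y" for y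
  by (simp add: sum_distrib_left mult.assoc sqrt_D_mult)
 then have "dil (%x. \<Sum>n | u n \<noteq> 0. of_real (sqrt D) * u n * shift \<phi> n x) = (%x. of_real D * ?g (M *v x))"
  unfolding dil_def by (intro ext)
 then show ?thesis using fourier_matrix [OF g] fourier_comb [OF assms] by simp
qed

text \<open>This makes every sum over shifts at a fixed level finite, so the telescoping below needs
  no convergence.\<close>

lemma finite_coefficients:
 assumes "bdsupp f" "bdsupp h" shows "finite {k. L2_inner f (dilate_shift M h j k) \<noteq> 0}"
proof -
 obtain r r' where r: "bsupp r f" "bsupp r' h" using assms by (auto simp: bdsupp_def)
 obtain C where "0 < C" "!!x. norm (mpow M j x) \<le> C * norm x" using linear_bounded_pos [OF linear_mpow] by blast
 then have C: "0 \<le> C" "!!x. norm (mpow M j x) \<le> C * norm x" by auto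
 have "{k. L2_inner f (dilate_shift M h j k) \<noteq> 0} \<subseteq> {k. norm (of_lattice k) \<le> C * r + r'}"
 proof (rule subsetI, unfold mem_Collect_eq)
  fix k assume k: "L2_inner f (dilate_shift M h j k) \<noteq> 0"
  obtain x where x: "f x \<noteq> 0" "h (mpow M j x - of_lattice k) \<noteq> 0"
   using L2_inner_nonzeroE [OF k] by (auto simp: dilate_shift_eq)
  have "norm (of_lattice k) \<le> norm (mpow M j x) + norm (mpow M j x - of_lattice k)"
   using norm_triangle_ineq4 [of "mpow M j x" "mpow M j x - of_lattice k"] by simp
  also have "... \<le> C * r + r'"
   by (intro add_mono order_trans [OF C(2)] mult_left_mono C(1) bsuppD [OF r(1)] bsuppD [OF r(2)] x)
  finally show "norm (of_lattice k) \<le> C * r + r'" .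
 qed
 then show ?thesis by (rule finite_subset) (rule finite_lattice_ball)
qed

subsection \<open>Character sums over \<open>\<Omega>\<close>\<close>

text \<open>Lattice duality: each M^{-T}e_i is a point of \<Omega> up to an integer vector, so
  triviality on \<Omega> makes every coordinate of M^{-1}j integral.\<close>

lemma ek_trivial_on_Omega:
 assumes "!!\<omega>. \<omega> \<in> Omega M ==> ek j (tp \<omega>) = 1"
 shows "j \<in> range (zmul M)"
proof -
 have "\<exists>z. (Mi *v of_lattice j) $ i = real_of_int z" for i
 proof -
  obtain \<omega> l where o: "\<omega> \<in> Omega M" "MTi *v of_lattice (axis i 1) = \<omega> + of_lattice l" by (rule Omega_frac)
  have "ek j (tp (MTi *v of_lattice (axis i 1))) = 1"
   unfolding o(2) ek_per by (rule assms [OF o(1)])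
  then have e1: "exp (- (\<i> * complex_of_real (2 * pi * (of_lattice j \<bullet> (MTi *v of_lattice (axis i 1)))))) = 1"
   unfolding ek_def inner_scaleR_right .
  have int: "\<exists>z. t = real_of_int z" if t1: "exp (- (\<i> * complex_of_real (2 * pi * t))) = 1" for t
  proof -
   obtain z :: int where "- (2 * pi * t) = of_int (2 * z) * pi" using t1 unfolding exp_eq_1 by auto
   then have "(2 * pi) * t = (2 * pi) * of_int (- z)" by simp
   then have "t = of_int (- z)" by (subst (asm) mult_left_cancel) auto
   then show ?thesis by blast
  qed
  have "of_lattice j \<bullet> (MTi *v of_lattice (axis i 1)) = (MTi *v of_lattice (axis i 1)) \<bullet> of_lattice j" by (rule inner_commute)
  also have "... = axis i 1 \<bullet> (Mi *v of_lattice j)" unfolding Mi_adjoint by (simp add: of_lattice_axis)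
  also have "... = (Mi *v of_lattice j) $ i" by (simp add: inner_axis')
  finally show ?thesis using int [OF e1] by simp
 qed
 then obtain z where "!!i. (Mi *v of_lattice j) $ i = real_of_int (z i)" by metis
 then have "Mi *v of_lattice j = of_lattice (\<chi> i. z i)" by (simp add: vec_eq_iff)
 then have "of_lattice j = of_lattice (zmul M (\<chi> i. z i))" by (metis M_Mi of_lattice_zmul intM)
 then show ?thesis by simp
qed

text \<open>Orthogonality of characters of the group M^{-T}Z^d / Z^d of order |det M|: adding an
  element on which the character is not 1 permutes \<Omega> modulo Z^d and multiplies the sum by
  that value.\<close>

lemma character_sum:
 "(\<Sum>\<omega>\<in>Omega M. ek j (tp \<omega>)) = (if j \<in> range (zmul M) then of_real D else 0)"
proof (cases "j \<in> range (zmul M)")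
 case True
 then obtain k where k: "j = zmul M k" by blast
 have "ek j (tp \<omega>) = 1" if w: "\<omega> \<in> Omega M" for \<omega>
 proof -
  obtain p where p: "MT *v \<omega> = of_lattice p" by (rule Omega_lattice [OF w])
  have "ek j (tp \<omega>) = ek k (tp (MT *v \<omega>))"
   unfolding k ek_zmul [OF intM, symmetric] by (simp add: matrix_vector_mult_scaleR)
  then show ?thesis by (simp add: p ek_lattice)
 qed
 then show ?thesis using True by (simp flip: card_Omega)
next
 case False
 then obtain \<omega>1 where w1: "\<omega>1 \<in> Omega M" "ek j (tp \<omega>1) \<noteq> 1" using ek_trivial_on_Omega by blast
 have "\<exists>\<omega>'\<in>Omega M. \<exists>l. \<omega> + \<omega>1 = \<omega>' + of_lattice l" if w: "\<omega> \<in> Omega M" for \<omega>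
 proof -
  obtain p where p: "MT *v \<omega> = of_lattice p" by (rule Omega_lattice [OF w])
  obtain p1 where p1: "MT *v \<omega>1 = of_lattice p1" by (rule Omega_lattice [OF w1(1)])
  have "\<omega> + \<omega>1 = MTi *v of_lattice (p + p1)"
   unfolding of_lattice_add p [symmetric] p1 [symmetric] by (simp add: matrix_vector_right_distrib)
  then show ?thesis using Omega_frac [of "p + p1"] by metis
 qed
 then obtain g L where g: "!!\<omega>. \<omega> \<in> Omega M ==> g \<omega> \<in> Omega M" "!!\<omega>. \<omega> \<in> Omega M ==> \<omega> + \<omega>1 = g \<omega> + of_lattice (L \<omega>)" by metis
 have inj: "inj_on g (Omega M)"
 proof (rule inj_onI)
  fix \<omega> \<omega>' assume w: "\<omega> \<in> Omega M" "\<omega>' \<in> Omega M" "g \<omega> = g \<omega>'"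
  have "\<omega> - \<omega>' = (\<omega> + \<omega>1) - (\<omega>' + \<omega>1)" by simp
  also have "... = of_lattice (L \<omega> - L \<omega>')" unfolding g(2) [OF w(1)] g(2) [OF w(2)] w(3) by (simp add: of_lattice_diff)
  finally have "\<omega> - \<omega>' = of_lattice (L \<omega> - L \<omega>')" .
  then show "\<omega> = \<omega>'" by (rule Omega_diff_lattice [OF w(1,2)])
 qed
 then have im: "g ` Omega M = Omega M" using g(1) finite_Omega by (intro endo_inj_surj) auto
 let ?S = "\<Sum>\<omega>\<in>Omega M. ek j (tp \<omega>)"
 have "?S = (\<Sum>\<omega>\<in>g ` Omega M. ek j (tp \<omega>))" unfolding im ..
 also have "... = (\<Sum>\<omega>\<in>Omega M. ek j (tp (g \<omega>)))" by (simp add: sum.reindex [OF inj])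
 also have "... = (\<Sum>\<omega>\<in>Omega M. ek j (tp \<omega>) * ek j (tp \<omega>1))"
 proof (rule sum.cong [OF refl])
  fix \<omega> assume "\<omega> \<in> Omega M"
  then have "ek j (tp (g \<omega>)) = ek j (tp (\<omega> + \<omega>1))" by (simp only: g(2) ek_per)
  then show "ek j (tp (g \<omega>)) = ek j (tp \<omega>) * ek j (tp \<omega>1)" by (simp add: scaleR_add_right ek_plus)
 qed
 also have "... = ?S * ek j (tp \<omega>1)" by (rule sum_distrib_right [symmetric])
 finally have "?S * (1 - ek j (tp \<omega>1)) = 0" by (simp add: algebra_simps)
 then show ?thesis using w1 False by simp
qed

end

subsection \<open>Gram sums\<close>

lemma sum_shift_support:
 fixes F :: "int ^ 'n::finite => complex"
 assumes "finite N" "finite U" and F: "!!n. F n \<noteq> 0 ==> n \<in> N \<and> c + n \<in> U"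
 shows "(\<Sum>n\<in>N. F n) = (\<Sum>p\<in>U. F (p - c))"
proof -
 have "(\<Sum>p\<in>U. F (p - c)) = (\<Sum>n\<in>(%p. p - c) ` U. F n)" by (simp add: sum.reindex inj_on_def)
 also have "... = (\<Sum>n\<in>N. F n)"
 proof (rule sum.mono_neutral_cong)
  fix n assume "n \<in> N - (%p. p - c) ` U"
  then show "F n = 0" using F [of n] by (metis DiffD2 add_diff_cancel_left' image_eqI)
 qed (use assms in auto)
 finally show ?thesis ..
qed

text \<open>The substitution p = g k + n, q = g k + n' separates the data u, v from Gram
  coefficients that depend on the filter only. It serves with \<open>zmul M\<close> for the wavelets
  and with the identity for \<open>\<phi>'\<close>.\<close>

lemma gram_sum:
 fixes g :: "'k => int ^ 'n::finite" and u v \<beta> :: "int ^ 'n => complex"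
 assumes fin: "finite N" "finite U" "finite V" and \<beta>: "!!n. n \<notin> N ==> \<beta> n = 0" and u: "!!p. p \<notin> U ==> u p = 0"
  and V: "!!k n. k \<in> K ==> n \<in> N ==> g k + n \<in> V"
 shows "(\<Sum>k\<in>K. (\<Sum>n\<in>N. cnj (\<beta> n) * u (g k + n)) * (\<Sum>n\<in>N. \<beta> n * v (g k + n)))
  = (\<Sum>p\<in>U. \<Sum>q\<in>V. u p * v q * (\<Sum>k\<in>K. cnj (\<beta> (p - g k)) * \<beta> (q - g k)))"
proof -
 have "(\<Sum>n\<in>N. cnj (\<beta> n) * u (g k + n)) * (\<Sum>n\<in>N. \<beta> n * v (g k + n))
   = (\<Sum>p\<in>U. \<Sum>q\<in>V. u p * v q * (cnj (\<beta> (p - g k)) * \<beta> (q - g k)))" if k: "k \<in> K" for k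
 proof -
  have e1: "(\<Sum>n\<in>N. cnj (\<beta> n) * u (g k + n)) = (\<Sum>p\<in>U. cnj (\<beta> (p - g k)) * u p)"
   by (subst sum_shift_support [OF fin(1,2), where c = "g k"]) (use \<beta> u in \<open>auto\<close>)
  have e2: "(\<Sum>n\<in>N. \<beta> n * v (g k + n)) = (\<Sum>q\<in>V. \<beta> (q - g k) * v q)"
   by (subst sum_shift_support [OF fin(1,3), where c = "g k"]) (use \<beta> V k in \<open>auto\<close>)
  show ?thesis unfolding e1 e2 sum_product by (simp only: mult_ac)
 qed
 then have "(\<Sum>k\<in>K. (\<Sum>n\<in>N. cnj (\<beta> n) * u (g k + n)) * (\<Sum>n\<in>N. \<beta> n * v (g k + n)))
   = (\<Sum>k\<in>K. \<Sum>p\<in>U. \<Sum>q\<in>V. u p * v q * (cnj (\<beta> (p - g k)) * \<beta> (q - g k)))" by (rule sum.cong [OF refl])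
 also have "... = (\<Sum>p\<in>U. \<Sum>k\<in>K. \<Sum>q\<in>V. u p * v q * (cnj (\<beta> (p - g k)) * \<beta> (q - g k)))" by (rule sum.swap)
 also have "... = (\<Sum>p\<in>U. \<Sum>q\<in>V. \<Sum>k\<in>K. u p * v q * (cnj (\<beta> (p - g k)) * \<beta> (q - g k)))"
  by (intro sum.cong refl sum.swap)
 finally show ?thesis by (simp only: sum_distrib_left)
qed

text \<open>Weighted autocorrelations as Fourier coefficients of a product; the weight
  \<open>w\<close> will single out a coset of M Z^d.\<close>

lemma gram_trig:
 fixes \<beta> w :: "int ^ 'n::finite => complex"
 assumes N: "finite N" and \<beta>: "!!n. n \<notin> N ==> \<beta> n = 0"
 shows "cnj (\<Sum>n\<in>N. \<beta> n * ek n \<xi>) * (\<Sum>n\<in>N. \<beta> n * w n * ek n \<xi>)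
  = (\<Sum>r\<in>(%p. fst p - snd p) ` (N \<times> N). (\<Sum>n\<in>N. cnj (\<beta> (n - r)) * \<beta> n * w n) * ek r \<xi>)"
proof -
 let ?T = "(%p. fst p - snd p) ` (N \<times> N)"
 have T: "finite ?T" using N by auto
 have row: "(\<Sum>n'\<in>N. cnj (\<beta> n') * ek (n - n') \<xi>) = (\<Sum>r\<in>?T. cnj (\<beta> (n - r)) * ek r \<xi>)" if n: "n \<in> N" for n
 proof -
  have "(\<Sum>n'\<in>N. cnj (\<beta> n') * ek (n - n') \<xi>) = (\<Sum>r\<in>(%n'. n - n') ` N. cnj (\<beta> (n - r)) * ek r \<xi>)"
   by (simp add: sum.reindex inj_on_def)
  also have "... = (\<Sum>r\<in>?T. cnj (\<beta> (n - r)) * ek r \<xi>)"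
  proof (rule sum.mono_neutral_left [OF T])
   show "(%n'. n - n') ` N \<subseteq> ?T" using n by force
   show "\<forall>r\<in>?T - (%n'. n - n') ` N. cnj (\<beta> (n - r)) * ek r \<xi> = 0"
   proof
    fix r assume r: "r \<in> ?T - (%n'. n - n') ` N"
    have "n - r \<notin> N"
    proof
     assume "n - r \<in> N"
     then have "r \<in> (%n'. n - n') ` N" by (intro image_eqI [of _ _ "n - r"]) auto
     then show False using r by blast
    qed
    then show "cnj (\<beta> (n - r)) * ek r \<xi> = 0" using \<beta> by simp
   qed
  qed
  finally show ?thesis .
 qed
 have "cnj (\<Sum>n\<in>N. \<beta> n * ek n \<xi>) * (\<Sum>n\<in>N. \<beta> n * w n * ek n \<xi>) = (\<Sum>n'\<in>N. \<Sum>n\<in>N. \<beta> n * w n * (cnj (\<beta> n') * ek (n - n') \<xi>))"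
  unfolding cnj_sum sum_product
  by (intro sum.cong refl) (simp add: cnj_ek mult_ac ek_add [of n "- n'" for n n', simplified])
 also have "... = (\<Sum>n\<in>N. \<beta> n * w n * (\<Sum>n'\<in>N. cnj (\<beta> n') * ek (n - n') \<xi>))"
  unfolding sum_distrib_left by (rule sum.swap)
 also have "... = (\<Sum>n\<in>N. \<beta> n * w n * (\<Sum>r\<in>?T. cnj (\<beta> (n - r)) * ek r \<xi>))" by (intro sum.cong refl arg_cong [of _ _ "(*) _"] row)
 also have "... = (\<Sum>r\<in>?T. \<Sum>n\<in>N. \<beta> n * w n * (cnj (\<beta> (n - r)) * ek r \<xi>))"
  unfolding sum_distrib_left by (rule sum.swap)
 also have "... = (\<Sum>r\<in>?T. (\<Sum>n\<in>N. cnj (\<beta> (n - r)) * \<beta> n * w n) * ek r \<xi>)"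
  unfolding sum_distrib_right by (simp add: mult_ac)
 finally show ?thesis .
qed

subsection \<open>The framelet operators\<close>

context integer_matrix begin

text \<open>For \<open>f\<close> and \<open>h\<close> of bounded support this is the whole sum \<open>\<Sum>\<^sub>k \<langle>f, h\<^bsub>M^j;k\<^esub>\<rangle> h\<^bsub>M^j;k\<^esub>\<close>.\<close>
definition part :: "(real ^ 'n => complex) => (real ^ 'n => complex) => nat => real ^ 'n => complex" where
 "part h f j x = (\<Sum>k | L2_inner f (dilate_shift M h j k) \<noteq> 0. L2_inner f (dilate_shift M h j k) * dilate_shift M h j k x)"

lemma part_superset:
 assumes "finite K" "!!k. L2_inner f (dilate_shift M h j k) \<noteq> 0 ==> k \<in> K"
 shows "part h f j x = (\<Sum>k\<in>K. L2_inner f (dilate_shift M h j k) * dilate_shift M h j k x)"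
 unfolding part_def using assms by (intro sum.mono_neutral_left) auto

lemma part_L2: "h \<in> L2 ==> part h f j \<in> L2"
 using L2_sum [of "{k. L2_inner f (dilate_shift M h j k) \<noteq> 0}" "%k x. L2_inner f (dilate_shift M h j k) * dilate_shift M h j k x"]
 unfolding part_def [abs_def] by (simp add: L2_scale dilate_shift_L2)

lemma dilate_shift_AE:
 assumes "AE x in leb. g x = h x" shows "AE x in leb. dilate_shift M g j k x = dilate_shift M h j k x"
 unfolding dilate_shift_dil0
proof (induction j)
 case 0
 show ?case using shift_AE [OF assms] by simp
next
 case (Suc j)
 then show ?case unfolding funpow.simps o_apply by (rule dil_AE)
qed

lemma part_cong_AE:
 assumes e: "AE x in leb. g x = h x" and L: "g \<in> L2" "h \<in> L2" "f \<in> L2" and b: "bdsupp f" "bdsupp h"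
 shows "AE x in leb. part g f j x = part h f j x"
proof -
 have c: "L2_inner f (dilate_shift M g j k) = L2_inner f (dilate_shift M h j k)" for k
  by (intro L2_inner_cong_AE dilate_shift_AE e dilate_shift_L2 L)
 let ?K = "{k. L2_inner f (dilate_shift M h j k) \<noteq> 0}"
 have "AE x in leb. \<forall>k\<in>?K. dilate_shift M g j k x = dilate_shift M h j k x"
  using finite_coefficients [OF b] by (subst AE_ball_countable) (auto intro: countable_finite dilate_shift_AE e)
 then show ?thesis unfolding part_def c by eventually_elim simp
qed

end

locale framelet_system = refinable M a \<phi> R for M :: "real ^ 'n::finite ^ 'n" and a \<phi> R +
 fixes \<theta> :: "int ^ 'n => complex" and s :: nat and b :: "nat => int ^ 'n => complex" and \<epsilon> :: "nat => real"
 assumes fourier_refine: "!!\<xi>. fourier \<phi> (transpose M *v \<xi>) = filter_hat a \<xi> * fourier \<phi> \<xi>"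
  and a_zero: "!!\<omega>. \<omega> \<in> Omega M ==> \<omega> \<noteq> 0 ==> filter_hat a (tp \<omega>) = 0"
  and \<theta>: "\<theta> \<in> l0" and \<theta>_0: "filter_hat \<theta> 0 * fourier \<phi> 0 = 1"
  and b: "!!l. l \<in> {1..s} ==> b l \<in> l0" and b_0: "!!l. l \<in> {1..s} ==> filter_hat (b l) 0 = 0"
  and \<epsilon>: "!!l. l \<in> {1..s} ==> \<epsilon> l \<in> {1, -1}"
  and OEP: "!!\<xi> \<omega>. \<omega> \<in> Omega M ==>
    cnj (filter_hat a \<xi>) * (cnj (filter_hat \<theta> (transpose M *v \<xi>)) * filter_hat \<theta> (transpose M *v \<xi>)) * filter_hat a (\<xi> + tp \<omega>)
    + (\<Sum>l=1..s. cnj (filter_hat (b l) \<xi>) * complex_of_real (\<epsilon> l) * filter_hat (b l) (\<xi> + tp \<omega>))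
    = delta \<omega> * (cnj (filter_hat \<theta> \<xi>) * filter_hat \<theta> \<xi>)"
begin

text \<open>The filter \<open>a(\<xi>) \<theta>(M\<^sup>T\<xi>)\<close> is added to the bank as a further generator with index \<open>0\<close>; it produces \<open>\<theta>\<phi>\<close> itself.\<close>
definition b' :: "nat => int ^ 'n => complex" where
 "b' l = (if l = 0 then SOME u. u \<in> l0 \<and> filter_hat u = (%\<xi>. filter_hat a \<xi> * filter_hat \<theta> (MT *v \<xi>)) else b l)"

definition \<epsilon>' :: "nat => complex" where
 "\<epsilon>' l = (if l = 0 then 1 else complex_of_real (\<epsilon> l))"

lemma b'_0: "b' 0 \<in> l0" "filter_hat (b' 0) = (%\<xi>. filter_hat a \<xi> * filter_hat \<theta> (MT *v \<xi>))"
proof -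
 have "(%\<xi>. filter_hat a \<xi> * filter_hat \<theta> (MT *v \<xi>)) \<in> TP"
  by (intro TP_mult TP_transpose [OF _ intM]) (auto simp: TP_def a \<theta>)
 then obtain w where w: "(%\<xi>. filter_hat a \<xi> * filter_hat \<theta> (MT *v \<xi>)) = filter_hat w" "w \<in> l0" unfolding TP_def by (rule imageE)
 have "\<exists>u. u \<in> l0 \<and> filter_hat u = (%\<xi>. filter_hat a \<xi> * filter_hat \<theta> (MT *v \<xi>))"
  by (intro exI [of _ w] conjI w(2) w(1) [symmetric])
 note P = someI_ex [OF this]
 have e: "b' 0 = (SOME u. u \<in> l0 \<and> filter_hat u = (%\<xi>. filter_hat a \<xi> * filter_hat \<theta> (MT *v \<xi>)))" unfolding b'_def by simp
 show "b' 0 \<in> l0" unfolding e by (rule conjunct1 [OF P])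
 show "filter_hat (b' 0) = (%\<xi>. filter_hat a \<xi> * filter_hat \<theta> (MT *v \<xi>))" unfolding e by (rule conjunct2 [OF P])
qed

lemma b'_l0: "l \<le> s ==> b' l \<in> l0"
proof (cases "l = 0")
 case False
 assume "l \<le> s"
 then have "l \<in> {1..s}" using False by simp
 from b [OF this] show ?thesis using False by (simp add: b'_def)
qed (simp add: b'_0)

lemma atMost_insert: "{..s} = insert 0 {1..s}"
 by auto

lemma extended_OEP:
 assumes w: "\<omega> \<in> Omega M"
 shows "(\<Sum>l\<le>s. \<epsilon>' l * (cnj (filter_hat (b' l) \<xi>) * filter_hat (b' l) (\<xi> + tp \<omega>))) = delta \<omega> * (cnj (filter_hat \<theta> \<xi>) * filter_hat \<theta> \<xi>)"
proof -
 have "filter_hat \<theta> \<in> TP" using \<theta> by (simp add: TP_def)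
 then have p: "filter_hat \<theta> (MT *v (\<xi> + tp \<omega>)) = filter_hat \<theta> (MT *v \<xi>)" by (rule TP_MT_periodic [OF _ w])
 have "(\<Sum>l\<le>s. \<epsilon>' l * (cnj (filter_hat (b' l) \<xi>) * filter_hat (b' l) (\<xi> + tp \<omega>)))
   = \<epsilon>' 0 * (cnj (filter_hat (b' 0) \<xi>) * filter_hat (b' 0) (\<xi> + tp \<omega>))
    + (\<Sum>l=1..s. \<epsilon>' l * (cnj (filter_hat (b' l) \<xi>) * filter_hat (b' l) (\<xi> + tp \<omega>)))"
  unfolding atMost_insert by simp
 also have "(\<Sum>l=1..s. \<epsilon>' l * (cnj (filter_hat (b' l) \<xi>) * filter_hat (b' l) (\<xi> + tp \<omega>)))
   = (\<Sum>l=1..s. cnj (filter_hat (b l) \<xi>) * complex_of_real (\<epsilon> l) * filter_hat (b l) (\<xi> + tp \<omega>))"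
  by (intro sum.cong refl) (simp add: \<epsilon>'_def b'_def mult_ac)
 also have "\<epsilon>' 0 * (cnj (filter_hat (b' 0) \<xi>) * filter_hat (b' 0) (\<xi> + tp \<omega>))
   = cnj (filter_hat a \<xi>) * (cnj (filter_hat \<theta> (MT *v \<xi>)) * filter_hat \<theta> (MT *v \<xi>)) * filter_hat a (\<xi> + tp \<omega>)"
  unfolding b'_0(2) p by (simp add: \<epsilon>'_def mult_ac)
 finally show ?thesis using OEP [OF w] by simp
qed

definition Nb :: "(int ^ 'n) set" where
 "Nb = {n. \<theta> n \<noteq> 0} \<union> (\<Union>l\<le>s. {n. b' l n \<noteq> 0})"

lemma Nb: "finite Nb" "n \<notin> Nb ==> \<theta> n = 0" "l \<le> s ==> n \<notin> Nb ==> b' l n = 0"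
 using \<theta> b'_l0 by (auto simp: Nb_def l0_def)

lemma filter_hat_Nb:
 "filter_hat \<theta> \<xi> = (\<Sum>n\<in>Nb. \<theta> n * ek n \<xi>)" "l \<le> s ==> filter_hat (b' l) \<xi> = (\<Sum>n\<in>Nb. b' l n * ek n \<xi>)"
 using Nb by (auto intro!: filter_hat_superset)

text \<open>Weight the filter identity at \<omega> with the character of frequency -q and sum over
  \<Omega>: on the left only n in the coset q + M Z^d survive in the second factor, on the right
  only \<omega> = 0. Independence of the characters then allows comparing coefficients in
  \<xi>.\<close>

lemma coefficient_sums:
 "(\<Sum>l\<le>s. \<epsilon>' l * (\<Sum>n\<in>Nb. cnj (b' l (n - r)) * b' l n * (if n - q \<in> range (zmul M) then of_real D else 0)))
  = (\<Sum>n\<in>Nb. cnj (\<theta> (n - r)) * \<theta> n)"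
proof -
 define w where "w n = (if n - q \<in> range (zmul M) then complex_of_real D else 0)" for n
 define cl where "cl r = (\<Sum>l\<le>s. \<epsilon>' l * (\<Sum>n\<in>Nb. cnj (b' l (n - r)) * b' l n * w n))" for r
 define cr where "cr r = (\<Sum>n\<in>Nb. cnj (\<theta> (n - r)) * \<theta> n * 1)" for r
 let ?T = "(%p. fst p - snd p) ` (Nb \<times> Nb)"
 have w: "(\<Sum>n\<in>Nb. b' l n * w n * ek n \<xi>) = (\<Sum>\<omega>\<in>Omega M. ek (- q) (tp \<omega>) * filter_hat (b' l) (\<xi> + tp \<omega>))" if l: "l \<le> s" for l \<xi>
 proof -
  have "(\<Sum>n\<in>Nb. b' l n * w n * ek n \<xi>) = (\<Sum>n\<in>Nb. \<Sum>\<omega>\<in>Omega M. b' l n * ek (n - q) (tp \<omega>) * ek n \<xi>)"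
   unfolding w_def character_sum [symmetric] by (simp only: sum_distrib_left sum_distrib_right)
  also have "... = (\<Sum>\<omega>\<in>Omega M. \<Sum>n\<in>Nb. b' l n * ek (n - q) (tp \<omega>) * ek n \<xi>)" by (rule sum.swap)
  also have "... = (\<Sum>\<omega>\<in>Omega M. \<Sum>n\<in>Nb. ek (- q) (tp \<omega>) * (b' l n * ek n (\<xi> + tp \<omega>)))"
  proof (intro sum.cong refl)
   fix \<omega> n
   have "ek (n - q) (tp \<omega>) = ek n (tp \<omega>) * ek (- q) (tp \<omega>)" unfolding ek_add [symmetric] by simp
   then show "b' l n * ek (n - q) (tp \<omega>) * ek n \<xi> = ek (- q) (tp \<omega>) * (b' l n * ek n (\<xi> + tp \<omega>))"
    by (simp add: ek_plus mult_ac)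
  qed
  finally show ?thesis unfolding filter_hat_Nb(2) [OF l] sum_distrib_left .
 qed
 have "(\<Sum>r\<in>?T. cl r * ek r \<xi>) = (\<Sum>r\<in>?T. cr r * ek r \<xi>)" for \<xi>
 proof -
  have "(\<Sum>r\<in>?T. cl r * ek r \<xi>) = (\<Sum>r\<in>?T. \<Sum>l\<le>s. \<epsilon>' l * ((\<Sum>n\<in>Nb. cnj (b' l (n - r)) * b' l n * w n) * ek r \<xi>))"
   unfolding cl_def sum_distrib_right [where A = "{..s}"] mult.assoc ..
  also have "... = (\<Sum>l\<le>s. \<Sum>r\<in>?T. \<epsilon>' l * ((\<Sum>n\<in>Nb. cnj (b' l (n - r)) * b' l n * w n) * ek r \<xi>))" by (rule sum.swap)
  also have "... = (\<Sum>l\<le>s. \<epsilon>' l * (cnj (filter_hat (b' l) \<xi>) * (\<Sum>\<omega>\<in>Omega M. ek (- q) (tp \<omega>) * filter_hat (b' l) (\<xi> + tp \<omega>))))"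
  proof (intro sum.cong refl)
   fix l assume "l \<in> {..s}"
   then have l: "l \<le> s" by simp
   have "(\<Sum>r\<in>?T. \<epsilon>' l * ((\<Sum>n\<in>Nb. cnj (b' l (n - r)) * b' l n * w n) * ek r \<xi>))
     = \<epsilon>' l * (\<Sum>r\<in>?T. (\<Sum>n\<in>Nb. cnj (b' l (n - r)) * b' l n * w n) * ek r \<xi>)" by (rule sum_distrib_left [symmetric])
   also have "(\<Sum>r\<in>?T. (\<Sum>n\<in>Nb. cnj (b' l (n - r)) * b' l n * w n) * ek r \<xi>) = cnj (\<Sum>n\<in>Nb. b' l n * ek n \<xi>) * (\<Sum>n\<in>Nb. b' l n * w n * ek n \<xi>)"
    by (rule gram_trig [OF Nb(1) Nb(3) [OF l], symmetric])
   finally show "(\<Sum>r\<in>?T. \<epsilon>' l * ((\<Sum>n\<in>Nb. cnj (b' l (n - r)) * b' l n * w n) * ek r \<xi>))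
     = \<epsilon>' l * (cnj (filter_hat (b' l) \<xi>) * (\<Sum>\<omega>\<in>Omega M. ek (- q) (tp \<omega>) * filter_hat (b' l) (\<xi> + tp \<omega>)))"
    unfolding w [OF l] filter_hat_Nb(2) [OF l, of \<xi>] .
  qed
  also have "... = (\<Sum>l\<le>s. \<Sum>\<omega>\<in>Omega M. ek (- q) (tp \<omega>) * (\<epsilon>' l * (cnj (filter_hat (b' l) \<xi>) * filter_hat (b' l) (\<xi> + tp \<omega>))))"
   by (simp add: sum_distrib_left mult_ac)
  also have "... = (\<Sum>\<omega>\<in>Omega M. \<Sum>l\<le>s. ek (- q) (tp \<omega>) * (\<epsilon>' l * (cnj (filter_hat (b' l) \<xi>) * filter_hat (b' l) (\<xi> + tp \<omega>))))"
   by (rule sum.swap)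
  also have "... = (\<Sum>\<omega>\<in>Omega M. ek (- q) (tp \<omega>) * (\<Sum>l\<le>s. \<epsilon>' l * (cnj (filter_hat (b' l) \<xi>) * filter_hat (b' l) (\<xi> + tp \<omega>))))"
   by (simp only: sum_distrib_left)
  also have "... = (\<Sum>\<omega>\<in>Omega M. if \<omega> = 0 then cnj (filter_hat \<theta> \<xi>) * filter_hat \<theta> \<xi> else 0)"
   by (intro sum.cong refl) (simp add: extended_OEP delta_def)
  also have "... = cnj (filter_hat \<theta> \<xi>) * filter_hat \<theta> \<xi>" by (simp add: finite_Omega zero_in_Omega)
  also have "... = cnj (\<Sum>n\<in>Nb. \<theta> n * ek n \<xi>) * (\<Sum>n\<in>Nb. \<theta> n * 1 * ek n \<xi>)" by (simp add: filter_hat_Nb)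
  also have "... = (\<Sum>r\<in>?T. cr r * ek r \<xi>)" unfolding cr_def by (rule gram_trig [OF Nb(1,2)])
  finally show ?thesis .
 qed
 then have "(\<Sum>r\<in>?T. (cl r - cr r) * ek r \<xi>) = 0" for \<xi> by (simp add: left_diff_distrib sum_subtractf)
 then have T: "cl r = cr r" if "r \<in> ?T" for r
  using ek_independent [of ?T "%r. cl r - cr r"] Nb(1) that by auto
 have "cl r = cr r"
 proof (cases "r \<in> ?T")
  case False
  have z: "n - r \<notin> Nb" if n: "n \<in> Nb" for n
  proof
   assume "n - r \<in> Nb"
   then have "r \<in> ?T" using n by (intro image_eqI [of _ _ "(n, n - r)"]) auto
   then show False using False by simp
  qed
  then show ?thesis using Nb by (simp add: cl_def cr_def)
 qed (rule T)
 then show ?thesis by (simp add: cl_def cr_def w_def)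
qed

text \<open>The preceding identity at r = q - p, with n = q - Mk on the left and n = q - k on the
  right. \<open>K\<close> and \<open>K'\<close> may be any finite sets that contain all contributing
  indices, so one choice serves every p, q and filter.\<close>

lemma coefficient_identity:
 assumes K: "finite K" "!!k. p - zmul M k \<in> Nb ==> k \<in> K" and K': "finite K'" "!!k. p - k \<in> Nb ==> k \<in> K'"
 shows "of_real D * (\<Sum>l\<le>s. \<epsilon>' l * (\<Sum>k\<in>K. cnj (b' l (p - zmul M k)) * b' l (q - zmul M k))) = (\<Sum>k\<in>K'. cnj (\<theta> (p - k)) * \<theta> (q - k))"
proof -
 define r where "r = q - p"
 have dec: "(\<Sum>n\<in>Nb. cnj (b' l (n - r)) * b' l n * (if n - q \<in> range (zmul M) then of_real D else 0))
   = of_real D * (\<Sum>k\<in>K. cnj (b' l (p - zmul M k)) * b' l (q - zmul M k))" if l: "l \<le> s" for l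
 proof -
  let ?F = "%n. cnj (b' l (n - r)) * b' l n * (if n - q \<in> range (zmul M) then of_real D else 0)"
  let ?I = "(%k. q - zmul M k) ` K"
  have um: "zmul M (- k) = - zmul M k" for k by (simp add: zmul_def vec_eq_iff sum_negf)
  have "(\<Sum>n\<in>Nb. ?F n) = (\<Sum>n\<in>?I. ?F n)"
  proof (rule sum.mono_neutral_cong)
   show "finite ?I" "finite Nb" using K Nb by auto
   fix n assume n: "n \<in> Nb - ?I"
   show "?F n = 0"
   proof (cases "n - q \<in> range (zmul M)")
    case True
    then obtain k where "n - q = zmul M k" by blast
    then have k: "n = q - zmul M (- k)" unfolding um by (simp add: algebra_simps)
    then have "- k \<notin> K" using n by blast
    then have "p - zmul M (- k) \<notin> Nb" using K(2) by blast
    moreover have "n - r = p - zmul M (- k)" unfolding k r_def by simp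
    ultimately show ?thesis using Nb(3) [OF l] by simp
   qed simp
  next
   fix n assume "n \<in> ?I - Nb"
   then show "?F n = 0" using Nb(3) [OF l] by simp
  qed simp
  also have "... = (\<Sum>k\<in>K. ?F (q - zmul M k))"
   using inj_zmul by (subst sum.reindex) (auto simp: inj_on_def inj_def)
  also have "... = (\<Sum>k\<in>K. of_real D * (cnj (b' l (p - zmul M k)) * b' l (q - zmul M k)))"
  proof (intro sum.cong refl)
   fix k
   have "- zmul M k \<in> range (zmul M)" unfolding um [symmetric] by blast
   then show "?F (q - zmul M k) = of_real D * (cnj (b' l (p - zmul M k)) * b' l (q - zmul M k))"
    by (simp add: r_def algebra_simps)
  qed
  finally show ?thesis by (simp only: sum_distrib_left)
 qed
 have "(\<Sum>n\<in>Nb. cnj (\<theta> (n - r)) * \<theta> n) = (\<Sum>n\<in>(%k. q - k) ` K'. cnj (\<theta> (n - r)) * \<theta> n)"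
 proof (rule sum.mono_neutral_cong)
  show "finite ((%k. q - k) ` K')" "finite Nb" using K' Nb by auto
  fix n assume n: "n \<in> Nb - (%k. q - k) ` K'"
  have "q - n \<notin> K'"
  proof
   assume "q - n \<in> K'"
   then have "n \<in> (%k. q - k) ` K'" by (intro image_eqI [of _ _ "q - n"]) auto
   then show False using n by blast
  qed
  then have "p - (q - n) \<notin> Nb" using K'(2) by blast
  moreover have "p - (q - n) = n - r" by (simp add: r_def)
  ultimately show "cnj (\<theta> (n - r)) * \<theta> n = 0" using Nb(2) by simp
 next
  fix n assume "n \<in> (%k. q - k) ` K' - Nb"
  then show "cnj (\<theta> (n - r)) * \<theta> n = 0" using Nb(2) by simp
 qed simp
 also have "... = (\<Sum>k\<in>K'. cnj (\<theta> (p - k)) * \<theta> (q - k))"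
  by (subst sum.reindex) (auto simp: inj_on_def r_def algebra_simps)
 finally have "(\<Sum>k\<in>K'. cnj (\<theta> (p - k)) * \<theta> (q - k))
   = (\<Sum>l\<le>s. \<epsilon>' l * (\<Sum>n\<in>Nb. cnj (b' l (n - r)) * b' l n * (if n - q \<in> range (zmul M) then of_real D else 0)))"
  unfolding coefficient_sums ..
 also have "... = (\<Sum>l\<le>s. \<epsilon>' l * (of_real D * (\<Sum>k\<in>K. cnj (b' l (p - zmul M k)) * b' l (q - zmul M k))))"
  by (intro sum.cong refl arg_cong [of _ _ "(*) _"] dec) simp
 also have "... = of_real D * (\<Sum>l\<le>s. \<epsilon>' l * (\<Sum>k\<in>K. cnj (b' l (p - zmul M k)) * b' l (q - zmul M k)))"
  by (rule trans [OF sum.cong [OF refl mult.left_commute] sum_distrib_left [symmetric]])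
 finally show ?thesis ..
qed

definition \<phi>' :: "real ^ 'n => complex" where
 "\<phi>' = (%x. \<Sum>n | \<theta> n \<noteq> 0. \<theta> n * shift \<phi> n x)"

lemma bd_\<phi>: "bdsupp \<phi>"
 using R(1) by (rule bdsuppI)

lemma int_\<phi>: "Lint \<phi>"
 by (rule bdsupp_integrable [OF \<phi> bd_\<phi>])

lemma \<phi>'_L2: "\<phi>' \<in> L2" and \<phi>'_bd: "bdsupp \<phi>'" and \<phi>'_fourier: "fourier \<phi>' \<xi> = filter_hat \<theta> \<xi> * fourier \<phi> \<xi>"
 unfolding \<phi>'_def by (intro L2_sum L2_scale shift_L2 \<phi> bdsupp_sum bdsupp_scale bdsupp_shift bd_\<phi> fourier_comb int_\<phi>)+

lemma wavelet_bd: "bdsupp (wavelet u)"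
 unfolding wavelet_def by (intro bdsupp_dil bdsupp_sum bdsupp_scale bdsupp_shift bd_\<phi>)

lemma wavelet_fourier: "fourier (wavelet u) \<xi> = filter_hat u (MTi *v \<xi>) * fourier \<phi> (MTi *v \<xi>)"
 unfolding wavelet_def by (rule fourier_dil_comb [OF int_\<phi>])

lemma wavelet_b'_0: "AE x in leb. wavelet (b' 0) x = \<phi>' x"
proof (rule fourier_unique2 [OF wavelet_L2 wavelet_bd \<phi>'_L2 \<phi>'_bd])
 fix \<xi>
 show "fourier (wavelet (b' 0)) \<xi> = fourier \<phi>' \<xi>"
  unfolding wavelet_fourier \<phi>'_fourier b'_0(2) using fourier_refine [of "MTi *v \<xi>"] by (simp add: mult_ac)
qed

lemma dilate_shift_\<phi>': "dilate_shift M \<phi>' j k = (%x. \<Sum>n | \<theta> n \<noteq> 0. \<theta> n * dilate_shift M \<phi> j (k + n) x)"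
proof -
 have "dilate_shift M \<phi>' j k = (dil ^^ j) (%x. \<Sum>n | \<theta> n \<noteq> 0. \<theta> n * shift \<phi> (k + n) x)"
  unfolding dilate_shift_dil0 \<phi>'_def shift_sum shift_shift by (simp add: add.commute)
 then show ?thesis unfolding dil_pow_sum dilate_shift_dil0 .
qed

text \<open>Both sides are expanded in the coefficients \<open>u\<close> of \<open>f\<close> and the
  values \<open>v\<close> of \<phi> at level j + 1. They are then quadratic sums with the Gram
  coefficients of the filters, which \<open>coefficient_identity\<close> equates.\<close>

lemma telescope:
 assumes f: "f \<in> L2" "bdsupp f"
 shows "(\<Sum>l\<le>s. \<epsilon>' l * part (wavelet (b' l)) f j x) = part \<phi>' f (Suc j) x"
proof -
 define u where "u p = L2_inner f (dilate_shift M \<phi> (Suc j) p)" for p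
 define v where "v q = dilate_shift M \<phi> (Suc j) q x" for q
 define U where "U = {p. u p \<noteq> 0}"
 \<comment> \<open>\<open>K\<close> and \<open>K'\<close> collect the shifts whose coefficient can
   be nonzero on the wavelet side and on the coarse side; \<open>V\<close> collects all fine shifts
   reached from either.\<close>
 define K where "K = {k. \<exists>n\<in>Nb. zmul M k + n \<in> U}"
 define K' where "K' = {k. \<exists>n\<in>Nb. k + n \<in> U}"
 define V where "V = (%p. zmul M (fst p) + snd p) ` (K \<times> Nb) \<union> (%p. fst p + snd p) ` (K' \<times> Nb)"
 have U: "finite U" "!!p. p \<notin> U ==> u p = 0"
  using finite_coefficients [OF f(2) bd_\<phi>] by (auto simp: U_def u_def)
 have fK': "finite K'"
 proof (rule finite_subset)
  show "K' \<subseteq> (%p. fst p - snd p) ` (U \<times> Nb)"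
   by (auto simp: K'_def intro!: image_eqI [of _ _ "(k + n, n)" for k n])
 qed (use U Nb in auto)
 have "zmul M ` K \<subseteq> (%p. fst p - snd p) ` (U \<times> Nb)"
  by (auto simp: K_def intro!: image_eqI [of _ _ "(k + n, n)" for k n])
 then have "finite (zmul M ` K)" by (rule finite_subset) (use U Nb in auto)
 then have fK: "finite K" by (rule finite_imageD) (rule inj_on_subset [OF inj_zmul subset_UNIV])
 have fV: "finite V" unfolding V_def using fK fK' Nb by auto
 let ?A = "%\<beta> c. \<Sum>n\<in>Nb. cnj (\<beta> n) * u (c + n)" and ?B = "%\<beta> c. \<Sum>n\<in>Nb. \<beta> n * v (c + n)"
 have LD: "dilate_shift M \<phi> j' k \<in> L2" for j' k by (rule dilate_shift_L2 [OF \<phi>])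
 define G where "G l p q = (\<Sum>k\<in>K. cnj (b' l (p - zmul M k)) * b' l (q - zmul M k))" for l p q
 have w: "part (wavelet (b' l)) f j x = of_real D * (\<Sum>p\<in>U. \<Sum>q\<in>V. u p * v q * G l p q)" if l: "l \<le> s" for l
 proof -
  have c1: "L2_inner f (dilate_shift M (wavelet (b' l)) j k) = of_real (sqrt D) * ?A (b' l) (zmul M k)" for k
  proof -
   have "L2_inner f (dilate_shift M (wavelet (b' l)) j k) = (\<Sum>n | b' l n \<noteq> 0. cnj (of_real (sqrt D) * b' l n) * u (zmul M k + n))"
    unfolding dilate_shift_wavelet u_def by (rule L2_inner_sum_right [OF LD f(1)])
   also have "... = (\<Sum>n\<in>Nb. cnj (of_real (sqrt D) * b' l n) * u (zmul M k + n))"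
    using Nb(1,3) l by (intro sum.mono_neutral_left) auto
   finally show ?thesis by (simp add: sum_distrib_left mult.assoc)
  qed
  have c2: "dilate_shift M (wavelet (b' l)) j k x = of_real (sqrt D) * ?B (b' l) (zmul M k)" for k
  proof -
   have "dilate_shift M (wavelet (b' l)) j k x = (\<Sum>n\<in>Nb. of_real (sqrt D) * b' l n * v (zmul M k + n))"
    unfolding dilate_shift_wavelet v_def using Nb(1,3) l by (intro sum.mono_neutral_left) auto
   then show ?thesis by (simp add: sum_distrib_left mult.assoc)
  qed
  have D: "complex_of_real (sqrt D) * A * (of_real (sqrt D) * B) = of_real D * (A * B)" for A B
   by (metis mult.assoc mult.left_commute sqrt_D_mult)
  have "part (wavelet (b' l)) f j x = (\<Sum>k\<in>K. of_real D * (?A (b' l) (zmul M k) * ?B (b' l) (zmul M k)))"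
   unfolding D [symmetric] c1 [symmetric] c2 [symmetric]
  proof (rule part_superset [OF fK])
   fix k assume "L2_inner f (dilate_shift M (wavelet (b' l)) j k) \<noteq> 0"
   then have "?A (b' l) (zmul M k) \<noteq> 0" unfolding c1 by auto
   then obtain n where "n \<in> Nb" "cnj (b' l n) * u (zmul M k + n) \<noteq> 0" by (meson sum.not_neutral_contains_not_neutral)
   then show "k \<in> K" by (auto simp: K_def U_def)
  qed
  also have "... = of_real D * (\<Sum>k\<in>K. ?A (b' l) (zmul M k) * ?B (b' l) (zmul M k))" by (rule sum_distrib_left [symmetric])
  also have "(\<Sum>k\<in>K. ?A (b' l) (zmul M k) * ?B (b' l) (zmul M k)) = (\<Sum>p\<in>U. \<Sum>q\<in>V. u p * v q * G l p q)"
   unfolding G_def by (rule gram_sum [OF Nb(1) U(1) fV Nb(3) [OF l] U(2)]) (force simp: V_def)+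
  finally show ?thesis .
 qed
 have c1: "L2_inner f (dilate_shift M \<phi>' (Suc j) k) = ?A \<theta> k" for k
 proof -
  have "L2_inner f (dilate_shift M \<phi>' (Suc j) k) = (\<Sum>n | \<theta> n \<noteq> 0. cnj (\<theta> n) * u (k + n))"
   unfolding dilate_shift_\<phi>' u_def by (rule L2_inner_sum_right [OF LD f(1)])
  also have "... = ?A \<theta> k" using Nb(1,2) by (intro sum.mono_neutral_left) auto
  finally show ?thesis .
 qed
 have c2: "dilate_shift M \<phi>' (Suc j) k x = ?B \<theta> k" for k
  unfolding dilate_shift_\<phi>' v_def using Nb(1,2) by (intro sum.mono_neutral_left) auto
 have "part \<phi>' f (Suc j) x = (\<Sum>k\<in>K'. ?A \<theta> k * ?B \<theta> k)"
  unfolding c1 [symmetric] c2 [symmetric]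
 proof (rule part_superset [OF fK'])
  fix k assume "L2_inner f (dilate_shift M \<phi>' (Suc j) k) \<noteq> 0"
  then have "?A \<theta> k \<noteq> 0" unfolding c1 .
  then obtain n where "n \<in> Nb" "cnj (\<theta> n) * u (k + n) \<noteq> 0" by (meson sum.not_neutral_contains_not_neutral)
  then show "k \<in> K'" by (auto simp: K'_def U_def)
 qed
 also have "... = (\<Sum>p\<in>U. \<Sum>q\<in>V. u p * v q * (\<Sum>k\<in>K'. cnj (\<theta> (p - k)) * \<theta> (q - k)))"
  by (rule gram_sum [OF Nb(1) U(1) fV Nb(2) U(2)]) (force simp: V_def)+
 also have "... = (\<Sum>p\<in>U. \<Sum>q\<in>V. u p * v q * (of_real D * (\<Sum>l\<le>s. \<epsilon>' l * G l p q)))"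
 proof (intro sum.cong refl arg_cong [of _ _ "(*) _"])
  fix p q assume p: "p \<in> U"
  show "(\<Sum>k\<in>K'. cnj (\<theta> (p - k)) * \<theta> (q - k)) = of_real D * (\<Sum>l\<le>s. \<epsilon>' l * G l p q)"
   unfolding G_def
  proof (rule coefficient_identity [OF fK _ fK', symmetric])
   fix k assume "p - zmul M k \<in> Nb"
   then show "k \<in> K" using p unfolding K_def by (intro CollectI bexI [of _ "p - zmul M k"]) auto
  next
   fix k assume "p - k \<in> Nb"
   then show "k \<in> K'" using p unfolding K'_def by (intro CollectI bexI [of _ "p - k"]) auto
  qed
 qed
 also have "... = (\<Sum>p\<in>U. \<Sum>q\<in>V. \<Sum>l\<le>s. \<epsilon>' l * (of_real D * (u p * v q * G l p q)))"
  by (simp add: sum_distrib_left mult_ac)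
 also have "... = (\<Sum>p\<in>U. \<Sum>l\<le>s. \<Sum>q\<in>V. \<epsilon>' l * (of_real D * (u p * v q * G l p q)))"
  by (intro sum.cong refl sum.swap)
 also have "... = (\<Sum>l\<le>s. \<Sum>p\<in>U. \<Sum>q\<in>V. \<epsilon>' l * (of_real D * (u p * v q * G l p q)))" by (rule sum.swap)
 also have "... = (\<Sum>l\<le>s. \<epsilon>' l * part (wavelet (b' l)) f j x)"
  by (intro sum.cong refl) (simp add: w sum_distrib_left)
 finally show ?thesis ..
qed

lemma part_step:
 assumes f: "f \<in> L2" "bdsupp f"
 shows "AE x in leb. part \<phi>' f (Suc j) x = part \<phi>' f j x + (\<Sum>l=1..s. of_real (\<epsilon> l) * part (wavelet (b l)) f j x)"
 using part_cong_AE [OF wavelet_b'_0 wavelet_L2 \<phi>'_L2 f(1) f(2) \<phi>'_bd, of j]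
proof eventually_elim
 case (elim x)
 have "part \<phi>' f (Suc j) x = (\<Sum>l\<le>s. \<epsilon>' l * part (wavelet (b' l)) f j x)" by (rule telescope [OF f, symmetric])
 also have "... = \<epsilon>' 0 * part (wavelet (b' 0)) f j x + (\<Sum>l=1..s. \<epsilon>' l * part (wavelet (b' l)) f j x)"
  unfolding atMost_insert by simp
 also have "(\<Sum>l=1..s. \<epsilon>' l * part (wavelet (b' l)) f j x) = (\<Sum>l=1..s. of_real (\<epsilon> l) * part (wavelet (b l)) f j x)"
  by (intro sum.cong refl) (simp add: \<epsilon>'_def b'_def)
 finally show ?case by (simp add: elim \<epsilon>'_def)
qed

lemma part_sums:
 assumes f: "f \<in> L2" "bdsupp f"
 shows "AE x in leb. part \<phi>' f N x = part \<phi>' f 0 x + (\<Sum>j<N. \<Sum>l=1..s. of_real (\<epsilon> l) * part (wavelet (b l)) f j x)"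
proof (induction N)
 case (Suc N)
 then show ?case using part_step [OF f, of N] by eventually_elim simp
qed simp

end

section \<open>Convergence of the coarse operators and of the full expansion\<close>

subsection \<open>Approximation by the coarse operators\<close>

lemma L2_norm_mono_AE:
 assumes f: "f \<in> L2" and g: "g \<in> L2" and le: "AE x in leb. cmod (f x) \<le> cmod (g x)"
 shows "L2_norm f \<le> L2_norm g"
 unfolding L2_norm_def
proof (rule real_sqrt_le_mono, rule integral_mono_AE [OF L2_int [OF f] L2_int [OF g]])
 show "AE x in leb. (cmod (f x))^2 \<le> (cmod (g x))^2"
  using le by eventually_elim (rule power_mono, auto)
qed

context integer_matrix begin

lemma dil_integral:
 assumes h: "Lint h"
 shows "Lint (dil h)" "of_real (sqrt D) * (LI x. dil h x) = (LI x. h x)"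
proof -
 have m: "h \<in> Lmeas" using h by auto
 show "Lint (dil h)" unfolding dil_def
  by (intro integrable_mult_right) (simp add: integrable_matrix [OF invM m] h)
 show "of_real (sqrt D) * (LI x. dil h x) = (LI x. h x)"
  unfolding dil_def integral_mult_right_zero sqrt_D_mult using integral_matrix [OF invM m] by (simp add: scaleR_conv_of_real)
qed

lemma dilate_shift_integral:
 assumes h: "Lint h"
 shows "Lint (dilate_shift M h j k)"
  and "of_real (sqrt D ^ j) * (LI x. dilate_shift M h j k x) = (LI x. h x)"
proof -
 have hm: "h \<in> Lmeas" using h by auto
 have "Lint (dilate_shift M h j k) \<and> of_real (sqrt D ^ j) * (LI x. dilate_shift M h j k x) = (LI x. h x)"
 proof (induction j)
  case 0
  show ?case using integrable_translate [OF hm, of "- of_lattice k"] integral_translate [OF hm, of "- of_lattice k"] h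
   by (simp add: dilate_shift_0 shift_def)
 next
  case (Suc j)
  have "of_real (sqrt D ^ Suc j) * (LI x. dilate_shift M h (Suc j) k x)
    = of_real (sqrt D ^ j) * (of_real (sqrt D) * (LI x. dil (dilate_shift M h j k) x))"
   unfolding dilate_shift_Suc power_Suc2 of_real_mult mult.assoc ..
  also have "... = of_real (sqrt D ^ j) * (LI x. dilate_shift M h j k x)"
   unfolding dil_integral(2) [OF conjunct1 [OF Suc]] ..
  also have "... = (LI x. h x)" by (rule conjunct2 [OF Suc])
  finally show ?case unfolding dilate_shift_Suc using dil_integral(1) [OF conjunct1 [OF Suc]] by blast
 qed
 then show "Lint (dilate_shift M h j k)"
  and "of_real (sqrt D ^ j) * (LI x. dilate_shift M h j k x) = (LI x. h x)" by auto
qed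

lemma dilate_shift_sqrt: "dilate_shift M f n k x = of_real (sqrt D ^ n) * f (mpow M n x - of_lattice k)"
proof -
 have "D powr (real n / 2) = sqrt D ^ n"
 proof -
  have "D powr (real n / 2) = (D powr (1 / 2)) powr real n" by (simp add: powr_powr)
  also have "... = sqrt D ^ n" using D_pos by (simp add: powr_half_sqrt powr_realpow)
  finally show ?thesis .
 qed
 then show ?thesis unfolding dilate_shift_eq by simp
qed

end

context refinable begin

text \<open>Pointwise convergence on the basis vectors bounds the operator norms by a null sequence,
  so supports at level j shrink uniformly.\<close>

lemma mpow_Mi_norm:
 obtains E where "!!n. 0 \<le> E n" "!!n w. norm (mpow Mi n w) \<le> E n * norm w" "E \<longlonglongrightarrow> 0"
proof -
 define E where "E n = (\<Sum>i\<in>UNIV. norm (mpow Mi n (axis i 1)))" for n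
 have "norm (mpow Mi n w) \<le> E n * norm w" for n w
 proof -
  have "mpow Mi n w = mpow Mi n (\<Sum>i\<in>UNIV. w $ i *\<^sub>R axis i 1)" by (simp add: basis_expansion scalar_mult_eq_scaleR [symmetric])
  also have "... = (\<Sum>i\<in>UNIV. w $ i *\<^sub>R mpow Mi n (axis i 1))"
   by (simp only: linear_sum [OF linear_mpow] linear_cmul [OF linear_mpow])
  finally have "norm (mpow Mi n w) \<le> (\<Sum>i\<in>UNIV. \<bar>w $ i\<bar> * norm (mpow Mi n (axis i 1)))"
   by (metis (no_types, lifting) norm_scaleR norm_sum sum.cong)
  also have "... \<le> (\<Sum>i\<in>UNIV. norm w * norm (mpow Mi n (axis i 1)))"
   by (intro sum_mono mult_right_mono component_le_norm_cart) auto
  finally show ?thesis by (simp add: E_def sum_distrib_left mult.commute)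
 qed
 moreover have "E \<longlonglongrightarrow> 0"
 proof -
  have "(%n. \<Sum>i\<in>UNIV. norm (mpow Mi n (axis i 1))) \<longlonglongrightarrow> (\<Sum>i\<in>(UNIV :: 'n set). norm (0 :: real ^ 'n))" by (intro tendsto_intros contr)
  then show ?thesis by (simp add: E_def [abs_def])
 qed
 moreover have "0 \<le> E n" for n unfolding E_def by (intro sum_nonneg) auto
 ultimately show ?thesis using that by blast
qed

text \<open>The cardinality bound is the Bessel inequality for the shifts of the indicator of a ball,
 applied to the indicator of a large ball.\<close>
lemma relevant_shifts:
 assumes B: "0 \<le> B" and r: "0 \<le> r"
 obtains C where "!!j. finite {k. \<exists>x. norm x \<le> B \<and> norm (mpow M j x - of_lattice k) \<le> r}"
  "!!j. real (card {k. \<exists>x. norm x \<le> B \<and> norm (mpow M j x - of_lattice k) \<le> r}) \<le> C * D ^ j"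
proof -
 obtain E where E: "!!n. 0 \<le> E n" "!!n w. norm (mpow Mi n w) \<le> E n * norm w" "E \<longlonglongrightarrow> 0"
  using mpow_Mi_norm by blast
 have "Bseq E" by (rule convergent_imp_Bseq [OF convergentI [OF E(3)]])
 then obtain Y where Y: "0 < Y" "!!n. norm (E n) \<le> Y" unfolding Bseq_def by blast
 \<comment> \<open>Large enough to contain the support of every bump at a shift counted below: its
   points differ from some x of norm at most \<open>B\<close> by at most Y(r + 1). The inner product
   with \<open>F\<close> is therefore the full integral of the bump.\<close>
 define B'' where "B'' = B + Y * (r + 1)"
 define g :: "real ^ 'n => complex" where "g = (%x. of_real (indicator (cball 0 1) x))"
 define F :: "real ^ 'n => complex" where "F = (%x. of_real (indicator (cball 0 B'') x))"
 have ind: "Lint (%x :: real ^ 'n. complex_of_real (indicator (cball 0 c) x))" for c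
  by (simp only: complex_of_real_integrable_eq integrable_indicator_cball)
 have indL: "(%x :: real ^ 'n. complex_of_real (indicator (cball 0 c) x)) \<in> L2" for c
 proof (rule L2I)
  show "(%x :: real ^ 'n. complex_of_real (indicator (cball 0 c) x)) \<in> Lmeas" using ind [of c] by auto
  have "(%x :: real ^ 'n. (cmod (complex_of_real (indicator (cball 0 c) x)))^2) = indicator (cball 0 c)"
   by (auto simp: indicator_def)
  then show "Lint (%x :: real ^ 'n. (cmod (complex_of_real (indicator (cball 0 c) x)))^2)"
   by (simp only: integrable_indicator_cball)
 qed
 have g: "g \<in> L2" "Lint g" "bsupp 1 g" using ind indL by (auto simp: g_def bsupp_def indicator_def)
 have F: "F \<in> L2" unfolding F_def by (rule indL)
 define V where "V = measure leb (cball (0 :: real ^ 'n) 1)"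
 have V: "0 < V" unfolding V_def by (simp add: content_cball_pos)
 have gV: "(LI x. g x) = of_real V"
  unfolding g_def V_def by (subst integral_complex_of_real) simp
 define C0 where "C0 = overlap TYPE('n) 1 * (L2_norm g)^2 * (L2_norm F)^2"
 let ?S = "%j. {k. \<exists>x. norm x \<le> B \<and> norm (mpow M j x - of_lattice k) \<le> r}"
 have inner: "(cmod (L2_inner F (dilate_shift M g j k)))^2 = V^2 / D ^ j" if k: "k \<in> ?S j" for j k
 proof -
  obtain x where x: "norm x \<le> B" "norm (mpow M j x - of_lattice k) \<le> r" using k by blast
  have "F y * cnj (dilate_shift M g j k y) = dilate_shift M g j k y" for y
  proof (cases "dilate_shift M g j k y = 0")
   case False
   then have "g (mpow M j y - of_lattice k) \<noteq> 0" by (auto simp: dilate_shift_eq)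
   then have 1: "norm (mpow M j y - of_lattice k) \<le> 1" by (rule bsuppD [OF g(3)])
   have "y - x = mpow Mi j (mpow M j (y - x))" by simp
   then have "norm (y - x) \<le> E j * norm (mpow M j (y - x))" using E(2) by metis
   also have "... \<le> Y * (r + 1)"
   proof (intro mult_mono)
    show "E j \<le> Y" using Y(2) [of j] by simp
    have "mpow M j (y - x) = (mpow M j y - of_lattice k) - (mpow M j x - of_lattice k)" by (simp add: mpow_diff)
    then have "norm (mpow M j (y - x)) \<le> norm (mpow M j y - of_lattice k) + norm (mpow M j x - of_lattice k)" by (metis norm_triangle_ineq4)
    then show "norm (mpow M j (y - x)) \<le> r + 1" using 1 x(2) by linarith
   qed (use Y in auto)
   finally have "norm y \<le> B''" using norm_triangle_ineq [of x "y - x"] x(1) by (simp add: B''_def)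
   then show ?thesis by (simp add: F_def dilate_shift_eq g_def)
  qed simp
  then have "L2_inner F (dilate_shift M g j k) = (LI y. dilate_shift M g j k y)" by (simp add: L2_inner_def)
  then have "complex_of_real (sqrt D ^ j) * L2_inner F (dilate_shift M g j k) = of_real V"
   using dilate_shift_integral(2) [OF g(2), of j k] gV by simp
  then have "(cmod (complex_of_real (sqrt D ^ j) * L2_inner F (dilate_shift M g j k)))^2 = V^2" using V by simp
  moreover have "(sqrt D ^ j)^2 = D ^ j" by (simp add: power_even_abs power_mult [symmetric] mult.commute [of j]) (simp add: power_mult)
  ultimately have "D ^ j * (cmod (L2_inner F (dilate_shift M g j k)))^2 = V^2"
   using D_pos by (simp only: norm_mult power_mult_distrib norm_of_real power2_abs)
  then show ?thesis using D_pos by (simp add: field_simps)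
 qed
 have cardle: "real (card K) \<le> C0 / V^2 * D ^ j" if K: "finite K" "K \<subseteq> ?S j" for K j
 proof -
  have "(\<Sum>k\<in>K. (cmod (L2_inner F (dilate_shift M g j k)))^2) \<le> (overlap TYPE('n) 1 * (L2_norm g)^2) * (L2_norm F)^2"
   by (rule synthesis_imp_analysis [OF dilate_shift_L2 [OF g(1)] F bessel_level [OF g(1,3) K(1)]]) (simp add: overlap_def)
  moreover have "(\<Sum>k\<in>K. (cmod (L2_inner F (dilate_shift M g j k)))^2) = (\<Sum>k\<in>K. V^2 / D ^ j)"
   using K(2) by (intro sum.cong refl inner) blast
  ultimately have "real (card K) * (V^2 / D ^ j) \<le> C0" by (simp add: C0_def)
  then show ?thesis using V D_pos by (simp add: field_simps)
 qed
 have "finite (?S j) \<and> card (?S j) \<le> nat \<lfloor>C0 / V^2 * D ^ j\<rfloor>" for j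
 proof (rule finite_if_finite_subsets_card_bdd)
  fix K assume "K \<subseteq> ?S j" "finite K"
  then have "real (card K) \<le> C0 / V^2 * D ^ j" using cardle by blast
  then show "card K \<le> nat \<lfloor>C0 / V^2 * D ^ j\<rfloor>" by (simp add: le_nat_floor)
 qed
 then have fin: "finite (?S j)" for j by blast
 show ?thesis using that [of "C0 / V^2"] fin cardle by blast
qed

end

context framelet_system begin

lemma partition_of_unity:
 "AE x in leb. \<forall>K. finite K \<longrightarrow> {k. \<phi>' (x - of_lattice k) \<noteq> 0} \<subseteq> K \<longrightarrow> (\<Sum>k\<in>K. \<phi>' (x - of_lattice k)) = 1"
proof -
 obtain r where r: "bsupp r \<phi>'" using \<phi>'_bd by (auto simp: bdsupp_def)
 have "fourier \<phi>' (tp (of_lattice k)) = 0" if "k \<noteq> 0" for k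
  unfolding \<phi>'_fourier using fourier_lattice_zero [OF fourier_refine a_zero that] by simp
 moreover have "fourier \<phi>' 0 = 1" by (simp add: \<phi>'_fourier \<theta>_0)
 ultimately show ?thesis using poisson_everywhere [OF bdsupp_integrable [OF \<phi>'_L2 \<phi>'_bd] r] by simp
qed

text \<open>By the partition of unity the error at x is the sum of the terms \<phi>'(M^j x - k)
  times the deviation of a normalized coefficient from f(x), and the Lipschitz bound makes this
  deviation O(E j). The number of relevant shifts grows like |det M|^j, which the normalization of
  the level offsets in the Bessel bound.\<close>

lemma part_tendsto:
 assumes f: "lipbd f"
 shows "(%j. L2_norm (%x. part \<phi>' f j x - f x)) \<longlonglongrightarrow> 0"
proof -
 have fL: "f \<in> L2" by (rule lipbd_L2 [OF f])
 obtain L0 B0 where L0: "!!x y. cmod (f x - f y) \<le> L0 * norm (x - y)" and B0: "!!x. norm x > B0 ==> f x = 0"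
  using f by (auto simp: lipbd_def)
 define L where "L = \<bar>L0\<bar>"
 define B where "B = max 0 B0"
 have L: "0 \<le> L" "cmod (f x - f y) \<le> L * norm (x - y)" for x y
  unfolding L_def using order_trans [OF L0 mult_right_mono [OF abs_ge_self norm_ge_zero]] by auto
 have B: "0 \<le> B" "bsupp B f" using B0 by (auto simp: B_def bsupp_def)
 have fbd: "bdsupp f" using B(2) by (rule bdsuppI)
 obtain r where r: "0 \<le> r" "bsupp r \<phi>'" using \<phi>'_bd by (auto simp: bdsupp_def)
 obtain E where E: "!!n. 0 \<le> E n" "!!n w. norm (mpow Mi n w) \<le> E n * norm w" "E \<longlonglongrightarrow> 0"
  using mpow_Mi_norm by blast
 have "Bseq E" by (rule convergent_imp_Bseq [OF convergentI [OF E(3)]])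
 then obtain Y where Y: "0 < Y" "!!n. norm (E n) \<le> Y" unfolding Bseq_def by blast
 \<comment> \<open>Beyond this radius both \<open>f\<close> and its coarse approximations vanish,
   since two points in the support of one element differ by at most 2rY.\<close>
 define B' where "B' = B + Y * (2 * r)"
 have B': "0 \<le> B'" using B Y r by (simp add: B'_def)
 define S where "S j = {k. \<exists>x. norm x \<le> B' \<and> norm (mpow M j x - of_lattice k) \<le> r}" for j
 obtain C where S: "!!j. finite (S j)" "!!j. real (card (S j)) \<le> C * D ^ j"
  unfolding S_def using relevant_shifts [OF B' r(1)] by blast
 \<comment> \<open>The pointwise estimate involves |\<phi>'|, so the Bessel bound is applied to the
   shifts of the absolute value.\<close>
 define h where "h = (%x. complex_of_real (cmod (\<phi>' x)))"
 have h: "h \<in> L2" "bsupp r h" unfolding h_def using L2_norm_fun [OF \<phi>'_L2] r by (auto simp: bsupp_def)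
 have \<phi>'i: "Lint \<phi>'" by (rule bdsupp_integrable [OF \<phi>'_L2 \<phi>'_bd])
 define I1 where "I1 = (LI x. cmod (\<phi>' x))"
 have I1: "0 \<le> I1" "(LI x. h x) = of_real I1"
  by (simp_all add: I1_def h_def integral_complex_of_real)
 have hi: "Lint h" using bdsupp_integrable [OF h(1) bdsuppI [OF h(2)]] .
 have one: "of_real (sqrt D ^ j) * (LI y. dilate_shift M \<phi>' j k y) = 1" for j k
 proof -
  have "(LI x. \<phi>' x) = fourier \<phi>' 0" by (simp add: fourier_def)
  then show ?thesis unfolding dilate_shift_integral(2) [OF \<phi>'i] by (simp add: \<phi>'_fourier \<theta>_0)
 qed
 have dn: "cmod (dilate_shift M \<phi>' j k y) = sqrt D ^ j * cmod (\<phi>' (mpow M j y - of_lattice k))" for j k y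
  using D_pos by (simp add: dilate_shift_sqrt norm_mult norm_power)
 have dh: "dilate_shift M h j k y = of_real (cmod (dilate_shift M \<phi>' j k y))" for j k y
  unfolding dn by (simp add: dilate_shift_sqrt h_def)
 have dL: "dilate_shift M \<phi>' j k \<in> L2" for j k by (rule dilate_shift_L2 [OF \<phi>'_L2])
 have near: "norm (x - y) \<le> E j * (2 * r)"
  if "norm (mpow M j x - of_lattice k) \<le> r" "norm (mpow M j y - of_lattice k) \<le> r" for x y j k
 proof -
  have "x - y = mpow Mi j (mpow M j (x - y))" by simp
  then have "norm (x - y) \<le> E j * norm (mpow M j (x - y))" using E(2) by metis
  also have "... \<le> E j * (2 * r)"
  proof (intro mult_left_mono E)
   have "mpow M j (x - y) = (mpow M j x - of_lattice k) - (mpow M j y - of_lattice k)" by (simp add: mpow_diff)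
   then have "norm (mpow M j (x - y)) \<le> norm (mpow M j x - of_lattice k) + norm (mpow M j y - of_lattice k)" by (metis norm_triangle_ineq4)
   then show "norm (mpow M j (x - y)) \<le> 2 * r" using that by linarith
  qed
  finally show ?thesis .
 qed
 have coef: "cmod (of_real (sqrt D ^ j) * L2_inner f (dilate_shift M \<phi>' j k) - f x) \<le> L * (E j * (2 * r)) * I1"
  if x: "norm (mpow M j x - of_lattice k) \<le> r" for x j k
 proof -
  let ?d = "dilate_shift M \<phi>' j k"
  have di: "Lint ?d" by (rule dilate_shift_integral(1) [OF \<phi>'i])
  have ci: "Lint (%y. cnj (?d y))" using di by (rule integrable_cnj)
  have "cnj (of_real (sqrt D ^ j) * (LI y. ?d y)) = 1" unfolding one by simp
  then have o: "of_real (sqrt D ^ j) * (LI y. cnj (?d y)) = 1"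
   by (simp add: Bochner_Integration.integral_cnj)
  have "(LI y. (f y - f x) * cnj (?d y)) = L2_inner f ?d - f x * (LI y. cnj (?d y))"
  proof -
   have "(LI y. (f y - f x) * cnj (?d y)) = (LI y. f y * cnj (?d y) - f x * cnj (?d y))" by (simp add: left_diff_distrib)
   also have "... = (LI y. f y * cnj (?d y)) - (LI y. f x * cnj (?d y))"
    by (intro Bochner_Integration.integral_diff L2_inner_integrable fL dL integrable_mult_right ci)
   finally show ?thesis by (simp add: L2_inner_def integral_mult_right_zero)
  qed
  then have "of_real (sqrt D ^ j) * (LI y. (f y - f x) * cnj (?d y))
    = of_real (sqrt D ^ j) * L2_inner f ?d - f x * (of_real (sqrt D ^ j) * (LI y. cnj (?d y)))"
   by (simp only: right_diff_distrib mult.left_commute)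
  then have "of_real (sqrt D ^ j) * L2_inner f ?d - f x = of_real (sqrt D ^ j) * (LI y. (f y - f x) * cnj (?d y))"
   unfolding o by simp
  then have "cmod (of_real (sqrt D ^ j) * L2_inner f ?d - f x) = sqrt D ^ j * cmod (LI y. (f y - f x) * cnj (?d y))"
   using D_pos by (simp add: norm_mult norm_power)
  also have "... \<le> sqrt D ^ j * (LI y. L * (E j * (2 * r)) * cmod (?d y))"
  proof (intro mult_left_mono)
   have pt: "cmod ((f y - f x) * cnj (?d y)) \<le> L * (E j * (2 * r)) * cmod (?d y)" for y
   proof (cases "?d y = 0")
    case False
    then have "\<phi>' (mpow M j y - of_lattice k) \<noteq> 0" by (auto simp: dilate_shift_eq)
    then have "norm (mpow M j y - of_lattice k) \<le> r" by (rule bsuppD [OF r(2)])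
    then have "norm (y - x) \<le> E j * (2 * r)" using near x by blast
    then have "cmod (f y - f x) \<le> L * (E j * (2 * r))" by (intro order_trans [OF L(2)] mult_left_mono L)
    then show ?thesis unfolding norm_mult complex_mod_cnj by (intro mult_right_mono) auto
   qed simp
   have "cmod (LI y. (f y - f x) * cnj (?d y)) \<le> (LI y. cmod ((f y - f x) * cnj (?d y)))" by (rule integral_norm_bound)
   also have "... \<le> (LI y. L * (E j * (2 * r)) * cmod (?d y))"
   proof (rule integral_mono [OF _ _ pt])
    have "Lint (%y. f y * cnj (?d y) - f x * cnj (?d y))"
     by (intro Bochner_Integration.integrable_diff L2_inner_integrable fL dL integrable_mult_right ci)
    then show "Lint (%y. cmod ((f y - f x) * cnj (?d y)))" by (intro integrable_norm) (simp add: left_diff_distrib)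
    show "Lint (%y. L * (E j * (2 * r)) * cmod (?d y))" by (intro integrable_mult_right integrable_norm di)
   qed
   finally show "cmod (LI y. (f y - f x) * cnj (?d y)) \<le> (LI y. L * (E j * (2 * r)) * cmod (?d y))" .
  qed (use D_pos in auto)
  also have "... = L * (E j * (2 * r)) * (sqrt D ^ j * (LI y. cmod (?d y)))" by (simp add: integral_mult_right_zero)
  also have "sqrt D ^ j * (LI y. cmod (?d y)) = I1"
  proof -
   have "complex_of_real (sqrt D ^ j * (LI y. cmod (?d y))) = of_real (sqrt D ^ j) * (LI y. dilate_shift M h j k y)"
    unfolding dh by (subst integral_complex_of_real) simp
   also have "... = of_real I1" unfolding dilate_shift_integral(2) [OF hi] by (rule I1(2))
   finally show ?thesis by (simp only: of_real_eq_iff)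
  qed
  finally show ?thesis .
 qed
 \<comment> \<open>The uniform error of a normalized coefficient, rescaled to the elements of level
   j; its square compensates the number of shifts in \<open>S j\<close>.\<close>
 define c where "c j = L * (E j * (2 * r)) * I1 / sqrt D ^ j" for j
 have c0: "0 \<le> c j" for j unfolding c_def using L E r I1 D_pos by (intro divide_nonneg_nonneg mult_nonneg_nonneg) auto
 define W where "W j = (%x. \<Sum>k\<in>S j. complex_of_real (c j) * dilate_shift M h j k x)" for j
 have WL: "W j \<in> L2" for j unfolding W_def by (intro L2_sum L2_scale dilate_shift_L2 h)
 have AEj: "AE x in leb. \<forall>K. finite K \<longrightarrow> {k. \<phi>' (mpow M j x - of_lattice k) \<noteq> 0} \<subseteq> K \<longrightarrow> (\<Sum>k\<in>K. \<phi>' (mpow M j x - of_lattice k)) = 1" for j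
 proof (induction j)
  case 0
  show ?case using partition_of_unity by simp
 next
  case (Suc j)
  from AE_matrix [OF invM Suc] show ?case by (simp add: mpow_Suc')
 qed
 have bound: "AE x in leb. cmod (part \<phi>' f j x - f x) \<le> cmod (W j x)" for j
  using AEj [of j]
 proof eventually_elim
  case (elim x)
  let ?A = "{k. \<phi>' (mpow M j x - of_lattice k) \<noteq> 0}"
  let ?F = "{k. L2_inner f (dilate_shift M \<phi>' j k) \<noteq> 0}"
  have Ar: "norm (mpow M j x - of_lattice k) \<le> r" if "k \<in> ?A" for k using that by (intro bsuppD [OF r(2)]) simp
  have finF: "finite ?F" by (rule finite_coefficients [OF fbd \<phi>'_bd])
  show ?case
  proof (cases "norm x \<le> B'")
   case True
   have AS: "?A \<subseteq> S j" using Ar True by (auto simp: S_def)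
   have finA: "finite ?A" by (rule finite_subset [OF AS S(1)])
   have "part \<phi>' f j x = (\<Sum>k\<in>?F \<union> ?A. L2_inner f (dilate_shift M \<phi>' j k) * dilate_shift M \<phi>' j k x)"
    by (rule part_superset) (use finF finA in auto)
   also have "... = (\<Sum>k\<in>?A. L2_inner f (dilate_shift M \<phi>' j k) * dilate_shift M \<phi>' j k x)"
    using finF finA by (intro sum.mono_neutral_right) (auto simp: dilate_shift_eq)
   also have "... = (\<Sum>k\<in>?A. of_real (sqrt D ^ j) * L2_inner f (dilate_shift M \<phi>' j k) * \<phi>' (mpow M j x - of_lattice k))"
    by (simp add: dilate_shift_sqrt mult_ac)
   finally have P: "part \<phi>' f j x = ..." .
   have "f x = f x * (\<Sum>k\<in>?A. \<phi>' (mpow M j x - of_lattice k))" using elim [rule_format, OF finA order_refl] by simp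
   then have "part \<phi>' f j x - f x = (\<Sum>k\<in>?A. of_real (sqrt D ^ j) * L2_inner f (dilate_shift M \<phi>' j k) * \<phi>' (mpow M j x - of_lattice k)) - f x * (\<Sum>k\<in>?A. \<phi>' (mpow M j x - of_lattice k))"
    unfolding P by (rule arg_cong)
   also have "... = (\<Sum>k\<in>?A. (of_real (sqrt D ^ j) * L2_inner f (dilate_shift M \<phi>' j k) - f x) * \<phi>' (mpow M j x - of_lattice k))"
    by (simp only: sum_distrib_left left_diff_distrib sum_subtractf)
   finally have "cmod (part \<phi>' f j x - f x) \<le> (\<Sum>k\<in>?A. cmod (of_real (sqrt D ^ j) * L2_inner f (dilate_shift M \<phi>' j k) - f x) * cmod (\<phi>' (mpow M j x - of_lattice k)))"
    by (simp only: norm_mult [symmetric] norm_sum)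
   also have "... \<le> (\<Sum>k\<in>?A. L * (E j * (2 * r)) * I1 * cmod (\<phi>' (mpow M j x - of_lattice k)))"
    by (intro sum_mono mult_right_mono coef Ar) auto
   also have "... \<le> (\<Sum>k\<in>S j. L * (E j * (2 * r)) * I1 * cmod (\<phi>' (mpow M j x - of_lattice k)))"
    using L E r I1 by (intro sum_mono2 S AS mult_nonneg_nonneg) auto
   also have "... = (\<Sum>k\<in>S j. c j * cmod (dilate_shift M \<phi>' j k x))"
    unfolding dn c_def using D_pos by (intro sum.cong refl) simp
   also have "... = cmod (W j x)"
   proof -
    have "W j x = complex_of_real (\<Sum>k\<in>S j. c j * cmod (dilate_shift M \<phi>' j k x))" unfolding W_def dh by simp
    then have "cmod (W j x) = \<bar>\<Sum>k\<in>S j. c j * cmod (dilate_shift M \<phi>' j k x)\<bar>" by (simp only: norm_of_real)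
    also have "... = (\<Sum>k\<in>S j. c j * cmod (dilate_shift M \<phi>' j k x))" by (intro abs_of_nonneg sum_nonneg mult_nonneg_nonneg c0) auto
    finally show ?thesis ..
   qed
   finally show ?thesis .
  next
   case False
   have "norm x > B" using False Y r by (smt (verit) B'_def mult_nonneg_nonneg)
   then have fx: "f x = 0" using B(2) by (simp add: bsupp_def)
   have "L2_inner f (dilate_shift M \<phi>' j k) * dilate_shift M \<phi>' j k x = 0" for k
   proof (rule ccontr)
    assume nz: "L2_inner f (dilate_shift M \<phi>' j k) * dilate_shift M \<phi>' j k x \<noteq> 0"
    then have kA: "k \<in> ?A" by (auto simp: dilate_shift_eq)
    have "L2_inner f (dilate_shift M \<phi>' j k) \<noteq> 0" using nz by simp
    then obtain y where y: "f y \<noteq> 0" "\<phi>' (mpow M j y - of_lattice k) \<noteq> 0"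
     by (rule L2_inner_nonzeroE) (auto simp: dilate_shift_eq intro: that)
    have "norm (x - y) \<le> E j * (2 * r)" by (rule near [OF Ar [OF kA] bsuppD [OF r(2) y(2)]])
    also have "... \<le> Y * (2 * r)" using Y(2) [of j] r by (intro mult_right_mono) auto
    finally have "norm x \<le> B'" using bsuppD [OF B(2) y(1)] norm_triangle_ineq [of "x - y" y] by (simp add: B'_def)
    then show False using False by simp
   qed
   then have "part \<phi>' f j x = 0" unfolding part_def by (simp only: sum.neutral_const)
   then show ?thesis using fx by simp
  qed
 qed
 define K0 where "K0 = sqrt (overlap TYPE('n) r * (L2_norm h)^2 * C) * (L * (2 * r) * I1)"
 have "L2_norm (%x. part \<phi>' f j x - f x) \<le> K0 * E j" for j
 proof -
  have ov: "0 \<le> overlap TYPE('n) r * (L2_norm h)^2" by (simp add: overlap_def)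
  have C0: "0 \<le> C" using S(2) [of 0] by simp
  have "L2_norm (%x. part \<phi>' f j x - f x) \<le> L2_norm (W j)"
   by (rule L2_norm_mono_AE [OF _ WL bound]) (intro L2_diff part_L2 \<phi>'_L2 fL)
  also have "... \<le> K0 * E j"
  proof (rule power2_le_imp_le)
   have "(L2_norm (W j))^2 \<le> overlap TYPE('n) r * (L2_norm h)^2 * (\<Sum>k\<in>S j. (cmod (complex_of_real (c j)))^2)"
    unfolding W_def by (rule bessel_level [OF h S(1)])
   also have "... = overlap TYPE('n) r * (L2_norm h)^2 * (real (card (S j)) * (c j)^2)" by simp
   also have "... \<le> overlap TYPE('n) r * (L2_norm h)^2 * (C * D ^ j * (c j)^2)"
    by (intro mult_left_mono mult_right_mono S ov) auto
   also have "D ^ j * (c j)^2 = (L * (E j * (2 * r)) * I1)^2"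
   proof -
    have "(sqrt D ^ j)^2 = D ^ j" by (simp add: power_even_abs power_mult [symmetric] mult.commute [of j]) (simp add: power_mult)
    then show ?thesis using D_pos by (simp add: c_def power_divide)
   qed
   then have "C * D ^ j * (c j)^2 = C * (L * (E j * (2 * r)) * I1)^2" by (simp only: mult.assoc)
   then have "overlap TYPE('n) r * (L2_norm h)^2 * (C * D ^ j * (c j)^2) = (overlap TYPE('n) r * (L2_norm h)^2 * C) * (L * (E j * (2 * r)) * I1)^2"
    by (simp only: mult.assoc)
   also have "... = (K0 * E j)^2"
    unfolding K0_def power_mult_distrib using ov C0 by (simp add: mult_nonneg_nonneg power_mult_distrib mult_ac)
   finally show "(L2_norm (W j))^2 \<le> (K0 * E j)^2" .
   show "0 \<le> K0 * E j" unfolding K0_def using L r I1 E ov C0 by (intro mult_nonneg_nonneg real_sqrt_ge_zero) (auto simp: overlap_def)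
  qed
  finally show ?thesis .
 qed
 moreover have "(%j. K0 * E j) \<longlonglongrightarrow> 0" using tendsto_mult_right_zero [OF E(3), of K0] .
 ultimately show ?thesis
  by (intro Lim_null_comparison [of "%j. L2_norm (%x. part \<phi>' f j x - f x)" "%j. K0 * E j"]) auto
qed

end

subsection \<open>The framelet property\<close>

lemma sum_le_infsum_ennreal:
 fixes f :: "'i => ennreal"
 assumes "finite F" "F \<subseteq> A" shows "sum f F \<le> infsum f A"
 by (subst nonneg_infsum_complete) (use assms in \<open>auto intro: SUP_upper2\<close>)

lemma infsum_le_ennreal:
 fixes f :: "'i => ennreal"
 assumes "!!F. finite F ==> F \<subseteq> A ==> sum f F \<le> c" shows "infsum f A \<le> c"
 by (rule infsum_le_finite_sums [OF nonneg_summable_on_complete assms]) auto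

lemma sum_infsum_ennreal:
 fixes g :: "'p => 'i => ennreal"
 assumes "finite P" shows "(\<Sum>p\<in>P. infsum (g p) A) = infsum (%k. \<Sum>p\<in>P. g p k) A"
 using assms
proof (induction P rule: finite_induct)
 case (insert p P)
 have s: "f summable_on A" for f :: "'i => ennreal" by (rule nonneg_summable_on_complete) simp
 show ?case using insert infsum_add [OF s s, of "g p" "%k. \<Sum>p\<in>P. g p k"] by simp
qed simp

context framelet_system begin

abbreviation "I \<equiv> (framelet_indices s :: 'n framelet_index set)"
abbreviation "\<psi> l \<equiv> wavelet (b l)"
abbreviation "el \<equiv> framelet_elem M \<phi>' (%l. wavelet (b l))"
abbreviation "co f i \<equiv> L2_inner f (framelet_elem M \<phi>' (%l. wavelet (b l)) i)"

lemma el_L2: "el i \<in> L2"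
 by (induction i rule: framelet_elem.induct [where ?P = "%_ _ _ i. el i \<in> L2"])
  (auto intro: shift_L2 dilate_shift_L2 \<phi>'_L2 wavelet_L2)

lemma sign_norm: "i \<in> I ==> cmod (framelet_sign \<epsilon> i) = 1"
 using \<epsilon> by (fastforce simp: framelet_indices_def)

text \<open>The Bessel estimates concern all levels below some J together with one finite set of
  shifts; every finite set of indices lies in such a box.\<close>

lemma index_box:
 assumes F: "finite F" "F \<subseteq> I"
 obtains J K where "finite K" "F \<subseteq> Inl ` K \<union> Inr ` ({..<J} \<times> {1..s} \<times> K)"
proof -
 define K where "K = (%i. case i of Inl k => k | Inr p => snd (snd p)) ` F"
 define J where "J = Suc (Max (insert 0 ((%i. case i of Inl k => 0 | Inr p => fst p) ` F)))"
 have "F \<subseteq> Inl ` K \<union> Inr ` ({..<J} \<times> {1..s} \<times> K)"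
 proof
  fix i assume i: "i \<in> F"
  have K: "(case i of Inl k => k | Inr p => snd (snd p)) \<in> K" unfolding K_def using i by (rule imageI)
  have J: "(case i of Inl k => 0 | Inr p => fst p) < J" unfolding J_def less_Suc_eq_le using i F by (intro Max_ge) auto
  show "i \<in> Inl ` K \<union> Inr ` ({..<J} \<times> {1..s} \<times> K)"
  proof (cases i)
   case (Inl k)
   then show ?thesis using K by simp
  next
   case (Inr p)
   obtain j l k where p: "p = (j, l, k)" by (cases p)
   have "l \<in> {1..s}" using i F(2) Inr p by (auto simp: framelet_indices_def)
   then show ?thesis using K J Inr p by auto
  qed
 qed
 moreover have "finite K" unfolding K_def using F by simp
 ultimately show ?thesis using that by blast
qed

lemma sum_index_box:
 fixes q :: "'n framelet_index => real"
 assumes "finite K"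
 shows "sum q (Inl ` K \<union> Inr ` ({..<J} \<times> {1..s} \<times> K)) = (\<Sum>k\<in>K. q (Inl k)) + (\<Sum>j<J. \<Sum>l=1..s. \<Sum>k\<in>K. q (Inr (j, l, k)))"
proof -
 have "sum q (Inl ` K \<union> Inr ` ({..<J} \<times> {1..s} \<times> K)) = sum q (Inl ` K) + sum q (Inr ` ({..<J} \<times> {1..s} \<times> K))"
  using assms by (intro sum.union_disjoint) auto
 also have "sum q (Inl ` K) = (\<Sum>k\<in>K. q (Inl k))" by (simp add: sum.reindex)
 also have "sum q (Inr ` ({..<J} \<times> {1..s} \<times> K)) = (\<Sum>p\<in>{..<J} \<times> {1..s} \<times> K. q (Inr p))" by (simp add: sum.reindex)
 also have "... = (\<Sum>j<J. \<Sum>l=1..s. \<Sum>k\<in>K. q (Inr (j, l, k)))"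
  by (simp add: sum.cartesian_product split_beta)
 finally show ?thesis .
qed

lemma bessel:
 obtains B where "0 \<le> B" "!!f F. f \<in> L2 ==> finite F ==> F \<subseteq> I ==> (\<Sum>i\<in>F. (cmod (co f i))^2) \<le> B * (L2_norm f)^2"
proof -
 obtain r where r: "bsupp r \<phi>'" using \<phi>'_bd by (auto simp: bdsupp_def)
 define B0 where "B0 = overlap TYPE('n) r * (L2_norm \<phi>')^2"
 have B0: "0 \<le> B0" by (simp add: B0_def overlap_def)
 have 0: "(\<Sum>k\<in>K. (cmod (L2_inner f (shift \<phi>' k)))^2) \<le> B0 * (L2_norm f)^2" if "f \<in> L2" "finite K" for f K
  by (rule synthesis_imp_analysis [OF shift_L2 [OF \<phi>'_L2] that(1) _ B0]) (unfold B0_def, rule bessel_shift [OF \<phi>'_L2 r that(2)])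
 have "\<exists>B\<ge>0. \<forall>f\<in>L2. \<forall>J K. finite K \<longrightarrow>
  (\<Sum>j<J. \<Sum>k\<in>K. (cmod (L2_inner f (dilate_shift M (\<psi> l) j k)))^2) \<le> B * (L2_norm f)^2" if l: "l \<in> {1..s}" for l
 proof (rule bessel_wavelet [OF b [OF l]])
  show "(\<Sum>n | b l n \<noteq> 0. b l n) = 0" using b_0 [OF l] by (simp add: filter_hat_ek)
 qed
 then obtain B1 where B1: "!!l. l \<in> {1..s} ==> 0 \<le> B1 l" "!!l f J K. l \<in> {1..s} ==> f \<in> L2 ==> finite K ==>
  (\<Sum>j<J. \<Sum>k\<in>K. (cmod (L2_inner f (dilate_shift M (\<psi> l) j k)))^2) \<le> B1 l * (L2_norm f)^2" by metis
 have "(\<Sum>i\<in>F. (cmod (co f i))^2) \<le> (B0 + (\<Sum>l=1..s. B1 l)) * (L2_norm f)^2" if f: "f \<in> L2" and F: "finite F" "F \<subseteq> I" for f F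
 proof -
  obtain J K where K: "finite K" "F \<subseteq> Inl ` K \<union> Inr ` ({..<J} \<times> {1..s} \<times> K)" by (rule index_box [OF F])
  have "(\<Sum>i\<in>F. (cmod (co f i))^2) \<le> (\<Sum>i\<in>Inl ` K \<union> Inr ` ({..<J} \<times> {1..s} \<times> K). (cmod (co f i))^2)"
   using K by (intro sum_mono2) auto
  also have "... = (\<Sum>k\<in>K. (cmod (L2_inner f (shift \<phi>' k)))^2) + (\<Sum>j<J. \<Sum>l=1..s. \<Sum>k\<in>K. (cmod (L2_inner f (dilate_shift M (\<psi> l) j k)))^2)"
   unfolding sum_index_box [OF K(1)] by simp
  also have "(\<Sum>j<J. \<Sum>l=1..s. \<Sum>k\<in>K. (cmod (L2_inner f (dilate_shift M (\<psi> l) j k)))^2) = (\<Sum>l=1..s. \<Sum>j<J. \<Sum>k\<in>K. (cmod (L2_inner f (dilate_shift M (\<psi> l) j k)))^2)"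
   by (rule sum.swap)
  also have "(\<Sum>k\<in>K. (cmod (L2_inner f (shift \<phi>' k)))^2) + ... \<le> B0 * (L2_norm f)^2 + (\<Sum>l=1..s. B1 l * (L2_norm f)^2)"
   by (intro add_mono 0 sum_mono B1 f K)
  finally show ?thesis by (simp add: distrib_right sum_distrib_right)
 qed
 moreover have "0 \<le> B0 + (\<Sum>l=1..s. B1 l)" using B0 B1 by (intro add_nonneg_nonneg sum_nonneg) auto
 ultimately show ?thesis using that by blast
qed

definition psum :: "'n framelet_index set => (real ^ 'n => complex) => real ^ 'n => complex" where
 "psum F f = (%x. \<Sum>i\<in>F. framelet_sign \<epsilon> i * co f i * el i x)"

lemma psum_L2: "psum F f \<in> L2"
 unfolding psum_def by (intro L2_sum L2_scale el_L2)

lemma psum_diff: "f \<in> L2 ==> g \<in> L2 ==> psum F (%x. f x - g x) = (%x. psum F f x - psum F g x)"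
 by (simp add: psum_def L2_inner_diff_left el_L2 sum_subtractf left_diff_distrib right_diff_distrib)

text \<open>The signs have modulus 1 and drop out. The first bound controls tails through their
  coefficients, the second the effect of replacing \<open>f\<close> by an approximation.\<close>

lemma psum_bound:
 assumes B: "0 \<le> B" "!!f F. f \<in> L2 ==> finite F ==> F \<subseteq> I ==> (\<Sum>i\<in>F. (cmod (co f i))^2) \<le> B * (L2_norm f)^2"
  and f: "f \<in> L2" and F: "finite F" "F \<subseteq> I"
 shows "(L2_norm (psum F f))^2 \<le> B * (\<Sum>i\<in>F. (cmod (co f i))^2)" "L2_norm (psum F f) \<le> B * L2_norm f"
proof -
 have "(L2_norm (psum F f))^2 \<le> B * (\<Sum>i\<in>F. (cmod (framelet_sign \<epsilon> i * co f i))^2)"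
  unfolding psum_def by (rule analysis_imp_synthesis [OF el_L2 B(2) [OF _ F] B(1)])
 also have "(\<Sum>i\<in>F. (cmod (framelet_sign \<epsilon> i * co f i))^2) = (\<Sum>i\<in>F. (cmod (co f i))^2)"
  using F(2) by (intro sum.cong refl) (auto simp: norm_mult sign_norm subset_iff)
 finally show 1: "(L2_norm (psum F f))^2 \<le> B * (\<Sum>i\<in>F. (cmod (co f i))^2)" .
 also have "... \<le> B * (B * (L2_norm f)^2)" by (intro mult_left_mono B f F)
 finally have "(L2_norm (psum F f))^2 \<le> (B * L2_norm f)^2" by (simp add: power_mult_distrib power2_eq_square mult_ac)
 then show "L2_norm (psum F f) \<le> B * L2_norm f" by (rule power2_le_imp_le) (simp add: B)
qed

text \<open>Collecting the nonzero coefficients below level N makes the coarse operator itself a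
  finite partial sum of the expansion, which links telescoping to convergence of the net.\<close>

definition level_set :: "(real ^ 'n => complex) => nat => 'n framelet_index set" where
 "level_set f N = {i \<in> I. co f i \<noteq> 0 \<and> (case i of Inl k => True | Inr p => fst p < N)}"

lemma level_set:
 assumes f: "f \<in> L2" "bdsupp f"
 shows "finite (level_set f N)" "AE x in leb. psum (level_set f N) f x = part \<phi>' f N x"
proof -
 let ?A = "{k. L2_inner f (dilate_shift M \<phi>' 0 k) \<noteq> 0}"
 let ?B = "%j l. {k. L2_inner f (dilate_shift M (\<psi> l) j k) \<noteq> 0}"
 have eq: "level_set f N = Inl ` ?A \<union> Inr ` (SIGMA j:{..<N}. SIGMA l:{1..s}. ?B j l)"
  by (auto simp: level_set_def framelet_indices_def dilate_shift_0)
 have fA: "finite ?A" and fB: "finite (?B j l)" for j l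
  by (intro finite_coefficients f \<phi>'_bd wavelet_bd)+
 have fS: "finite (SIGMA j:{..<N}. SIGMA l:{1..s}. ?B j l)" by (intro finite_SigmaI fB) auto
 show "finite (level_set f N)" unfolding eq using fA fS by blast
 have e: "psum (level_set f N) f x = part \<phi>' f 0 x + (\<Sum>j<N. \<Sum>l=1..s. of_real (\<epsilon> l) * part (\<psi> l) f j x)" for x
 proof -
  let ?t = "%i. framelet_sign \<epsilon> i * co f i * el i x"
  have "psum (level_set f N) f x = sum ?t (Inl ` ?A) + sum ?t (Inr ` (SIGMA j:{..<N}. SIGMA l:{1..s}. ?B j l))"
   unfolding psum_def eq using fA fS by (intro sum.union_disjoint) auto
  also have "sum ?t (Inl ` ?A) = part \<phi>' f 0 x" by (simp add: sum.reindex part_def dilate_shift_0)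
  also have "sum ?t (Inr ` (SIGMA j:{..<N}. SIGMA l:{1..s}. ?B j l)) = (\<Sum>p\<in>(SIGMA j:{..<N}. SIGMA l:{1..s}. ?B j l). ?t (Inr p))"
   by (simp add: sum.reindex)
  also have "... = (\<Sum>j<N. \<Sum>q\<in>(SIGMA l:{1..s}. ?B j l). ?t (Inr (j, q)))"
   using sum.Sigma [of "{..<N}" "%j. SIGMA l:{1..s}. ?B j l" "%j q. ?t (Inr (j, q))"] fB
   by (simp add: split_beta finite_SigmaI)
  also have "... = (\<Sum>j<N. \<Sum>l=1..s. \<Sum>k\<in>?B j l. ?t (Inr (j, l, k)))"
  proof (intro sum.cong refl)
   fix j
   have "(\<Sum>q\<in>(SIGMA l:{1..s}. ?B j l). ?t (Inr (j, q))) = (\<Sum>(l, k)\<in>(SIGMA l:{1..s}. ?B j l). ?t (Inr (j, l, k)))"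
    by (intro sum.cong refl) (simp only: case_prod_unfold prod.collapse)
   also have "... = (\<Sum>l=1..s. \<Sum>k\<in>?B j l. ?t (Inr (j, l, k)))"
    by (rule sum.Sigma [symmetric]) (use fB in auto)
   finally show "(\<Sum>q\<in>(SIGMA l:{1..s}. ?B j l). ?t (Inr (j, q))) = (\<Sum>l=1..s. \<Sum>k\<in>?B j l. ?t (Inr (j, l, k)))" .
  qed
  also have "... = (\<Sum>j<N. \<Sum>l=1..s. of_real (\<epsilon> l) * part (\<psi> l) f j x)"
   by (simp add: part_def sum_distrib_left mult.assoc)
  finally show ?thesis .
 qed
 show "AE x in leb. psum (level_set f N) f x = part \<phi>' f N x"
  using part_sums [OF f, of N] by eventually_elim (simp only: e)
qed

text \<open>Convergence along the level sets alone would depend on the order. A larger set F only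
  adds indices off a set \<open>F1\<close> that carries almost all of the Bessel sum, up to indices
  with coefficient 0, so their contribution is small in norm.\<close>

lemma reconstruction_lipbd:
 assumes f: "lipbd f" and \<eta>: "0 < \<eta>"
 shows "\<exists>F0. finite F0 \<and> F0 \<subseteq> I \<and> (\<forall>F. finite F \<longrightarrow> F0 \<subseteq> F \<longrightarrow> F \<subseteq> I \<longrightarrow> L2_norm (%x. f x - psum F f x) \<le> \<eta>)"
proof -
 have fL: "f \<in> L2" by (rule lipbd_L2 [OF f])
 have fb: "bdsupp f" using f by (auto simp: lipbd_def bsupp_def intro: bdsuppI)
 obtain B where B: "0 \<le> B" "!!f F. f \<in> L2 ==> finite F ==> F \<subseteq> I ==> (\<Sum>i\<in>F. (cmod (co f i))^2) \<le> B * (L2_norm f)^2"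
  using bessel by blast
 define q where "q i = (cmod (co f i))^2" for i
 have q0: "0 \<le> q i" for i by (simp add: q_def)
 define \<T> where "\<T> = sum q ` {F. finite F \<and> F \<subseteq> I}"
 have bdd: "bdd_above \<T>" unfolding \<T>_def q_def by (rule bdd_aboveI2 [of _ _ "B * (L2_norm f)^2"]) (use B(2) [OF fL] in blast)
 have ne: "\<T> \<noteq> {}" unfolding \<T>_def by blast
 \<comment> \<open>Chosen so that B \<delta> \<le> (\<eta>/2)^2, also when B = 0.\<close>
 define \<delta> where "\<delta> = (\<eta> / 2)^2 / (B + 1)"
 have \<delta>: "0 < \<delta>" using \<eta> B by (simp add: \<delta>_def)
 then have "Sup \<T> - \<delta> < Sup \<T>" by simp
 then obtain F1 where F1: "finite F1" "F1 \<subseteq> I" "Sup \<T> - \<delta> < sum q F1"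
  using less_cSup_iff [OF ne bdd] unfolding \<T>_def by blast
 have tail: "sum q G \<le> \<delta>" if G: "finite G" "G \<subseteq> I" "G \<inter> F1 = {}" for G
 proof -
  have "sum q (F1 \<union> G) \<le> Sup \<T>" unfolding \<T>_def using F1 G bdd by (intro cSup_upper) (auto simp: \<T>_def)
  moreover have "sum q (F1 \<union> G) = sum q F1 + sum q G" using F1 G by (intro sum.union_disjoint) auto
  ultimately show ?thesis using F1(3) by linarith
 qed
 have "\<exists>N0. \<forall>i\<in>F1. (case i of Inl k => 0 | Inr p => fst p) < (N0::nat)"
  using finite_nat_set_iff_bounded [of "(%i. case i of Inl k => 0 | Inr p => fst p) ` F1"] F1(1) by auto
 then obtain N0 where N0: "!!i. i \<in> F1 ==> (case i of Inl k => 0 | Inr p => fst p) < (N0::nat)" by blast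
 have "\<forall>\<^sub>F j in sequentially. L2_norm (%x. part \<phi>' f j x - f x) < \<eta> / 2"
  using \<eta> by (intro order_tendstoD(2) [OF part_tendsto [OF f]]) auto
 then obtain N1 where N1: "!!j. j \<ge> N1 ==> L2_norm (%x. part \<phi>' f j x - f x) < \<eta> / 2"
  unfolding eventually_sequentially by blast
 define N where "N = max N0 N1"
 let ?L = "level_set f N"
 have L: "finite ?L" "?L \<subseteq> I" using level_set(1) [OF fL fb] by (auto simp: level_set_def)
 have F1L: "i \<in> ?L" if "i \<in> F1" "co f i \<noteq> 0" for i
 proof -
  have "(case i of Inl k => True | Inr p => fst p < N)"
  proof (cases i)
   case (Inr p)
   have "fst p < N0" using N0 [OF that(1)] Inr by simp
   then show ?thesis using Inr by (simp add: N_def)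
  qed simp
  then show ?thesis using that F1(2) by (auto simp: level_set_def)
 qed
 have near: "L2_norm (%x. f x - psum ?L f x) \<le> \<eta> / 2"
 proof -
  have "AE x in leb. f x - psum ?L f x = f x - part \<phi>' f N x"
   using level_set(2) [OF fL fb, of N] by eventually_elim simp
  then have "L2_norm (%x. f x - psum ?L f x) = L2_norm (%x. f x - part \<phi>' f N x)"
   by (rule L2_norm_cong_AE) (intro L2_diff fL psum_L2 part_L2 \<phi>'_L2)+
  also have "... = L2_norm (%x. part \<phi>' f N x - f x)" by (rule L2_norm_minus_commute)
  finally show ?thesis using N1 [of N] by (simp add: N_def)
 qed
 have "L2_norm (%x. f x - psum F f x) \<le> \<eta>" if F: "finite F" "?L \<union> F1 \<subseteq> F" "F \<subseteq> I" for F
 proof -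
  have G: "finite (F - ?L)" "F - ?L \<subseteq> I" using F by auto
  have "psum F f x = psum (F - ?L) f x + psum ?L f x" for x
   unfolding psum_def using F by (intro sum.subset_diff) auto
  then have "L2_norm (%x. f x - psum F f x) = L2_norm (%x. (f x - psum ?L f x) - psum (F - ?L) f x)"
   by (simp add: algebra_simps)
  also have "... \<le> L2_norm (%x. f x - psum ?L f x) + L2_norm (psum (F - ?L) f)"
   by (intro L2_norm_diff_le L2_diff fL psum_L2)
  also have "L2_norm (psum (F - ?L) f) \<le> \<eta> / 2"
  proof (rule power2_le_imp_le)
   have "(L2_norm (psum (F - ?L) f))^2 \<le> B * sum q (F - ?L)"
    unfolding q_def by (rule psum_bound(1) [OF B fL G])
   \<comment> \<open>Indices of \<open>F1\<close> outside the level set have coefficient 0, so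
     \<open>F1\<close> may be removed without changing the sum.\<close>
   also have "sum q (F - ?L) = sum q (F - ?L - F1)"
    using G F1L by (intro sum.mono_neutral_right) (auto simp: q_def)
   also have "B * ... \<le> B * \<delta>" using G B by (intro mult_left_mono tail) auto
   also have "... \<le> (\<eta> / 2)^2"
    using B unfolding \<delta>_def by (simp add: field_simps)
   finally show "(L2_norm (psum (F - ?L) f))^2 \<le> (\<eta> / 2)^2" .
  qed (use \<eta> in simp)
  finally show ?thesis using near by linarith
 qed
 then show ?thesis using L F1 by (intro exI [of _ "?L \<union> F1"]) auto
qed

lemma reconstruction:
 assumes f: "f \<in> L2" and \<eta>: "0 < \<eta>"
 shows "\<exists>F0. finite F0 \<and> F0 \<subseteq> I \<and> (\<forall>F. finite F \<longrightarrow> F0 \<subseteq> F \<longrightarrow> F \<subseteq> I \<longrightarrow> L2_norm (%x. f x - psum F f x) \<le> \<eta>)"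
proof -
 obtain B where B: "0 \<le> B" "!!f F. f \<in> L2 ==> finite F ==> F \<subseteq> I ==> (\<Sum>i\<in>F. (cmod (co f i))^2) \<le> B * (L2_norm f)^2"
  using bessel by blast
 \<comment> \<open>Replacing \<open>f\<close> by \<open>g\<close> costs \<delta> for the function
   and B \<delta> for its partial sum, together \<eta>/2.\<close>
 define \<delta> where "\<delta> = \<eta> / (2 * (B + 1))"
 have \<delta>: "0 < \<delta>" using \<eta> B by (simp add: \<delta>_def)
 obtain g where g: "lipbd g" "L2_norm (%x. f x - g x) < \<delta>"
  using L2_lipapprox [OF f] \<delta> unfolding lipapprox_def by blast
 have gL: "g \<in> L2" by (rule lipbd_L2 [OF g(1)])
 obtain F0 where F0: "finite F0" "F0 \<subseteq> I" "!!F. finite F ==> F0 \<subseteq> F ==> F \<subseteq> I ==> L2_norm (%x. g x - psum F g x) \<le> \<eta> / 2"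
  using reconstruction_lipbd [OF g(1), of "\<eta> / 2"] \<eta> by auto
 have "L2_norm (%x. f x - psum F f x) \<le> \<eta>" if F: "finite F" "F0 \<subseteq> F" "F \<subseteq> I" for F
 proof -
  let ?h = "%x. f x - g x"
  have h: "?h \<in> L2" by (rule L2_diff [OF f gL])
  have "L2_norm (%x. f x - psum F f x) = L2_norm (%x. (?h x + (g x - psum F g x)) - psum F ?h x)"
   unfolding psum_diff [OF f gL] by (simp add: algebra_simps)
  also have "... \<le> L2_norm (%x. ?h x + (g x - psum F g x)) + L2_norm (psum F ?h)"
   by (intro L2_norm_diff_le L2_add L2_diff f gL psum_L2)
  also have "L2_norm (%x. ?h x + (g x - psum F g x)) \<le> L2_norm ?h + L2_norm (%x. g x - psum F g x)"
   by (intro L2_norm_triangle L2_diff f gL psum_L2)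
  also have "L2_norm (psum F ?h) \<le> B * L2_norm ?h" by (rule psum_bound(2) [OF B h F(1,3)])
  finally have "L2_norm (%x. f x - psum F f x) \<le> (B + 1) * L2_norm ?h + \<eta> / 2"
   using F0(3) [OF F] by (simp add: distrib_right)
  also have "(B + 1) * L2_norm ?h \<le> (B + 1) * \<delta>" using B g by (intro mult_left_mono) auto
  also have "(B + 1) * \<delta> = \<eta> / 2" using B by (simp add: \<delta>_def field_simps)
  finally show ?thesis by simp
 qed
 then show ?thesis using F0 by blast
qed

text \<open>Pair the reconstruction with \<open>f\<close>: the squared norm is a signed sum of
  squared coefficients up to a small error, and dropping the signs only increases its modulus. Hence
  the lower constant 1.\<close>

lemma lower_frame_bound:
 assumes f: "f \<in> L2" and \<eta>: "0 < \<eta>"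
 obtains F where "finite F" "F \<subseteq> I" "(L2_norm f)^2 \<le> (\<Sum>i\<in>F. (cmod (co f i))^2) + \<eta> * L2_norm f"
proof -
 obtain F where F: "finite F" "F \<subseteq> I" "L2_norm (%x. f x - psum F f x) \<le> \<eta>"
  using reconstruction [OF f \<eta>] by blast
 have "complex_of_real ((L2_norm f)^2) = L2_inner (%x. f x - psum F f x) f + L2_inner (psum F f) f"
  unfolding L2_inner_self [symmetric] L2_inner_diff_left [OF f psum_L2 f] by simp
 then have "cmod (complex_of_real ((L2_norm f)^2)) \<le> cmod (L2_inner (%x. f x - psum F f x) f) + cmod (L2_inner (psum F f) f)"
  by (metis norm_triangle_ineq)
 then have "(L2_norm f)^2 \<le> cmod (L2_inner (%x. f x - psum F f x) f) + cmod (L2_inner (psum F f) f)"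
  unfolding norm_of_real by simp
 also have "cmod (L2_inner (%x. f x - psum F f x) f) \<le> L2_norm (%x. f x - psum F f x) * L2_norm f"
  by (intro L2_Cauchy_Schwarz L2_diff f psum_L2)
 also have "... \<le> \<eta> * L2_norm f" by (intro mult_right_mono F) auto
 also have "cmod (L2_inner (psum F f) f) \<le> (\<Sum>i\<in>F. (cmod (co f i))^2)"
 proof -
  have "L2_inner (psum F f) f = (\<Sum>i\<in>F. framelet_sign \<epsilon> i * co f i * L2_inner (el i) f)"
   unfolding psum_def by (rule L2_inner_sum_left [OF el_L2 f])
  then have "cmod (L2_inner (psum F f) f) \<le> (\<Sum>i\<in>F. cmod (framelet_sign \<epsilon> i * co f i * L2_inner (el i) f))"
   by (simp only: norm_sum)
  also have "... = (\<Sum>i\<in>F. (cmod (co f i))^2)"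
  proof (intro sum.cong refl)
   fix i assume "i \<in> F"
   then have "i \<in> I" using F(2) by blast
   have "cmod (L2_inner (el i) f) = cmod (co f i)" by (metis L2_inner_cnj complex_mod_cnj)
   then show "cmod (framelet_sign \<epsilon> i * co f i * L2_inner (el i) f) = (cmod (co f i))^2"
    by (simp add: norm_mult sign_norm [OF \<open>i \<in> I\<close>] power2_eq_square)
  qed
  finally show ?thesis .
 qed
 finally show ?thesis using that [OF F(1,2)] by simp
qed

theorem framelet: "is_framelet M \<phi>' s (%l. wavelet (b l))"
 unfolding is_framelet_def
proof (intro conjI ballI \<phi>'_L2 wavelet_L2)
 obtain B where B: "0 \<le> B" "!!f F. f \<in> L2 ==> finite F ==> F \<subseteq> I ==> (\<Sum>i\<in>F. (cmod (co f i))^2) \<le> B * (L2_norm f)^2"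
  using bessel by blast
 let ?a = "%f. \<Sum>\<^sub>\<infinity>k\<in>UNIV. ennreal ((cmod (L2_inner f (shift \<phi>' k)))^2)"
 let ?g = "%f j l k. ennreal ((cmod (L2_inner f (dilate_shift M (\<psi> l) j k)))^2)"
 let ?w = "%f. \<Sum>\<^sub>\<infinity>j\<in>UNIV. \<Sum>l=1..s. \<Sum>\<^sub>\<infinity>k\<in>UNIV. ?g f j l k"
 have up: "?a f \<le> ennreal (B * (L2_norm f)^2)" "?w f \<le> ennreal (B * (L2_norm f)^2)" if f: "f \<in> L2" for f
 proof -
  show "?a f \<le> ennreal (B * (L2_norm f)^2)"
  proof (rule infsum_le_ennreal)
   fix K :: "(int ^ 'n) set" assume K: "finite K"
   have "(\<Sum>i\<in>Inl ` K. (cmod (co f i))^2) \<le> B * (L2_norm f)^2"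
    using K by (intro B f) (auto simp: framelet_indices_def)
   then have "(\<Sum>k\<in>K. (cmod (L2_inner f (shift \<phi>' k)))^2) \<le> B * (L2_norm f)^2" by (simp add: sum.reindex)
   then show "(\<Sum>k\<in>K. ennreal ((cmod (L2_inner f (shift \<phi>' k)))^2)) \<le> ennreal (B * (L2_norm f)^2)"
    by (simp add: ennreal_leI)
  qed
  show "?w f \<le> ennreal (B * (L2_norm f)^2)"
  proof (rule infsum_le_ennreal)
   fix Js :: "nat set" assume Js: "finite Js"
   let ?P = "Js \<times> {1..s}"
   have "(\<Sum>j\<in>Js. \<Sum>l=1..s. \<Sum>\<^sub>\<infinity>k\<in>UNIV. ?g f j l k) = (\<Sum>p\<in>?P. \<Sum>\<^sub>\<infinity>k\<in>UNIV. ?g f (fst p) (snd p) k)"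
    by (simp add: sum.cartesian_product split_beta)
   also have "... = (\<Sum>\<^sub>\<infinity>k\<in>UNIV. \<Sum>p\<in>?P. ?g f (fst p) (snd p) k)" by (rule sum_infsum_ennreal) (use Js in simp)
   also have "... \<le> ennreal (B * (L2_norm f)^2)"
   proof (rule infsum_le_ennreal)
    fix K :: "(int ^ 'n) set" assume K: "finite K"
    let ?h = "%(k, p). Inr (fst p, snd p, k) :: 'n framelet_index"
    have "(\<Sum>i\<in>?h ` (K \<times> ?P). (cmod (co f i))^2) \<le> B * (L2_norm f)^2"
     using K Js by (intro B f) (auto simp: framelet_indices_def)
    moreover have "inj_on ?h (K \<times> ?P)" by (auto simp: inj_on_def)
    ultimately have "(\<Sum>x\<in>K \<times> ?P. (cmod (co f (?h x)))^2) \<le> B * (L2_norm f)^2"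
     by (simp only: sum.reindex o_def)
    then have "(\<Sum>k\<in>K. \<Sum>p\<in>?P. (cmod (L2_inner f (dilate_shift M (\<psi> (snd p)) (fst p) k)))^2) \<le> B * (L2_norm f)^2"
     by (simp only: sum.cartesian_product case_prod_unfold framelet_elem.simps)
    then show "(\<Sum>k\<in>K. \<Sum>p\<in>?P. ?g f (fst p) (snd p) k) \<le> ennreal (B * (L2_norm f)^2)"
     by (simp add: ennreal_leI sum_nonneg)
   qed
   finally show "(\<Sum>j\<in>Js. \<Sum>l=1..s. \<Sum>\<^sub>\<infinity>k\<in>UNIV. ?g f j l k) \<le> ennreal (B * (L2_norm f)^2)" .
  qed
 qed
 have fin: "ennreal (\<Sum>i\<in>F. (cmod (co f i))^2) \<le> ?a f + ?w f" if F: "finite F" "F \<subseteq> I" for f F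
 proof -
  obtain J K where K: "finite K" "F \<subseteq> Inl ` K \<union> Inr ` ({..<J} \<times> {1..s} \<times> K)" by (rule index_box [OF F])
  have "(\<Sum>i\<in>F. (cmod (co f i))^2) \<le> (\<Sum>i\<in>Inl ` K \<union> Inr ` ({..<J} \<times> {1..s} \<times> K). (cmod (co f i))^2)"
   using K by (intro sum_mono2) auto
  also have "... = (\<Sum>k\<in>K. (cmod (L2_inner f (shift \<phi>' k)))^2) + (\<Sum>j<J. \<Sum>l=1..s. \<Sum>k\<in>K. (cmod (L2_inner f (dilate_shift M (\<psi> l) j k)))^2)"
   unfolding sum_index_box [OF K(1)] by simp
  finally have "ennreal (\<Sum>i\<in>F. (cmod (co f i))^2)
    \<le> (\<Sum>k\<in>K. ennreal ((cmod (L2_inner f (shift \<phi>' k)))^2)) + (\<Sum>j<J. \<Sum>l=1..s. \<Sum>k\<in>K. ?g f j l k)"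
   by (simp add: ennreal_leI sum_nonneg flip: ennreal_plus)
  also have "... \<le> ?a f + ?w f"
  proof (rule add_mono)
   show "(\<Sum>k\<in>K. ennreal ((cmod (L2_inner f (shift \<phi>' k)))^2)) \<le> ?a f" by (rule sum_le_infsum_ennreal) (use K in auto)
   have "(\<Sum>j<J. \<Sum>l=1..s. \<Sum>k\<in>K. ?g f j l k) \<le> (\<Sum>j<J. \<Sum>l=1..s. \<Sum>\<^sub>\<infinity>k\<in>UNIV. ?g f j l k)"
    by (intro sum_mono sum_le_infsum_ennreal) (use K in auto)
   also have "... \<le> ?w f" by (rule sum_le_infsum_ennreal) auto
   finally show "(\<Sum>j<J. \<Sum>l=1..s. \<Sum>k\<in>K. ?g f j l k) \<le> ?w f" .
  qed
  finally show ?thesis .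
 qed
 show "\<exists>C1 C2 :: real. C1 > 0 \<and> C2 > 0 \<and> (\<forall>f\<in>L2. let S = ?a f + ?w f
   in ennreal (C1 * (L2_norm f)^2) \<le> S \<and> S \<le> ennreal (C2 * (L2_norm f)^2))"
 \<comment> \<open>The lower constant comes from \<open>lower_frame_bound\<close> with \<eta>
   tending to 0. The upper one adds the bound B for each of the two sums, and 1 to stay
   positive.\<close>
 proof (rule exI [of _ 1], rule exI [of _ "2 * B + 1"], intro conjI ballI)
  show "2 * B + 1 > 0" using B by simp
  fix f :: "real ^ 'n => complex" assume f: "f \<in> L2"
  have "?a f + ?w f \<le> ennreal (B * (L2_norm f)^2) + ennreal (B * (L2_norm f)^2)"
   by (intro add_mono up f)
  also have "... = ennreal (B * (L2_norm f)^2 + B * (L2_norm f)^2)"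
   using B by (intro ennreal_plus [symmetric]) auto
  also have "... \<le> ennreal ((2 * B + 1) * (L2_norm f)^2)"
   by (intro ennreal_leI) (simp add: algebra_simps)
  finally have hi: "?a f + ?w f \<le> ennreal ((2 * B + 1) * (L2_norm f)^2)" .
  then have "?a f + ?w f < top" by (rule order_le_less_trans) simp
  moreover have "\<exists>t. X = ennreal t \<and> 0 \<le> t" if "X < top" for X :: ennreal using that by (cases X) auto
  ultimately have "\<exists>t. ?a f + ?w f = ennreal t \<and> 0 \<le> t" by blast
  then obtain t where t: "?a f + ?w f = ennreal t" "0 \<le> t" by (elim exE conjE)
  have "(L2_norm f)^2 \<le> t"
  proof (rule field_le_epsilon)
   fix e :: real assume e: "0 < e"
   define \<eta> where "\<eta> = e / (L2_norm f + 1)"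
   have n: "0 < L2_norm f + 1" using L2_norm_nonneg [of f] by linarith
   have \<eta>: "0 < \<eta>" using e n by (simp add: \<eta>_def)
   obtain F where F: "finite F" "F \<subseteq> I" "(L2_norm f)^2 \<le> (\<Sum>i\<in>F. (cmod (co f i))^2) + \<eta> * L2_norm f"
    by (rule lower_frame_bound [OF f \<eta>])
   have "ennreal (\<Sum>i\<in>F. (cmod (co f i))^2) \<le> ennreal t" using fin [OF F(1,2), of f] unfolding t(1) .
   then have "(\<Sum>i\<in>F. (cmod (co f i))^2) \<le> t" using t(2) by simp
   moreover have "\<eta> * L2_norm f \<le> \<eta> * (L2_norm f + 1)" using \<eta> by simp
   moreover have "\<eta> * (L2_norm f + 1) = e" using n by (simp add: \<eta>_def)
   ultimately show "(L2_norm f)^2 \<le> t + e" using F(3) by linarith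
  qed
  then have "ennreal (1 * (L2_norm f)^2) \<le> ?a f + ?w f" unfolding t(1) by (simp add: ennreal_leI)
  then show "let S = ?a f + ?w f in ennreal (1 * (L2_norm f)^2) \<le> S \<and> S \<le> ennreal ((2 * B + 1) * (L2_norm f)^2)"
   using hi by (simp only: Let_def)
 qed simp
qed

theorem quasi_tight: "quasi_tight_framelet M \<phi>' s (%l. wavelet (b l)) \<epsilon>"
 unfolding quasi_tight_framelet_def
proof (intro conjI framelet ballI tendstoI)
 fix f :: "real ^ 'n => complex" and e :: real assume f: "f \<in> L2" and e: "0 < e"
 obtain F0 where F0: "finite F0" "F0 \<subseteq> I" "!!F. finite F ==> F0 \<subseteq> F ==> F \<subseteq> I ==> L2_norm (%x. f x - psum F f x) \<le> e / 2"
  using reconstruction [OF f, of "e / 2"] e by auto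
 show "\<forall>\<^sub>F F in finite_subsets_at_top I. dist (L2_norm (%x. f x - (\<Sum>i\<in>F. framelet_sign \<epsilon> i * co f i * el i x))) 0 < e"
  unfolding eventually_finite_subsets_at_top
 proof (intro exI [of _ F0] conjI allI impI F0(1,2))
  fix F assume "finite F \<and> F0 \<subseteq> F \<and> F \<subseteq> I"
  then have "L2_norm (%x. f x - psum F f x) \<le> e / 2" using F0(3) by blast
  then show "dist (L2_norm (%x. f x - (\<Sum>i\<in>F. framelet_sign \<epsilon> i * co f i * el i x))) 0 < e"
   using e unfolding psum_def by simp
 qed
qed

end

subsection \<open>The main theorem\<close>

text \<open>Compact support up to a null set is replaced by support at every point; the transform,
  through which \<phi> enters the claim, is unchanged.\<close>

lemma compactly_supported_cutoff:
 fixes \<phi> :: "real ^ 'n::finite => complex"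
 assumes \<phi>: "\<phi> \<in> L2" and c: "compactly_supported \<phi>"
 obtains \<phi>0 r where "\<phi>0 \<in> L2" "0 \<le> r" "bsupp r \<phi>0" "fourier \<phi>0 = fourier \<phi>"
proof -
 obtain K where K: "compact K" "AE x in leb. x \<notin> K \<longrightarrow> \<phi> x = 0" using c by (auto simp: compactly_supported_def)
 obtain r where r: "0 < r" "\<forall>x\<in>K. norm x \<le> r" using compact_imp_bounded [OF K(1)] by (auto simp: bounded_pos)
 define \<phi>0 where "\<phi>0 = (%x. \<phi> x * indicator (cball 0 r) x)"
 have m: "\<phi>0 \<in> Lmeas" unfolding \<phi>0_def
  by (intro borel_measurable_times L2_meas [OF \<phi>] borel_measurable_indicator) auto
 have L: "\<phi>0 \<in> L2"
 proof (rule L2I [OF m], rule Bochner_Integration.integrable_bound [OF L2_int [OF \<phi>]])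
  show "(%x. (cmod (\<phi>0 x))^2) \<in> Lmeas" using m by measurable
  show "AE x in leb. norm ((cmod (\<phi>0 x))^2) \<le> norm ((cmod (\<phi> x))^2)"
   by (rule AE_I2) (simp add: \<phi>0_def indicator_def)
 qed
 have e: "AE x in leb. \<phi>0 x = \<phi> x"
  using K(2) by eventually_elim (use r in \<open>auto simp: \<phi>0_def indicator_def\<close>)
 have "fourier \<phi>0 \<xi> = fourier \<phi> \<xi>" for \<xi>
  unfolding fourier_def
 proof (rule integral_cong_AE)
  have "(%x :: real ^ 'n. exp (- (\<i> * complex_of_real (x \<bullet> \<xi>)))) \<in> Lmeas"
   by (intro measurable_completion borel_measurable_continuous_onI) (auto intro!: continuous_intros)
  then show "(%x. \<phi>0 x * exp (- (\<i> * complex_of_real (x \<bullet> \<xi>)))) \<in> Lmeas"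
   "(%x. \<phi> x * exp (- (\<i> * complex_of_real (x \<bullet> \<xi>)))) \<in> Lmeas"
   using m L2_meas [OF \<phi>] by (intro borel_measurable_times; simp)+
  show "AE x in leb. \<phi>0 x * exp (- (\<i> * complex_of_real (x \<bullet> \<xi>))) = \<phi> x * exp (- (\<i> * complex_of_real (x \<bullet> \<xi>)))"
   using e by eventually_elim simp
 qed
 then have fe: "fourier \<phi>0 = fourier \<phi>" by (rule ext)
 have "bsupp r \<phi>0" by (simp add: \<phi>0_def bsupp_def)
 then show ?thesis by (rule that [OF L less_imp_le [OF r(1)] _ fe])
qed

lemma bdsupp_compactly_supported: assumes "bdsupp f" shows "compactly_supported f"
proof -
 obtain r where r: "bsupp r f" using assms by (auto simp: bdsupp_def)
 show ?thesis unfolding compactly_supported_def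
  by (intro exI [of _ "cball 0 r"] conjI compact_cball AE_I2 impI) (use r in \<open>simp add: bsupp_def\<close>)
qed

lemma flat_vanishing_moments:
 assumes "f \<in> L2" "bdsupp f" "flat m 0 (fourier f)" shows "vanishing_moments m f"
proof -
 obtain r where r: "0 \<le> r" "bsupp r f" using assms(2) by (auto simp: bdsupp_def)
 show ?thesis unfolding vanishing_moments_def fourier_as_FT [OF r(2)]
  using bounded_FT.agree_to_order_FT_iff [OF bounded_FT_lebesgue [OF r(1)] bdsupp_integrable [OF assms(1,2)], of m] assms(3)
  unfolding fourier_as_FT [OF r(2)] by blast
qed

lemma flat_fourier:
 assumes "f \<in> L2" "bdsupp f" shows "flat 0 p (fourier f)"
proof -
 obtain r where r: "0 \<le> r" "bsupp r f" using assms(2) by (auto simp: bdsupp_def)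
 show ?thesis unfolding fourier_as_FT [OF r(2)]
  by (rule bounded_FT.FT_bounded [OF bounded_FT_lebesgue [OF r(1)] bdsupp_integrable [OF assms]])
qed

lemma fourier_isCont_0:
 assumes "f \<in> L2" "bdsupp f" shows "isCont (fourier f) 0"
proof -
 obtain r where r: "0 \<le> r" "bsupp r f" using assms(2) by (auto simp: bdsupp_def)
 show ?thesis unfolding fourier_as_FT [OF r(2)]
  by (rule bounded_FT.FT_isCont_0 [OF bounded_FT_lebesgue [OF r(1)] bdsupp_integrable [OF assms]])
qed

lemma fourier_inverse_jet:
 assumes "f \<in> L2" "bdsupp f" "fourier f 0 \<noteq> 0"
 obtains t where "t \<in> TP" "flat n 0 (%\<xi>. t \<xi> * fourier f \<xi> - 1)"
proof -
 obtain r where r: "0 \<le> r" "bsupp r f" using assms(2) by (auto simp: bdsupp_def)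
 have nz: "FT leb (%x. if norm x \<le> r then x else 0) f 0 \<noteq> 0" using assms(3) unfolding fourier_as_FT [OF r(2)] .
 obtain t where "t \<in> TP" "flat n 0 (%\<xi>. t \<xi> * FT leb (%x. if norm x \<le> r then x else 0) f \<xi> - 1)"
  by (rule bounded_FT.FT_inverse_jet [OF bounded_FT_lebesgue [OF r(1)] bdsupp_integrable [OF assms(1,2)] nz])
 then show ?thesis using that unfolding fourier_as_FT [OF r(2)] by blast
qed

lemma TP_isCont: assumes "f \<in> TP" shows "isCont f p"
proof -
 obtain F c where f: "finite F" "f = (%\<xi>. \<Sum>k\<in>F. c k * ek k \<xi>)" using assms by (rule TP_E)
 show ?thesis unfolding f(2) ek_def by (intro continuous_intros)
qed

text \<open>Off the origin of \<open>\<Omega>\<close> the matching filter, which does not vanish at \<open>0\<close>, can be divided out.\<close>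
lemma (in integer_matrix) sum_rules_flat:
 assumes a: "a \<in> l0" and u: "\<upsilon> \<in> l0" and sr: "sum_rules m M a \<upsilon>" and w: "\<omega> \<in> Omega M" "\<omega> \<noteq> 0"
 shows "flat m 0 (%\<xi>. filter_hat a (\<xi> + tp \<omega>))"
proof -
 let ?A = "%\<xi>. filter_hat a (\<xi> + tp \<omega>)" and ?u = "%\<xi>. filter_hat \<upsilon> (MT *v \<xi>)"
 have A: "?A \<in> TP" by (rule TP_shift) (simp add: TP_def a)
 have U: "?u \<in> TP" by (rule TP_transpose [OF _ intM]) (simp add: TP_def u)
 have AU: "(%\<xi>. ?u \<xi> * ?A \<xi>) \<in> TP" by (rule TP_mult [OF U A])
 have "agree_to_order m (%\<xi>. ?u \<xi> * ?A \<xi>) (%\<xi>. delta \<omega> * filter_hat \<upsilon> \<xi>)" using sr w(1) by (simp add: sum_rules_def)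
 then have "agree_to_order m (%\<xi>. ?u \<xi> * ?A \<xi>) (%_. 0)" using w(2) by (simp add: delta_def)
 then have "flat m 0 (%\<xi>. ?u \<xi> * ?A \<xi>)" by (rule TP_agree_imp_flat [OF AU])
 then have f: "flat m 0 (%\<xi>. ?A \<xi> * ?u \<xi>)" by (simp only: mult.commute)
 have "?u 0 \<noteq> 0" using sr by (simp add: sum_rules_def)
 then show ?thesis by (rule flat_divide [OF f TP_flat_0 [OF A] TP_isCont [OF U]])
qed

text \<open>Multiplied by \<open>|\<phi>|^2\<close> the defect telescopes, and \<open>\<theta>\<phi> - 1\<close> is flat of order \<open>2m\<close>.\<close>
lemma (in integer_matrix) diagonal_flat:
 assumes F: "flat 0 0 F" "isCont F 0" "F 0 \<noteq> 0" and A: "A \<in> TP" and t: "t \<in> TP"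
  and refine: "!!\<xi>. F (MT *v \<xi>) = A \<xi> * F \<xi>" and tF: "flat n 0 (%\<xi>. t \<xi> * F \<xi> - 1)"
 shows "flat n 0 (%\<xi>. cnj (t \<xi>) * t \<xi> - cnj (A \<xi>) * (cnj (t (MT *v \<xi>)) * t (MT *v \<xi>)) * A \<xi>)"
proof -
 define w where "w \<xi> = t \<xi> * F \<xi> - 1" for \<xi>
 define W where "W \<xi> = cnj (t \<xi> * F \<xi>) * (t \<xi> * F \<xi>) - 1" for \<xi>
 define G where "G = (%\<xi>. cnj (t \<xi>) * t \<xi> - cnj (A \<xi>) * (cnj (t (MT *v \<xi>)) * t (MT *v \<xi>)) * A \<xi>)"
 have w: "flat n 0 w" using tF by (simp add: w_def [abs_def])
 have cw: "flat n 0 (%\<xi>. cnj (w \<xi>))" using w by (simp add: flat_cnj)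
 have tF0: "flat 0 0 (%\<xi>. t \<xi> * F \<xi>)" using flat_mult [OF TP_flat_0 [OF t] F(1)] by simp
 have "W = (%\<xi>. cnj (w \<xi>) * (t \<xi> * F \<xi>) + w \<xi>)" by (simp add: W_def w_def fun_eq_iff algebra_simps)
 then have W: "flat n 0 W" using flat_add [OF flat_mult_bounded [OF cw tF0] w] by simp
 have "linear ((*v) MT)" by (rule matrix_vector_mul_linear)
 then have W': "flat n 0 (%\<xi>. W (MT *v \<xi>))" by (rule flat_linear [OF W])
 have e: "G \<xi> * (cnj (F \<xi>) * F \<xi>) = W \<xi> - W (MT *v \<xi>)" for \<xi>
  by (simp add: G_def W_def refine algebra_simps)
 have G1: "flat n 0 (%\<xi>. G \<xi> * (cnj (F \<xi>) * F \<xi>))" unfolding e by (rule flat_diff [OF W W'])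
 have T: "(%\<xi>. cnj (t \<xi>) * t \<xi>) \<in> TP" by (intro TP_mult TP_cnj t)
 have "G \<in> TP" unfolding G_def by (intro TP_diff TP_mult TP_cnj t A TP_transpose [OF T intM])
 moreover have "isCont (%\<xi>. cnj (F \<xi>) * F \<xi>) 0" using F(2) by (intro continuous_intros)
 moreover have "cnj (F 0) * F 0 \<noteq> 0" using F(3) by simp
 ultimately have "flat n 0 G" by (intro flat_divide [OF G1 TP_flat_0])
 then show ?thesis by (simp add: G_def)
qed

theorem corollary4p4:
  fixes M :: "real ^ 'n ^ 'n"
    and \<phi> :: "real ^ 'n::finite \<Rightarrow> complex"
    and a \<upsilon> :: "int ^ 'n \<Rightarrow> complex"
    and m :: nat
  assumes "m > 0"
    and "dilation_matrix M"
    and "\<phi> \<in> L2" and "compactly_supported \<phi>"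
    and "a \<in> l0"
    and "\<forall>\<xi>. fourier \<phi> (transpose M *v \<xi>) = filter_hat a \<xi> * fourier \<phi> \<xi>"
    and "fourier \<phi> 0 \<noteq> 0"
    and "\<upsilon> \<in> l0"
    and "sum_rules m M a \<upsilon>"
    and "agree_to_order m (filter_hat \<upsilon>) (\<lambda>\<xi>. 1 / fourier \<phi> \<xi>)"
  shows "\<exists>(s::nat) (b :: nat \<Rightarrow> int ^ 'n \<Rightarrow> complex) (\<epsilon> :: nat \<Rightarrow> real)
            (\<theta> :: int ^ 'n \<Rightarrow> complex) (\<Theta> :: int ^ 'n \<Rightarrow> complex).
      s \<ge> 1 \<and> (\<forall>l\<in>{1..s}. b l \<in> l0) \<and> (\<forall>l\<in>{1..s}. \<epsilon> l \<in> {1, -1}) \<and> \<theta> \<in> l0 \<and>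
      \<Theta> \<in> l0 \<and> (\<forall>\<xi>. filter_hat \<Theta> \<xi> = cnj (filter_hat \<theta> \<xi>) * filter_hat \<theta> \<xi>) \<and>
      OEP_quasi_tight_filter_bank M a s b \<Theta> \<epsilon> \<and>
      (\<exists>(\<phi>' :: real ^ 'n \<Rightarrow> complex) (\<psi> :: nat \<Rightarrow> real ^ 'n \<Rightarrow> complex).
         \<phi>' \<in> L2 \<and> compactly_supported \<phi>' \<and>
         (\<forall>\<xi>. fourier \<phi>' \<xi> = filter_hat \<theta> \<xi> * fourier \<phi> \<xi>) \<and>
         (\<forall>l\<in>{1..s}. \<psi> l \<in> L2 \<and> compactly_supported (\<psi> l) \<and>
            (\<forall>\<xi>. fourier (\<psi> l) \<xi> =
                   filter_hat (b l) (matrix_inv (transpose M) *v \<xi>)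
                   * fourier \<phi> (matrix_inv (transpose M) *v \<xi>))) \<and>
         quasi_tight_framelet M \<phi>' s \<psi> \<epsilon> \<and>
         (\<forall>l\<in>{1..s}. vanishing_moments m (\<psi> l)))"
proof -
 interpret integer_matrix M
  by unfold_locales (use assms(2) dilation_invertible in \<open>auto simp: dilation_matrix_def intmat_def\<close>)
 obtain \<phi>0 r where p0: "\<phi>0 \<in> L2" "0 \<le> r" "bsupp r \<phi>0" "fourier \<phi>0 = fourier \<phi>"
  by (rule compactly_supported_cutoff [OF assms(3,4)])
 have pb: "bdsupp \<phi>0" by (rule bdsuppI [OF p0(3)])
 have pnz: "fourier \<phi>0 0 \<noteq> 0" using assms(7) by (simp add: p0(4))
 have pref: "fourier \<phi>0 (MT *v \<xi>) = filter_hat a \<xi> * fourier \<phi>0 \<xi>" for \<xi> unfolding p0(4) using assms(6) by blast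
 have aTP: "filter_hat a \<in> TP" using assms(5) by (simp add: TP_def)
 obtain t where t: "t \<in> TP" "flat (2 * m) 0 (%\<xi>. t \<xi> * fourier \<phi>0 \<xi> - 1)"
  by (rule fourier_inverse_jet [OF p0(1) pb pnz])
 then obtain \<theta> where \<theta>: "\<theta> \<in> l0" "filter_hat \<theta> = t" unfolding TP_def by blast
 define T where "T = (%\<xi>. cnj (t \<xi>) * t \<xi>)"
 have T: "T \<in> TP" unfolding T_def by (intro TP_mult TP_cnj t)
 then obtain \<Theta> where \<Theta>: "\<Theta> \<in> l0" "filter_hat \<Theta> = T" unfolding TP_def by blast
 have offdiag: "flat m 0 (%\<xi>. filter_hat a (\<xi> + tp \<omega>))" if "\<omega> \<in> Omega M" "\<omega> \<noteq> 0" for \<omega>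
  by (rule sum_rules_flat [OF assms(5,8,9) that])
 have diag: "flat (2 * m) 0 (%\<xi>. T \<xi> - cnj (filter_hat a \<xi>) * T (MT *v \<xi>) * filter_hat a \<xi>)"
  unfolding T_def
  by (rule diagonal_flat [OF flat_fourier [OF p0(1) pb] fourier_isCont_0 [OF p0(1) pb] pnz aTP t(1) pref t(2)])
 have Treal: "cnj (T \<xi>) = T \<xi>" for \<xi> by (simp add: T_def mult.commute)
 obtain s b \<epsilon> where sb: "s \<ge> (1 :: nat)"
  "!!l. l \<in> {1..s} ==> b l \<in> l0 \<and> flat m 0 (filter_hat (b l)) \<and> \<epsilon> l \<in> {1, -1 :: real}"
  "!!\<xi> \<omega>. \<omega> \<in> Omega M ==> cnj (filter_hat a \<xi>) * T (MT *v \<xi>) * filter_hat a (\<xi> + tp \<omega>)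
    + (\<Sum>l=1..s. cnj (filter_hat (b l) \<xi>) * complex_of_real (\<epsilon> l) * filter_hat (b l) (\<xi> + tp \<omega>))
    = delta \<omega> * T \<xi>"
  using OEP_filter_bank_exists [OF aTP T Treal offdiag diag] by blast
 \<comment> \<open>With m positive, flatness yields values: \<open>a\<close> vanishes at
   2\<pi>\<omega> for nonzero \<omega>, the transforms of the \<open>b l\<close> vanish at 0, and
   \<theta>\<phi> equals 1 there.\<close>
 obtain m' where m': "m = Suc m'" using assms(1) by (cases m) auto
 \<comment> \<open>The refinement equation is given on the Fourier side; uniqueness of the transform
   brings it to the space side, where the differences are studied.\<close>
 have refine: "AE x in leb. \<phi>0 x = dil (%x. \<Sum>l | a l \<noteq> 0. of_real (sqrt \<bar>det M\<bar>) * a l * shift \<phi>0 l x) x"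
 proof (rule fourier_unique2 [OF p0(1) pb])
  show "dil (%x. \<Sum>l | a l \<noteq> 0. of_real (sqrt \<bar>det M\<bar>) * a l * shift \<phi>0 l x) \<in> L2"
   by (intro dil_L2 L2_sum L2_scale shift_L2 p0)
  show "bdsupp (dil (%x. \<Sum>l | a l \<noteq> 0. of_real (sqrt \<bar>det M\<bar>) * a l * shift \<phi>0 l x))"
   by (intro bdsupp_dil bdsupp_sum bdsupp_scale bdsupp_shift pb)
  fix \<xi>
  have "fourier \<phi>0 \<xi> = fourier \<phi>0 (MT *v (MTi *v \<xi>))" by simp
  also have "... = fourier (dil (%x. \<Sum>l | a l \<noteq> 0. of_real (sqrt \<bar>det M\<bar>) * a l * shift \<phi>0 l x)) \<xi>"
   unfolding pref fourier_dil_comb [OF bdsupp_integrable [OF p0(1) pb]] ..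
  finally show "fourier \<phi>0 \<xi> = fourier (dil (%x. \<Sum>l | a l \<noteq> 0. of_real (sqrt \<bar>det M\<bar>) * a l * shift \<phi>0 l x)) \<xi>" .
 qed
 interpret fs: framelet_system M a \<phi>0 r \<theta> s b \<epsilon>
 proof unfold_locales
  show "(%n. mpow (matrix_inv M) n x) \<longlonglongrightarrow> 0" for x by (rule dilation_inverse_powers [OF assms(2)])
  show "filter_hat a (tp \<omega>) = 0" if "\<omega> \<in> Omega M" "\<omega> \<noteq> 0" for \<omega>
   using flat_at [OF offdiag [OF that, unfolded m']] by simp
  show "filter_hat \<theta> 0 * fourier \<phi>0 0 = 1"
  proof -
   have "2 * m = Suc (2 * m' + 1)" by (simp add: m')
   then show ?thesis using flat_at [of "2 * m' + 1" 0 "%\<xi>. t \<xi> * fourier \<phi>0 \<xi> - 1"] t(2) by (simp add: \<theta>(2))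
  qed
  show "filter_hat (b l) 0 = 0" if "l \<in> {1..s}" for l
   using sb(2) [OF that] unfolding m' by (blast intro: flat_at)
  show "cnj (filter_hat a \<xi>) * (cnj (filter_hat \<theta> (MT *v \<xi>)) * filter_hat \<theta> (MT *v \<xi>)) * filter_hat a (\<xi> + tp \<omega>)
    + (\<Sum>l=1..s. cnj (filter_hat (b l) \<xi>) * complex_of_real (\<epsilon> l) * filter_hat (b l) (\<xi> + tp \<omega>))
    = delta \<omega> * (cnj (filter_hat \<theta> \<xi>) * filter_hat \<theta> \<xi>)" if "\<omega> \<in> Omega M" for \<xi> \<omega>
   using sb(3) [OF that, of \<xi>] unfolding T_def \<theta>(2) .
 qed (use assms p0 \<theta> sb(2) refine pref in \<open>blast+\<close>)
 have wflat: "flat m 0 (fourier (fs.wavelet (b l)))" if l: "l \<in> {1..s}" for l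
 proof -
  have lin: "linear ((*v) MTi)" by (rule matrix_vector_mul_linear)
  have "flat m 0 (%\<xi>. filter_hat (b l) (MTi *v \<xi>) * fourier \<phi>0 (MTi *v \<xi>))"
   using sb(2) [OF l] by (intro flat_mult_bounded flat_linear [OF _ lin] flat_fourier p0 pb) auto
  then show ?thesis by (simp add: fs.wavelet_fourier [abs_def])
 qed
 show ?thesis
 proof (intro exI conjI ballI allI)
  show "s \<ge> 1" by (rule sb(1))
  show "b l \<in> l0" "\<epsilon> l \<in> {1, -1}" if "l \<in> {1..s}" for l using sb(2) [OF that] by auto
  show "\<theta> \<in> l0" "\<Theta> \<in> l0" by (rule \<theta> \<Theta>)+
  show "filter_hat \<Theta> \<xi> = cnj (filter_hat \<theta> \<xi>) * filter_hat \<theta> \<xi>" for \<xi> by (simp add: \<theta> \<Theta> T_def)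
  show "OEP_quasi_tight_filter_bank M a s b \<Theta> \<epsilon>"
   unfolding OEP_quasi_tight_filter_bank_def \<Theta>(2) using sb(3) by blast
  show "fs.\<phi>' \<in> L2" by (rule fs.\<phi>'_L2)
  show "compactly_supported fs.\<phi>'" by (rule bdsupp_compactly_supported [OF fs.\<phi>'_bd])
  show "fourier fs.\<phi>' \<xi> = filter_hat \<theta> \<xi> * fourier \<phi> \<xi>" for \<xi> unfolding fs.\<phi>'_fourier p0(4) ..
  show "fs.wavelet (b l) \<in> L2" for l by (rule fs.wavelet_L2)
  show "compactly_supported (fs.wavelet (b l))" for l by (rule bdsupp_compactly_supported [OF fs.wavelet_bd])
  show "fourier (fs.wavelet (b l)) \<xi> = filter_hat (b l) (MTi *v \<xi>) * fourier \<phi> (MTi *v \<xi>)" for l \<xi>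
   unfolding fs.wavelet_fourier p0(4) ..
  show "quasi_tight_framelet M fs.\<phi>' s (%l. fs.wavelet (b l)) \<epsilon>" by (rule fs.quasi_tight)
  show "vanishing_moments m (fs.wavelet (b l))" if "l \<in> {1..s}" for l
   by (rule flat_vanishing_moments [OF fs.wavelet_L2 fs.wavelet_bd wflat [OF that]])
 qed
qed

end
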